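(* Let $f\in G_\Delta$, let $\mathfrak a$ be an alcove, and let $B$ be a basis of $\mathcal B(\Delta)$ with $(\phi^\sigma)_{\sigma\in B}$ the basis of $S_\Delta^*$ dual to $(\phi_\sigma)_{\sigma\in B}$. For $y\in U_\Delta$ and $t\in\mathfrak a$ we have $$E^t(f)(y)=\mathrm{Tr}_{S_\Delta}\left(\mathrm{Res}_\Delta\, m(e^{\langle t,\cdot\rangle}f)\,\mathcal T(y)\,C\,E^t\,\mathrm{Res}_\Delta\right)=\sum_{\sigma\in B}\left\langle\phi^\sigma,\mathrm{Res}_\Delta\left(e^{\langle t,z\rangle}f(z)F^{\mathfrak a}_\sigma(y-z)\right)\right\rangle .$$ If moreover $B$ is the underlying basis of a diagonal basis $OB$, then $$E^t(f)(y)=\sum_{o\sigma\in OB}\mathrm{Res}^{o\sigma}\left(e^{\langle t,z\rangle}f(z)F^{\mathfrak a}_\sigma(y-z)\right).$$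
   Context: Setting. $V$ is a real vector space of dimension $r$ with a lattice $N$; $V_{\mathbb C}$ is its complexification; $M=N^*\subset V^*$ is the dual lattice. $\Delta\subset M$ is a finite set of non-zero elements, each indivisible in $M$. Rational functions. $S(V^* )$ is the ring of complex polynomial functions on $V_{\mathbb C}$, and $R_\Delta=\Delta^{-1}S(V^* )$. A basis of $\Delta$ is a subset $\sigma\subset\Delta$ that is a basis of $V^*$; $\mathcal B(\Delta)$ is the set of these, $O\mathcal B(\Delta)$ the set of ordered bases; $\phi_\sigma=1/\prod_{\alpha\in\sigma}\alpha$; $S_\Delta=\sum_{\sigma\in\mathcal B(\Delta)}\mathbb C\phi_\sigma$. A basis of $\mathcal B(\Delta)$ is a subset $B\subset\mathcal B(\Delta)$ such that $(\phi_\sigma)_{\sigma\in B}$ is a basis of $S_\Delta$. $G_\Delta\subset R_\Delta$ is the span of the functions $1/\prod_{\alpha\in\kappa}\alpha$, where $\kappa$ runs over finite sequences of (not necessarily distinct) elements of $\Delta$ that generate $V^*$. Residues. With $\partial(v)$ the derivative in direction $v$ and $\partial(V)R_\Delta=\sum_v\partial(v)R_\Delta$, it is known that $R_\Delta=\partial(V)R_\Delta\oplus S_\Delta$; $\mathrm{Res}_\Delta:R_\Delta\to S_\Delta$ is the projection. It vanishes on homogeneous elements of degree $\neq -r$. $\mathcal O$ is the space of holomorphic functions near $0\in V_{\mathbb C}$, $\mathcal O_\Delta=\Delta^{-1}\mathcal O$ the space of meromorphic functions near $0$ with denominators products of elements of $\Delta$; $\mathrm{Res}_\Delta$ extends to $\mathcal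 O_\Delta$ by Taylor expansion of the numerator at $0$. For an ordered basis $o\sigma=(\alpha_1,\dots,\alpha_r)$, with coordinates $z_j=\langle\alpha_j,z\rangle$, the iterated residue is $\mathrm{Res}^{o\sigma}(g)=\mathrm{Res}_{z_1=0}(\mathrm{Res}_{z_2=0}\cdots(\mathrm{Res}_{z_r=0}g(z_1,\dots,z_r))\cdots)$ (at each step the remaining variables are fixed at generic values), extended to $\mathcal O_\Delta$ in the same way. A diagonal basis is a subset $OB\subset O\mathcal B(\Delta)$ whose underlying unordered bases form a basis $B$ of $\mathcal B(\Delta)$ and such that $\mathrm{Res}^{o\tau}(\phi_\sigma)=\delta^\tau_\sigma$ for $o\sigma,o\tau\in OB$ ($\sigma$ denotes the unordered basis underlying $o\sigma$). Operators. $m(g)$ is multiplication by $g$; $(Cg)(z)=g(-z)$; $(\mathcal T(y)g)(z)=g(z-y)$. So the endomorphism of $S_\Delta$ whose trace is taken is $\phi\mapsto\mathrm{Res}_\Delta\big(e^{\langle t,z\rangle}f(z)E^t(\phi)(y-z)\big)$, where $z\mapsto E^t(\phi)(y-z)$ is holomorphic near $z=0$ for $y\in U_\Delta$. Alcoves. A wall of $\Delta$ is a hyperplane of $V^*$ generated by $r-1$ linearly independent elements of $\Delta$; an alcove is a connected component of the complement $V^*_{\Delta,areg}$ in $V^*$ of all walls and their translates by $M$. Eisenstein series. $U_\Delta=\{z\in V_{\mathbb C}:\langle\alpha,z+2i\pi n\rangle\neq0\ \forall n\in N,\ \alpha\in\Delta\}$. For $z\in U_\Delta$, $E(f)(t,z)=\sum_{n\in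 N}e^{\langle t,z+2i\pi n\rangle}f(z+2i\pi n)$ is a generalized function of $t\in V^*$, holomorphic in $z$; for $f\in G_\Delta$ it is smooth in $t$ on each alcove, and for $t$ in an alcove $E^t(f)$ denotes the holomorphic function $z\mapsto E(f)(t,z)$ on $U_\Delta$ (which defines an element of $\mathcal O_\Delta$ near $0$). For an alcove $\mathfrak a$ and $\sigma\in\mathcal B(\Delta)$, $$F^{\mathfrak a}_\sigma(z)=|M/M_\sigma|^{-1}\frac{\sum_{m\in\mathcal R(\mathfrak a,\sigma)}e^{\langle m,z\rangle}}{\prod_{\alpha\in\sigma}(1-e^{-\langle\alpha,z\rangle})},$$ where $M_\sigma=\bigoplus_{\alpha\in\sigma}\mathbb Z\alpha$ and $\mathcal R(\mathfrak a,\sigma)=(t-Q_\sigma)\cap M$ for any $t\in\mathfrak a$ (independent of $t\in\mathfrak a$), with $Q_\sigma=\{\sum_{\alpha\in\sigma}u_\alpha\alpha:0\le u_\alpha<1\}$. *)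

theory Defs
  imports "HOL-Complex_Analysis.Complex_Analysis" "HOL-Library.Function_Algebras"
begin

text \<open>
  Conventions.  \<open>V\<close> is \<open>real^'n\<close>, so \<open>r = CARD('n)\<close>, with an arbitrary lattice \<open>N\<close>; its
  complexification is \<open>complex^'n\<close>.  The dual space \<open>V\<^sup>*\<close> is \<open>real^'n\<close> again, acting through the
  standard bilinear pairing.
\<close>

definition pairing :: "real^'n \<Rightarrow> complex^'n \<Rightarrow> complex" where
  "pairing \<alpha> z = (\<Sum>i\<in>UNIV. complex_of_real (\<alpha> $ i) * z $ i)"

definition cvec :: "real^'n \<Rightarrow> complex^'n" where
  "cvec v = (\<chi> i. complex_of_real (v $ i))"


section \<open>Lattices\<close>

definition int_span :: "(real^'n) set \<Rightarrow> (real^'n) set" where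
  "int_span S = {\<Sum>b\<in>S. of_int (c b) *\<^sub>R b | c :: real^'n \<Rightarrow> int. True}"

definition is_lattice :: "(real^'n) set \<Rightarrow> bool" where
  "is_lattice N \<longleftrightarrow> (\<exists>S. independent S \<and> span S = UNIV \<and> N = int_span S)"

definition dual_lattice :: "(real^'n) set \<Rightarrow> (real^'n) set" where
  "dual_lattice N = {m. \<forall>n\<in>N. m \<bullet> n \<in> \<int>}"

definition indivisible_in :: "(real^'n) set \<Rightarrow> real^'n \<Rightarrow> bool" where
  "indivisible_in M \<alpha> \<longleftrightarrow> (\<forall>m\<in>M. \<forall>k::int. \<alpha> = of_int k *\<^sub>R m \<longrightarrow> \<bar>k\<bar> = 1)"


section \<open>Rational functions with poles along the hyperplanes\<close>

text \<open>
  A rational function with poles along the hyperplanes \<open>\<alpha> = 0\<close> (\<open>\<alpha> \<in> \<Delta>\<close>) is represented by the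
  total function that takes its values off these hyperplanes and is \<open>0\<close> on all of them.  Equality
  of rational functions is then equality of functions, and the vector space structure is the
  pointwise one.
\<close>

definition regular :: "(real^'n) set \<Rightarrow> complex^'n \<Rightarrow> bool" where
  "regular \<Delta> z \<longleftrightarrow> (\<forall>\<alpha>\<in>\<Delta>. pairing \<alpha> z \<noteq> 0)"

definition off_hyperplanes :: "(real^'n) set \<Rightarrow> (complex^'n \<Rightarrow> complex) \<Rightarrow> complex^'n \<Rightarrow> complex" where
  "off_hyperplanes \<Delta> g = (\<lambda>z. if regular \<Delta> z then g z else 0)"

interpretation cfun: vector_space "\<lambda>(c::complex) (g :: complex^'n \<Rightarrow> complex) z. c * g z"
  by unfold_locales (auto simp: fun_eq_iff algebra_simps)

inductive poly_fun :: "(complex^'n \<Rightarrow> complex) \<Rightarrow> bool" where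
  const: "poly_fun (\<lambda>z. c)"
| coord: "poly_fun (\<lambda>z. z $ i)"
| add: "poly_fun p \<Longrightarrow> poly_fun q \<Longrightarrow> poly_fun (\<lambda>z. p z + q z)"
| mult: "poly_fun p \<Longrightarrow> poly_fun q \<Longrightarrow> poly_fun (\<lambda>z. p z * q z)"

definition quot :: "(real^'n) set \<Rightarrow> (real^'n) list \<Rightarrow> (complex^'n \<Rightarrow> complex) \<Rightarrow> complex^'n \<Rightarrow> complex" where
  "quot \<Delta> \<kappa> h = off_hyperplanes \<Delta> (\<lambda>z. h z / (\<Prod>\<alpha>\<leftarrow>\<kappa>. pairing \<alpha> z))"

definition R_space :: "(real^'n) set \<Rightarrow> (complex^'n \<Rightarrow> complex) set" where
  "R_space \<Delta> = {quot \<Delta> \<kappa> p | \<kappa> p. set \<kappa> \<subseteq> \<Delta> \<and> poly_fun p}"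

definition G_space :: "(real^'n) set \<Rightarrow> (complex^'n \<Rightarrow> complex) set" where
  "G_space \<Delta> = cfun.span {quot \<Delta> \<kappa> (\<lambda>z. 1) | \<kappa>. set \<kappa> \<subseteq> \<Delta> \<and> span (set \<kappa>) = UNIV}"

definition bases :: "(real^'n) set \<Rightarrow> (real^'n) set set" where
  "bases \<Delta> = {\<sigma>. \<sigma> \<subseteq> \<Delta> \<and> independent \<sigma> \<and> span \<sigma> = UNIV}"

definition ordered_bases :: "(real^'n) set \<Rightarrow> (real^'n) list set" where
  "ordered_bases \<Delta> = {os. distinct os \<and> set os \<in> bases \<Delta>}"

definition phi :: "(real^'n) set \<Rightarrow> (real^'n) set \<Rightarrow> complex^'n \<Rightarrow> complex" where
  "phi \<Delta> \<sigma> = off_hyperplanes \<Delta> (\<lambda>z. 1 / (\<Prod>\<alpha>\<in>\<sigma>. pairing \<alpha> z))"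

definition S_space :: "(real^'n) set \<Rightarrow> (complex^'n \<Rightarrow> complex) set" where
  "S_space \<Delta> = cfun.span (phi \<Delta> ` bases \<Delta>)"

text \<open>
  Injectivity is needed because the condition concerns the family \<open>\<sigma> \<mapsto> phi \<Delta> \<sigma>\<close>: if
  \<open>\<alpha>, -\<alpha> \<in> \<Delta>\<close>, then distinct bases can give the same function.
\<close>

definition basis_of_bases :: "(real^'n) set \<Rightarrow> (real^'n) set set \<Rightarrow> bool" where
  "basis_of_bases \<Delta> B \<longleftrightarrow> B \<subseteq> bases \<Delta> \<and> inj_on (phi \<Delta>) B \<and>
     cfun.independent (phi \<Delta> ` B) \<and> cfun.span (phi \<Delta> ` B) = S_space \<Delta>"

text \<open>\<open>d\<close> lists the linear forms on \<open>S_space \<Delta>\<close>; their values elsewhere are irrelevant.\<close>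

definition dual_family ::
  "(real^'n) set \<Rightarrow> (real^'n) set set \<Rightarrow> ((real^'n) set \<Rightarrow> (complex^'n \<Rightarrow> complex) \<Rightarrow> complex) \<Rightarrow> bool" where
  "dual_family \<Delta> B d \<longleftrightarrow>
     (\<forall>\<sigma>\<in>B. \<forall>g\<in>S_space \<Delta>. \<forall>h\<in>S_space \<Delta>. \<forall>a b.
        d \<sigma> (\<lambda>z. a * g z + b * h z) = a * d \<sigma> g + b * d \<sigma> h) \<and>
     (\<forall>\<sigma>\<in>B. \<forall>\<tau>\<in>B. d \<sigma> (phi \<Delta> \<tau>) = (if \<sigma> = \<tau> then 1 else 0))"

definition trace_on ::
  "(complex^'n \<Rightarrow> complex) set \<Rightarrow> ((complex^'n \<Rightarrow> complex) \<Rightarrow> (complex^'n \<Rightarrow> complex)) \<Rightarrow> complex" where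
  "trace_on W A = (let b = (SOME b. cfun.independent b \<and> cfun.span b = W)
                   in \<Sum>g\<in>b. cfun.representation b (A g) g)"


section \<open>Residues\<close>

definition dir_deriv :: "(real^'n) set \<Rightarrow> real^'n \<Rightarrow> (complex^'n \<Rightarrow> complex) \<Rightarrow> complex^'n \<Rightarrow> complex" where
  "dir_deriv \<Delta> v g = off_hyperplanes \<Delta> (\<lambda>z. deriv (\<lambda>s. g (z + s *s cvec v)) 0)"

definition derivative_space :: "(real^'n) set \<Rightarrow> (complex^'n \<Rightarrow> complex) set" where
  "derivative_space \<Delta> = cfun.span {dir_deriv \<Delta> v g | v g. g \<in> R_space \<Delta>}"

text \<open>The projection of \<open>R_space \<Delta>\<close> onto \<open>S_space \<Delta>\<close> along \<open>derivative_space \<Delta>\<close>.\<close>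

definition Res_rat :: "(real^'n) set \<Rightarrow> (complex^'n \<Rightarrow> complex) \<Rightarrow> complex^'n \<Rightarrow> complex" where
  "Res_rat \<Delta> g = (THE s. s \<in> S_space \<Delta> \<and> g - s \<in> derivative_space \<Delta>)"

definition holo_on :: "(complex^'n) set \<Rightarrow> (complex^'n \<Rightarrow> complex) \<Rightarrow> bool" where
  "holo_on U h \<longleftrightarrow> open U \<and>
     (\<forall>z\<in>U. \<exists>D. (h has_derivative D) (at z) \<and> (\<forall>c v. D (c *s v) = c * D v))"

text \<open>
  Taylor polynomial at \<open>0\<close> of total degree at most \<open>K\<close>: the homogeneous component of degree \<open>d\<close>
  at \<open>z\<close> is the \<open>d\<close>-th Taylor coefficient of \<open>s \<mapsto> h (s z)\<close>.
\<close>

definition taylor_poly :: "nat \<Rightarrow> (complex^'n \<Rightarrow> complex) \<Rightarrow> complex^'n \<Rightarrow> complex" where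
  "taylor_poly K h z = (\<Sum>d\<le>K. (deriv ^^ d) (\<lambda>s. h (s *s z)) 0 / fact d)"

text \<open>
  \<open>germ_quot \<Delta> \<kappa> h g\<close>: near \<open>0\<close>, the function \<open>g\<close> is the meromorphic function with numerator
  \<open>h\<close>, holomorphic near \<open>0\<close>, and denominator the product of the \<open>\<alpha>\<close> in \<open>\<kappa>\<close>.
\<close>

definition germ_quot ::
  "(real^'n) set \<Rightarrow> (real^'n) list \<Rightarrow> (complex^'n \<Rightarrow> complex) \<Rightarrow> (complex^'n \<Rightarrow> complex) \<Rightarrow> bool" where
  "germ_quot \<Delta> \<kappa> h g \<longleftrightarrow> set \<kappa> \<subseteq> \<Delta> \<and>
     (\<exists>U. 0 \<in> U \<and> holo_on U h \<and>
        (\<forall>z\<in>U. regular \<Delta> z \<longrightarrow> g z = h z / (\<Prod>\<alpha>\<leftarrow>\<kappa>. pairing \<alpha> z)))"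

text \<open>
  Extension by Taylor expansion of the numerator, from rational functions to germs of meromorphic
  functions, of a linear map \<open>L\<close> that vanishes on homogeneous functions of all degrees but one:
  the value of \<open>L\<close> on the truncations is eventually constant.
\<close>

definition taylor_extension ::
  "(real^'n) set \<Rightarrow> ((complex^'n \<Rightarrow> complex) \<Rightarrow> 'b) \<Rightarrow> (complex^'n \<Rightarrow> complex) \<Rightarrow> 'b" where
  "taylor_extension \<Delta> L g = (THE c. \<exists>\<kappa> h. germ_quot \<Delta> \<kappa> h g \<and>
     (\<forall>\<^sub>F K in sequentially. L (quot \<Delta> \<kappa> (taylor_poly K h)) = c))"

definition Res :: "(real^'n) set \<Rightarrow> (complex^'n \<Rightarrow> complex) \<Rightarrow> complex^'n \<Rightarrow> complex" where
  "Res \<Delta> = taylor_extension \<Delta> (Res_rat \<Delta>)"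

text \<open>
  Iterated residue at \<open>0\<close> of a function of \<open>k\<close> variables, given as a list, in the last variable
  first.  A residue depends only on the values in small punctured discs, so each variable is
  evaluated only at points that are generic with respect to the preceding ones.
\<close>

primrec iter_residue :: "nat \<Rightarrow> (complex list \<Rightarrow> complex) \<Rightarrow> complex" where
  "iter_residue 0 G = G []"
| "iter_residue (Suc k) G = iter_residue k (\<lambda>ws. residue (\<lambda>w. G (ws @ [w])) 0)"

definition coord_point :: "(real^'n) list \<Rightarrow> complex list \<Rightarrow> complex^'n" where
  "coord_point os ws = (THE z. \<forall>j<length os. pairing (os ! j) z = ws ! j)"

definition IRes_rat :: "(real^'n) list \<Rightarrow> (complex^'n \<Rightarrow> complex) \<Rightarrow> complex" where
  "IRes_rat os g = iter_residue (length os) (\<lambda>ws. g (coord_point os ws))"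

definition IRes :: "(real^'n) set \<Rightarrow> (real^'n) list \<Rightarrow> (complex^'n \<Rightarrow> complex) \<Rightarrow> complex" where
  "IRes \<Delta> os = taylor_extension \<Delta> (IRes_rat os)"

definition diagonal_basis :: "(real^'n) set \<Rightarrow> (real^'n) list set \<Rightarrow> bool" where
  "diagonal_basis \<Delta> OB \<longleftrightarrow> OB \<subseteq> ordered_bases \<Delta> \<and> inj_on set OB \<and>
     basis_of_bases \<Delta> (set ` OB) \<and>
     (\<forall>os\<in>OB. \<forall>ot\<in>OB. IRes_rat ot (phi \<Delta> (set os)) = (if set os = set ot then 1 else 0))"


section \<open>Operators\<close>

definition mult_op :: "(complex^'n \<Rightarrow> complex) \<Rightarrow> (complex^'n \<Rightarrow> complex) \<Rightarrow> complex^'n \<Rightarrow> complex" where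
  "mult_op g h = (\<lambda>z. g z * h z)"

definition reflect_op :: "(complex^'n \<Rightarrow> complex) \<Rightarrow> complex^'n \<Rightarrow> complex" where
  "reflect_op g = (\<lambda>z. g (- z))"

definition translate_op :: "complex^'n \<Rightarrow> (complex^'n \<Rightarrow> complex) \<Rightarrow> complex^'n \<Rightarrow> complex" where
  "translate_op y g = (\<lambda>z. g (z - y))"


section \<open>Alcoves\<close>

definition walls :: "(real^'n) set \<Rightarrow> (real^'n) set set" where
  "walls \<Delta> = {span A | A. A \<subseteq> \<Delta> \<and> independent A \<and> card A = CARD('n) - 1}"

definition areg :: "(real^'n) set \<Rightarrow> (real^'n) set \<Rightarrow> (real^'n) set" where
  "areg N \<Delta> = - (\<Union>H\<in>walls \<Delta>. \<Union>m\<in>dual_lattice N. (\<lambda>x. m + x) ` H)"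

definition alcoves :: "(real^'n) set \<Rightarrow> (real^'n) set \<Rightarrow> (real^'n) set set" where
  "alcoves N \<Delta> = components (areg N \<Delta>)"


section \<open>Eisenstein series\<close>

definition lat_shift :: "complex^'n \<Rightarrow> real^'n \<Rightarrow> complex^'n" where
  "lat_shift z n = z + (2 * of_real pi * \<i>) *s cvec n"

definition U_set :: "(real^'n) set \<Rightarrow> (real^'n) set \<Rightarrow> (complex^'n) set" where
  "U_set N \<Delta> = {z. \<forall>n\<in>N. \<forall>\<alpha>\<in>\<Delta>. pairing \<alpha> (lat_shift z n) \<noteq> 0}"

text \<open>\<open>C\<^sup>k\<close> and smooth functions; only meant for open sets.\<close>

primrec Ck_on :: "nat \<Rightarrow> (real^'n) set \<Rightarrow> (real^'n \<Rightarrow> complex) \<Rightarrow> bool" where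
  "Ck_on 0 S u = continuous_on S u"
| "Ck_on (Suc k) S u = (\<exists>u'. (\<forall>x\<in>S. (u has_derivative u' x) (at x)) \<and>
                              (\<forall>v. Ck_on k S (\<lambda>x. u' x v)))"

definition smooth_on :: "(real^'n) set \<Rightarrow> (real^'n \<Rightarrow> complex) \<Rightarrow> bool" where
  "smooth_on S u \<longleftrightarrow> (\<forall>k. Ck_on k S u)"

definition test_fun :: "(real^'n) set \<Rightarrow> (real^'n \<Rightarrow> complex) \<Rightarrow> bool" where
  "test_fun S \<psi> \<longleftrightarrow> smooth_on UNIV \<psi> \<and> (\<exists>K. compact K \<and> K \<subseteq> S \<and> (\<forall>t. t \<notin> K \<longrightarrow> \<psi> t = 0))"

text \<open>
  The generalized function
  \<open>t \<mapsto> \<Sum>n\<in>N. exp \<langle>t, z + 2\<pi>in\<rangle> f (z + 2\<pi>in)\<close>, evaluated on a test function: the series does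
  not converge for fixed \<open>t\<close> in general, but it does after integration of each term.
\<close>

definition Eis_dist ::
  "(real^'n) set \<Rightarrow> (complex^'n \<Rightarrow> complex) \<Rightarrow> complex^'n \<Rightarrow> (real^'n \<Rightarrow> complex) \<Rightarrow> complex" where
  "Eis_dist N f z \<psi> =
     (\<Sum>\<^sub>\<infinity>n\<in>N. (LINT t|lborel. exp (pairing t (lat_shift z n)) * f (lat_shift z n) * \<psi> t))"

text \<open>
  The value at \<open>t\<close> of the smooth function on \<open>areg N \<Delta>\<close> that represents the restriction of this
  generalized function to \<open>areg N \<Delta>\<close>.
\<close>

definition Eis ::
  "(real^'n) set \<Rightarrow> (real^'n) set \<Rightarrow> real^'n \<Rightarrow> (complex^'n \<Rightarrow> complex) \<Rightarrow> complex^'n \<Rightarrow> complex" where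
  "Eis N \<Delta> t f z = (THE c. \<exists>u. smooth_on (areg N \<Delta>) u \<and>
     (\<forall>\<psi>. test_fun (areg N \<Delta>) \<psi> \<longrightarrow> Eis_dist N f z \<psi> = (LINT s|lborel. u s * \<psi> s)) \<and>
     u t = c)"


section \<open>The functions attached to an alcove and a basis\<close>

definition lattice_index :: "(real^'n) set \<Rightarrow> (real^'n) set \<Rightarrow> nat" where
  "lattice_index M L = card (M // {(x, y). x \<in> M \<and> y \<in> M \<and> x - y \<in> L})"

definition Q_box :: "(real^'n) set \<Rightarrow> (real^'n) set" where
  "Q_box \<sigma> = {\<Sum>\<alpha>\<in>\<sigma>. u \<alpha> *\<^sub>R \<alpha> | u :: real^'n \<Rightarrow> real. \<forall>\<alpha>\<in>\<sigma>. 0 \<le> u \<alpha> \<and> u \<alpha> < 1}"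

text \<open>The choice of the point of the alcove \<open>a\<close> is irrelevant.\<close>

definition R_set :: "(real^'n) set \<Rightarrow> (real^'n) set \<Rightarrow> (real^'n) set \<Rightarrow> (real^'n) set" where
  "R_set N a \<sigma> = (\<lambda>q. (SOME t. t \<in> a) - q) ` Q_box \<sigma> \<inter> dual_lattice N"

definition F_fun ::
  "(real^'n) set \<Rightarrow> (real^'n) set \<Rightarrow> (real^'n) set \<Rightarrow> complex^'n \<Rightarrow> complex" where
  "F_fun N a \<sigma> z =
     1 / of_nat (lattice_index (dual_lattice N) (int_span \<sigma>)) *
     ((\<Sum>m\<in>R_set N a \<sigma>. exp (pairing m z)) / (\<Prod>\<alpha>\<in>\<sigma>. 1 - exp (- pairing \<alpha> z)))"

end

theory Submission
 imports Defs
begin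

text \<open>
 By linearity \<open>f = 1 / \<Prod>\<kappa>\<close>. The residue reproduces \<open>f\<close> from the kernels \<open>\<phi>\<^sub>\<sigma>(w - z)\<close>: integration by parts
 reduces \<open>f(w) = \<Sum>\<sigma>. \<langle>\<phi>\<^sup>\<sigma>, Res (f(z) \<phi>\<^sub>\<sigma>(w - z))\<rangle>\<close>, with \<open>\<phi>\<^sub>\<sigma>(w - z)\<close> expanded at \<open>z = 0\<close>, to \<open>f \<in> S\<^sub>\<Delta>\<close>.
 Summing over \<open>w \<in> y + 2\<pi>iN\<close> turns the kernels into the Eisenstein series of \<open>\<phi>\<^sub>\<sigma>\<close> at \<open>y - z\<close>, which is
 \<open>F\<^sub>\<sigma>\<close> by Poisson summation over the half-open box \<open>Q\<^sub>\<sigma>\<close>; the sum may be taken inside the residue because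
 only finitely many Taylor coefficients matter. The trace formula is the same sum written in the basis \<open>\<phi>\<^sub>\<sigma>\<close>.
\<close>

text \<open>The Eisenstein series is only a generalized function of \<open>t\<close>, so its terms
  cannot be summed pointwise. Identities are first proved after integration against test functions
  supported off the walls (\<open>rep\<close>); both sides are smooth there, and bump functions give
  equality at each point. Test functions also supply the convergence, through the decay of their
  Fourier transforms. The other obstacle is to carry derivatives and lattice sums past the residue.
  On homogeneous polynomials of a fixed degree, \<open>d \<sigma>\<close> composed with the residue
  is a finite combination of point evaluations (\<open>ev\<close>), so it is enough to treat scalar
  Taylor coefficients along a line. The decomposition of \<open>R_space \<Delta>\<close> behind the
  residue is established too: straightening denominators to sets without broken circuits shows that
  the two summands suffice, and iterated residues along such bases, sorted by rank, show that the
  sum is direct. Indivisibility makes the zeros of \<open>1 - exp (- pairing \<alpha> z)\<close>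
  exactly the lattice translates of the hyperplane of \<alpha>.\<close>

lemmas int_cong = Bochner_Integration.integral_cong[OF refl]

section \<open>The bilinear pairing and polynomial functions with their directional
  derivatives\<close>

lemma pairing_add_right: "pairing a (z + w) = pairing a z + pairing a w"
 by (simp add: pairing_def algebra_simps sum.distrib)
lemma pairing_minus_right: "pairing a (- z) = - pairing a z"
 by (simp add: pairing_def sum_negf)
lemma pairing_diff_right: "pairing a (z - w) = pairing a z - pairing a w"
 by (simp add: pairing_def algebra_simps sum_subtractf)
lemma pairing_smult_right: "pairing a (c *s z) = c * pairing a z"
 by (simp add: pairing_def sum_distrib_left algebra_simps)
lemma pairing_zero_right [simp]: "pairing a 0 = 0"
 by (simp add: pairing_def)
lemma pairing_zero_left [simp]: "pairing 0 z = 0"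
 by (simp add: pairing_def)
lemma pairing_add_left: "pairing (a + b) z = pairing a z + pairing b z"
 by (simp add: pairing_def algebra_simps sum.distrib)
lemma pairing_diff_left: "pairing (a - b) z = pairing a z - pairing b z"
 by (simp add: pairing_def algebra_simps sum_subtractf)
lemma pairing_scaleR_left: "pairing (c *\<^sub>R a) z = of_real c * pairing a z"
 by (simp add: pairing_def sum_distrib_left algebra_simps)
lemma pairing_sum_left: "pairing (sum g A) z = (\<Sum>x\<in>A. pairing (g x) z)"
 by (induction A rule: infinite_finite_induct) (auto simp: pairing_add_left)
lemma pairing_sum_right: "pairing a (sum g A) = (\<Sum>x\<in>A. pairing a (g x))"
 by (induction A rule: infinite_finite_induct) (auto simp: pairing_add_right)
lemma pairing_cvec [simp]: "pairing a (cvec v) = of_real (a \<bullet> v)"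
 by (simp add: pairing_def cvec_def inner_vec_def)
lemma cvec_add: "cvec (u + v) = cvec u + cvec v"
 by (simp add: cvec_def vec_eq_iff)
lemma cvec_scaleR: "cvec (c *\<^sub>R v) = of_real c *s cvec v"
 by (simp add: cvec_def vec_eq_iff)
lemma cvec_zero [simp]: "cvec 0 = 0"
 by (simp add: cvec_def vec_eq_iff)
lemma pairing_axis_left: "pairing (axis i 1) z = z $ i"
proof -
 have "pairing (axis i 1) z = (\<Sum>j\<in>UNIV. if j = i then z $ j else 0)"
  unfolding pairing_def by (rule sum.cong) (auto simp: axis_def)
 then show ?thesis by simp
qed

lemmas pairing_simps = pairing_add_right pairing_minus_right pairing_diff_right
 pairing_smult_right pairing_add_left pairing_diff_left pairing_scaleR_left

lemma poly_fun_pairing: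
 fixes a :: "real^'n"
 shows "poly_fun (pairing a)"
proof -
 have "poly_fun (\<lambda>z. \<Sum>i\<in>A. complex_of_real (a $ i) * z $ i)" if "finite A" for A :: "'n set"
  using that by induction (auto intro!: poly_fun.intros)
 then show ?thesis unfolding pairing_def[abs_def] by simp
qed

lemma poly_fun_prod_list: "poly_fun (\<lambda>z. \<Prod>\<alpha>\<leftarrow>ks. pairing \<alpha> z)"
 by (induction ks) (auto intro!: poly_fun.intros poly_fun_pairing)

lemma poly_fun_scale: "poly_fun p \<Longrightarrow> poly_fun (\<lambda>z. c * p z)"
 by (intro poly_fun.intros)

lemma poly_fun_diff: "poly_fun p \<Longrightarrow> poly_fun q \<Longrightarrow> poly_fun (\<lambda>z. p z - q z)"
 using poly_fun.add[of p "\<lambda>z. (-1) * q z"] poly_fun_scale[of q "-1"] by simp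

lemma poly_fun_sum: "(\<And>x. x \<in> A \<Longrightarrow> poly_fun (g x)) \<Longrightarrow> poly_fun (\<lambda>z. \<Sum>x\<in>A. g x z)"
 by (induction A rule: infinite_finite_induct) (auto intro!: poly_fun.intros)

text \<open>Unlike \<open>dir_deriv\<close> it has no cut-off on the hyperplanes, so it maps
  polynomial functions to polynomial functions and serves for numerators and denominators
  separately.\<close>

definition pd :: "real^'n \<Rightarrow> (complex^'n \<Rightarrow> complex) \<Rightarrow> complex^'n \<Rightarrow> complex" where
 "pd v p = (\<lambda>z. deriv (\<lambda>s. p (z + s *s cvec v)) 0)"

text \<open>Directional derivatives are taken at parameter 0 only; moving the base point along the
  line turns them into derivatives at every parameter, as holomorphy along the line
  requires.\<close>

lemma line_shift:
 assumes "((\<lambda>s. p (z + s0 *s u + s *s u)) has_field_derivative D) (at 0)"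
 shows "((\<lambda>s. p (z + s *s u)) has_field_derivative D) (at (s0::complex))"
proof -
 have "((\<lambda>s. p (z + (s0 + s) *s u)) has_field_derivative D) (at 0)"
  using assms by (simp add: vector_sadd_rdistrib add.assoc)
 then have "((\<lambda>s. p (z + s *s u)) has_field_derivative D) (at (s0 + 0))"
  using DERIV_shift[of "\<lambda>s. p (z + s *s u)" D 0 s0] by (simp add: add.commute)
 then show ?thesis by simp
qed

text \<open>Both claims go through one induction: \<open>deriv\<close> says nothing about a function
  that is not differentiable, so the product case needs the derivatives of both factors to exist
  before \<open>pd\<close> of the product can be identified.\<close>

lemma poly_fun_pd:
 assumes "poly_fun p"
 shows "poly_fun (pd v p) \<and> (\<forall>z. ((\<lambda>s. p (z + s *s cvec v)) has_field_derivative pd v p z) (at 0))"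
 using assms
proof induction
 case (const c)
 have "pd v (\<lambda>z. c) = (\<lambda>z. 0)" by (simp add: pd_def)
 then show ?case by (auto intro: poly_fun.const)
next
 case (coord i)
 have d: "((\<lambda>s. (z + s *s cvec v) $ i) has_field_derivative cvec v $ i) (at 0)" for z :: "complex^'a"
  by (auto intro!: derivative_eq_intros)
 then have "pd v (\<lambda>z. z $ i) = (\<lambda>z. cvec v $ i)"
  unfolding pd_def using DERIV_imp_deriv by blast
 then show ?case using d poly_fun.const by metis
next
 case (add p q)
 have d: "((\<lambda>s. p (z + s *s cvec v) + q (z + s *s cvec v)) has_field_derivative pd v p z + pd v q z) (at 0)" for z
  using add by (auto intro!: derivative_eq_intros)
 then have e: "pd v (\<lambda>z. p z + q z) = (\<lambda>z. pd v p z + pd v q z)"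
  unfolding pd_def[of v "\<lambda>z. p z + q z"] using DERIV_imp_deriv by blast
 show ?case unfolding e using d add poly_fun.add by blast
next
 case (mult p q)
 have d: "((\<lambda>s. p (z + s *s cvec v) * q (z + s *s cvec v)) has_field_derivative pd v p z * q z + p z * pd v q z) (at 0)" for z
 proof -
  have "((\<lambda>s. p (z + s *s cvec v)) has_field_derivative pd v p z) (at 0)" "((\<lambda>s. q (z + s *s cvec v)) has_field_derivative pd v q z) (at 0)"
   using mult by auto
  from DERIV_mult[OF this] show ?thesis by (simp add: algebra_simps)
 qed
 then have e: "pd v (\<lambda>z. p z * q z) = (\<lambda>z. pd v p z * q z + p z * pd v q z)"
  unfolding pd_def[of v "\<lambda>z. p z * q z"] using DERIV_imp_deriv by blast
 have "poly_fun (\<lambda>z. pd v p z * q z + p z * pd v q z)"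
  using mult by (intro poly_fun.add poly_fun.mult) auto
 then show ?case unfolding e using d by blast
qed

lemmas poly_fun_pd_poly = poly_fun_pd[THEN conjunct1]
lemmas poly_fun_pd_deriv = poly_fun_pd[THEN conjunct2, rule_format]

lemma pd_eqI: "(\<And>z. ((\<lambda>s. p (z + s *s cvec v)) has_field_derivative D z) (at 0)) \<Longrightarrow> pd v p = D"
 unfolding pd_def using DERIV_imp_deriv by blast

lemma pd_add: "poly_fun p \<Longrightarrow> poly_fun q \<Longrightarrow> pd v (\<lambda>z. p z + q z) = (\<lambda>z. pd v p z + pd v q z)"
 by (rule pd_eqI) (auto intro!: derivative_eq_intros poly_fun_pd_deriv)

lemma pd_mult:
 assumes "poly_fun p" "poly_fun q"
 shows "pd v (\<lambda>z. p z * q z) = (\<lambda>z. pd v p z * q z + p z * pd v q z)"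
proof (rule pd_eqI)
 fix z
 from DERIV_mult[OF poly_fun_pd_deriv[OF assms(1), of z v] poly_fun_pd_deriv[OF assms(2), of z v]]
 show "((\<lambda>s. p (z + s *s cvec v) * q (z + s *s cvec v)) has_field_derivative pd v p z * q z + p z * pd v q z) (at 0)"
  by (simp add: algebra_simps)
qed

lemma pd_diff: "poly_fun p \<Longrightarrow> poly_fun q \<Longrightarrow> pd v (\<lambda>z. p z - q z) = (\<lambda>z. pd v p z - pd v q z)"
 by (rule pd_eqI) (auto intro!: derivative_eq_intros poly_fun_pd_deriv)

lemma pd_const: "pd v (\<lambda>z. c) = (\<lambda>z. 0)"
 by (simp add: pd_def)

lemma pd_pairing: "pd v (pairing a) = (\<lambda>z. of_real (a \<bullet> v))"
 by (rule pd_eqI) (auto simp: pairing_simps intro!: derivative_eq_intros)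

lemma pd_coord: "pd v (\<lambda>z. z $ i) = (\<lambda>z. cvec v $ i)"
 by (rule pd_eqI) (auto intro!: derivative_eq_intros)

lemma pd_commute: "poly_fun p \<Longrightarrow> pd u (pd v p) = pd v (pd u p)"
proof (induction rule: poly_fun.induct)
 case (add p q) then show ?case by (simp add: pd_add poly_fun_pd_poly)
next
 case (mult p q)
 then show ?case
  by (simp add: pd_add pd_mult poly_fun_pd_poly poly_fun.mult algebra_simps)
qed (simp_all add: pd_const pd_coord)

section \<open>Rational functions\<close>

lemma prod_list_pairing_nz: "set ks \<subseteq> \<Delta> \<Longrightarrow> regular \<Delta> z \<Longrightarrow> (\<Prod>\<alpha>\<leftarrow>ks. pairing \<alpha> z) \<noteq> 0"
 by (induction ks) (auto simp: regular_def)

lemma quot_regular: "regular \<Delta> z \<Longrightarrow> quot \<Delta> ks p z = p z / (\<Prod>\<alpha>\<leftarrow>ks. pairing \<alpha> z)"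
 by (simp add: quot_def off_hyperplanes_def)

lemma quot_not_regular: "\<not> regular \<Delta> z \<Longrightarrow> quot \<Delta> ks p z = 0"
 by (simp add: quot_def off_hyperplanes_def)

lemma R_not_regular: "g \<in> R_space \<Delta> \<Longrightarrow> \<not> regular \<Delta> z \<Longrightarrow> g z = 0"
 by (auto simp: R_space_def quot_not_regular)

lemma R_quot: "set ks \<subseteq> \<Delta> \<Longrightarrow> poly_fun p \<Longrightarrow> quot \<Delta> ks p \<in> R_space \<Delta>"
 by (auto simp: R_space_def)

lemma quot_add_denom: "set ks' \<subseteq> \<Delta> \<Longrightarrow> quot \<Delta> ks p = quot \<Delta> (ks @ ks') (\<lambda>z. p z * (\<Prod>\<alpha>\<leftarrow>ks'. pairing \<alpha> z))"
 using prod_list_pairing_nz[of ks' \<Delta>] by (auto simp: quot_def off_hyperplanes_def fun_eq_iff)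

lemma quot_add: "quot \<Delta> ks (\<lambda>z. p z + q z) = (\<lambda>z. quot \<Delta> ks p z + quot \<Delta> ks q z)"
 by (auto simp: quot_def off_hyperplanes_def add_divide_distrib)

lemma quot_scale: "quot \<Delta> ks (\<lambda>z. c * p z) = (\<lambda>z. c * quot \<Delta> ks p z)"
 by (auto simp: quot_def off_hyperplanes_def)

lemma quot_sum: "quot \<Delta> ks (\<lambda>z. \<Sum>x\<in>A. g x z) = (\<lambda>z. \<Sum>x\<in>A. quot \<Delta> ks (g x) z)"
 by (auto simp: quot_def off_hyperplanes_def sum_divide_distrib)

lemma quot_mult: "(\<lambda>z. quot \<Delta> ks p z * quot \<Delta> ks' q z) = quot \<Delta> (ks @ ks') (\<lambda>z. p z * q z)"
 by (auto simp: quot_def off_hyperplanes_def)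

lemma R_mult: "g \<in> R_space \<Delta> \<Longrightarrow> h \<in> R_space \<Delta> \<Longrightarrow> (\<lambda>z. g z * h z) \<in> R_space \<Delta>"
proof -
 assume "g \<in> R_space \<Delta>" "h \<in> R_space \<Delta>"
 then obtain ks p ks' q where *: "set ks \<subseteq> \<Delta>" "poly_fun p" "g = quot \<Delta> ks p"
  "set ks' \<subseteq> \<Delta>" "poly_fun q" "h = quot \<Delta> ks' q"
  by (auto simp: R_space_def)
 show ?thesis unfolding *(3,6) quot_mult by (rule R_quot) (use * in \<open>auto intro: poly_fun.mult\<close>)
qed

lemma R_scale: "g \<in> R_space \<Delta> \<Longrightarrow> (\<lambda>z. c * g z) \<in> R_space \<Delta>"
proof -
 assume "g \<in> R_space \<Delta>"
 then obtain ks p where *: "set ks \<subseteq> \<Delta>" "poly_fun p" "g = quot \<Delta> ks p"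
  by (auto simp: R_space_def)
 show ?thesis unfolding *(3) quot_scale[symmetric] by (rule R_quot) (use * in \<open>auto intro: poly_fun_scale\<close>)
qed

lemma R_zero: "(\<lambda>z. 0) \<in> R_space \<Delta>"
proof -
 have "(\<lambda>z. 0) = quot \<Delta> [] (\<lambda>z. 0)" by (auto simp: quot_def off_hyperplanes_def)
 then show ?thesis using R_quot[of "[]" \<Delta> "\<lambda>z. 0"] poly_fun.const by auto
qed

lemma R_common_denom:
 assumes "g \<in> R_space \<Delta>" "h \<in> R_space \<Delta>"
 obtains ks p q where "set ks \<subseteq> \<Delta>" "poly_fun p" "poly_fun q" "g = quot \<Delta> ks p" "h = quot \<Delta> ks q"
proof -
 obtain ks1 p where 1: "set ks1 \<subseteq> \<Delta>" "poly_fun p" "g = quot \<Delta> ks1 p"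
  using assms by (auto simp: R_space_def)
 obtain ks2 q where 2: "set ks2 \<subseteq> \<Delta>" "poly_fun q" "h = quot \<Delta> ks2 q"
  using assms by (auto simp: R_space_def)
 have "h = quot \<Delta> (ks2 @ ks1) (\<lambda>z. q z * (\<Prod>\<alpha>\<leftarrow>ks1. pairing \<alpha> z))"
  using 1 2 quot_add_denom by blast
 also have "\<dots> = quot \<Delta> (ks1 @ ks2) (\<lambda>z. q z * (\<Prod>\<alpha>\<leftarrow>ks1. pairing \<alpha> z))"
  by (auto simp: quot_def off_hyperplanes_def mult.commute)
 finally show ?thesis
  using 1 2 quot_add_denom[of ks2 \<Delta> ks1 p]
  by (intro that[of "ks1 @ ks2"]) (auto intro!: poly_fun.mult poly_fun_prod_list)
qed

lemma R_add: "g \<in> R_space \<Delta> \<Longrightarrow> h \<in> R_space \<Delta> \<Longrightarrow> (\<lambda>z. g z + h z) \<in> R_space \<Delta>"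
 by (erule (1) R_common_denom) (auto simp: quot_add[symmetric] intro!: R_quot poly_fun.add)

lemma R_sum: "(\<And>x. x \<in> A \<Longrightarrow> g x \<in> R_space \<Delta>) \<Longrightarrow> (\<lambda>z. \<Sum>x\<in>A. g x z) \<in> R_space \<Delta>"
 by (induction A rule: infinite_finite_induct) (auto intro: R_zero R_add)

lemma cfun_subspaceI:
 assumes "(\<lambda>z. 0) \<in> W" "\<And>g h. g \<in> W \<Longrightarrow> h \<in> W \<Longrightarrow> (\<lambda>z. g z + h z) \<in> W"
  "\<And>c g. g \<in> W \<Longrightarrow> (\<lambda>z. c * g z) \<in> W"
 shows "cfun.subspace W"
 using assms unfolding cfun.subspace_def by (simp add: zero_fun_def plus_fun_def)

lemma R_subspace: "cfun.subspace (R_space \<Delta>)"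
 by (intro cfun_subspaceI R_zero R_add R_scale)

section \<open>Differentiation of rational functions\<close>

lemma regular_eventually:
 assumes "finite \<Delta>" "regular \<Delta> z"
 shows "\<forall>\<^sub>F s in nhds 0. regular \<Delta> (z + s *s u)"
proof -
 have "\<forall>\<^sub>F s in nhds 0. pairing \<alpha> (z + s *s u) \<noteq> 0" if "\<alpha> \<in> \<Delta>" for \<alpha>
 proof -
  have "isCont (\<lambda>s. pairing \<alpha> (z + s *s u)) 0"
   by (simp add: pairing_simps)
  then have "((\<lambda>s. pairing \<alpha> (z + s *s u)) \<longlongrightarrow> pairing \<alpha> (z + 0 *s u)) (nhds 0)"
   using tendsto_at_iff_tendsto_nhds[of "\<lambda>s. pairing \<alpha> (z + s *s u)" 0] unfolding continuous_at by simp
  moreover have "pairing \<alpha> (z + 0 *s u) \<noteq> 0" using assms(2) that by (simp add: regular_def)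
  ultimately show ?thesis
   by (rule tendsto_imp_eventually_ne)
 qed
 then show ?thesis unfolding regular_def using assms(1) by (simp add: eventually_ball_finite)
qed

text \<open>The numerator in the quotient rule. The denominator that goes with it is the full
  square, that is, the list \<open>ks @ ks\<close>; nothing is cancelled.\<close>

definition quot_deriv_num :: "real^'n \<Rightarrow> (real^'n) list \<Rightarrow> (complex^'n \<Rightarrow> complex) \<Rightarrow> complex^'n \<Rightarrow> complex" where
 "quot_deriv_num v ks p = (\<lambda>z. (\<Prod>\<alpha>\<leftarrow>ks. pairing \<alpha> z) * pd v p z - p z * pd v (\<lambda>z. \<Prod>\<alpha>\<leftarrow>ks. pairing \<alpha> z) z)"

lemma poly_fun_quot_deriv_num: "poly_fun p \<Longrightarrow> poly_fun (quot_deriv_num v ks p)"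
 unfolding quot_deriv_num_def
 by (intro poly_fun_diff poly_fun.mult poly_fun_prod_list poly_fun_pd_poly)

lemma quot_has_deriv:
 assumes "finite \<Delta>" "set ks \<subseteq> \<Delta>" "poly_fun p" "regular \<Delta> z"
 shows "((\<lambda>s. quot \<Delta> ks p (z + s *s cvec v)) has_field_derivative quot \<Delta> (ks @ ks) (quot_deriv_num v ks p) z) (at 0)"
proof -
 define Q where "Q = (\<lambda>z. \<Prod>\<alpha>\<leftarrow>ks. pairing \<alpha> z)"
 have nz: "Q z \<noteq> 0" using prod_list_pairing_nz assms Q_def by metis
 have "((\<lambda>s. p (z + s *s cvec v) / Q (z + s *s cvec v)) has_field_derivative
   (pd v p z * Q z - p z * pd v Q z) / (Q z * Q z)) (at 0)"
  using DERIV_divide[OF poly_fun_pd_deriv[OF assms(3), of z v] poly_fun_pd_deriv[of Q z v]] nz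
  by (simp add: Q_def poly_fun_prod_list)
 moreover have "(pd v p z * Q z - p z * pd v Q z) / (Q z * Q z) = quot \<Delta> (ks @ ks) (quot_deriv_num v ks p) z"
  using assms by (simp add: quot_regular quot_deriv_num_def Q_def mult.commute)
 ultimately have *: "((\<lambda>s. p (z + s *s cvec v) / Q (z + s *s cvec v)) has_field_derivative
   quot \<Delta> (ks @ ks) (quot_deriv_num v ks p) z) (at 0)" by simp
 have "\<forall>\<^sub>F s in nhds 0. p (z + s *s cvec v) / Q (z + s *s cvec v) = quot \<Delta> ks p (z + s *s cvec v)"
  using regular_eventually[OF assms(1,4), of "cvec v"]
  by (rule eventually_mono) (auto simp: quot_regular Q_def)
 from DERIV_cong_ev[OF refl this refl] show ?thesis using * by blast
qed

lemma dir_deriv_quot: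
 assumes "finite \<Delta>" "set ks \<subseteq> \<Delta>" "poly_fun p"
 shows "dir_deriv \<Delta> v (quot \<Delta> ks p) = quot \<Delta> (ks @ ks) (quot_deriv_num v ks p)"
 using quot_has_deriv[OF assms, THEN DERIV_imp_deriv, of _ v]
 by (auto simp: fun_eq_iff dir_deriv_def off_hyperplanes_def quot_not_regular)

lemma R_has_deriv:
 assumes "finite \<Delta>" "g \<in> R_space \<Delta>" "regular \<Delta> z"
 shows "((\<lambda>s. g (z + s *s cvec v)) has_field_derivative dir_deriv \<Delta> v g z) (at 0)"
 using assms quot_has_deriv[OF assms(1) _ _ assms(3)] by (auto simp: R_space_def dir_deriv_quot)

lemma R_has_deriv_at:
 assumes "finite \<Delta>" "g \<in> R_space \<Delta>" "regular \<Delta> (z + s0 *s cvec v)"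
 shows "((\<lambda>s. g (z + s *s cvec v)) has_field_derivative dir_deriv \<Delta> v g (z + s0 *s cvec v)) (at s0)"
 using R_has_deriv[OF assms] by (rule line_shift)

lemma R_dir_deriv: "finite \<Delta> \<Longrightarrow> g \<in> R_space \<Delta> \<Longrightarrow> dir_deriv \<Delta> v g \<in> R_space \<Delta>"
proof -
 assume fin: "finite \<Delta>" and "g \<in> R_space \<Delta>"
 then obtain ks p where *: "set ks \<subseteq> \<Delta>" "poly_fun p" "g = quot \<Delta> ks p"
  by (auto simp: R_space_def)
 show ?thesis unfolding *(3) dir_deriv_quot[OF fin *(1,2)]
  by (rule R_quot) (use * in \<open>auto intro: poly_fun_quot_deriv_num\<close>)
qed

lemma dir_deriv_eqI:
 assumes "\<And>z. regular \<Delta> z \<Longrightarrow> ((\<lambda>s. g (z + s *s cvec v)) has_field_derivative D z) (at 0)"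
  "\<And>z. \<not> regular \<Delta> z \<Longrightarrow> D z = 0"
 shows "dir_deriv \<Delta> v g = D"
 using assms by (auto simp: dir_deriv_def off_hyperplanes_def fun_eq_iff DERIV_imp_deriv)

lemma dir_deriv_not_regular: "\<not> regular \<Delta> z \<Longrightarrow> dir_deriv \<Delta> v g z = 0"
 by (simp add: dir_deriv_def off_hyperplanes_def)

lemma dir_deriv_add:
 assumes "finite \<Delta>" "g \<in> R_space \<Delta>" "h \<in> R_space \<Delta>"
 shows "dir_deriv \<Delta> v (\<lambda>z. g z + h z) = (\<lambda>z. dir_deriv \<Delta> v g z + dir_deriv \<Delta> v h z)"
 by (rule dir_deriv_eqI) (auto intro!: derivative_eq_intros R_has_deriv assms simp: dir_deriv_not_regular)

lemma dir_deriv_scale: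
 assumes "finite \<Delta>" "g \<in> R_space \<Delta>"
 shows "dir_deriv \<Delta> v (\<lambda>z. c * g z) = (\<lambda>z. c * dir_deriv \<Delta> v g z)"
proof (rule dir_deriv_eqI)
 fix z assume "regular \<Delta> z"
 from DERIV_cmult[OF R_has_deriv[OF assms this]]
 show "((\<lambda>s. c * g (z + s *s cvec v)) has_field_derivative c * dir_deriv \<Delta> v g z) (at 0)" .
qed (simp add: dir_deriv_not_regular)

lemma dir_deriv_mult:
 assumes "finite \<Delta>" "g \<in> R_space \<Delta>" "h \<in> R_space \<Delta>"
 shows "dir_deriv \<Delta> v (\<lambda>z. g z * h z) = (\<lambda>z. dir_deriv \<Delta> v g z * h z + g z * dir_deriv \<Delta> v h z)"
proof (rule dir_deriv_eqI)
 fix z assume "regular \<Delta> z"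
 from DERIV_mult[OF R_has_deriv[OF assms(1,2) this] R_has_deriv[OF assms(1,3) this]]
 show "((\<lambda>s. g (z + s *s cvec v) * h (z + s *s cvec v)) has_field_derivative
   dir_deriv \<Delta> v g z * h z + g z * dir_deriv \<Delta> v h z) (at 0)" by (simp add: algebra_simps)
qed (simp add: dir_deriv_not_regular)

text \<open>Over the common denominator, the fourth power of the given one, the claim is an identity
  between numerators, and it follows from the commutation of derivatives of polynomial
  functions.\<close>

lemma dir_deriv_commute:
 assumes "finite \<Delta>" "g \<in> R_space \<Delta>"
 shows "dir_deriv \<Delta> u (dir_deriv \<Delta> v g) = dir_deriv \<Delta> v (dir_deriv \<Delta> u g)"
proof -
 obtain ks p where g: "set ks \<subseteq> \<Delta>" "poly_fun p" "g = quot \<Delta> ks p"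
  using assms by (auto simp: R_space_def)
 define Q where "Q = (\<lambda>z. \<Prod>\<alpha>\<leftarrow>ks. pairing \<alpha> z)"
 have pq: "poly_fun p" "poly_fun Q" using g poly_fun_prod_list by (auto simp: Q_def)
 note polys = pq pq[THEN poly_fun_pd_poly] pq[THEN poly_fun_pd_poly, THEN poly_fun_pd_poly]
 have QQ: "(\<lambda>z. \<Prod>\<alpha>\<leftarrow>ks @ ks. pairing \<alpha> z) = (\<lambda>z. Q z * Q z)" by (simp add: Q_def)
 have pdQ: "pd w (\<lambda>z. \<Prod>\<alpha>\<leftarrow>ks @ ks. pairing \<alpha> z) = (\<lambda>z. pd w Q z * Q z + Q z * pd w Q z)" for w
  unfolding QQ by (rule pd_mult) (use pq in auto)
 have num: "quot_deriv_num w ks p = (\<lambda>z. Q z * pd w p z - p z * pd w Q z)" for w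
  by (simp add: quot_deriv_num_def Q_def)
 have pdn: "pd w' (quot_deriv_num w ks p) = (\<lambda>z. pd w' Q z * pd w p z + Q z * pd w' (pd w p) z
   - (pd w' p z * pd w Q z + p z * pd w' (pd w Q) z))" for w w'
  unfolding num using polys by (simp add: pd_diff pd_mult poly_fun.mult)
 have num2: "quot_deriv_num w (ks @ ks) h = (\<lambda>z. Q z * Q z * pd w h z - h z * (pd w Q z * Q z + Q z * pd w Q z))" for w h
  unfolding quot_deriv_num_def[of w "ks @ ks"] pdQ by (simp add: QQ fun_eq_iff Q_def)
 have eq: "quot_deriv_num u (ks @ ks) (quot_deriv_num v ks p) = quot_deriv_num v (ks @ ks) (quot_deriv_num u ks p)"
  unfolding num2 unfolding pdn unfolding num pd_commute[OF pq(1), of u v] pd_commute[OF pq(2), of u v]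
  by (rule ext) (simp only: algebra_simps)
 then show ?thesis
  using g assms(1) by (simp add: dir_deriv_quot poly_fun_quot_deriv_num)
qed

text \<open>Each direction has its own one-variable derivative, so additivity in the direction is a
  separate fact; for polynomial functions it is an induction. It reduces statements about all
  directions to those of a basis.\<close>

lemma dir_deriv_add_dir:
 assumes "finite \<Delta>" "g \<in> R_space \<Delta>"
 shows "dir_deriv \<Delta> (u + v) g = (\<lambda>z. dir_deriv \<Delta> u g z + dir_deriv \<Delta> v g z)"
proof -
 have pda: "poly_fun p \<Longrightarrow> pd (u + v) p = (\<lambda>z. pd u p z + pd v p z)" for p :: "complex^'a \<Rightarrow> complex"
  by (induction rule: poly_fun.induct)
   (simp_all add: pd_const pd_coord pd_add pd_mult cvec_add algebra_simps)
 obtain ks p where g: "set ks \<subseteq> \<Delta>" "poly_fun p" "g = quot \<Delta> ks p"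
  using assms by (auto simp: R_space_def)
 have n: "quot_deriv_num (u + v) ks p = (\<lambda>z. quot_deriv_num u ks p z + quot_deriv_num v ks p z)"
  unfolding quot_deriv_num_def pda[OF g(2)] pda[OF poly_fun_prod_list]
  by (rule ext) (simp only: algebra_simps)
 show ?thesis unfolding g(3) dir_deriv_quot[OF assms(1) g(1,2)] n quot_add ..
qed

lemma dir_deriv_scale_dir:
 assumes "finite \<Delta>" "g \<in> R_space \<Delta>"
 shows "dir_deriv \<Delta> (c *\<^sub>R v) g = (\<lambda>z. of_real c * dir_deriv \<Delta> v g z)"
proof -
 have pda: "poly_fun p \<Longrightarrow> pd (c *\<^sub>R v) p = (\<lambda>z. of_real c * pd v p z)" for p :: "complex^'a \<Rightarrow> complex"
  by (induction rule: poly_fun.induct)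
   (simp_all add: pd_const pd_coord pd_add pd_mult cvec_scaleR algebra_simps)
 obtain ks p where g: "set ks \<subseteq> \<Delta>" "poly_fun p" "g = quot \<Delta> ks p"
  using assms by (auto simp: R_space_def)
 have n: "quot_deriv_num (c *\<^sub>R v) ks p = (\<lambda>z. of_real c * quot_deriv_num v ks p z)"
  unfolding quot_deriv_num_def pda[OF g(2)] pda[OF poly_fun_prod_list]
  by (rule ext) (simp only: algebra_simps)
 show ?thesis unfolding g(3) dir_deriv_quot[OF assms(1) g(1,2)] n quot_scale ..
qed

section \<open>Complex spans of functions, dual vectors, products of linear forms\<close>

lemma cfun_span_induct [consumes 1, case_names zero add scale base]:
 assumes "g \<in> cfun.span X" "P (\<lambda>z. 0)" "\<And>g h. P g \<Longrightarrow> P h \<Longrightarrow> P (\<lambda>z. g z + h z)"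
  "\<And>c g. P g \<Longrightarrow> P (\<lambda>z. c * g z)" "\<And>x. x \<in> X \<Longrightarrow> P x"
 shows "P g"
proof -
 have "cfun.subspace {g. P g}" using assms(2-4) by (intro cfun_subspaceI) auto
 then have "cfun.span X \<subseteq> {g. P g}" using assms(5) by (intro cfun.span_minimal) auto
 then show ?thesis using assms(1) by auto
qed

lemma cfun_span_add: "g \<in> cfun.span X \<Longrightarrow> h \<in> cfun.span X \<Longrightarrow> (\<lambda>z. g z + h z) \<in> cfun.span X"
 using cfun.span_add[of g X h] by (simp add: plus_fun_def)
lemma cfun_span_scale: "g \<in> cfun.span X \<Longrightarrow> (\<lambda>z. c * g z) \<in> cfun.span X"
 using cfun.span_scale[of g X c] by simp
lemma cfun_span_zero: "(\<lambda>z. 0) \<in> cfun.span X"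
 using cfun.span_zero[of X] by (simp add: zero_fun_def)
lemma cfun_span_sum: "(\<And>x. x \<in> A \<Longrightarrow> g x \<in> cfun.span X) \<Longrightarrow> (\<lambda>z. \<Sum>x\<in>A. g x z) \<in> cfun.span X"
 by (induction A rule: infinite_finite_induct) (auto intro: cfun_span_zero cfun_span_add)

lemma cfun_span_mult:
 assumes "p \<in> cfun.span X" "q \<in> cfun.span Y" "\<And>x y. x \<in> X \<Longrightarrow> y \<in> Y \<Longrightarrow> (\<lambda>z. x z * y z) \<in> cfun.span Z"
 shows "(\<lambda>z. p z * q z) \<in> cfun.span Z"
 using assms(1)
proof (induction p rule: cfun_span_induct)
 case (base x)
 show ?case using assms(2)
 proof (induction q rule: cfun_span_induct)
  case (add g h)
  from cfun_span_add[OF add] show ?case by (simp add: algebra_simps)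
 next
  case (scale c g)
  from cfun_span_scale[OF scale, of c] show ?case by (simp add: algebra_simps)
 qed (use base assms(3) in \<open>auto intro: cfun_span_zero\<close>)
next
 case (add g h)
 from cfun_span_add[OF add] show ?case by (simp add: algebra_simps)
next
 case (scale c g)
 from cfun_span_scale[OF scale, of c] show ?case by (simp add: algebra_simps)
qed (auto intro: cfun_span_zero)

text \<open>The coordinate functional of \<gamma>, extended linearly to the whole space, is the
  inner product with the value of its adjoint at 1. These vectors also serve as directions of
  differentiation that see only one element of \<open>b\<close>.\<close>

lemma dual_vectors:
 fixes b :: "(real^'n) set"
 assumes "independent b"
 obtains dv where "\<And>\<beta> \<gamma>. \<beta> \<in> b \<Longrightarrow> \<gamma> \<in> b \<Longrightarrow> \<beta> \<bullet> dv \<gamma> = (if \<beta> = \<gamma> then 1 else 0)"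
proof -
 have "\<exists>v. \<forall>\<beta>\<in>b. \<beta> \<bullet> v = (if \<beta> = \<gamma> then 1 else 0)" for \<gamma>
 proof -
  obtain g :: "real^'n \<Rightarrow> real" where g: "linear g" "\<forall>x\<in>b. g x = (if x = \<gamma> then 1 else 0)"
   using linear_independent_extend[OF assms, of "\<lambda>x. if x = \<gamma> then 1 else 0 :: real"] by blast
  then show ?thesis using adjoint_works[OF g(1), of _ 1]
   by (intro exI[of _ "adjoint g 1"]) auto
 qed
 then have "\<exists>dv. \<forall>\<gamma>. \<forall>\<beta>\<in>b. \<beta> \<bullet> dv \<gamma> = (if \<beta> = \<gamma> then 1 else 0)" by (intro choice allI)
 then show ?thesis using that by auto
qed

lemma dual_expand:
 fixes b :: "(real^'n) set"
 assumes "independent b" "\<And>\<beta> \<gamma>. \<beta> \<in> b \<Longrightarrow> \<gamma> \<in> b \<Longrightarrow> \<beta> \<bullet> dv \<gamma> = (if \<beta> = \<gamma> then 1 else 0)" "x \<in> span b"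
 shows "x = (\<Sum>\<beta>\<in>b. (x \<bullet> dv \<beta>) *\<^sub>R \<beta>)"
proof -
 have fin: "finite b" using assms(1) by (rule independent_imp_finite)
 obtain u where u: "x = (\<Sum>\<beta>\<in>b. u \<beta> *\<^sub>R \<beta>)" using assms(3) by (auto simp: span_finite[OF fin])
 have "x \<bullet> dv \<gamma> = u \<gamma>" if "\<gamma> \<in> b" for \<gamma>
 proof -
  have "x \<bullet> dv \<gamma> = (\<Sum>\<beta>\<in>b. u \<beta> * (\<beta> \<bullet> dv \<gamma>))" by (simp add: u inner_sum_left)
  also have "\<dots> = (\<Sum>\<beta>\<in>b. if \<beta> = \<gamma> then u \<beta> else 0)" using that by (intro sum.cong) (auto simp: assms(2))
  finally show ?thesis using that fin by simp
 qed
 then show ?thesis using u by simp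
qed

abbreviation lprod :: "(real^'n) list \<Rightarrow> complex^'n \<Rightarrow> complex" where
 "lprod ks z \<equiv> (\<Prod>\<alpha>\<leftarrow>ks. pairing \<alpha> z)"

lemma lprod_remove1: "\<gamma> \<in> set ks \<Longrightarrow> lprod ks z = pairing \<gamma> z * lprod (remove1 \<gamma> ks) z"
 by (induction ks) auto

lemma lprod_count:
 assumes "finite b" "set ks \<subseteq> b"
 shows "lprod ks z = (\<Prod>\<beta>\<in>b. pairing \<beta> z ^ count_list ks \<beta>)"
 using assms(2)
proof (induction ks)
 case (Cons a ks)
 have "(\<Prod>\<beta>\<in>b. pairing \<beta> z ^ count_list (a # ks) \<beta>)
  = (\<Prod>\<beta>\<in>b. (if \<beta> = a then pairing a z else 1) * pairing \<beta> z ^ count_list ks \<beta>)"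
  by (intro prod.cong) auto
 also have "\<dots> = pairing a z * (\<Prod>\<beta>\<in>b. pairing \<beta> z ^ count_list ks \<beta>)"
  using Cons assms(1) by (simp add: prod.distrib prod.delta)
 finally show ?case using Cons by simp
qed simp

lemma lprod_distinct: "distinct ks \<Longrightarrow> lprod ks z = (\<Prod>\<alpha>\<in>set ks. pairing \<alpha> z)"
 by (induction ks) auto

lemma phi_quot: "distinct ks \<Longrightarrow> phi \<Delta> (set ks) = quot \<Delta> ks (\<lambda>z. 1)"
 by (simp add: phi_def quot_def lprod_distinct)

section \<open>Broken circuits\<close>

text \<open>The no-broken-circuit condition for the order given by \<open>rk\<close>:
  \<open>X\<close> contains no circuit of \<Delta> deprived of its element of lowest rank.\<close>

definition unbroken :: "(real^'n) set \<Rightarrow> (real^'n \<Rightarrow> nat) \<Rightarrow> (real^'n) set \<Rightarrow> bool" where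
 "unbroken \<Delta> rk X \<longleftrightarrow> (\<forall>\<beta>\<in>\<Delta>. \<beta> \<notin> span {\<gamma>\<in>X. rk \<beta> < rk \<gamma>})"

text \<open>In a linear relation among elements of \<open>X\<close>, the element of lowest rank with
  a nonzero coefficient would lie in the span of elements of higher rank.\<close>

lemma unbroken_independent:
 assumes "inj_on rk \<Delta>" "X \<subseteq> \<Delta>" "finite X" "unbroken \<Delta> rk X"
 shows "independent X"
proof
 assume "dependent X"
 then obtain u v where u: "v \<in> X" "u v \<noteq> 0" "(\<Sum>v\<in>X. u v *\<^sub>R v) = 0"
  using dependent_finite[OF assms(3)] by auto
 define Y where "Y = {v\<in>X. u v \<noteq> 0}"
 have Y: "finite Y" "Y \<noteq> {}" using u assms(3) by (auto simp: Y_def)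
 define \<beta> where "\<beta> = arg_min_on rk Y"
 have \<beta>: "\<beta> \<in> Y" "\<And>x. x \<in> Y \<Longrightarrow> rk \<beta> \<le> rk x"
  using arg_min_if_finite[OF Y, of rk] unfolding \<beta>_def by (auto simp: not_less)
 have lt: "rk \<beta> < rk x" if "x \<in> Y" "x \<noteq> \<beta>" for x
  using \<beta> that assms(1,2) by (metis (no_types, lifting) Y_def inj_onD le_neq_implies_less mem_Collect_eq subsetD)
 have "0 = u \<beta> *\<^sub>R \<beta> + (\<Sum>v\<in>Y-{\<beta>}. u v *\<^sub>R v)"
 proof -
  have "(\<Sum>v\<in>X. u v *\<^sub>R v) = (\<Sum>v\<in>Y. u v *\<^sub>R v)"
   using assms(3) by (intro sum.mono_neutral_right) (auto simp: Y_def)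
  then show ?thesis using u sum.remove[OF Y(1) \<beta>(1), of "\<lambda>v. u v *\<^sub>R v"] by simp
 qed
 then have "u \<beta> *\<^sub>R \<beta> = - (\<Sum>v\<in>Y-{\<beta>}. u v *\<^sub>R v)" by (simp add: eq_neg_iff_add_eq_0)
 then have "(1 / u \<beta>) *\<^sub>R (u \<beta> *\<^sub>R \<beta>) = (1 / u \<beta>) *\<^sub>R (- (\<Sum>v\<in>Y-{\<beta>}. u v *\<^sub>R v))" by simp
 moreover have "u \<beta> \<noteq> 0" using \<beta>(1) by (simp add: Y_def)
 ultimately have "\<beta> = (1 / u \<beta>) *\<^sub>R (- (\<Sum>v\<in>Y-{\<beta>}. u v *\<^sub>R v))" by simp
 also have "\<dots> \<in> span {\<gamma>\<in>X. rk \<beta> < rk \<gamma>}"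
  using lt by (intro span_scale span_neg span_sum) (auto intro!: span_base simp: Y_def)
 finally have "\<beta> \<in> span {\<gamma>\<in>X. rk \<beta> < rk \<gamma>}" .
 then show False using assms(2,4) \<beta>(1) by (auto simp: unbroken_def Y_def)
qed

lemma sum_list_remove1_nat: "\<gamma> \<in> set ks \<Longrightarrow> sum_list (map rk ks) = (rk \<gamma> :: nat) + sum_list (map rk (remove1 \<gamma> ks))"
 by (induction ks) auto

lemma set_remove1_supset: "set ks - {\<gamma>} \<subseteq> set (remove1 \<gamma> ks)"
 by (induction ks) auto

text \<open>A relation \<open>\<beta> = \<Sum> u \<gamma> \<gamma>\<close> with all \<open>\<gamma>\<close> above \<open>\<beta>\<close> trades one \<open>\<gamma>\<close> in the denominator for
 \<open>\<beta>\<close>, which lowers the total rank.\<close>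

lemma quot_unbroken:
 assumes "finite \<Delta>" "inj_on rk \<Delta>" "0 \<notin> \<Delta>" "set ks \<subseteq> \<Delta>"
 shows "quot \<Delta> ks p \<in> cfun.span {quot \<Delta> ks' p | ks'. set ks' \<subseteq> \<Delta> \<and> length ks' = length ks \<and>
      span (set ks') = span (set ks) \<and> unbroken \<Delta> rk (set ks')}"
 using assms(4)
proof (induction "sum_list (map rk ks)" arbitrary: ks rule: less_induct)
 case less
 show ?case
 proof (cases "unbroken \<Delta> rk (set ks)")
  case True
  then show ?thesis using less.prems by (intro cfun.span_base) auto
 next
  case False
  then obtain \<beta> where \<beta>: "\<beta> \<in> \<Delta>" "\<beta> \<in> span {\<gamma>\<in>set ks. rk \<beta> < rk \<gamma>}" by (auto simp: unbroken_def)
  define Y where "Y = {\<gamma>\<in>set ks. rk \<beta> < rk \<gamma>}"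
  obtain u where u: "\<beta> = (\<Sum>\<gamma>\<in>Y. u \<gamma> *\<^sub>R \<gamma>)"
   using \<beta>(2) span_finite[of Y] by (auto simp: Y_def)
  \<comment> \<open>Zero coefficients are dropped: only a \<gamma> with nonzero coefficient can be
    recovered from \<beta> and the remaining elements, which keeps the span of the denominator
    unchanged.\<close>
  define Z where "Z = {\<gamma>\<in>Y. u \<gamma> \<noteq> 0}"
  have uZ: "\<beta> = (\<Sum>\<gamma>\<in>Z. u \<gamma> *\<^sub>R \<gamma>)"
   unfolding u by (intro sum.mono_neutral_right) (auto simp: Z_def Y_def)
  have Zfin: "finite Z" by (simp add: Z_def Y_def)
  \<comment> \<open>Multiplication by \<beta> / \<beta>, with the upper \<beta> expanded by the
    relation; each \<gamma> then cancels one of its own occurrences in the denominator.\<close>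
  have ex: "quot \<Delta> ks p z = (\<Sum>\<gamma>\<in>Z. of_real (u \<gamma>) * quot \<Delta> (\<beta> # remove1 \<gamma> ks) p z)" for z
  proof (cases "regular \<Delta> z")
   case True
   have nb: "pairing \<beta> z \<noteq> 0" using True \<beta>(1) by (auto simp: regular_def)
   have nk: "lprod ks z \<noteq> 0" using True less.prems prod_list_pairing_nz by blast
   have "pairing \<beta> z = (\<Sum>\<gamma>\<in>Z. of_real (u \<gamma>) * pairing \<gamma> z)"
    by (subst uZ) (simp add: pairing_sum_left pairing_scaleR_left)
   then have "p z / lprod ks z = (\<Sum>\<gamma>\<in>Z. of_real (u \<gamma>) * pairing \<gamma> z) * (p z / (pairing \<beta> z * lprod ks z))"
    using nb by simp
   also have "\<dots> = (\<Sum>\<gamma>\<in>Z. of_real (u \<gamma>) * (p z / (pairing \<beta> z * lprod (remove1 \<gamma> ks) z)))"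
    unfolding sum_distrib_right
   proof (rule sum.cong, simp)
    fix \<gamma> assume "\<gamma> \<in> Z"
    then have g: "\<gamma> \<in> set ks" by (auto simp: Z_def Y_def)
    have "pairing \<gamma> z \<noteq> 0" using g True less.prems by (auto simp: regular_def)
    then show "of_real (u \<gamma>) * pairing \<gamma> z * (p z / (pairing \<beta> z * lprod ks z))
      = of_real (u \<gamma>) * (p z / (pairing \<beta> z * lprod (remove1 \<gamma> ks) z))"
     by (simp add: lprod_remove1[OF g])
   qed
   finally show ?thesis using True by (simp add: quot_regular)
  qed (simp add: quot_not_regular)
  have "quot \<Delta> (\<beta> # remove1 \<gamma> ks) p \<in> cfun.span {quot \<Delta> ks' p | ks'. set ks' \<subseteq> \<Delta> \<and> length ks' = length ks \<and>
      span (set ks') = span (set ks) \<and> unbroken \<Delta> rk (set ks')}" if "\<gamma> \<in> Z" for \<gamma>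
  proof -
   have g: "\<gamma> \<in> set ks" "rk \<beta> < rk \<gamma>" "u \<gamma> \<noteq> 0" using that by (auto simp: Z_def Y_def)
   let ?k = "\<beta> # remove1 \<gamma> ks"
   have sub: "set ?k \<subseteq> \<Delta>" using \<beta>(1) less.prems set_remove1_subset[of \<gamma> ks] by auto
   have len: "length ?k = length ks" using g(1) by (simp add: length_remove1) (metis Suc_pred length_pos_if_in_set)
   have "\<gamma> \<in> span (set ?k)"
   proof -
    have "\<beta> = u \<gamma> *\<^sub>R \<gamma> + (\<Sum>\<delta>\<in>Z-{\<gamma>}. u \<delta> *\<^sub>R \<delta>)"
     by (subst uZ) (rule sum.remove[OF Zfin that])
    then have "u \<gamma> *\<^sub>R \<gamma> = \<beta> - (\<Sum>\<delta>\<in>Z-{\<gamma>}. u \<delta> *\<^sub>R \<delta>)" by (simp add: algebra_simps)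
    then have "\<gamma> = (1 / u \<gamma>) *\<^sub>R (\<beta> - (\<Sum>\<delta>\<in>Z-{\<gamma>}. u \<delta> *\<^sub>R \<delta>))"
     using g(3) by (simp add: eq_vector_fraction_iff)
    also have "\<dots> \<in> span (set ?k)"
    proof (intro span_scale span_diff span_sum)
     show "\<beta> \<in> span (set ?k)" by (rule span_base) simp
     fix \<delta> assume "\<delta> \<in> Z - {\<gamma>}"
     then have "\<delta> \<in> set ?k" using set_remove1_supset[of ks \<gamma>] by (auto simp: Z_def Y_def)
     then show "\<delta> \<in> span (set ?k)" by (rule span_base)
    qed
    finally show ?thesis .
   qed
   then have "set ks \<subseteq> span (set ?k)"
    using set_remove1_supset[of ks \<gamma>] span_superset[of "set ?k"] by auto
   moreover have "set ?k \<subseteq> span (set ks)"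
    using set_remove1_subset[of \<gamma> ks] span_superset[of "set ks"] \<beta>(2) span_mono[of "{\<gamma>\<in>set ks. rk \<beta> < rk \<gamma>}" "set ks"] by auto
   ultimately have sp: "span (set ?k) = span (set ks)"
    by (simp add: span_eq)
   have "sum_list (map rk ?k) < sum_list (map rk ks)"
    using sum_list_remove1_nat[OF g(1), of rk] g(2) by simp
   from less.hyps[OF this sub] show ?thesis unfolding len sp .
  qed
  then have "(\<lambda>z. \<Sum>\<gamma>\<in>Z. of_real (u \<gamma>) * quot \<Delta> (\<beta> # remove1 \<gamma> ks) p z) \<in> cfun.span {quot \<Delta> ks' p | ks'. set ks' \<subseteq> \<Delta> \<and> length ks' = length ks \<and>
      span (set ks') = span (set ks) \<and> unbroken \<Delta> rk (set ks')}"
   by (intro cfun_span_sum cfun_span_scale)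
  moreover have "quot \<Delta> ks p = (\<lambda>z. \<Sum>\<gamma>\<in>Z. of_real (u \<gamma>) * quot \<Delta> (\<beta> # remove1 \<gamma> ks) p z)" using ex by (rule ext)
  ultimately show ?thesis by simp
 qed
qed

definition unbroken_bases :: "(real^'n) set \<Rightarrow> (real^'n \<Rightarrow> nat) \<Rightarrow> (real^'n) set set" where
 "unbroken_bases \<Delta> rk = {\<sigma>\<in>bases \<Delta>. unbroken \<Delta> rk \<sigma>}"

lemma basis_finite: "\<sigma> \<in> bases \<Delta> \<Longrightarrow> finite \<sigma>"
 by (auto simp: bases_def independent_imp_finite)

lemma basis_card: fixes \<sigma> :: "(real^'n) set" shows "\<sigma> \<in> bases \<Delta> \<Longrightarrow> card \<sigma> = CARD('n)"
 using dim_eq_card[of \<sigma> UNIV] by (auto simp: bases_def dim_UNIV)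

lemma phi_unbroken:
 fixes \<sigma> :: "(real^'n) set"
 assumes "finite \<Delta>" "inj_on rk \<Delta>" "0 \<notin> \<Delta>" "\<sigma> \<in> bases \<Delta>"
 shows "phi \<Delta> \<sigma> \<in> cfun.span (phi \<Delta> ` unbroken_bases \<Delta> rk)"
proof -
 obtain ks where ks: "set ks = \<sigma>" "distinct ks" using basis_finite[OF assms(4)] finite_distinct_list by blast
 have len: "length ks = CARD('n)" using ks basis_card[OF assms(4)] distinct_card by force
 have "phi \<Delta> \<sigma> = quot \<Delta> ks (\<lambda>z. 1)" using phi_quot ks by blast
 also have "\<dots> \<in> cfun.span {quot \<Delta> ks' (\<lambda>z. 1) | ks'. set ks' \<subseteq> \<Delta> \<and> length ks' = length ks \<and>
      span (set ks') = span (set ks) \<and> unbroken \<Delta> rk (set ks')}"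
  using assms ks by (intro quot_unbroken) (auto simp: bases_def)
 also have "\<dots> \<subseteq> cfun.span (phi \<Delta> ` unbroken_bases \<Delta> rk)"
 proof (rule cfun.span_mono, safe)
  fix ks' assume *: "set ks' \<subseteq> \<Delta>" "length ks' = length ks" "span (set ks') = span (set ks)" "unbroken \<Delta> rk (set ks')"
  have ind: "independent (set ks')" using unbroken_independent * assms by blast
  have sp: "span (set ks') = UNIV" using * ks assms by (auto simp: bases_def)
  have mem: "set ks' \<in> unbroken_bases \<Delta> rk" using ind sp * by (auto simp: unbroken_bases_def bases_def)
  \<comment> \<open>Straightening keeps the length \<open>CARD('n)\<close>, and a list of that
    length whose set is a basis has no repetition; so the fraction is a \<open>phi\<close>.\<close>
  then have "distinct ks'" using * len basis_card[of "set ks'" \<Delta>] by (auto simp: unbroken_bases_def card_distinct)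
  then show "quot \<Delta> ks' (\<lambda>z. 1) \<in> phi \<Delta> ` unbroken_bases \<Delta> rk" using mem phi_quot by (metis imageI)
 qed
 finally show ?thesis .
qed

lemma S_space_unbroken:
 assumes "finite \<Delta>" "inj_on rk \<Delta>" "0 \<notin> \<Delta>"
 shows "S_space \<Delta> = cfun.span (phi \<Delta> ` unbroken_bases \<Delta> rk)"
proof
 show "S_space \<Delta> \<subseteq> cfun.span (phi \<Delta> ` unbroken_bases \<Delta> rk)"
  unfolding S_space_def by (rule cfun.span_minimal) (use phi_unbroken[OF assms] in auto)
 show "cfun.span (phi \<Delta> ` unbroken_bases \<Delta> rk) \<subseteq> S_space \<Delta>"
  unfolding S_space_def by (rule cfun.span_mono) (auto simp: unbroken_bases_def)
qed

section \<open>The decomposition of rational functions\<close>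

text \<open>Numerators are rewritten as polynomials in the elements of a basis \<open>b\<close>, so
  that over a denominator drawn from \<open>b\<close> they become Laurent monomials.\<close>

lemma poly_fun_in_span:
 fixes b :: "(real^'n) set"
 assumes "finite b" "span b = UNIV" "poly_fun p"
 shows "p \<in> cfun.span {lprod c | c. set c \<subseteq> b}"
 using assms(3)
proof induction
 case (const c)
 have "lprod [] \<in> {lprod c | c. set c \<subseteq> b}" by (auto intro!: exI[of _ "[]"])
 from cfun_span_scale[OF cfun.span_base[OF this], of c] show ?case by simp
next
 case (coord i)
 obtain u where u: "axis i 1 = (\<Sum>\<beta>\<in>b. u \<beta> *\<^sub>R \<beta>)"
  using assms(2) span_finite[OF assms(1)] by (metis (no_types, lifting) UNIV_I rangeE)
 have "(\<lambda>z. \<Sum>\<beta>\<in>b. of_real (u \<beta>) * lprod [\<beta>] z) \<in> cfun.span {lprod c | c. set c \<subseteq> b}"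
  by (intro cfun_span_sum cfun_span_scale cfun.span_base CollectI exI[of _ "[_]"]) auto
 moreover have "z $ i = (\<Sum>\<beta>\<in>b. of_real (u \<beta>) * lprod [\<beta>] z)" for z
  unfolding pairing_axis_left[symmetric] u by (simp add: pairing_sum_left pairing_scaleR_left)
 ultimately show ?case by simp
next
 case (add p q) then show ?case by (intro cfun_span_add)
next
 case (mult p q)
 from mult.IH show ?case
 proof (rule cfun_span_mult)
  fix x y :: "complex^'n \<Rightarrow> complex" assume "x \<in> {lprod c | c. set c \<subseteq> b}" "y \<in> {lprod c | c. set c \<subseteq> b}"
  then obtain c d where "x = lprod c" "y = lprod d" "set c \<subseteq> b" "set d \<subseteq> b" by auto
  then show "(\<lambda>z. x z * y z) \<in> cfun.span {lprod c | c. set c \<subseteq> b}"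
   by (intro cfun.span_base CollectI exI[of _ "c @ d"]) auto
 qed
qed

text \<open>For a direction dual to \<beta>, the operator \<beta> times the derivative multiplies a
  monomial by its degree in \<beta>. The factor \<beta> stays on the left so that no occurrence has
  to be removed from the list.\<close>

lemma pd_lprod:
 assumes "\<beta> \<bullet> v = 1" "\<And>\<gamma>. \<gamma> \<in> set ks \<Longrightarrow> \<gamma> \<noteq> \<beta> \<Longrightarrow> \<gamma> \<bullet> v = 0"
 shows "pairing \<beta> z * pd v (lprod ks) z = of_nat (count_list ks \<beta>) * lprod ks z"
 using assms(2)
proof (induction ks)
 case Nil then show ?case by (simp add: pd_const)
next
 case (Cons a ks)
 have "pd v (lprod (a # ks)) z = of_real (a \<bullet> v) * lprod ks z + pairing a z * pd v (lprod ks) z"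
  by (simp add: pd_mult poly_fun_pairing poly_fun_prod_list pd_pairing)
 moreover have "pairing \<beta> z * pd v (lprod ks) z = of_nat (count_list ks \<beta>) * lprod ks z" using Cons by auto
 ultimately show ?case using assms(1) Cons.prems by (cases "a = \<beta>") (auto simp: algebra_simps)
qed

lemma derivative_space_base: "g \<in> R_space \<Delta> \<Longrightarrow> dir_deriv \<Delta> v g \<in> derivative_space \<Delta>"
 unfolding derivative_space_def by (rule cfun.span_base) auto

text \<open>Straightening leaves denominators with independent support. Completing the support to a
  basis \<open>b\<close> and expanding the numerator in \<open>b\<close> gives Laurent monomials in
  \<open>b\<close>: if some exponent differs from -1 the monomial is a derivative in the dual
  direction, and if all equal -1 it is a \<open>phi\<close>.\<close>

lemma S_derivative_sum:
 fixes \<Delta> :: "(real^'n) set"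
 assumes "finite \<Delta>" "0 \<notin> \<Delta>" "g \<in> R_space \<Delta>"
 shows "\<exists>s\<in>S_space \<Delta>. g - s \<in> derivative_space \<Delta>"
proof -
 define W where "W = cfun.span (phi \<Delta> ` bases \<Delta> \<union> {dir_deriv \<Delta> v g | v g. g \<in> R_space \<Delta>})"
 have SW: "g \<in> S_space \<Delta> \<Longrightarrow> g \<in> W" and DW: "g \<in> derivative_space \<Delta> \<Longrightarrow> g \<in> W" for g
  unfolding W_def S_space_def derivative_space_def by (auto elim: cfun.span_mono[THEN subsetD, rotated])
 have subW: "cfun.subspace W" unfolding W_def by (rule cfun.subspace_span)
 have mono: "quot \<Delta> ks (lprod c) \<in> W"
  if k: "set ks \<subseteq> \<Delta>" "set ks \<subseteq> b" and b: "independent b" "span b = UNIV" and c: "set c \<subseteq> b" for ks b c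
 proof -
  have finb: "finite b" using b independent_imp_finite by blast
  obtain dv where dv: "\<And>\<beta> \<gamma>. \<beta> \<in> b \<Longrightarrow> \<gamma> \<in> b \<Longrightarrow> \<beta> \<bullet> dv \<gamma> = (if \<beta> = \<gamma> then 1 else 0)"
   using dual_vectors[OF b(1)] by blast
  show ?thesis
  proof (cases "\<exists>\<beta>\<in>b. count_list ks \<beta> \<noteq> Suc (count_list c \<beta>)")
   case True
   then obtain \<beta> where \<beta>: "\<beta> \<in> b" "count_list ks \<beta> \<noteq> Suc (count_list c \<beta>)" by auto
   define v where "v = dv \<beta>"
   have v: "\<beta> \<bullet> v = 1" "\<And>\<gamma>. \<gamma> \<in> b \<Longrightarrow> \<gamma> \<noteq> \<beta> \<Longrightarrow> \<gamma> \<bullet> v = 0" using dv \<beta> by (auto simp: v_def)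
   \<comment> \<open>The exponent of \<beta> plus one: the factor produced by differentiating the
     monomial raised by one power of \<beta>. It is nonzero because the exponent is not -1.\<close>
   define e :: complex where "e = of_nat (Suc (count_list c \<beta>)) - of_nat (count_list ks \<beta>)"
   have e: "e \<noteq> 0" using \<beta>(2) unfolding e_def by (metis eq_iff_diff_eq_0 of_nat_eq_iff)
   have pl: "poly_fun (lprod (\<beta> # c))" by (rule poly_fun_prod_list)
   have num: "quot_deriv_num v ks (lprod (\<beta> # c)) = (\<lambda>z. e * (lprod c z * lprod ks z))"
   proof
    fix z
    have 1: "pd v (lprod (\<beta> # c)) z = of_nat (Suc (count_list c \<beta>)) * lprod c z"
     using pd_lprod[of \<beta> v c z] v c
     by (simp add: pd_mult poly_fun_pairing poly_fun_prod_list pd_pairing subset_iff algebra_simps)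
    have 2: "pairing \<beta> z * pd v (lprod ks) z = of_nat (count_list ks \<beta>) * lprod ks z"
     using pd_lprod[of \<beta> v ks z] v k by auto
    have "lprod (\<beta> # c) z * pd v (lprod ks) z = lprod c z * (pairing \<beta> z * pd v (lprod ks) z)"
     by simp
    then show "quot_deriv_num v ks (lprod (\<beta> # c)) z = e * (lprod c z * lprod ks z)"
     unfolding quot_deriv_num_def 1 2 e_def by (simp only: algebra_simps)
   qed
   have "dir_deriv \<Delta> v (quot \<Delta> ks (lprod (\<beta> # c))) = quot \<Delta> (ks @ ks) (\<lambda>z. e * (lprod c z * lprod ks z))"
    unfolding dir_deriv_quot[OF assms(1) k(1) pl] num ..
   also have "\<dots> = (\<lambda>z. e * quot \<Delta> ks (lprod c) z)"
    unfolding quot_scale using quot_add_denom[OF k(1), of ks "lprod c"] by simp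
   finally have "(\<lambda>z. e * quot \<Delta> ks (lprod c) z) \<in> derivative_space \<Delta>"
    using derivative_space_base[of "quot \<Delta> ks (lprod (\<beta> # c))" \<Delta> v] R_quot[OF k(1) pl] by simp
   from cfun_span_scale[OF this[unfolded derivative_space_def], of "1 / e"]
   show ?thesis using e by (intro DW) (simp add: derivative_space_def)
  next
   case False
   then have cnt: "count_list ks \<beta> = Suc (count_list c \<beta>)" if "\<beta> \<in> b" for \<beta> using that by auto
   \<comment> \<open>The completed basis may contain vectors outside \<Delta>; exponent -1
     everywhere forces each of its elements into the denominator, hence into \<Delta>.\<close>
   then have "b \<subseteq> set ks" by (metis count_list_0_iff nat.distinct(1) subsetI)
   then have kb: "set ks = b" using k by auto
   then have bb: "b \<in> bases \<Delta>" using k b by (auto simp: bases_def)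
   have "quot \<Delta> ks (lprod c) = phi \<Delta> b"
   proof
    fix z
    show "quot \<Delta> ks (lprod c) z = phi \<Delta> b z"
    proof (cases "regular \<Delta> z")
     case True
     have "lprod ks z = lprod c z * (\<Prod>\<beta>\<in>b. pairing \<beta> z)"
      unfolding lprod_count[OF finb k(2)] lprod_count[OF finb c] prod.distrib[symmetric]
      by (rule prod.cong) (auto simp: cnt)
     moreover have "lprod c z \<noteq> 0" using c kb k True prod_list_pairing_nz by blast
     ultimately show ?thesis using True by (simp add: quot_regular phi_def off_hyperplanes_def)
    qed (simp add: quot_not_regular phi_def off_hyperplanes_def)
   qed
   then show ?thesis unfolding S_space_def using bb by (auto intro!: SW cfun.span_base simp: S_space_def)
  qed
 qed
 have indep: "quot \<Delta> ks p \<in> W" if k: "set ks \<subseteq> \<Delta>" "independent (set ks)" and p: "poly_fun p" for ks p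
 proof -
  obtain b where b': "set ks \<subseteq> b" "b \<subseteq> UNIV" "independent b" "UNIV \<subseteq> span b"
   by (rule maximal_independent_subset_extend[OF subset_UNIV k(2)])
  then have b: "set ks \<subseteq> b" "independent b" "span b = UNIV" by auto
  have finb: "finite b" using b independent_imp_finite by blast
  show ?thesis using poly_fun_in_span[OF finb b(3) p]
  proof (induction p rule: cfun_span_induct)
   case zero
   have "quot \<Delta> ks (\<lambda>z. 0) = 0" by (auto simp: quot_def off_hyperplanes_def fun_eq_iff)
   then show ?case using cfun.subspace_0[OF subW] by (simp add: zero_fun_def)
  next
   case (add g h)
   then show ?case unfolding quot_add using cfun.subspace_add[OF subW add] by (simp add: plus_fun_def)
  next
   case (scale c g)
   show ?case unfolding quot_scale using cfun.subspace_scale[OF subW scale, of c] by simp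
  next
   case (base x) then show ?case using mono[OF k(1) b(1,2,3)] by auto
  qed
 qed
 obtain ks p where g: "set ks \<subseteq> \<Delta>" "poly_fun p" "g = quot \<Delta> ks p" using assms(3) by (auto simp: R_space_def)
 obtain rk :: "real^'n \<Rightarrow> nat" where rk: "inj_on rk \<Delta>" using finite_imp_inj_to_nat_seg[OF assms(1)] by metis
 have "g \<in> cfun.span {quot \<Delta> ks' p | ks'. set ks' \<subseteq> \<Delta> \<and> length ks' = length ks \<and>
      span (set ks') = span (set ks) \<and> unbroken \<Delta> rk (set ks')}"
  unfolding g(3) by (rule quot_unbroken[OF assms(1) rk assms(2) g(1)])
 also have "\<dots> \<subseteq> W"
  using subW indep[OF _ _ g(2)] unbroken_independent[OF rk] by (intro cfun.span_minimal) auto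
 finally obtain x y where "g = x + y" "x \<in> S_space \<Delta>" "y \<in> derivative_space \<Delta>"
  unfolding W_def cfun.span_Un S_space_def derivative_space_def by blast
 then show ?thesis by (intro bexI[of _ x]) auto
qed

section \<open>Iterated residues\<close>

text \<open>A nested quantifier: each coordinate ranges over a punctured neighbourhood of 0 whose
  size may depend on the earlier coordinates. This is the order in which \<open>iter_residue\<close>
  fixes its variables.\<close>

primrec generic :: "nat \<Rightarrow> (complex list \<Rightarrow> bool) \<Rightarrow> bool" where
 "generic 0 P = P []"
| "generic (Suc k) P = generic k (\<lambda>ws. \<forall>\<^sub>F w in at 0. P (ws @ [w]))"

lemma generic_mono:
 "generic k P \<Longrightarrow> (\<And>ws. length ws = k \<Longrightarrow> P ws \<Longrightarrow> Q ws) \<Longrightarrow> generic k Q"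
proof (induction k arbitrary: P Q)
 case (Suc k)
 have "generic k (\<lambda>ws. \<forall>\<^sub>F w in at 0. P (ws @ [w]))" using Suc.prems(1) by simp
 then have "generic k (\<lambda>ws. \<forall>\<^sub>F w in at 0. Q (ws @ [w]))"
  by (rule Suc.IH) (auto elim!: eventually_mono intro!: Suc.prems(2))
 then show ?case by simp
qed simp

lemma generic_True: "(\<And>ws. length ws = k \<Longrightarrow> P ws) \<Longrightarrow> generic k P"
proof (induction k arbitrary: P)
 case (Suc k)
 have "generic k (\<lambda>ws. \<forall>\<^sub>F w in at 0. P (ws @ [w]))"
  by (rule Suc.IH) (auto intro!: always_eventually Suc.prems)
 then show ?case by simp
qed simp

lemma generic_conj: "generic k P \<Longrightarrow> generic k Q \<Longrightarrow> generic k (\<lambda>ws. P ws \<and> Q ws)"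
 by (induction k arbitrary: P Q) (auto simp: eventually_conj_iff)

lemma generic_ball: "finite A \<Longrightarrow> (\<And>x. x \<in> A \<Longrightarrow> generic k (P x)) \<Longrightarrow> generic k (\<lambda>ws. \<forall>x\<in>A. P x ws)"
proof (induction rule: finite_induct)
 case empty then show ?case by (auto intro: generic_True)
next
 case (insert x A)
 then have "generic k (\<lambda>ws. P x ws \<and> (\<forall>x\<in>A. P x ws))" by (intro generic_conj) auto
 then show ?case by simp
qed

text \<open>Each single residue sees only a punctured neighbourhood of 0, with the earlier variables
  fixed, so agreement at generic points propagates outwards.\<close>

lemma iter_residue_generic_cong: "generic k (\<lambda>ws. G ws = H ws) \<Longrightarrow> iter_residue k G = iter_residue k H"
proof (induction k arbitrary: G H)
 case (Suc k)
 have "generic k (\<lambda>ws. \<forall>\<^sub>F w in at 0. G (ws @ [w]) = H (ws @ [w]))" using Suc.prems by simp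
 then have "generic k (\<lambda>ws. residue (\<lambda>w. G (ws @ [w])) 0 = residue (\<lambda>w. H (ws @ [w])) 0)"
  by (rule generic_mono) (auto intro: residue_cong)
 then show ?case using Suc.IH by simp
qed simp

lemma iter_residue_zero: "iter_residue k (\<lambda>ws. 0) = 0"
 by (induction k) (simp_all add: residue_const)

text \<open>A single-valued primitive on the punctured neighbourhood makes the integral over a small
  circle vanish.\<close>

lemma residue_deriv:
 assumes "open A" "z \<in> A" "\<And>w. w \<in> A - {z} \<Longrightarrow> (f has_field_derivative f' w) (at w)"
 shows "residue f' z = 0"
proof -
 obtain r where r: "r > 0" "cball z r \<subseteq> A" using assms(1,2) open_contains_cball by blast
 have opn: "open (A - {z})" using assms(1) by auto
 have "f holomorphic_on A - {z}" using assms(3) opn holomorphic_on_open by blast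
 then have "deriv f holomorphic_on A - {z}" using opn by (intro holomorphic_deriv)
 then have hol: "f' holomorphic_on A - {z}"
  by (rule holomorphic_transform) (use assms(3) DERIV_imp_deriv in blast)
 have 1: "(f' has_contour_integral 2 * of_real pi * \<i> * residue f' z) (circlepath z r)"
  using base_residue[OF assms(1,2) r(1) hol r(2)] by simp
 have "(f' has_contour_integral 0) (circlepath z r)"
 proof (rule Cauchy_theorem_primitive)
  show "\<And>x. x \<in> A - {z} \<Longrightarrow> (f has_field_derivative f' x) (at x within A - {z})"
   using assms(3) has_field_derivative_at_within by blast
  show "path_image (circlepath z r) \<subseteq> A - {z}" using r by (auto simp: sphere_def)
 qed auto
 from has_contour_integral_unique[OF 1 this] show ?thesis by simp
qed

lemma regular_open:
 assumes "finite \<Delta>" shows "open {w. regular \<Delta> (z + w *s u)}"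
proof -
 have "{w. regular \<Delta> (z + w *s u)} = (\<Inter>\<alpha>\<in>\<Delta>. {w. pairing \<alpha> z + w * pairing \<alpha> u \<noteq> 0})"
  by (auto simp: regular_def pairing_simps)
 moreover have "open {w. pairing \<alpha> z + w * pairing \<alpha> u \<noteq> 0}" for \<alpha>
  by (intro open_Collect_neq continuous_intros)
 ultimately show ?thesis using assms by auto
qed

section \<open>Residues along the flag of coordinate subspaces of an ordered basis\<close>

locale flag =
 fixes os :: "(real^'n) list" and e :: "nat \<Rightarrow> real^'n"
 assumes len: "length os = CARD('n)" and dist: "distinct os"
  and ind: "independent (set os)" and sp: "span (set os) = UNIV"
  and dual: "\<And>i j. i < CARD('n) \<Longrightarrow> j < CARD('n) \<Longrightarrow> (os ! i) \<bullet> e j = (if i = j then 1 else 0)"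
begin

text \<open>A list shorter than \<open>CARD('n)\<close> stands for a point whose remaining
  coordinates are 0. After the residues in the last variables, functions live on the span of the
  first directions \<open>e j\<close>.\<close>

definition pt :: "complex list \<Rightarrow> complex^'n" where
 "pt ws = (\<Sum>j<length ws. ws ! j *s cvec (e j))"

lemma pairing_pt: "pairing \<alpha> (pt ws) = (\<Sum>j<length ws. ws ! j * of_real (\<alpha> \<bullet> e j))"
 by (simp add: pt_def pairing_sum_right pairing_smult_right)

lemma pt_snoc: "pt (ws @ [w]) = pt ws + w *s cvec (e (length ws))"
 by (simp add: pt_def nth_append)

lemma pt_update: "j < length ws \<Longrightarrow> pt (ws[j := ws ! j + s]) = pt ws + s *s cvec (e j)"
proof -
 assume j: "j < length ws"
 have "pt (ws[j := ws ! j + s]) = (\<Sum>i<length ws. ws ! i *s cvec (e i) + (if i = j then s *s cvec (e j) else 0))"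
  unfolding pt_def by (intro sum.cong) (auto simp: nth_list_update vector_sadd_rdistrib)
 then show ?thesis using j by (simp add: sum.distrib pt_def)
qed

lemma expand: "x = (\<Sum>j<CARD('n). (x \<bullet> e j) *\<^sub>R (os ! j))"
proof -
 define dv where "dv = (\<lambda>\<beta>. e (SOME j. j < CARD('n) \<and> os ! j = \<beta>))"
 have dv: "dv (os ! j) = e j" if "j < CARD('n)" for j
 proof -
  have "(SOME i. i < CARD('n) \<and> os ! i = os ! j) = j"
  proof (rule some_equality)
   show "\<And>i. i < CARD('n) \<and> os ! i = os ! j \<Longrightarrow> i = j"
    using that dist len nth_eq_iff_index_eq[of os] by auto
  qed (use that in simp)
  then show ?thesis by (simp add: dv_def)
 qed
 have d: "\<beta> \<bullet> dv \<gamma> = (if \<beta> = \<gamma> then 1 else 0)" if "\<beta> \<in> set os" "\<gamma> \<in> set os" for \<beta> \<gamma>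
  using that dv dual dist len by (auto simp: in_set_conv_nth nth_eq_iff_index_eq)
 have "x = (\<Sum>\<beta>\<in>set os. (x \<bullet> dv \<beta>) *\<^sub>R \<beta>)"
  by (rule dual_expand[OF ind d]) (auto simp: sp)
 also have "\<dots> = (\<Sum>j<CARD('n). (x \<bullet> dv (os ! j)) *\<^sub>R (os ! j))"
  by (rule sum.reindex_bij_betw[symmetric]) (use bij_betw_nth[OF dist, of "{..<CARD('n)}" "set os"] len in auto)
 finally show ?thesis using dv by simp
qed

lemma pairing_expand: "pairing x z = (\<Sum>j<CARD('n). of_real (x \<bullet> e j) * pairing (os ! j) z)"
 by (subst expand[of x]) (simp add: pairing_sum_left pairing_scaleR_left)

lemma coord_point_pt: assumes "length ws = CARD('n)" shows "coord_point os ws = pt ws"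
 unfolding coord_point_def
proof (rule the_equality)
 show 1: "\<forall>j<length os. pairing (os ! j) (pt ws) = ws ! j"
 proof safe
  fix j assume j: "j < length os"
  have "pairing (os ! j) (pt ws) = (\<Sum>i<length ws. if i = j then ws ! i else 0)"
   unfolding pairing_pt using j len assms by (intro sum.cong) (auto simp: dual)
  then show "pairing (os ! j) (pt ws) = ws ! j" using j len assms by simp
 qed
 fix z assume z: "\<forall>j<length os. pairing (os ! j) z = ws ! j"
 have "pairing x z = pairing x (pt ws)" for x
  unfolding pairing_expand[of x] using z 1 len by (intro sum.cong) auto
 then show "z = pt ws" by (metis pairing_axis_left vec_eq_iff)
qed

text \<open>The form \<alpha> does not vanish identically on the span of the first \<open>k\<close>
  directions, so it still defines a hyperplane there.\<close>

definition nz :: "nat \<Rightarrow> real^'n \<Rightarrow> bool" where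
 "nz k \<alpha> \<longleftrightarrow> (\<exists>j<k. \<alpha> \<bullet> e j \<noteq> 0)"

lemma nz_Suc: "nz (Suc k) \<alpha> \<longleftrightarrow> nz k \<alpha> \<or> \<alpha> \<bullet> e k \<noteq> 0"
 by (auto simp: nz_def less_Suc_eq)

lemma nz_full: "\<alpha> \<noteq> 0 \<Longrightarrow> nz CARD('n) \<alpha>"
proof (rule ccontr)
 assume a: "\<alpha> \<noteq> 0" "\<not> nz CARD('n) \<alpha>"
 then have "(\<Sum>j<CARD('n). (\<alpha> \<bullet> e j) *\<^sub>R (os ! j)) = 0" by (intro sum.neutral) (auto simp: nz_def)
 then show False using expand[of \<alpha>] a by simp
qed

lemma generic_nz: "nz k \<alpha> \<Longrightarrow> generic k (\<lambda>ws. pairing \<alpha> (pt ws) \<noteq> 0)"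
proof (induction k)
 case (Suc k)
 show ?case
 proof (cases "\<alpha> \<bullet> e k = 0")
  case True
  then have "generic k (\<lambda>ws. pairing \<alpha> (pt ws) \<noteq> 0)" using Suc by (simp add: nz_Suc)
  then show ?thesis unfolding generic.simps
   by (rule generic_mono) (simp add: pt_snoc pairing_simps True)
 next
  case False
  have "\<forall>\<^sub>F w in at 0. pairing \<alpha> (pt ws) + w * of_real (\<alpha> \<bullet> e k) \<noteq> 0" for ws
  proof (cases "pairing \<alpha> (pt ws) = 0")
   case True
   have "\<forall>\<^sub>F w in at (0::complex). w \<noteq> 0" by (simp add: eventually_at_filter)
   then show ?thesis by (rule eventually_mono) (use True False in auto)
  next
   case F: False
   have "((\<lambda>w. pairing \<alpha> (pt ws) + w * of_real (\<alpha> \<bullet> e k)) \<longlongrightarrow> pairing \<alpha> (pt ws) + 0 * of_real (\<alpha> \<bullet> e k)) (at 0)"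
    by (intro tendsto_intros)
   then show ?thesis by (rule tendsto_imp_eventually_ne) (use F in simp)
  qed
  then show ?thesis unfolding generic.simps
   by (intro generic_True) (simp add: pt_snoc pairing_simps)
 qed
qed (simp add: nz_def)

lemma generic_regular: "finite \<Delta> \<Longrightarrow> (\<And>\<alpha>. \<alpha> \<in> \<Delta> \<Longrightarrow> nz k \<alpha>) \<Longrightarrow> generic k (\<lambda>ws. regular \<Delta> (pt ws))"
 unfolding regular_def by (intro generic_ball generic_nz)

text \<open>Residues in the first \<open>k\<close> variables of the restriction to the
  \<open>k\<close>-th step of the flag; leaving \<open>k\<close> free allows induction on the number
  of variables.\<close>

definition V :: "nat \<Rightarrow> (complex^'n \<Rightarrow> complex) \<Rightarrow> complex" where
 "V k g = iter_residue k (\<lambda>ws. g (pt ws))"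

lemma V_cong:
 assumes "finite \<Delta>" "\<And>\<alpha>. \<alpha> \<in> \<Delta> \<Longrightarrow> nz k \<alpha>"
  "\<And>ws. length ws = k \<Longrightarrow> regular \<Delta> (pt ws) \<Longrightarrow> g (pt ws) = h (pt ws)"
 shows "V k g = V k h"
 unfolding V_def
 by (rule iter_residue_generic_cong, rule generic_mono[OF generic_regular[OF assms(1,2)]]) (use assms(3) in auto)

lemma V_step:
 assumes "finite \<Delta>" "\<And>\<alpha>. \<alpha> \<in> \<Delta> \<Longrightarrow> nz k \<alpha>"
  "\<And>ws. length ws = k \<Longrightarrow> regular \<Delta> (pt ws) \<Longrightarrow> residue (\<lambda>w. g (pt ws + w *s cvec (e k))) 0 = \<rho> (pt ws)"
 shows "V (Suc k) g = V k \<rho>"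
 unfolding V_def iter_residue.simps
 by (rule iter_residue_generic_cong, rule generic_mono[OF generic_regular[OF assms(1,2)]])
  (use assms(3) in \<open>auto simp: pt_snoc\<close>)

lemma V_zero: "V k (\<lambda>z. 0) = 0"
 by (simp add: V_def iter_residue_zero)

text \<open>In the last coordinate \<open>w\<close> the function \<open>g\<close> has the shape of a
  pole of order at most \<open>m\<close> whose numerator \<open>h\<close> is still defined at
  \<open>w = 0\<close>. Here \<Delta> collects the forms that survive on step
  \<open>k\<close>.\<close>

definition pole_form where
 "pole_form k \<Delta> m g h \<longleftrightarrow> (\<forall>ws w. length ws = k \<longrightarrow> w \<noteq> 0 \<longrightarrow> regular \<Delta> (pt ws + w *s cvec (e k)) \<longrightarrow>
   g (pt ws + w *s cvec (e k)) = h (pt ws + w *s cvec (e k)) / w ^ m)"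

text \<open>The residue of \<open>h / w ^ m\<close>: the Taylor coefficient of order
  \<open>m - 1\<close> of \<open>h\<close> in the last direction. For \<open>m = 0\<close> there is
  no pole, and the case is split off because \<open>m - 1\<close> would be 0.\<close>

definition res_form where
 "res_form k \<Delta> m h = (if m = 0 then (\<lambda>z. 0) else (\<lambda>z. 1 / fact (m - 1) * (dir_deriv \<Delta> (e k) ^^ (m - 1)) h z))"

lemma R_dir_deriv_iter: "finite \<Delta> \<Longrightarrow> h \<in> R_space \<Delta> \<Longrightarrow> (dir_deriv \<Delta> v ^^ n) h \<in> R_space \<Delta>"
 by (induction n) (auto intro: R_dir_deriv)

lemma higher_deriv_line:
 assumes "finite \<Delta>" "h \<in> R_space \<Delta>" "regular \<Delta> (z + w *s cvec v)"
 shows "(deriv ^^ n) (\<lambda>w. h (z + w *s cvec v)) w = (dir_deriv \<Delta> v ^^ n) h (z + w *s cvec v)"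
 using assms(3)
proof (induction n arbitrary: w)
 case (Suc n)
 have "\<forall>\<^sub>F x in nhds w. x \<in> {w. regular \<Delta> (z + w *s cvec v)}"
  using regular_open[OF assms(1)] Suc.prems by (intro eventually_nhds_in_open) auto
 then have "\<forall>\<^sub>F x in nhds w. (deriv ^^ n) (\<lambda>w. h (z + w *s cvec v)) x = (dir_deriv \<Delta> v ^^ n) h (z + x *s cvec v)"
  by (rule eventually_mono) (use Suc.IH in auto)
 from deriv_cong_ev[OF this refl]
 show ?case using R_has_deriv_at[OF assms(1) R_dir_deriv_iter[OF assms(1,2)] Suc.prems, of n]
  by (auto dest: DERIV_imp_deriv)
qed simp

lemma residue_form:
 assumes "finite \<Delta>" "h \<in> R_space \<Delta>" "pole_form k \<Delta> m g h" "length ws = k" "regular \<Delta> (pt ws)"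
 shows "residue (\<lambda>w. g (pt ws + w *s cvec (e k))) 0 = res_form k \<Delta> m h (pt ws)"
proof -
 define A where "A = {w. regular \<Delta> (pt ws + w *s cvec (e k))}"
 define H where "H = (\<lambda>w. h (pt ws + w *s cvec (e k)))"
 have A: "open A" "0 \<in> A" using regular_open assms by (auto simp: A_def)
 have hol: "H holomorphic_on A"
  unfolding holomorphic_on_open[OF A(1)] H_def
 proof
  fix w assume "w \<in> A"
  then have "regular \<Delta> (pt ws + w *s cvec (e k))" by (simp add: A_def)
  from R_has_deriv_at[OF assms(1,2) this]
  show "\<exists>f'. ((\<lambda>w. h (pt ws + w *s cvec (e k))) has_field_derivative f') (at w)" by blast
 qed
 have "\<forall>\<^sub>F w in at 0. w \<in> A \<and> w \<noteq> 0"
  using eventually_at_in_open[OF A] by (rule eventually_mono) auto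
 then have "\<forall>\<^sub>F w in at 0. g (pt ws + w *s cvec (e k)) = H w / w ^ m"
  by (rule eventually_mono) (use assms(3,4) in \<open>auto simp: pole_form_def A_def H_def\<close>)
 then have eq: "residue (\<lambda>w. g (pt ws + w *s cvec (e k))) 0 = residue (\<lambda>w. H w / w ^ m) 0"
  by (rule residue_cong) simp
 show ?thesis
 proof (cases m)
  case 0
  then show ?thesis unfolding eq using residue_holo[OF A hol] by (simp add: res_form_def)
 next
  case (Suc n)
  have "residue (\<lambda>w. H w / w ^ Suc n) 0 = (deriv ^^ n) H 0 / fact n"
   by (rule residue_holomorphic_over_power'[OF A hol])
  then show ?thesis unfolding eq unfolding Suc H_def
   using higher_deriv_line[OF assms(1,2), of "pt ws" 0 "e k" n] assms(5) by (simp add: res_form_def)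
 qed
qed

lemma res_form_R: "finite \<Delta> \<Longrightarrow> h \<in> R_space \<Delta> \<Longrightarrow> res_form k \<Delta> m h \<in> R_space \<Delta>"
 unfolding res_form_def by (cases "m = 0") (simp_all only: if_True if_False R_zero R_scale R_dir_deriv_iter simp_thms)

text \<open>A form that vanishes on step \<open>k\<close> is a nonzero multiple of \<open>w\<close>
  on the next step, so off \<open>w = 0\<close> it imposes no condition.\<close>

lemma regular_step:
 assumes "\<And>\<alpha>. \<alpha> \<in> \<Delta>' \<Longrightarrow> nz (Suc k) \<alpha>" "length ws = k" "w \<noteq> 0"
  "regular {\<alpha>\<in>\<Delta>'. nz k \<alpha>} (pt ws + w *s cvec (e k))"
 shows "regular \<Delta>' (pt ws + w *s cvec (e k))"
 unfolding regular_def
proof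
 fix \<alpha> assume a: "\<alpha> \<in> \<Delta>'"
 show "pairing \<alpha> (pt ws + w *s cvec (e k)) \<noteq> 0"
 proof (cases "nz k \<alpha>")
  case True then show ?thesis using a assms(4) by (auto simp: regular_def)
 next
  case False
  then have "pairing \<alpha> (pt ws) = 0" using assms(2) by (simp add: pairing_pt nz_def)
  then show ?thesis using a assms(1,3) False by (auto simp: pairing_simps nz_Suc)
 qed
qed

text \<open>The denominator splits in two: forms vanishing on step \<open>k\<close> are constants
  times \<open>w\<close> and make up the pole, the others stay in the numerator function.\<close>

lemma pole_form_exists:
 assumes "\<And>\<alpha>. \<alpha> \<in> \<Delta>' \<Longrightarrow> nz (Suc k) \<alpha>" "set ks \<subseteq> \<Delta>'"
 shows "pole_form k {\<alpha>\<in>\<Delta>'. nz k \<alpha>} (length (filter (\<lambda>\<alpha>. \<not> nz k \<alpha>) ks)) (quot \<Delta>' ks p)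
   (\<lambda>z. (1 / (\<Prod>\<alpha>\<leftarrow>filter (\<lambda>\<alpha>. \<not> nz k \<alpha>) ks. of_real (\<alpha> \<bullet> e k))) * quot {\<alpha>\<in>\<Delta>'. nz k \<alpha>} (filter (nz k) ks) p z)"
 unfolding pole_form_def
proof (intro allI impI)
 fix ws :: "complex list" and w :: complex
 assume ws: "length ws = k" "w \<noteq> 0" "regular {\<alpha>\<in>\<Delta>'. nz k \<alpha>} (pt ws + w *s cvec (e k))"
 let ?z = "pt ws + w *s cvec (e k)"
 have reg: "regular \<Delta>' ?z" by (rule regular_step[OF assms(1) ws])
 have "lprod ks ?z = lprod (filter (nz k) ks) ?z * (w ^ length (filter (\<lambda>\<alpha>. \<not> nz k \<alpha>) ks) *
   (\<Prod>\<alpha>\<leftarrow>filter (\<lambda>\<alpha>. \<not> nz k \<alpha>) ks. of_real (\<alpha> \<bullet> e k)))"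
 proof (induction ks)
  case (Cons a ks)
  show ?case
  proof (cases "nz k a")
   case False
   then have "pairing a (pt ws) = 0" using ws(1) by (simp add: pairing_pt nz_def)
   then show ?thesis using Cons False by (simp add: pairing_simps)
  qed (use Cons in simp)
 qed simp
 then show "quot \<Delta>' ks p ?z = 1 / (\<Prod>\<alpha>\<leftarrow>filter (\<lambda>\<alpha>. \<not> nz k \<alpha>) ks. of_real (\<alpha> \<bullet> e k)) *
   quot {\<alpha>\<in>\<Delta>'. nz k \<alpha>} (filter (nz k) ks) p ?z / w ^ length (filter (\<lambda>\<alpha>. \<not> nz k \<alpha>) ks)"
  using reg ws(3) by (simp add: quot_regular)
qed

text \<open>Moving in an earlier direction does not change \<open>w\<close>, so the pole factor
  behaves as a constant under this derivative.\<close>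

lemma pole_form_deriv:
 assumes "finite \<Delta>'" "\<And>\<alpha>. \<alpha> \<in> \<Delta>' \<Longrightarrow> nz (Suc k) \<alpha>" "g \<in> R_space \<Delta>'"
  "h \<in> R_space {\<alpha>\<in>\<Delta>'. nz k \<alpha>}" "pole_form k {\<alpha>\<in>\<Delta>'. nz k \<alpha>} m g h" "j < k"
 shows "pole_form k {\<alpha>\<in>\<Delta>'. nz k \<alpha>} m (dir_deriv \<Delta>' (e j) g) (dir_deriv {\<alpha>\<in>\<Delta>'. nz k \<alpha>} (e j) h)"
 unfolding pole_form_def
proof (intro allI impI)
 fix ws :: "complex list" and w :: complex
 let ?D = "{\<alpha>\<in>\<Delta>'. nz k \<alpha>}"
 assume ws: "length ws = k" "w \<noteq> 0" "regular ?D (pt ws + w *s cvec (e k))"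
 let ?z = "pt ws + w *s cvec (e k)"
 have fin: "finite ?D" using assms(1) by simp
 have reg: "regular \<Delta>' ?z" by (rule regular_step[OF assms(2) ws])
 have "\<forall>\<^sub>F s in nhds 0. regular ?D (?z + s *s cvec (e j))" by (rule regular_eventually[OF fin ws(3)])
 then have ev: "\<forall>\<^sub>F s in nhds 0. g (?z + s *s cvec (e j)) = h (?z + s *s cvec (e j)) / w ^ m"
 proof (rule eventually_mono)
  fix s assume r: "regular ?D (?z + s *s cvec (e j))"
  have eq: "?z + s *s cvec (e j) = pt (ws[j := ws ! j + s]) + w *s cvec (e k)"
   using ws(1) assms(6) by (simp add: pt_update)
  show "g (?z + s *s cvec (e j)) = h (?z + s *s cvec (e j)) / w ^ m"
   using assms(5) r ws(1,2) unfolding pole_form_def eq by simp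
 qed
 have 1: "((\<lambda>s. g (?z + s *s cvec (e j))) has_field_derivative dir_deriv \<Delta>' (e j) g ?z) (at 0)"
  by (rule R_has_deriv[OF assms(1,3) reg])
 have 2: "((\<lambda>s. h (?z + s *s cvec (e j)) / w ^ m) has_field_derivative dir_deriv ?D (e j) h ?z / w ^ m) (at 0)"
  by (rule DERIV_cdivide[OF R_has_deriv[OF fin assms(4) ws(3)]])
 have "((\<lambda>s. g (?z + s *s cvec (e j))) has_field_derivative dir_deriv ?D (e j) h ?z / w ^ m) (at 0)"
  using 2 DERIV_cong_ev[OF refl ev refl] by blast
 from DERIV_unique[OF 1 this]
 show "dir_deriv \<Delta>' (e j) g ?z = dir_deriv ?D (e j) h ?z / w ^ m" .
qed

text \<open>In the last direction the inner residue is that of a derivative and vanishes. In an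
  earlier direction the derivative commutes with extracting the coefficient \<open>res_form\<close>,
  and one variable fewer remains.\<close>

lemma V_dir_deriv:
 assumes "finite \<Delta>'" "\<And>\<alpha>. \<alpha> \<in> \<Delta>' \<Longrightarrow> nz k \<alpha>" "g \<in> R_space \<Delta>'" "j < k"
 shows "V k (dir_deriv \<Delta>' (e j) g) = 0"
 using assms
proof (induction k arbitrary: g \<Delta>')
 case (Suc k)
 let ?D = "{\<alpha>\<in>\<Delta>'. nz k \<alpha>}"
 have fin: "finite ?D" using Suc.prems by simp
 obtain ks p where g: "set ks \<subseteq> \<Delta>'" "poly_fun p" "g = quot \<Delta>' ks p"
  using Suc.prems(3) by (auto simp: R_space_def)
 show ?case
 proof (cases "j = k")
  case True
  have "V (Suc k) (dir_deriv \<Delta>' (e j) g) = V k (\<lambda>z. 0)"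
  proof (rule V_step[OF fin])
   fix ws assume ws: "length ws = k" "regular ?D (pt ws)"
   show "residue (\<lambda>w. dir_deriv \<Delta>' (e j) g (pt ws + w *s cvec (e k))) 0 = 0"
   proof (rule residue_deriv[where f = "\<lambda>w. g (pt ws + w *s cvec (e k))"])
    show "open {w. regular ?D (pt ws + w *s cvec (e k))}" by (rule regular_open[OF fin])
    fix w assume "w \<in> {w. regular ?D (pt ws + w *s cvec (e k))} - {0}"
    then have "regular \<Delta>' (pt ws + w *s cvec (e k))" using regular_step[OF Suc.prems(2) ws(1)] by auto
    then show "((\<lambda>w. g (pt ws + w *s cvec (e k))) has_field_derivative
      dir_deriv \<Delta>' (e j) g (pt ws + w *s cvec (e k))) (at w)"
     unfolding True by (rule R_has_deriv_at[OF Suc.prems(1,3)])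
   qed (use ws in simp)
  qed simp
  then show ?thesis by (simp add: V_zero)
 next
  case False
  then have j: "j < k" using Suc.prems by simp
  define m h where "m = length (filter (\<lambda>\<alpha>. \<not> nz k \<alpha>) ks)"
   and "h = (\<lambda>z. (1 / (\<Prod>\<alpha>\<leftarrow>filter (\<lambda>\<alpha>. \<not> nz k \<alpha>) ks. of_real (\<alpha> \<bullet> e k))) * quot ?D (filter (nz k) ks) p z)"
  have pf: "pole_form k ?D m g h" unfolding g(3) m_def h_def by (rule pole_form_exists[OF Suc.prems(2) g(1)])
  have hR: "h \<in> R_space ?D" unfolding h_def by (intro R_scale R_quot g(2)) (use g(1) in auto)
  have pfd: "pole_form k ?D m (dir_deriv \<Delta>' (e j) g) (dir_deriv ?D (e j) h)"
   by (rule pole_form_deriv[OF Suc.prems(1,2,3) hR pf j])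
  have "V (Suc k) (dir_deriv \<Delta>' (e j) g) = V k (res_form k ?D m (dir_deriv ?D (e j) h))"
   by (rule V_step[OF fin], simp) (rule residue_form[OF fin R_dir_deriv[OF fin hR] pfd])
  also have "res_form k ?D m (dir_deriv ?D (e j) h) = dir_deriv ?D (e j) (res_form k ?D m h)"
  proof (cases "m = 0")
   case True
   then show ?thesis by (simp add: res_form_def dir_deriv_def off_hyperplanes_def fun_eq_iff)
  next
   case False
   have "(dir_deriv ?D (e k) ^^ n) (dir_deriv ?D (e j) h) = dir_deriv ?D (e j) ((dir_deriv ?D (e k) ^^ n) h)" for n
    by (induction n) (simp_all add: dir_deriv_commute[OF fin R_dir_deriv_iter[OF fin hR], of "e j"])
   then show ?thesis using False unfolding res_form_def
    by (simp only: if_False dir_deriv_scale[OF fin R_dir_deriv_iter[OF fin hR]])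
  qed
  also have "V k \<dots> = 0" by (rule Suc.IH[OF fin _ res_form_R[OF fin hR] j]) simp
  finally show ?thesis .
 qed
qed simp

text \<open>Over a common denominator both functions have the same pole order, so the inner residue
  becomes the operator \<open>res_form\<close>, which is visibly linear.\<close>

lemma V_linear:
 assumes "finite \<Delta>'" "\<And>\<alpha>. \<alpha> \<in> \<Delta>' \<Longrightarrow> nz k \<alpha>" "g1 \<in> R_space \<Delta>'" "g2 \<in> R_space \<Delta>'"
 shows "V k (\<lambda>z. a * g1 z + b * g2 z) = a * V k g1 + b * V k g2"
 using assms
proof (induction k arbitrary: g1 g2 \<Delta>')
 case 0
 then show ?case by (simp add: V_def)
next
 case (Suc k)
 let ?D = "{\<alpha>\<in>\<Delta>'. nz k \<alpha>}"
 have fin: "finite ?D" using Suc.prems by simp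
 obtain ks p q where g: "set ks \<subseteq> \<Delta>'" "poly_fun p" "poly_fun q" "g1 = quot \<Delta>' ks p" "g2 = quot \<Delta>' ks q"
  using R_common_denom[OF Suc.prems(3,4)] by metis
 define m C where "m = length (filter (\<lambda>\<alpha>. \<not> nz k \<alpha>) ks)"
  and "C = 1 / (\<Prod>\<alpha>\<leftarrow>filter (\<lambda>\<alpha>. \<not> nz k \<alpha>) ks. complex_of_real (\<alpha> \<bullet> e k))"
 define h1 h2 where "h1 = (\<lambda>z. C * quot ?D (filter (nz k) ks) p z)"
  and "h2 = (\<lambda>z. C * quot ?D (filter (nz k) ks) q z)"
 have pf: "pole_form k ?D m g1 h1" "pole_form k ?D m g2 h2"
  unfolding g(4,5) m_def h1_def h2_def C_def by (rule pole_form_exists[OF Suc.prems(2) g(1)]; simp)+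
 have hR: "h1 \<in> R_space ?D" "h2 \<in> R_space ?D"
  unfolding h1_def h2_def by (intro R_scale R_quot g(2,3); use g(1) in auto)+
 have pf3: "pole_form k ?D m (\<lambda>z. a * g1 z + b * g2 z) (\<lambda>z. a * h1 z + b * h2 z)"
  using pf unfolding pole_form_def by (simp add: add_divide_distrib)
 have hR3: "(\<lambda>z. a * h1 z + b * h2 z) \<in> R_space ?D" by (intro R_add R_scale hR)
 have it: "(dir_deriv ?D (e k) ^^ n) (\<lambda>z. a * h1 z + b * h2 z) =
   (\<lambda>z. a * (dir_deriv ?D (e k) ^^ n) h1 z + b * (dir_deriv ?D (e k) ^^ n) h2 z)" for n
  by (induction n) (simp_all add: dir_deriv_add[OF fin] dir_deriv_scale[OF fin] R_scale R_dir_deriv_iter[OF fin] hR)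
 have rf: "res_form k ?D m (\<lambda>z. a * h1 z + b * h2 z) = (\<lambda>z. a * res_form k ?D m h1 z + b * res_form k ?D m h2 z)"
  by (simp add: res_form_def it algebra_simps add_divide_distrib)
 have s1: "V (Suc k) g1 = V k (res_form k ?D m h1)"
  by (rule V_step[OF fin], simp) (rule residue_form[OF fin hR(1) pf(1)])
 have s2: "V (Suc k) g2 = V k (res_form k ?D m h2)"
  by (rule V_step[OF fin], simp) (rule residue_form[OF fin hR(2) pf(2)])
 have s3: "V (Suc k) (\<lambda>z. a * g1 z + b * g2 z) = V k (res_form k ?D m (\<lambda>z. a * h1 z + b * h2 z))"
  by (rule V_step[OF fin], simp) (rule residue_form[OF fin hR3 pf3])
 show ?case unfolding s1 s2 s3 rf by (rule Suc.IH[OF fin]) (auto intro: res_form_R[OF fin] hR)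
qed

lemma IRes_V: "IRes_rat os g = V CARD('n) g"
 unfolding IRes_rat_def V_def len
 by (rule iter_residue_generic_cong, rule generic_True) (simp add: coord_point_pt)

text \<open>An arbitrary direction is expanded in the \<open>e i\<close>; for these
  \<open>V_dir_deriv\<close> applies, and linearity does the rest.\<close>

lemma IRes_derivative_space:
 assumes "finite \<Delta>" "0 \<notin> \<Delta>" "g \<in> derivative_space \<Delta>"
 shows "IRes_rat os g = 0" and "g \<in> R_space \<Delta>"
proof -
 have nz: "nz CARD('n) \<alpha>" if "\<alpha> \<in> \<Delta>" for \<alpha> using that assms(2) nz_full by metis
 have base: "V CARD('n) (dir_deriv \<Delta> v g) = 0 \<and> dir_deriv \<Delta> v g \<in> R_space \<Delta>" if g: "g \<in> R_space \<Delta>" for v g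
 proof -
  define u where "u = (\<lambda>i. v \<bullet> os ! i)"
  have ve: "v = (\<Sum>i<CARD('n). u i *\<^sub>R e i)"
  proof -
   have "x \<bullet> v = x \<bullet> (\<Sum>i<CARD('n). u i *\<^sub>R e i)" for x
   proof -
    have "x \<bullet> v = (\<Sum>j<CARD('n). (x \<bullet> e j) * u j)"
     by (subst expand[of x]) (simp add: inner_sum_left u_def inner_commute inner_sum_right)
    then show ?thesis by (simp add: inner_sum_right mult.commute)
   qed
   then show ?thesis using vector_eq_ldot[of v "\<Sum>i<CARD('n). u i *\<^sub>R e i"] by blast
  qed
  have "V CARD('n) (dir_deriv \<Delta> (\<Sum>i<m. u i *\<^sub>R e i) g) = 0" if "m \<le> CARD('n)" for m
   using that
  proof (induction m)
   case 0
   have "dir_deriv \<Delta> 0 g = (\<lambda>z. 0)" by (simp add: dir_deriv_def off_hyperplanes_def fun_eq_iff)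
   then show ?case by (simp add: V_zero)
  next
   case (Suc m)
   have "dir_deriv \<Delta> (\<Sum>i<Suc m. u i *\<^sub>R e i) g =
    (\<lambda>z. 1 * dir_deriv \<Delta> (\<Sum>i<m. u i *\<^sub>R e i) g z + of_real (u m) * dir_deriv \<Delta> (e m) g z)"
    by (simp add: dir_deriv_add_dir[OF assms(1) g] dir_deriv_scale_dir[OF assms(1) g])
   then show ?case
    using Suc V_linear[OF assms(1) nz R_dir_deriv[OF assms(1) g, of "\<Sum>i<m. u i *\<^sub>R e i"] R_dir_deriv[OF assms(1) g, of "e m"], of 1 "of_real (u m)"]
     V_dir_deriv[OF assms(1) nz g, of m] by simp
  qed
  from this[of "CARD('n)"] show ?thesis using R_dir_deriv[OF assms(1) g] by (simp flip: ve)
 qed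
 have "V CARD('n) g = 0 \<and> g \<in> R_space \<Delta>"
  using assms(3) unfolding derivative_space_def
 proof (induction g rule: cfun_span_induct)
  case (add g h)
  then show ?case using V_linear[OF assms(1) nz, of g h 1 1] by (simp add: R_add)
 next
  case (scale c g)
  then show ?case using V_linear[OF assms(1) nz, of g g c 0] by (simp add: R_scale)
 qed (use base V_zero R_zero in auto)
 then show "IRes_rat os g = 0" "g \<in> R_space \<Delta>" by (auto simp: IRes_V)
qed

lemma IRes_linear:
 assumes "finite \<Delta>" "0 \<notin> \<Delta>" "g1 \<in> R_space \<Delta>" "g2 \<in> R_space \<Delta>"
 shows "IRes_rat os (\<lambda>z. a * g1 z + b * g2 z) = a * IRes_rat os g1 + b * IRes_rat os g2"
 unfolding IRes_V by (rule V_linear[OF assms(1) _ assms(3,4)]) (metis assms(2) nz_full)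

lemma nz_os: "i < CARD('n) \<Longrightarrow> k \<le> CARD('n) \<Longrightarrow> nz k (os ! i) \<longleftrightarrow> i < k"
 unfolding nz_def by (metis dual less_le_trans zero_neq_one)

lemma not_nz_span:
 assumes "k \<le> CARD('n)" "\<not> nz k \<alpha>" shows "\<alpha> \<in> span (set (drop k os))"
proof -
 have "(\<Sum>j<CARD('n). (\<alpha> \<bullet> e j) *\<^sub>R (os ! j)) \<in> span (set (drop k os))"
 proof (intro span_sum)
  fix j assume j: "j \<in> {..<CARD('n)}"
  show "(\<alpha> \<bullet> e j) *\<^sub>R (os ! j) \<in> span (set (drop k os))"
  proof (cases "j < k")
   case True then show ?thesis using assms by (simp add: nz_def span_zero)
  next
   case False
   then have "os ! j \<in> set (drop k os)" using j len by (auto simp: in_set_conv_nth intro!: exI[of _ "j - k"])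
   then show ?thesis by (intro span_scale span_base)
  qed
 qed
 then show ?thesis using expand[of \<alpha>] by simp
qed

text \<open>If no denominator form vanishes on step \<open>k\<close>, the function is holomorphic in
  the last variable. If exactly one does, the pole is simple and its residue divides by the slope of
  that form.\<close>

lemma V_quot_step:
 assumes "\<And>\<alpha>. \<alpha> \<in> set ks \<Longrightarrow> nz (Suc k) \<alpha>" "poly_fun p"
 shows "filter (\<lambda>\<alpha>. \<not> nz k \<alpha>) ks = [] \<Longrightarrow> V (Suc k) (quot (set ks) ks p) = 0"
  and "filter (\<lambda>\<alpha>. \<not> nz k \<alpha>) ks = [\<beta>] \<Longrightarrow> V (Suc k) (quot (set ks) ks p) =
   1 / of_real (\<beta> \<bullet> e k) * V k (quot (set (filter (nz k) ks)) (filter (nz k) ks) p)"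
proof -
 let ?D = "{\<alpha>\<in>set ks. nz k \<alpha>}"
 have fin: "finite ?D" by simp
 define h where "h = (\<lambda>z. (1 / (\<Prod>\<alpha>\<leftarrow>filter (\<lambda>\<alpha>. \<not> nz k \<alpha>) ks. of_real (\<alpha> \<bullet> e k))) * quot ?D (filter (nz k) ks) p z)"
 have qR: "quot ?D (filter (nz k) ks) p \<in> R_space ?D" by (rule R_quot) (use assms(2) in auto)
 then have hR: "h \<in> R_space ?D" unfolding h_def by (rule R_scale)
 have pf: "pole_form k ?D (length (filter (\<lambda>\<alpha>. \<not> nz k \<alpha>) ks)) (quot (set ks) ks p) h"
  unfolding h_def by (rule pole_form_exists[OF assms(1)]) auto
 have V: "V (Suc k) (quot (set ks) ks p) = V k (res_form k ?D (length (filter (\<lambda>\<alpha>. \<not> nz k \<alpha>) ks)) h)"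
  by (rule V_step[OF fin], simp) (rule residue_form[OF fin hR pf])
 show "V (Suc k) (quot (set ks) ks p) = 0" if "filter (\<lambda>\<alpha>. \<not> nz k \<alpha>) ks = []"
  unfolding V that by (simp add: res_form_def V_zero)
 show "V (Suc k) (quot (set ks) ks p) =
   1 / of_real (\<beta> \<bullet> e k) * V k (quot (set (filter (nz k) ks)) (filter (nz k) ks) p)"
  if b: "filter (\<lambda>\<alpha>. \<not> nz k \<alpha>) ks = [\<beta>]"
  unfolding V unfolding b using V_linear[OF fin _ qR qR, of k "1 / of_real (\<beta> \<bullet> e k)" 0]
  by (simp add: res_form_def h_def b)
qed

text \<open>The cut-off on hyperplanes outside the denominator changes no value at generic points;
  the smaller cut-off set is the one that shrinks together with the denominator.\<close>

lemma V_phi_step: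
 assumes "distinct ks" "finite \<Delta>" "\<And>\<alpha>. \<alpha> \<in> \<Delta> \<Longrightarrow> nz k \<alpha>" "set ks \<subseteq> \<Delta>"
 shows "V k (quot \<Delta> ks p) = V k (quot (set ks) ks p)"
 by (rule V_cong[OF assms(2,3)]) (use assms(4) in \<open>auto simp: quot_regular regular_def subset_iff\<close>)

text \<open>Going down from the full flag, a nonzero residue needs a pole at each step, so at least
  one more element of \<tau> vanishes each time. Independence bounds their number by
  \<open>CARD('n) - k\<close>, since they lie in the span of the last forms of \<open>os\<close>;
  hence exactly one is lost per step.\<close>

lemma IRes_phi_nonzero:
 assumes "finite \<Delta>" "0 \<notin> \<Delta>" "\<tau> \<in> bases \<Delta>" "IRes_rat os (phi \<Delta> \<tau>) \<noteq> 0" "k \<le> CARD('n)"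
 shows "card {\<beta>\<in>\<tau>. \<not> nz k \<beta>} = CARD('n) - k"
proof -
 obtain ks where k: "set ks = \<tau>" "distinct ks" using basis_finite[OF assms(3)] finite_distinct_list by blast
 define W where "W k = V k (quot (set (filter (nz k) ks)) (filter (nz k) ks) (\<lambda>z. 1))" for k
 have sub: "set ks \<subseteq> \<Delta>" using assms(3) k by (auto simp: bases_def)
 have nzD: "nz CARD('n) \<alpha>" if "\<alpha> \<in> \<Delta>" for \<alpha> using that assms(2) nz_full by metis
 have full: "filter (nz CARD('n)) ks = ks" by (intro filter_True ballI nzD) (use sub in auto)
 have "W CARD('n) = IRes_rat os (phi \<Delta> \<tau>)"
  unfolding W_def full IRes_V k(1)[symmetric] phi_quot[OF k(2)] by (rule V_phi_step[OF k(2) assms(1) nzD sub, symmetric])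
 then have W0: "W CARD('n) \<noteq> 0" using assms(4) by simp
 have cardf: "card {\<beta>\<in>\<tau>. \<not> nz k \<beta>} = length (filter (\<lambda>\<beta>. \<not> nz k \<beta>) ks)" for k
  using k distinct_card[of "filter (\<lambda>\<beta>. \<not> nz k \<beta>) ks"] by simp
 have bound: "card {\<beta>\<in>\<tau>. \<not> nz k \<beta>} \<le> CARD('n) - k" if "k \<le> CARD('n)" for k
 proof -
  have "independent \<tau>" using assms(3) by (simp add: bases_def)
  then have "independent {\<beta>\<in>\<tau>. \<not> nz k \<beta>}" by (rule independent_mono) auto
  moreover have "{\<beta>\<in>\<tau>. \<not> nz k \<beta>} \<subseteq> span (set (drop k os))" using not_nz_span[OF that] by auto
  ultimately have "card {\<beta>\<in>\<tau>. \<not> nz k \<beta>} \<le> card (set (drop k os))"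
   using independent_span_bound by blast
  also have "\<dots> \<le> CARD('n) - k" using card_length[of "drop k os"] len by simp
  finally show ?thesis .
 qed
 have "W k \<noteq> 0 \<and> card {\<beta>\<in>\<tau>. \<not> nz k \<beta>} = CARD('n) - k" using assms(5)
 proof (induction k rule: inc_induct)
  case base
  have e: "{\<beta>\<in>\<tau>. \<not> nz CARD('n) \<beta>} = {}" using sub k nzD by auto
  show ?case using W0 unfolding e by simp
 next
  case (step j)
  let ?ks = "filter (nz (Suc j)) ks"
  have ff: "filter (nz j) ?ks = filter (nz j) ks" by (auto simp: nz_Suc intro: filter_cong)
  have split: "{\<beta>\<in>\<tau>. \<not> nz j \<beta>} = {\<beta>\<in>\<tau>. \<not> nz (Suc j) \<beta>} \<union> set (filter (\<lambda>\<alpha>. \<not> nz j \<alpha>) ?ks)"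
   using k by (auto simp: nz_Suc)
  have disj: "{\<beta>\<in>\<tau>. \<not> nz (Suc j) \<beta>} \<inter> set (filter (\<lambda>\<alpha>. \<not> nz j \<alpha>) ?ks) = {}" by auto
  have cd: "card {\<beta>\<in>\<tau>. \<not> nz j \<beta>} = card {\<beta>\<in>\<tau>. \<not> nz (Suc j) \<beta>} + length (filter (\<lambda>\<alpha>. \<not> nz j \<alpha>) ?ks)"
   unfolding split using k basis_finite[OF assms(3)] distinct_card[of "filter (\<lambda>\<alpha>. \<not> nz j \<alpha>) ?ks"]
   by (subst card_Un_disjoint[OF _ _ disj]) auto
  have qs: "\<And>\<alpha>. \<alpha> \<in> set ?ks \<Longrightarrow> nz (Suc j) \<alpha>" by simp
  have ne: "filter (\<lambda>\<alpha>. \<not> nz j \<alpha>) ?ks \<noteq> []"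
   using step.IH V_quot_step(1)[OF qs poly_fun.const] unfolding W_def by blast
  have "length (filter (\<lambda>\<alpha>. \<not> nz j \<alpha>) ?ks) \<le> 1"
   using bound[of j] cd step by simp
  then obtain \<beta> where b: "filter (\<lambda>\<alpha>. \<not> nz j \<alpha>) ?ks = [\<beta>]"
   using ne by (cases "filter (\<lambda>\<alpha>. \<not> nz j \<alpha>) ?ks") auto
  have "W (Suc j) = 1 / of_real (\<beta> \<bullet> e j) * W j"
   using V_quot_step(2)[OF qs poly_fun.const b] unfolding W_def ff .
  then have "W j \<noteq> 0" using step.IH by auto
  moreover have "card {\<beta>\<in>\<tau>. \<not> nz j \<beta>} = CARD('n) - j" using cd b step by simp
  ultimately show ?case by simp
 qed
 then show ?thesis by simp
qed

lemma IRes_phi_self: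
 assumes "finite \<Delta>" "0 \<notin> \<Delta>" "set os \<subseteq> \<Delta>"
 shows "IRes_rat os (phi \<Delta> (set os)) = 1"
proof -
 have "V k (quot (set (take k os)) (take k os) (\<lambda>z. 1)) = 1" if "k \<le> CARD('n)" for k
  using that
 proof (induction k)
  case 0
  show ?case by (simp add: V_def quot_def off_hyperplanes_def regular_def)
 next
  case (Suc k)
  have tk: "take (Suc k) os = take k os @ [os ! k]" using Suc.prems len by (simp add: take_Suc_conv_app_nth)
  have nzt: "nz k \<alpha>" if "\<alpha> \<in> set (take k os)" for \<alpha>
   using that Suc.prems len nz_os by (auto simp: in_set_conv_nth)
  have nk: "\<not> nz k (os ! k)" "nz (Suc k) (os ! k)" using nz_os[of k] Suc.prems by auto
  have f1: "filter (\<lambda>\<alpha>. \<not> nz k \<alpha>) (take (Suc k) os) = [os ! k]"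
   unfolding tk using nzt nk by simp
  have f2: "filter (nz k) (take (Suc k) os) = take k os" unfolding tk using nzt nk by simp
  have "V (Suc k) (quot (set (take (Suc k) os)) (take (Suc k) os) (\<lambda>z. 1)) =
   1 / of_real ((os ! k) \<bullet> e k) * V k (quot (set (filter (nz k) (take (Suc k) os))) (filter (nz k) (take (Suc k) os)) (\<lambda>z. 1))"
   by (rule V_quot_step(2)[OF _ poly_fun.const f1]) (use nzt nk in \<open>auto simp: tk nz_Suc\<close>)
  then show ?case using Suc unfolding f2 by (simp add: dual)
 qed
 from this[of "CARD('n)"] have "V CARD('n) (quot (set os) os (\<lambda>z. 1)) = 1" using len by simp
 moreover have "V CARD('n) (quot \<Delta> os (\<lambda>z. 1)) = V CARD('n) (quot (set os) os (\<lambda>z. 1))"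
  by (rule V_phi_step[OF dist assms(1) _ assms(3)]) (metis assms(2) nz_full)
 ultimately show ?thesis unfolding IRes_V phi_quot[OF dist] by simp
qed

text \<open>Suppose \<open>os ! k\<close> is missing from \<tau>. The \<open>CARD('n) - k\<close>
  elements of \<tau> vanishing on step \<open>k\<close> span the same space as
  \<open>drop k os\<close>, which contains \<open>os ! k\<close>. None has lower rank than
  \<open>os ! k\<close>: it would lie in the span of \<open>drop k os\<close>, all of higher rank,
  and \<open>os\<close> would be broken. So all have higher rank, and \<tau> is broken.\<close>

lemma IRes_phi_unbroken:
 assumes "finite \<Delta>" "0 \<notin> \<Delta>" "inj_on rk \<Delta>" "sorted (map rk os)" "set os \<in> unbroken_bases \<Delta> rk"
  "\<tau> \<in> unbroken_bases \<Delta> rk" "IRes_rat os (phi \<Delta> \<tau>) \<noteq> 0"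
 shows "\<tau> = set os"
proof -
 have osD: "set os \<subseteq> \<Delta>" and osU: "unbroken \<Delta> rk (set os)" using assms(5) by (auto simp: unbroken_bases_def bases_def)
 have \<tau>: "\<tau> \<in> bases \<Delta>" "\<tau> \<subseteq> \<Delta>" "independent \<tau>" "unbroken \<Delta> rk \<tau>" using assms(6) by (auto simp: unbroken_bases_def bases_def)
 have "os ! k \<in> \<tau>" if k: "k < CARD('n)" for k
 proof (rule ccontr)
  assume nin: "os ! k \<notin> \<tau>"
  have okD: "os ! k \<in> \<Delta>" using osD k len by auto
  let ?T = "{\<beta>\<in>\<tau>. \<not> nz k \<beta>}"
  have cT: "card ?T = CARD('n) - k" using IRes_phi_nonzero[OF assms(1,2) \<tau>(1) assms(7)] k by simp
  have iT: "independent ?T" by (rule independent_mono[OF \<tau>(3)]) auto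
  have Tsub: "?T \<subseteq> span (set (drop k os))" using not_nz_span k by auto
  have "set (drop k os) \<subseteq> span ?T"
  proof (rule card_ge_dim_independent[THEN subset_trans[OF span_superset]])
   show "?T \<subseteq> span (set (drop k os))" by (rule Tsub)
   show "independent ?T" by (rule iT)
   have "dim (span (set (drop k os))) \<le> card (set (drop k os))" by (simp add: dim_le_card')
   also have "\<dots> \<le> CARD('n) - k" using card_length[of "drop k os"] len by simp
   finally show "dim (span (set (drop k os))) \<le> card ?T" using cT by simp
  qed
  moreover have "os ! k \<in> set (drop k os)" using k len by (metis Cons_nth_drop_Suc list.set_intros(1))
  ultimately have in1: "os ! k \<in> span ?T" by auto
  have "?T \<subseteq> {\<gamma>\<in>\<tau>. rk (os ! k) < rk \<gamma>}"
  proof safe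
   fix \<beta> assume b: "\<beta> \<in> \<tau>" "\<not> nz k \<beta>"
   have bD: "\<beta> \<in> \<Delta>" using b \<tau> by auto
   show "rk (os ! k) < rk \<beta>"
   proof (rule ccontr)
    assume "\<not> rk (os ! k) < rk \<beta>"
    then have lt: "rk \<beta> < rk (os ! k)" using assms(3) bD okD b nin by (metis inj_onD linorder_neqE_nat)
    have "set (drop k os) \<subseteq> {\<gamma>\<in>set os. rk \<beta> < rk \<gamma>}"
    proof
     fix x assume "x \<in> set (drop k os)"
     then obtain i where i: "k \<le> i" "i < length os" "x = os ! i"
      by (auto simp: in_set_conv_nth) (metis add.commute le_add1 less_diff_conv)
     then have "rk (os ! k) \<le> rk x" using assms(4) sorted_nth_mono[of "map rk os" k i] by simp
     then show "x \<in> {\<gamma>\<in>set os. rk \<beta> < rk \<gamma>}" using lt i by auto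
    qed
    then have "\<beta> \<in> span {\<gamma>\<in>set os. rk \<beta> < rk \<gamma>}"
     using not_nz_span[OF _ b(2)] k span_mono by (metis less_imp_le subsetD)
    then show False using osU bD by (auto simp: unbroken_def)
   qed
  qed
  then have "os ! k \<in> span {\<gamma>\<in>\<tau>. rk (os ! k) < rk \<gamma>}" using in1 span_mono by blast
  then show False using \<tau>(4) okD by (auto simp: unbroken_def)
 qed
 then have "set os \<subseteq> \<tau>" using len by (auto simp: in_set_conv_nth)
 moreover have "card (set os) = card \<tau>" using basis_card[OF \<tau>(1)] dist len distinct_card by metis
 ultimately show ?thesis using card_subset_eq[OF basis_finite[OF \<tau>(1)]] by auto
qed

end

section \<open>Directness of the decomposition\<close>

lemma flag_exists:
 fixes os :: "(real^'n) list"
 assumes "os \<in> ordered_bases \<Delta>"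
 obtains e where "flag os e"
proof -
 have o: "distinct os" "independent (set os)" "span (set os) = UNIV" using assms by (auto simp: ordered_bases_def bases_def)
 obtain dv where dv: "\<And>\<beta> \<gamma>. \<beta> \<in> set os \<Longrightarrow> \<gamma> \<in> set os \<Longrightarrow> \<beta> \<bullet> dv \<gamma> = (if \<beta> = \<gamma> then 1 else 0)"
  using dual_vectors[OF o(2)] by blast
 have l: "length os = CARD('n)" using assms basis_card[of "set os" \<Delta>] distinct_card[OF o(1)] by (auto simp: ordered_bases_def)
 have "flag os (\<lambda>j. dv (os ! j))"
  by unfold_locales (use o l dv nth_eq_iff_index_eq[OF o(1)] in auto)
 then show ?thesis by (rule that)
qed

lemma derivative_space_R:
 fixes \<Delta> :: "(real^'n) set"
 assumes "finite \<Delta>" shows "derivative_space \<Delta> \<subseteq> R_space \<Delta>"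
 unfolding derivative_space_def using R_dir_deriv[OF assms] by (intro cfun.span_minimal R_subspace) auto

lemma S_space_R:
 assumes "finite \<Delta>" shows "S_space \<Delta> \<subseteq> R_space \<Delta>"
 unfolding S_space_def
proof (intro cfun.span_minimal R_subspace image_subsetI)
 fix \<sigma> assume s: "\<sigma> \<in> bases \<Delta>"
 obtain ks where k: "set ks = \<sigma>" "distinct ks" using basis_finite[OF s] finite_distinct_list by blast
 then show "phi \<Delta> \<sigma> \<in> R_space \<Delta>" using phi_quot[OF k(2), of \<Delta>] R_quot[of ks \<Delta> "\<lambda>z. 1"] s poly_fun.const[of 1] by (auto simp: bases_def)
qed

text \<open>Iterated residues along the unbroken bases kill derivatives and are dual to the
  corresponding \<open>phi\<close>, so every coefficient of a derivative lying in
  \<open>S_space \<Delta>\<close> is zero.\<close>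

lemma S_derivative_Int:
 fixes \<Delta> :: "(real^'n) set"
 assumes "finite \<Delta>" "0 \<notin> \<Delta>" "s \<in> S_space \<Delta>" "s \<in> derivative_space \<Delta>"
 shows "s = (\<lambda>z. 0)"
proof -
 obtain rk :: "real^'n \<Rightarrow> nat" where rk: "inj_on rk \<Delta>" using finite_imp_inj_to_nat_seg[OF assms(1)] by metis
 let ?U = "unbroken_bases \<Delta> rk"
 have finU: "finite ?U" using assms(1) finite_subset[of ?U "Pow \<Delta>"] by (auto simp: unbroken_bases_def bases_def)
 have "s \<in> cfun.span (phi \<Delta> ` ?U)" using assms(3) S_space_unbroken[OF assms(1) rk assms(2)] by simp
 then have "\<exists>c. s = (\<lambda>z. \<Sum>\<sigma>\<in>?U. c \<sigma> * phi \<Delta> \<sigma> z)"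
 proof (induction s rule: cfun_span_induct)
  case zero then show ?case by (intro exI[of _ "\<lambda>_. 0"]) simp
 next
  case (add g h)
  then obtain c d where "g = (\<lambda>z. \<Sum>\<sigma>\<in>?U. c \<sigma> * phi \<Delta> \<sigma> z)" "h = (\<lambda>z. \<Sum>\<sigma>\<in>?U. d \<sigma> * phi \<Delta> \<sigma> z)" by blast
  then show ?case by (intro exI[of _ "\<lambda>\<sigma>. c \<sigma> + d \<sigma>"]) (simp add: algebra_simps sum.distrib)
 next
  case (scale a g)
  then obtain c where "g = (\<lambda>z. \<Sum>\<sigma>\<in>?U. c \<sigma> * phi \<Delta> \<sigma> z)" by blast
  then show ?case by (intro exI[of _ "\<lambda>\<sigma>. a * c \<sigma>"]) (simp add: sum_distrib_left mult.assoc)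
 next
  case (base x)
  then obtain \<tau> where "\<tau> \<in> ?U" "x = phi \<Delta> \<tau>" by auto
  then show ?case using finU by (intro exI[of _ "\<lambda>\<sigma>. if \<sigma> = \<tau> then 1 else 0"]) (simp add: if_distrib[of "\<lambda>x. x * _"] cong: if_cong)
 qed
 then obtain c where c: "s = (\<lambda>z. \<Sum>\<sigma>\<in>?U. c \<sigma> * phi \<Delta> \<sigma> z)" by blast
 have "c \<tau> = 0" if t: "\<tau> \<in> ?U" for \<tau>
 proof -
  have tb: "\<tau> \<in> bases \<Delta>" using t by (auto simp: unbroken_bases_def)
  \<comment> \<open>Sorting by rank is what makes the residue along \<tau> vanish on all other
    unbroken bases.\<close>
  define os where "os = sort_key rk (SOME xs. set xs = \<tau> \<and> distinct xs)"
  have "\<exists>xs. set xs = \<tau> \<and> distinct xs" using basis_finite[OF tb] finite_distinct_list by blast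
  then have os: "set os = \<tau>" "distinct os" "sorted (map rk os)" unfolding os_def
   using someI_ex[of "\<lambda>xs. set xs = \<tau> \<and> distinct xs"] by auto
  have ob: "os \<in> ordered_bases \<Delta>" using os tb by (auto simp: ordered_bases_def)
  obtain e where fl: "flag os e" using flag_exists[OF ob] by blast
  interpret flag os e by (rule fl)
  have lin: "IRes_rat os (\<lambda>z. \<Sum>\<sigma>\<in>A. c \<sigma> * phi \<Delta> \<sigma> z) = (\<Sum>\<sigma>\<in>A. c \<sigma> * IRes_rat os (phi \<Delta> \<sigma>))"
   if "finite A" "A \<subseteq> ?U" for A using that
  proof (induction A rule: finite_induct)
   case empty
   then show ?case by (simp add: IRes_V V_zero)
  next
   case (insert \<sigma> A)
   have R: "phi \<Delta> \<sigma> \<in> R_space \<Delta>" if "\<sigma> \<in> ?U" for \<sigma>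
   proof -
    have "phi \<Delta> \<sigma> \<in> S_space \<Delta>" unfolding S_space_def
     by (rule cfun.span_base) (use that in \<open>auto simp: unbroken_bases_def\<close>)
    then show ?thesis using S_space_R[OF assms(1)] by auto
   qed
   have "(\<lambda>z. \<Sum>\<sigma>\<in>A. c \<sigma> * phi \<Delta> \<sigma> z) \<in> R_space \<Delta>"
    using insert R by (intro R_sum R_scale) auto
   then show ?case using insert IRes_linear[OF assms(1,2) R, of \<sigma> "\<lambda>z. \<Sum>\<sigma>\<in>A. c \<sigma> * phi \<Delta> \<sigma> z" "c \<sigma>" 1] by simp
  qed
  have "0 = IRes_rat os s" using IRes_derivative_space(1)[OF assms(1,2,4)] by simp
  also have "\<dots> = (\<Sum>\<sigma>\<in>?U. c \<sigma> * IRes_rat os (phi \<Delta> \<sigma>))" unfolding c by (rule lin[OF finU]) simp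
  also have "\<dots> = (\<Sum>\<sigma>\<in>?U. if \<sigma> = \<tau> then c \<sigma> else 0)"
  proof (rule sum.cong, simp)
   fix \<sigma> assume sg: "\<sigma> \<in> ?U"
   have sub: "set os \<subseteq> \<Delta>" using os(1) tb by (simp add: bases_def)
   have self: "IRes_rat os (phi \<Delta> \<tau>) = 1" using IRes_phi_self[OF assms(1,2) sub] os(1) by simp
   have "IRes_rat os (phi \<Delta> \<sigma>) = 0" if "\<sigma> \<noteq> \<tau>"
    using IRes_phi_unbroken[OF assms(1,2) rk os(3) _ sg] t os(1) that by blast
   then show "c \<sigma> * IRes_rat os (phi \<Delta> \<sigma>) = (if \<sigma> = \<tau> then c \<sigma> else 0)"
    using self by (cases "\<sigma> = \<tau>") simp_all
  qed
  finally show ?thesis using finU t by simp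
 qed
 then show ?thesis unfolding c by simp
qed

section \<open>The projection onto simple fractions\<close>

lemma derivative_space_diff: "g \<in> derivative_space \<Delta> \<Longrightarrow> h \<in> derivative_space \<Delta> \<Longrightarrow> g - h \<in> derivative_space \<Delta>"
 unfolding derivative_space_def by (rule cfun.span_diff)

lemma S_space_diff: "g \<in> S_space \<Delta> \<Longrightarrow> h \<in> S_space \<Delta> \<Longrightarrow> g - h \<in> S_space \<Delta>"
 unfolding S_space_def by (rule cfun.span_diff)

lemma Res_rat_props:
 fixes \<Delta> :: "(real^'n) set"
 assumes "finite \<Delta>" "0 \<notin> \<Delta>" "g \<in> R_space \<Delta>"
 shows "Res_rat \<Delta> g \<in> S_space \<Delta>" "g - Res_rat \<Delta> g \<in> derivative_space \<Delta>"
proof -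
 have "\<exists>!s. s \<in> S_space \<Delta> \<and> g - s \<in> derivative_space \<Delta>"
 proof (rule ex_ex1I)
  show "\<exists>s. s \<in> S_space \<Delta> \<and> g - s \<in> derivative_space \<Delta>" using S_derivative_sum[OF assms] by blast
  fix s t assume *: "s \<in> S_space \<Delta> \<and> g - s \<in> derivative_space \<Delta>" "t \<in> S_space \<Delta> \<and> g - t \<in> derivative_space \<Delta>"
  have "s - t \<in> S_space \<Delta>" using * by (intro S_space_diff) auto
  moreover have "(g - t) - (g - s) \<in> derivative_space \<Delta>"
   by (rule derivative_space_diff) (use * in auto)
  then have "s - t \<in> derivative_space \<Delta>" by (simp add: algebra_simps)
  ultimately have "s - t = (\<lambda>z. 0)" by (rule S_derivative_Int[OF assms(1,2)])
  then show "s = t" by (simp add: fun_eq_iff)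
 qed
 from theI'[OF this] show "Res_rat \<Delta> g \<in> S_space \<Delta>" "g - Res_rat \<Delta> g \<in> derivative_space \<Delta>"
  unfolding Res_rat_def by auto
qed

lemma Res_rat_eqI:
 fixes \<Delta> :: "(real^'n) set"
 assumes "finite \<Delta>" "0 \<notin> \<Delta>" "s \<in> S_space \<Delta>" "g - s \<in> derivative_space \<Delta>"
 shows "Res_rat \<Delta> g = s"
proof -
 have gs: "g = (\<lambda>z. (g - s) z + s z)" by (simp add: fun_eq_iff)
 have "g \<in> R_space \<Delta>"
  by (subst gs, rule R_add) (use assms(3,4) derivative_space_R[OF assms(1)] S_space_R[OF assms(1)] in \<open>auto simp del: minus_apply\<close>)
 note * = Res_rat_props[OF assms(1,2) this]
 have "Res_rat \<Delta> g - s \<in> S_space \<Delta>" using * assms by (intro S_space_diff) auto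
 moreover have "(g - s) - (g - Res_rat \<Delta> g) \<in> derivative_space \<Delta>"
  by (rule derivative_space_diff) (use * assms in auto)
 then have "Res_rat \<Delta> g - s \<in> derivative_space \<Delta>" by (simp add: algebra_simps)
 ultimately have "Res_rat \<Delta> g - s = (\<lambda>z. 0)" by (rule S_derivative_Int[OF assms(1,2)])
 then show ?thesis by (simp add: fun_eq_iff)
qed

lemma Res_rat_linear:
 fixes \<Delta> :: "(real^'n) set"
 assumes "finite \<Delta>" "0 \<notin> \<Delta>" "g \<in> R_space \<Delta>" "h \<in> R_space \<Delta>"
 shows "Res_rat \<Delta> (\<lambda>z. a * g z + b * h z) = (\<lambda>z. a * Res_rat \<Delta> g z + b * Res_rat \<Delta> h z)"
proof (rule Res_rat_eqI[OF assms(1,2)])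
 note 1 = Res_rat_props[OF assms(1,2,3)] and 2 = Res_rat_props[OF assms(1,2,4)]
 show "(\<lambda>z. a * Res_rat \<Delta> g z + b * Res_rat \<Delta> h z) \<in> S_space \<Delta>"
  using 1 2 unfolding S_space_def by (intro cfun_span_add cfun_span_scale)
 have "(\<lambda>z. a * (g - Res_rat \<Delta> g) z + b * (h - Res_rat \<Delta> h) z) \<in> derivative_space \<Delta>"
  using 1 2 unfolding derivative_space_def by (intro cfun_span_add cfun_span_scale)
 then show "(\<lambda>z. a * g z + b * h z) - (\<lambda>z. a * Res_rat \<Delta> g z + b * Res_rat \<Delta> h z) \<in> derivative_space \<Delta>"
  by (simp add: fun_diff_def algebra_simps)
qed

lemma Res_rat_S:
 fixes \<Delta> :: "(real^'n) set"
 assumes "finite \<Delta>" "0 \<notin> \<Delta>" "s \<in> S_space \<Delta>" shows "Res_rat \<Delta> s = s"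
 by (rule Res_rat_eqI[OF assms]) (simp add: derivative_space_def cfun.span_zero)

lemma Res_rat_derivative:
 fixes \<Delta> :: "(real^'n) set"
 assumes "finite \<Delta>" "0 \<notin> \<Delta>" "s \<in> derivative_space \<Delta>" shows "Res_rat \<Delta> s = (\<lambda>z. 0)"
 by (rule Res_rat_eqI[OF assms(1,2)]) (use assms(3) in \<open>simp_all add: S_space_def cfun_span_zero fun_diff_def\<close>)

lemma Res_rat_sum:
 fixes \<Delta> :: "(real^'n) set"
 assumes "finite \<Delta>" "0 \<notin> \<Delta>" "\<And>x. x \<in> A \<Longrightarrow> g x \<in> R_space \<Delta>"
 shows "Res_rat \<Delta> (\<lambda>z. \<Sum>x\<in>A. g x z) = (\<lambda>z. \<Sum>x\<in>A. Res_rat \<Delta> (g x) z)"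
 using assms(3)
proof (induction A rule: infinite_finite_induct)
 case (insert x A)
 then show ?case using Res_rat_linear[OF assms(1,2), of "g x" "\<lambda>z. \<Sum>x\<in>A. g x z" 1 1] by (simp add: R_sum)
qed (auto intro: Res_rat_derivative[OF assms(1,2)] simp: derivative_space_def cfun_span_zero)

section \<open>Homogeneous polynomials\<close>

text \<open>Monomials are indexed by words in the coordinates instead of exponents: a given degree
  has finitely many words, and words that differ by a permutation merely repeat a generator of the
  span.\<close>

definition coord_mono :: "'n list \<Rightarrow> complex^'n \<Rightarrow> complex" where
 "coord_mono c = lprod (map (\<lambda>i. axis i 1) c)"

definition hom_poly :: "nat \<Rightarrow> (complex^'n \<Rightarrow> complex) set" where
 "hom_poly d = cfun.span (coord_mono ` {c. length c = d})"

lemma finite_coord_mono: "finite (coord_mono ` {c :: 'n::finite list. length c = d})"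
 using finite_lists_length_eq[of "UNIV :: 'n set" d] by simp

lemma hom_poly_mult: "p \<in> hom_poly d \<Longrightarrow> q \<in> hom_poly d' \<Longrightarrow> (\<lambda>z. p z * q z) \<in> hom_poly (d + d')"
 unfolding hom_poly_def
proof (erule (1) cfun_span_mult)
 fix x y :: "complex^'n \<Rightarrow> complex"
 assume "x \<in> coord_mono ` {c. length c = d}" "y \<in> coord_mono ` {c. length c = d'}"
 then obtain c c' where c: "x = coord_mono c" "length c = d" "y = coord_mono c'" "length c' = d'" by auto
 have "(\<lambda>z. x z * y z) = coord_mono (c @ c')" by (simp add: coord_mono_def c)
 then show "(\<lambda>z. x z * y z) \<in> cfun.span (coord_mono ` {c. length c = d + d'})"
  using c by (intro cfun.span_base) auto
qed

lemma hom_poly_sum: "(\<And>x. x \<in> A \<Longrightarrow> g x \<in> hom_poly d) \<Longrightarrow> (\<lambda>z. \<Sum>x\<in>A. g x z) \<in> hom_poly d"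
 unfolding hom_poly_def by (rule cfun_span_sum)
lemma hom_poly_scale: "g \<in> hom_poly d \<Longrightarrow> (\<lambda>z. c * g z) \<in> hom_poly d"
 unfolding hom_poly_def by (rule cfun_span_scale)
lemma hom_poly_add: "g \<in> hom_poly d \<Longrightarrow> h \<in> hom_poly d \<Longrightarrow> (\<lambda>z. g z + h z) \<in> hom_poly d"
 unfolding hom_poly_def by (rule cfun_span_add)
lemma hom_poly_zero: "(\<lambda>z. 0) \<in> hom_poly d"
 unfolding hom_poly_def by (rule cfun_span_zero)

lemma hom_poly_const: "(\<lambda>z. c) \<in> hom_poly 0"
proof -
 have "coord_mono [] \<in> hom_poly 0" unfolding hom_poly_def by (rule cfun.span_base) auto
 from hom_poly_scale[OF this, of c] show ?thesis by (simp add: coord_mono_def)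
qed

lemma hom_poly_pairing: "pairing a \<in> hom_poly 1"
proof -
 have "(\<lambda>z. z $ i) \<in> hom_poly 1" for i :: 'a
 proof -
  have "coord_mono [i] \<in> hom_poly 1" unfolding hom_poly_def by (rule cfun.span_base) auto
  moreover have "coord_mono [i] = (\<lambda>z. z $ i)" by (simp add: coord_mono_def pairing_axis_left)
  ultimately show ?thesis by simp
 qed
 then have "(\<lambda>z. \<Sum>i\<in>UNIV. of_real (a $ i) * z $ i) \<in> hom_poly 1" by (intro hom_poly_sum hom_poly_scale)
 then show ?thesis by (simp add: pairing_def[abs_def])
qed

lemma hom_poly_power: "p \<in> hom_poly d \<Longrightarrow> (\<lambda>z. p z ^ k) \<in> hom_poly (d * k)"
proof (induction k)
 case 0 then show ?case using hom_poly_const[of 1] by simp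
next
 case (Suc k) then show ?case using hom_poly_mult[of p d "\<lambda>z. p z ^ k" "d * k"] by simp
qed

lemma hom_poly_lprod: "lprod ks \<in> hom_poly (length ks)"
proof (induction ks)
 case Nil then show ?case using hom_poly_const[of 1] by simp
next
 case (Cons a ks) then show ?case using hom_poly_mult[OF hom_poly_pairing[of a] Cons] by simp
qed

lemma hom_poly_induct [consumes 1, case_names zero add scale base]:
 assumes "g \<in> hom_poly d" "P (\<lambda>z. 0)" "\<And>g h. g \<in> hom_poly d \<Longrightarrow> h \<in> hom_poly d \<Longrightarrow> P g \<Longrightarrow> P h \<Longrightarrow> P (\<lambda>z. g z + h z)"
  "\<And>c g. g \<in> hom_poly d \<Longrightarrow> P g \<Longrightarrow> P (\<lambda>z. c * g z)" "\<And>ks. length ks = d \<Longrightarrow> P (lprod ks)"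
 shows "P g"
proof -
 have "P g \<and> g \<in> hom_poly d"
  using assms(1) unfolding hom_poly_def
 proof (induction g rule: cfun_span_induct)
  case zero then show ?case using assms(2) cfun_span_zero by blast
 next
  case (add g h) then show ?case using assms(3) cfun_span_add unfolding hom_poly_def by blast
 next
  case (scale c g) then show ?case using assms(4) cfun_span_scale unfolding hom_poly_def by blast
 next
  case (base x)
  then obtain c where "x = coord_mono c" "length c = d" by auto
  then show ?case using assms(5)[of "map (\<lambda>i. axis i 1) c"] base cfun.span_base[OF base] by (simp add: coord_mono_def)
 qed
 then show ?thesis by simp
qed

lemma hom_poly_poly_fun: "p \<in> hom_poly d \<Longrightarrow> poly_fun p"
 by (induction rule: hom_poly_induct) (auto intro: poly_fun.intros poly_fun_prod_list)

lemma hom_poly_homogeneous: "p \<in> hom_poly d \<Longrightarrow> p (c *s z) = c ^ d * p z"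
proof (induction rule: hom_poly_induct)
 case (base ks)
 have "lprod ks (c *s z) = c ^ length ks * lprod ks z"
  by (induction ks) (auto simp: pairing_simps)
 then show ?case using base by simp
qed (auto simp: algebra_simps)

lemma pd_scale: "poly_fun p \<Longrightarrow> pd v (\<lambda>z. c * p z) = (\<lambda>z. c * pd v p z)"
 using pd_mult[OF poly_fun.const, of p v c] by (simp add: pd_const)

lemma hom_poly_pd: "p \<in> hom_poly (Suc d) \<Longrightarrow> pd v p \<in> hom_poly d"
proof (induction rule: hom_poly_induct)
 case zero then show ?case by (simp add: pd_const hom_poly_zero)
next
 case (add g h) then show ?case by (simp add: pd_add hom_poly_poly_fun hom_poly_add)
next
 case (scale c g) then show ?case by (simp add: pd_scale hom_poly_poly_fun hom_poly_scale)
next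
 case (base ks)
 have "pd v (lprod ks) \<in> hom_poly n" if "length ks = Suc n" for n ks
  using that
 proof (induction n arbitrary: ks)
  case 0
  then obtain a where "ks = [a]" by (cases ks) auto
  then show ?case by (simp add: pd_pairing hom_poly_const)
 next
  case (Suc n)
  then obtain a ks' where k: "ks = a # ks'" "length ks' = Suc n" by (cases ks) auto
  have "pd v (lprod ks) = (\<lambda>z. of_real (a \<bullet> v) * lprod ks' z + pairing a z * pd v (lprod ks') z)"
   by (simp add: k pd_mult poly_fun_pairing poly_fun_prod_list pd_pairing)
  moreover have "(\<lambda>z. of_real (a \<bullet> v) * lprod ks' z) \<in> hom_poly (Suc n)"
   using hom_poly_lprod[of ks'] k by (intro hom_poly_scale) simp
  moreover have "(\<lambda>z. pairing a z * pd v (lprod ks') z) \<in> hom_poly (Suc n)"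
   using hom_poly_mult[OF hom_poly_pairing[of a] Suc.IH[OF k(2)]] by simp
  ultimately show ?case by (simp add: hom_poly_add)
 qed
 then show ?case using base by blast
qed

lemma pd_hom_poly_0: "p \<in> hom_poly 0 \<Longrightarrow> pd v p = (\<lambda>z. 0)"
proof (induction rule: hom_poly_induct)
 case (add g h) then show ?case by (simp add: pd_add hom_poly_poly_fun)
next
 case (scale c g) then show ?case by (simp add: pd_scale hom_poly_poly_fun)
qed (auto simp: pd_const)

lemma euler:
 fixes p :: "complex^'n \<Rightarrow> complex"
 assumes "p \<in> hom_poly d"
 shows "(\<Sum>i\<in>UNIV. z $ i * pd (axis i 1) p z) = of_nat d * p z"
 using assms
proof (induction rule: hom_poly_induct)
 case zero then show ?case by (simp add: pd_const)
next
 case (add g h) then show ?case by (simp add: pd_add hom_poly_poly_fun algebra_simps sum.distrib)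
next
 case (scale c g)
 have "(\<Sum>i\<in>UNIV. z $ i * pd (axis i 1) (\<lambda>z. c * g z) z) = c * (\<Sum>i\<in>UNIV. z $ i * pd (axis i 1) g z)"
  unfolding sum_distrib_left by (intro sum.cong) (simp_all add: pd_scale[OF hom_poly_poly_fun[OF scale(1)]])
 then show ?case using scale by simp
next
 case (base ks)
 have "(\<Sum>i\<in>UNIV. z $ i * pd (axis i 1) (lprod ks) z) = of_nat (length ks) * lprod ks z"
 proof (induction ks)
  case Nil then show ?case by (simp add: pd_const)
 next
  case (Cons a ks)
  have "pd (axis i 1) (lprod (a # ks)) z = of_real (a $ i) * lprod ks z + pairing a z * pd (axis i 1) (lprod ks) z" for i
   by (simp add: pd_mult poly_fun_pairing poly_fun_prod_list pd_pairing inner_axis)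
  then have "(\<Sum>i\<in>UNIV. z $ i * pd (axis i 1) (lprod (a # ks)) z) =
    pairing a z * lprod ks z + pairing a z * (\<Sum>i\<in>UNIV. z $ i * pd (axis i 1) (lprod ks) z)"
   by (simp add: pairing_def algebra_simps sum.distrib sum_distrib_left sum_distrib_right)
  then show ?case using Cons by (simp add: algebra_simps)
 qed
 then show ?case using base by simp
qed

text \<open>Euler: \<open>\<Sum>i. \<partial>\<^sub>i (z\<^sub>i g) = (r + deg g) g\<close>.\<close>

lemma quot_hom_derivative:
 fixes \<Delta> :: "(real^'n) set"
 assumes "finite \<Delta>" "set ks \<subseteq> \<Delta>" "q \<in> hom_poly d" "d + CARD('n) \<noteq> length ks"
 shows "quot \<Delta> ks q \<in> derivative_space \<Delta>"
proof -
 define c :: complex where "c = of_nat (d + CARD('n)) - of_nat (length ks)"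
 have c: "c \<noteq> 0" using assms(4) unfolding c_def by (metis eq_iff_diff_eq_0 of_nat_eq_iff)
 have pq: "poly_fun q" using assms(3) by (rule hom_poly_poly_fun)
 have pz: "poly_fun (\<lambda>z. z $ i * q z)" for i by (intro poly_fun.intros pq)
 have num: "(\<Sum>i\<in>UNIV. quot_deriv_num (axis i 1) ks (\<lambda>z. z $ i * q z) z) = c * (q z * lprod ks z)" for z
 proof -
  have "quot_deriv_num (axis i 1) ks (\<lambda>z. z $ i * q z) z =
    lprod ks z * q z + lprod ks z * (z $ i * pd (axis i 1) q z) - q z * (z $ i * pd (axis i 1) (lprod ks) z)" for i
   by (simp add: quot_deriv_num_def pd_mult poly_fun.coord pq pd_coord cvec_def algebra_simps)
  then have "(\<Sum>i\<in>UNIV. quot_deriv_num (axis i 1) ks (\<lambda>z. z $ i * q z) z) =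
    of_nat CARD('n) * (lprod ks z * q z) + lprod ks z * (\<Sum>i\<in>UNIV. z $ i * pd (axis i 1) q z)
    - q z * (\<Sum>i\<in>UNIV. z $ i * pd (axis i 1) (lprod ks) z)"
   by (simp add: sum.distrib sum_subtractf sum_distrib_left)
  also have "\<dots> = c * (q z * lprod ks z)"
   unfolding euler[OF assms(3)] euler[OF hom_poly_lprod] c_def by (simp add: algebra_simps)
  finally show ?thesis .
 qed
 have "(\<lambda>z. \<Sum>i\<in>UNIV. dir_deriv \<Delta> (axis i 1) (quot \<Delta> ks (\<lambda>z. z $ i * q z)) z) \<in> derivative_space \<Delta>"
  unfolding derivative_space_def
  by (intro cfun_span_sum derivative_space_base[unfolded derivative_space_def] R_quot assms(2) pz)
 also have "(\<lambda>z. \<Sum>i\<in>UNIV. dir_deriv \<Delta> (axis i 1) (quot \<Delta> ks (\<lambda>z. z $ i * q z)) z) =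
   quot \<Delta> (ks @ ks) (\<lambda>z. \<Sum>i\<in>UNIV. quot_deriv_num (axis i 1) ks (\<lambda>z. z $ i * q z) z)"
  unfolding quot_sum by (simp add: dir_deriv_quot[OF assms(1,2) pz])
 also have "\<dots> = (\<lambda>z. c * quot \<Delta> ks q z)"
  unfolding num quot_scale quot_add_denom[OF assms(2), symmetric] ..
 finally have "(\<lambda>z. c * quot \<Delta> ks q z) \<in> derivative_space \<Delta>" .
 from cfun_span_scale[OF this[unfolded derivative_space_def], of "1 / c"]
 show ?thesis using c by (simp add: derivative_space_def)
qed

section \<open>Point evaluations\<close>

text \<open>A linear functional on a finite-dimensional space of functions is such a combination. In
  this form it commutes visibly with derivatives, integrals and sums in a parameter.\<close>

definition ev :: "((complex^'n) \<times> complex) list \<Rightarrow> (complex^'n \<Rightarrow> complex) \<Rightarrow> complex" where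
 "ev l q = (\<Sum>(x, a)\<leftarrow>l. a * q x)"

lemma ev_append: "ev (l @ l') q = ev l q + ev l' q"
 by (simp add: ev_def)

lemma ev_scale_ex: "\<exists>l'. \<forall>q. ev l' q = c * ev l q"
proof
 show "\<forall>q. ev (map (\<lambda>(x, a). (x, c * a)) l) q = c * ev l q"
 proof
  fix q show "ev (map (\<lambda>(x, a). (x, c * a)) l) q = c * ev l q"
   by (induction l) (auto simp: ev_def algebra_simps)
 qed
qed

lemma ev_lincomb_ex: "finite b \<Longrightarrow> \<exists>l'. \<forall>q. ev l' q = (\<Sum>p\<in>b. c p * ev (l p) q)"
proof (induction rule: finite_induct)
 case empty
 have "\<forall>q. ev [] q = 0" by (simp add: ev_def)
 then show ?case by auto
next
 case (insert p b)
 then obtain l' where l': "\<forall>q. ev l' q = (\<Sum>p\<in>b. c p * ev (l p) q)" by blast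
 obtain l'' where l'': "\<forall>q. ev l'' q = c p * ev (l p) q" using ev_scale_ex by blast
 have "\<forall>q. ev (l'' @ l') q = (\<Sum>p\<in>insert p b. c p * ev (l p) q)"
  using insert l' l'' by (simp add: ev_append)
 then show ?case by blast
qed

lemma ev_add: "ev l (\<lambda>z. p z + q z) = ev l p + ev l q"
 by (induction l) (auto simp: ev_def algebra_simps)
lemma ev_scale: "ev l (\<lambda>z. c * p z) = c * ev l p"
 by (induction l) (auto simp: ev_def algebra_simps)
lemma ev_zero: "ev l (\<lambda>z. 0) = 0"
 by (induction l) (auto simp: ev_def)
text \<open>Interpolation by adding one function at a time. Subtracting from \<open>q0\<close> its
  interpolant leaves a function that is nonzero at some \<open>x\<close> by independence; evaluation
  at \<open>x\<close>, corrected by the earlier functionals and normalized, kills \<open>b\<close>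
  and is 1 on \<open>q0\<close>. The earlier functionals are then corrected on
  \<open>q0\<close>.\<close>

lemma ev_dual:
 assumes "finite b" "cfun.independent b"
 shows "\<forall>q\<in>b. \<exists>l. \<forall>p\<in>b. ev l p = (if p = q then 1 else 0)"
 using assms
proof (induction b rule: finite_induct)
 case (insert q0 b)
 have ind: "cfun.independent b" "q0 \<notin> cfun.span b"
  using insert by (auto simp: cfun.independent_insert split: if_splits)
 from insert.IH[OF ind(1)] have "\<exists>E. \<forall>q\<in>b. \<forall>p\<in>b. ev (E q) p = (if p = q then 1 else 0)"
  by (intro bchoice) auto
 then obtain E where E: "\<And>q p. q \<in> b \<Longrightarrow> p \<in> b \<Longrightarrow> ev (E q) p = (if p = q then 1 else 0)" by blast
 define q1 where "q1 = (\<lambda>z. q0 z - (\<Sum>q\<in>b. ev (E q) q0 * q z))"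
 have "q1 \<noteq> (\<lambda>z. 0)"
 proof
  assume "q1 = (\<lambda>z. 0)"
  then have "q0 = (\<lambda>z. \<Sum>q\<in>b. ev (E q) q0 * q z)" by (simp add: q1_def fun_eq_iff)
  also have "\<dots> \<in> cfun.span b" by (intro cfun_span_sum cfun_span_scale cfun.span_base)
  finally show False using ind by blast
 qed
 then obtain x where x: "q1 x \<noteq> 0" by auto
 obtain l1 where l1: "\<forall>q. ev l1 q = (\<Sum>p\<in>b. (- p x) * ev (E p) q)" using ev_lincomb_ex[OF insert.hyps(1), of "\<lambda>p. - p x" E] by blast
 obtain l0 where l0: "\<forall>q. ev l0 q = (1 / q1 x) * ev ((x, 1) # l1) q" using ev_scale_ex by blast
 have ev0: "ev l0 q = (q x - (\<Sum>p\<in>b. p x * ev (E p) q)) / q1 x" for q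
  using l0 l1 by (simp add: ev_def[of "_ # _"] ev_def[symmetric] sum_negf)
 have e1: "ev l0 q0 = 1" using x unfolding ev0 q1_def by (simp add: mult.commute)
 have e2: "ev l0 p = 0" if "p \<in> b" for p
 proof -
  have "(\<Sum>q\<in>b. q x * ev (E q) p) = (\<Sum>q\<in>b. if q = p then q x else 0)"
   using that E by (intro sum.cong) auto
  then show ?thesis unfolding ev0 using that insert.hyps by simp
 qed
 show ?case
 proof
  fix q assume q: "q \<in> insert q0 b"
  show "\<exists>l. \<forall>p\<in>insert q0 b. ev l p = (if p = q then 1 else 0)"
  proof (cases "q = q0")
   case True
   then show ?thesis using e1 e2 insert.hyps by (intro exI[of _ l0]) auto
  next
   case False
   then have qb: "q \<in> b" using q by auto
   obtain l2 where l2: "\<forall>p. ev l2 p = - ev (E q) q0 * ev l0 p" using ev_scale_ex by blast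
   have "ev (E q @ l2) p = (if p = q then 1 else 0)" if "p \<in> insert q0 b" for p
    using that l2 e1 e2 E[OF qb] False qb by (auto simp: ev_append)
   then show ?thesis by blast
  qed
 qed
qed simp

lemma functional_point_evaluations:
 assumes "finite X" "\<And>p q a b. p \<in> cfun.span X \<Longrightarrow> q \<in> cfun.span X \<Longrightarrow> L (\<lambda>z. a * p z + b * q z) = a * L p + b * L q"
 shows "\<exists>l. \<forall>q\<in>cfun.span X. L q = ev l q"
proof -
 obtain b where b: "b \<subseteq> X" "cfun.independent b" "X \<subseteq> cfun.span b"
  by (rule cfun.maximal_independent_subset)
 have fin: "finite b" using b assms(1) finite_subset by blast
 have spb: "cfun.span X = cfun.span b"
  using b cfun.span_mono cfun.span_minimal[OF b(3) cfun.subspace_span] by blast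
 have "\<exists>E. \<forall>q\<in>b. \<forall>p\<in>b. ev (E q) p = (if p = q then 1 else 0)"
  using ev_dual[OF fin b(2)] by (intro bchoice) auto
 then obtain E where E: "\<And>q p. q \<in> b \<Longrightarrow> p \<in> b \<Longrightarrow> ev (E q) p = (if p = q then 1 else 0)" by blast
 obtain l where l: "\<forall>q. ev l q = (\<Sum>p\<in>b. L p * ev (E p) q)" using ev_lincomb_ex[OF fin, of L E] by blast
 have L0: "L (\<lambda>z. 0) = 0" using assms(2)[OF cfun_span_zero cfun_span_zero, of 0 0] by simp
 have "L q = ev l q \<and> q \<in> cfun.span X" if "q \<in> cfun.span b" for q using that
 proof (induction q rule: cfun_span_induct)
  case zero then show ?case using L0 cfun_span_zero by (simp add: ev_zero)
 next
  case (add g h)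
  then show ?case using assms(2)[of g h 1 1] by (simp add: ev_add cfun_span_add)
 next
  case (scale c g)
  then show ?case using assms(2)[of g g c 0] by (simp add: ev_scale cfun_span_scale)
 next
  case (base x)
  have "ev l x = (\<Sum>p\<in>b. if p = x then L p else 0)" using l E base by (auto intro!: sum.cong)
  then show ?case using base fin b(1) by (auto intro: cfun.span_base)
 qed
 then show ?thesis using spb by auto
qed

lemma hom_poly_functional:
 fixes L :: "(complex^'n \<Rightarrow> complex) \<Rightarrow> complex"
 assumes "\<And>p q a b. p \<in> hom_poly d \<Longrightarrow> q \<in> hom_poly d \<Longrightarrow> L (\<lambda>z. a * p z + b * q z) = a * L p + b * L q"
 shows "\<exists>l. \<forall>q\<in>hom_poly d. L q = ev l q"
 unfolding hom_poly_def
 by (rule functional_point_evaluations[OF finite_coord_mono]) (use assms[unfolded hom_poly_def] in auto)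

section \<open>Taylor expansions along lines\<close>

text \<open>The homogeneous component of degree \<open>d\<close> at 0, read off along the line
  through \<open>z\<close>, so that products and inverses become operations on power series in one
  variable.\<close>

definition tc :: "nat \<Rightarrow> (complex^'n \<Rightarrow> complex) \<Rightarrow> complex^'n \<Rightarrow> complex" where
 "tc d h z = (deriv ^^ d) (\<lambda>s. h (s *s z)) 0 / fact d"

definition tfps :: "(complex^'n \<Rightarrow> complex) \<Rightarrow> complex^'n \<Rightarrow> complex fps" where
 "tfps h z = Abs_fps (\<lambda>d. tc d h z)"

lemma tfps_nth [simp]: "fps_nth (tfps h z) d = tc d h z"
 by (simp add: tfps_def)

lemma taylor_poly_tc: "taylor_poly K h z = (\<Sum>d\<le>K. tc d h z)"
 by (simp add: taylor_poly_def tc_def)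

lemma tfps_eqI: "(\<lambda>s. h (s *s z)) has_fps_expansion F \<Longrightarrow> tfps h z = F"
 by (simp add: fps_eq_iff tc_def fps_nth_fps_expansion)

definition holo_at0 :: "(complex^'n \<Rightarrow> complex) \<Rightarrow> bool" where
 "holo_at0 h \<longleftrightarrow> (\<exists>U. 0 \<in> U \<and> holo_on U h)"

lemma has_derivative_smult: "((\<lambda>s::complex. s *s z) has_derivative (\<lambda>t. t *s z)) F"
proof -
 have "bounded_linear (\<lambda>s::complex. s *s z)"
  by (rule linear_conv_bounded_linear[THEN iffD1], rule linearI)
   (simp_all add: vec_eq_iff algebra_simps)
 then show ?thesis by (rule bounded_linear_imp_has_derivative)
qed

lemma holo_on_line:
 assumes "holo_on U h" "s *s z \<in> U"
 shows "\<exists>D. ((\<lambda>s. h (s *s z)) has_field_derivative D) (at s)"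
proof -
 obtain D where D: "(h has_derivative D) (at (s *s z))" "\<forall>c v. D (c *s v) = c * D v"
  using assms unfolding holo_on_def by blast
 have "((\<lambda>s. h (s *s z)) has_derivative (\<lambda>t. D (t *s z))) (at s)"
  by (rule has_derivative_compose[OF has_derivative_smult D(1)])
 moreover have "(\<lambda>t. D (t *s z)) = (*) (D z)" using D(2) by (auto simp: mult.commute)
 ultimately show ?thesis unfolding has_field_derivative_def by auto
qed

lemma line_open:
 assumes "open U" shows "open {s::complex. s *s z \<in> U}"
proof -
 have "continuous_on UNIV (\<lambda>s::complex. s *s z)"
  by (intro continuous_at_imp_continuous_on ballI has_derivative_continuous[OF has_derivative_smult])
 from open_vimage[OF assms this] show ?thesis by (simp add: vimage_def)
qed

lemma holo_on_line_holomorphic: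
 assumes "holo_on U h" shows "(\<lambda>s. h (s *s z)) holomorphic_on {s. s *s z \<in> U}"
 using holo_on_line[OF assms] line_open[of U z] assms
 by (subst holomorphic_on_open) (auto simp: holo_on_def)

lemma holo_at0_fps: "holo_at0 h \<Longrightarrow> (\<lambda>s. h (s *s z)) has_fps_expansion tfps h z"
proof -
 assume "holo_at0 h"
 then obtain U where U: "0 \<in> U" "holo_on U h" by (auto simp: holo_at0_def)
 then have "open U" by (simp add: holo_on_def)
 then have *: "(\<lambda>s. h (s *s z)) has_fps_expansion fps_expansion (\<lambda>s. h (s *s z)) 0"
  using holo_on_line_holomorphic[OF U(2)] U(1) line_open by (intro has_fps_expansion_fps_expansion[of "{s. s *s z \<in> U}"]) auto
 show ?thesis using * tfps_eqI[OF *] by simp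
qed

lemma holo_at0_mult:
 assumes "holo_at0 g" "holo_at0 h" shows "holo_at0 (\<lambda>z. g z * h z)"
proof -
 obtain U V where UV: "0 \<in> U" "holo_on U g" "0 \<in> V" "holo_on V h" using assms by (auto simp: holo_at0_def)
 have "holo_on (U \<inter> V) (\<lambda>z. g z * h z)"
  unfolding holo_on_def
 proof (intro conjI ballI)
  show "open (U \<inter> V)" using UV by (auto simp: holo_on_def)
  fix z assume "z \<in> U \<inter> V"
  then obtain D E where D: "(g has_derivative D) (at z)" "\<forall>c v. D (c *s v) = c * D v"
   and E: "(h has_derivative E) (at z)" "\<forall>c v. E (c *s v) = c * E v"
   using UV unfolding holo_on_def by blast
  show "\<exists>D. ((\<lambda>z. g z * h z) has_derivative D) (at z) \<and> (\<forall>c v. D (c *s v) = c * D v)"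
   using has_derivative_mult[OF D(1) E(1)] D(2) E(2)
   by (intro exI[of _ "\<lambda>v. g z * E v + D v * h z"]) (auto simp: algebra_simps)
 qed
 then show ?thesis using UV unfolding holo_at0_def by blast
qed

lemma holo_at0_add:
 assumes "holo_at0 g" "holo_at0 h" shows "holo_at0 (\<lambda>z. g z + h z)"
proof -
 obtain U V where UV: "0 \<in> U" "holo_on U g" "0 \<in> V" "holo_on V h" using assms by (auto simp: holo_at0_def)
 have "holo_on (U \<inter> V) (\<lambda>z. g z + h z)"
  unfolding holo_on_def
 proof (intro conjI ballI)
  show "open (U \<inter> V)" using UV by (auto simp: holo_on_def)
  fix z assume "z \<in> U \<inter> V"
  then obtain D E where D: "(g has_derivative D) (at z)" "\<forall>c v. D (c *s v) = c * D v"
   and E: "(h has_derivative E) (at z)" "\<forall>c v. E (c *s v) = c * E v"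
   using UV unfolding holo_on_def by blast
  show "\<exists>D. ((\<lambda>z. g z + h z) has_derivative D) (at z) \<and> (\<forall>c v. D (c *s v) = c * D v)"
   using has_derivative_add[OF D(1) E(1)] D(2) E(2)
   by (intro exI[of _ "\<lambda>v. D v + E v"]) (auto simp: algebra_simps)
 qed
 then show ?thesis using UV unfolding holo_at0_def by blast
qed

lemma has_derivative_pairing: "(pairing a has_derivative pairing a) F"
proof -
 have "bounded_linear (pairing a)"
  by (rule linear_conv_bounded_linear[THEN iffD1], rule linearI)
   (simp_all add: pairing_def scaleR_sum_right algebra_simps sum.distrib)
 then show ?thesis by (rule bounded_linear_imp_has_derivative)
qed

lemma holo_at0_compose:
 assumes "holo_at0 h" "F holomorphic_on V" "open V" "h 0 \<in> V" shows "holo_at0 (\<lambda>z. F (h z))"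
proof -
 obtain U where U: "0 \<in> U" "holo_on U h" using assms by (auto simp: holo_at0_def)
 have "continuous_on U h"
  using U(2) unfolding holo_on_def
  by (intro continuous_at_imp_continuous_on ballI) (blast intro: has_derivative_continuous)
 then have opn: "open (U \<inter> h -` V)"
  using U(2) assms(3) by (intro continuous_open_preimage) (auto simp: holo_on_def)
 have "holo_on (U \<inter> h -` V) (\<lambda>z. F (h z))"
  unfolding holo_on_def
 proof (intro conjI ballI opn)
  fix z assume z: "z \<in> U \<inter> h -` V"
  then obtain D where D: "(h has_derivative D) (at z)" "\<forall>c v. D (c *s v) = c * D v"
   using U unfolding holo_on_def by blast
  have "(F has_field_derivative deriv F (h z)) (at (h z))"
   using z assms(2,3) by (intro holomorphic_derivI[of F V]) auto
  from has_derivative_compose[OF D(1) this[unfolded has_field_derivative_def]]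
  show "\<exists>D. ((\<lambda>z. F (h z)) has_derivative D) (at z) \<and> (\<forall>c v. D (c *s v) = c * D v)"
   using D(2) by (intro exI[of _ "\<lambda>v. deriv F (h z) * D v"]) (auto simp: algebra_simps)
 qed
 then show ?thesis using U(1) assms(4) unfolding holo_at0_def by (intro exI[of _ "U \<inter> h -` V"]) auto
qed

lemma holo_at0_const: "holo_at0 (\<lambda>z. c)"
 unfolding holo_at0_def holo_on_def
 by (intro exI[of _ UNIV] conjI ballI exI[of _ "\<lambda>v. 0"]) auto

lemma holo_at0_pairing: "holo_at0 (pairing a)"
 unfolding holo_at0_def holo_on_def
 by (intro exI[of _ UNIV] conjI ballI exI[of _ "pairing a"] has_derivative_pairing) (auto simp: pairing_smult_right)

text \<open>Polynomiality of the Taylor components is carried along as a closure property: it holds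
  for constants, linear forms and exponentials and passes to sums, products and inverses, from which
  all numerators below are built.\<close>

definition nice :: "(complex^'n \<Rightarrow> complex) \<Rightarrow> bool" where
 "nice h \<longleftrightarrow> holo_at0 h \<and> (\<forall>d. tc d h \<in> hom_poly d)"

lemma tc_0: "tc 0 h z = h 0"
 by (simp add: tc_def)

lemma tc_mult:
 assumes "holo_at0 g" "holo_at0 h"
 shows "tc d (\<lambda>z. g z * h z) z = (\<Sum>i\<le>d. tc i g z * tc (d - i) h z)"
proof -
 have "tfps (\<lambda>z. g z * h z) z = tfps g z * tfps h z"
  by (intro tfps_eqI has_fps_expansion_mult holo_at0_fps assms)
 then have "fps_nth (tfps (\<lambda>z. g z * h z) z) d = fps_nth (tfps g z * tfps h z) d" by simp
 then show ?thesis by (simp add: fps_mult_nth atLeast0AtMost)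
qed

lemma tc_add:
 assumes "holo_at0 g" "holo_at0 h"
 shows "tc d (\<lambda>z. g z + h z) z = tc d g z + tc d h z"
proof -
 have "tfps (\<lambda>z. g z + h z) z = tfps g z + tfps h z"
  by (intro tfps_eqI has_fps_expansion_add holo_at0_fps assms)
 then have "fps_nth (tfps (\<lambda>z. g z + h z) z) d = fps_nth (tfps g z + tfps h z) d" by simp
 then show ?thesis by simp
qed

lemma tc_const: "tc d (\<lambda>z. c) z = (if d = 0 then c else 0)"
proof -
 have "tfps (\<lambda>z. c) z = fps_const c"
  by (intro tfps_eqI has_fps_expansion_const)
 then have "fps_nth (tfps (\<lambda>z. c) z) d = fps_nth (fps_const c) d" by simp
 then show ?thesis by simp
qed

lemma tc_scale: "holo_at0 h \<Longrightarrow> tc d (\<lambda>z. c * h z) z = c * tc d h z"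
 by (subst tc_mult[OF holo_at0_const]) (simp_all add: tc_const if_distrib[of "\<lambda>x. x * _"] cong: if_cong)

lemma nice_holo: "nice h \<Longrightarrow> holo_at0 h" by (simp add: nice_def)
lemma nice_tc: "nice h \<Longrightarrow> tc d h \<in> hom_poly d" by (simp add: nice_def)

lemma nice_const: "nice (\<lambda>z. c)"
 unfolding nice_def
proof (intro conjI allI holo_at0_const)
 fix d show "tc d (\<lambda>z. c) \<in> hom_poly d"
  by (cases "d = 0") (simp_all add: tc_const[abs_def] hom_poly_zero hom_poly_const)
qed

lemma nice_add: "nice g \<Longrightarrow> nice h \<Longrightarrow> nice (\<lambda>z. g z + h z)"
 unfolding nice_def
proof (intro conjI allI)
 assume gh: "holo_at0 g \<and> (\<forall>d. tc d g \<in> hom_poly d)" "holo_at0 h \<and> (\<forall>d. tc d h \<in> hom_poly d)"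
 then show "holo_at0 (\<lambda>z. g z + h z)" by (simp add: holo_at0_add)
 fix d
 have "tc d (\<lambda>z. g z + h z) = (\<lambda>z. tc d g z + tc d h z)" using gh by (intro ext tc_add) auto
 then show "tc d (\<lambda>z. g z + h z) \<in> hom_poly d" using gh by (simp add: hom_poly_add)
qed

lemma nice_mult: "nice g \<Longrightarrow> nice h \<Longrightarrow> nice (\<lambda>z. g z * h z)"
 unfolding nice_def
proof (intro conjI allI)
 assume gh: "holo_at0 g \<and> (\<forall>d. tc d g \<in> hom_poly d)" "holo_at0 h \<and> (\<forall>d. tc d h \<in> hom_poly d)"
 then show "holo_at0 (\<lambda>z. g z * h z)" by (simp add: holo_at0_mult)
 fix d
 have "(\<lambda>z. \<Sum>i\<le>d. tc i g z * tc (d - i) h z) \<in> hom_poly d"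
 proof (rule hom_poly_sum)
  fix i assume "i \<in> {..d}"
  then show "(\<lambda>z. tc i g z * tc (d - i) h z) \<in> hom_poly d"
   using hom_poly_mult[of "tc i g" i "tc (d - i) h" "d - i"] gh by auto
 qed
 moreover have "tc d (\<lambda>z. g z * h z) = (\<lambda>z. \<Sum>i\<le>d. tc i g z * tc (d - i) h z)"
  using gh by (intro ext tc_mult) auto
 ultimately show "tc d (\<lambda>z. g z * h z) \<in> hom_poly d" by simp
qed

lemma nice_scale: "nice h \<Longrightarrow> nice (\<lambda>z. c * h z)"
 by (intro nice_mult nice_const)

lemma nice_sum: "(\<And>x. x \<in> A \<Longrightarrow> nice (g x)) \<Longrightarrow> nice (\<lambda>z. \<Sum>x\<in>A. g x z)"
 by (induction A rule: infinite_finite_induct) (auto intro: nice_const nice_add)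

lemma nice_prod: "(\<And>x. x \<in> A \<Longrightarrow> nice (g x)) \<Longrightarrow> nice (\<lambda>z. \<Prod>x\<in>A. g x z)"
 by (induction A rule: infinite_finite_induct) (auto intro: nice_const nice_mult)

lemma tc_exp: "tc d (\<lambda>z. exp (pairing a z)) z = pairing a z ^ d / fact d"
proof -
 have "tfps (\<lambda>z. exp (pairing a z)) z = fps_exp (pairing a z)"
  using has_fps_expansion_exp[of "pairing a z"] by (intro tfps_eqI) (simp add: pairing_smult_right mult.commute)
 then have "fps_nth (tfps (\<lambda>z. exp (pairing a z)) z) d = fps_nth (fps_exp (pairing a z)) d" by simp
 then show ?thesis by simp
qed

lemma nice_exp: "nice (\<lambda>z. exp (pairing a z))"
 unfolding nice_def
proof (intro conjI allI)
 show "holo_at0 (\<lambda>z. exp (pairing a z))"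
  by (rule holo_at0_compose[OF holo_at0_pairing, of exp UNIV]) (auto intro: holomorphic_intros)
 fix d
 have "(\<lambda>z. (1 / fact d) * pairing a z ^ d) \<in> hom_poly d"
  using hom_poly_power[OF hom_poly_pairing[of a], of d] by (intro hom_poly_scale) simp
 then show "tc d (\<lambda>z. exp (pairing a z)) \<in> hom_poly d" by (simp add: tc_exp[abs_def])
qed

lemma tc_pairing: "tc d (pairing a) z = (if d = 1 then pairing a z else 0)"
proof -
 have "tfps (pairing a) z = fps_const (pairing a z) * fps_X"
  using has_fps_expansion_cmult_left[OF has_fps_expansion_fps_X, of "pairing a z"]
  by (intro tfps_eqI) (simp add: pairing_smult_right mult.commute)
 then have "fps_nth (tfps (pairing a) z) d = fps_nth (fps_const (pairing a z) * fps_X) d" by simp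
 then show ?thesis by simp
qed

lemma nice_pairing: "nice (pairing a)"
 unfolding nice_def
proof (intro conjI allI holo_at0_pairing)
 fix d
 show "tc d (pairing a) \<in> hom_poly d"
  using hom_poly_pairing[of a] by (cases "d = 1") (simp_all add: tc_pairing[abs_def] hom_poly_zero eta_contract_eq)
qed

lemma nice_lprod: "nice (lprod ks)"
 by (induction ks) (auto intro: nice_const nice_mult nice_pairing)

text \<open>Comparing coefficients in \<open>h * inverse h = 1\<close> expresses the component of
  degree \<open>d\<close> of the inverse by lower ones, with the constant \<open>h 0\<close> as the
  only divisor.\<close>

lemma nice_inverse:
 assumes "nice h" "h 0 \<noteq> 0" shows "nice (\<lambda>z. inverse (h z))"
 unfolding nice_def
proof (intro conjI allI)
 show hi: "holo_at0 (\<lambda>z. inverse (h z))"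
  by (rule holo_at0_compose[OF nice_holo[OF assms(1)], of inverse "- {0}"]) (use assms in \<open>auto intro!: holomorphic_intros\<close>)
 have rec: "tc 0 h z * tc d (\<lambda>z. inverse (h z)) z =
   (if d = 0 then 1 else - (\<Sum>i\<in>{1..d}. tc i h z * tc (d - i) (\<lambda>z. inverse (h z)) z))" for d z
 proof -
  have F: "tfps (\<lambda>z. inverse (h z)) z = inverse (tfps h z)"
   using holo_at0_fps[OF nice_holo[OF assms(1)], of z] assms(2)
   by (intro tfps_eqI has_fps_expansion_inverse) (auto simp: tc_0)
  have "tfps h z * tfps (\<lambda>z. inverse (h z)) z = 1"
   unfolding F by (rule inverse_mult_eq_1') (use assms(2) in \<open>simp add: tc_0\<close>)
  then have "fps_nth (tfps h z * tfps (\<lambda>z. inverse (h z)) z) d = fps_nth 1 d" by simp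
  then have "(\<Sum>i=0..d. tc i h z * tc (d - i) (\<lambda>z. inverse (h z)) z) = (if d = 0 then 1 else 0)"
   by (simp add: fps_mult_nth)
  moreover have "(\<Sum>i=0..d. tc i h z * tc (d - i) (\<lambda>z. inverse (h z)) z) =
    tc 0 h z * tc d (\<lambda>z. inverse (h z)) z + (\<Sum>i\<in>{1..d}. tc i h z * tc (d - i) (\<lambda>z. inverse (h z)) z)"
   by (simp add: sum.atLeast_Suc_atMost)
  ultimately show ?thesis by (auto simp: eq_neg_iff_add_eq_0)
 qed
 fix d
 show "tc d (\<lambda>z. inverse (h z)) \<in> hom_poly d"
 proof (induction d rule: less_induct)
  case (less d)
  show ?case
  proof (cases "d = 0")
   case True
   then show ?thesis by (simp add: tc_0[abs_def] hom_poly_const)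
  next
   case False
   have "tc d (\<lambda>z. inverse (h z)) z = (- 1 / h 0) * (\<Sum>i\<in>{1..d}. tc i h z * tc (d - i) (\<lambda>z. inverse (h z)) z)" for z
    using rec[of z d] False assms(2) by (simp add: tc_0 field_simps)
   then have eq: "tc d (\<lambda>z. inverse (h z)) = (\<lambda>z. (- 1 / h 0) * (\<Sum>i\<in>{1..d}. tc i h z * tc (d - i) (\<lambda>z. inverse (h z)) z))" by blast
   show ?thesis unfolding eq
   proof (intro hom_poly_scale hom_poly_sum)
    fix i assume i: "i \<in> {1..d}"
    then have "tc (d - i) (\<lambda>z. inverse (h z)) \<in> hom_poly (d - i)" using less False by auto
    from hom_poly_mult[OF nice_tc[OF assms(1), of i] this] i
    show "(\<lambda>z. tc i h z * tc (d - i) (\<lambda>z. inverse (h z)) z) \<in> hom_poly d" by simp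
   qed
  qed
 qed
qed

section \<open>Residues of meromorphic germs\<close>

lemma regular_smult: "regular \<Delta> z \<Longrightarrow> s \<noteq> 0 \<Longrightarrow> regular \<Delta> (s *s z)"
 by (simp add: regular_def pairing_smult_right)

lemma lprod_smult: "lprod ks (s *s z) = s ^ length ks * lprod ks z"
 by (rule hom_poly_homogeneous[OF hom_poly_lprod])

lemma germ_quot_holo: "germ_quot \<Delta> ks h g \<Longrightarrow> holo_at0 h"
 by (auto simp: germ_quot_def holo_at0_def)

text \<open>A longer denominator is matched by a numerator of correspondingly higher order.
  Truncating each numerator at \<open>K\<close> plus the length of its own denominator therefore
  cuts the germ at the same degree \<open>K\<close>; this is compared on the line through
  \<open>z\<close>.\<close>

lemma germ_truncation_aux:
 assumes "germ_quot \<Delta> ks h g" "germ_quot \<Delta> ks' h' g" "regular \<Delta> z" "length ks \<le> length ks'"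
 shows "taylor_poly (K + length ks) h z / lprod ks z = taylor_poly (K + length ks') h' z / lprod ks' z"
proof -
 obtain U where U: "0 \<in> U" "holo_on U h" "\<And>z. z \<in> U \<Longrightarrow> regular \<Delta> z \<Longrightarrow> g z = h z / lprod ks z"
  using assms(1) by (auto simp: germ_quot_def)
 obtain U' where U': "0 \<in> U'" "holo_on U' h'" "\<And>z. z \<in> U' \<Longrightarrow> regular \<Delta> z \<Longrightarrow> g z = h' z / lprod ks' z"
  using assms(2) by (auto simp: germ_quot_def)
 have nz: "lprod ks z \<noteq> 0" "lprod ks' z \<noteq> 0"
  using assms prod_list_pairing_nz unfolding germ_quot_def by blast+
 have nzs: "lprod ks (s *s z) \<noteq> 0" "lprod ks' (s *s z) \<noteq> 0" if "s \<noteq> 0" for s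
  using nz that by (auto simp: lprod_smult)
 define k k' where "k = length ks" and "k' = length ks'"
 \<comment> \<open>The surplus factor \<open>s\<close> makes both sides vanish at
   \<open>s = 0\<close>, where the quotient formula says nothing, so the equality holds on a full
   neighbourhood.\<close>
 have ev: "\<forall>\<^sub>F s in nhds 0. h (s *s z) * (lprod ks' z * s ^ (k' + 1)) = h' (s *s z) * (lprod ks z * s ^ (k + 1))"
 proof -
  have "open {s. s *s z \<in> U \<inter> U'}" using U U' by (intro line_open) (auto simp: holo_on_def)
  then have "\<forall>\<^sub>F s in nhds 0. s \<in> {s. s *s z \<in> U \<inter> U'}" using U U' by (intro eventually_nhds_in_open) auto
  then show ?thesis
  proof (rule eventually_mono)
   fix s assume s: "s \<in> {s. s *s z \<in> U \<inter> U'}"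
   show "h (s *s z) * (lprod ks' z * s ^ (k' + 1)) = h' (s *s z) * (lprod ks z * s ^ (k + 1))"
   proof (cases "s = 0")
    case False
    have "h (s *s z) / lprod ks (s *s z) = h' (s *s z) / lprod ks' (s *s z)"
     using U(3)[of "s *s z"] U'(3)[of "s *s z"] s regular_smult[OF assms(3) False] by simp
    then have "h (s *s z) * lprod ks' (s *s z) = h' (s *s z) * lprod ks (s *s z)"
     using nzs[OF False] by (simp add: frac_eq_eq)
    then show ?thesis by (simp add: lprod_smult k_def k'_def algebra_simps)
   qed simp
  qed
 qed
 have X: "(\<lambda>s. c * s ^ m) has_fps_expansion fps_const c * fps_X ^ m" for c :: complex and m
  by (intro has_fps_expansion_cmult_left has_fps_expansion_fps_X_power)
 have 1: "(\<lambda>s. h (s *s z) * (lprod ks' z * s ^ (k' + 1))) has_fps_expansion tfps h z * (fps_const (lprod ks' z) * fps_X ^ (k' + 1))"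
  by (intro has_fps_expansion_mult holo_at0_fps germ_quot_holo[OF assms(1)] X)
 have 2: "(\<lambda>s. h' (s *s z) * (lprod ks z * s ^ (k + 1))) has_fps_expansion tfps h' z * (fps_const (lprod ks z) * fps_X ^ (k + 1))"
  by (intro has_fps_expansion_mult holo_at0_fps germ_quot_holo[OF assms(2)] X)
 have "(\<lambda>s. h (s *s z) * (lprod ks' z * s ^ (k' + 1))) has_fps_expansion tfps h' z * (fps_const (lprod ks z) * fps_X ^ (k + 1))"
  using 2 has_fps_expansion_cong[OF ev refl] by blast
 then have eq: "tfps h z * (fps_const (lprod ks' z) * fps_X ^ (k' + 1)) = tfps h' z * (fps_const (lprod ks z) * fps_X ^ (k + 1))"
  using 1 fps_expansion_unique_complex by blast
 have coeff: "fps_nth (tfps F z * (fps_const c * fps_X ^ m)) n = (if n < m then 0 else c * tc (n - m) F z)" for F c m n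
  by (simp add: mult.assoc[symmetric] fps_X_power_mult_right_nth mult.commute[of _ "fps_const c"])
 have c: "(if n < k' + 1 then 0 else lprod ks' z * tc (n - (k' + 1)) h z) = (if n < k + 1 then 0 else lprod ks z * tc (n - (k + 1)) h' z)" for n
  unfolding coeff[symmetric] eq ..
 \<comment> \<open>The second numerator vanishes to order \<open>m\<close> along the line, and its
   coefficients beyond that are those of the first, shifted by \<open>m\<close>.\<close>
 define m where "m = k' - k"
 have m: "k' = k + m" using assms(4) by (simp add: m_def k_def k'_def)
 have low: "tc d h' z = 0" if "d < m" for d
  using c[of "d + (k + 1)"] that nz m by simp
 have high: "lprod ks' z * tc d h z = lprod ks z * tc (d + m) h' z" for d
  using c[of "d + (k' + 1)"] m by (simp add: algebra_simps)
 have "taylor_poly (K + k') h' z = (\<Sum>d\<le>K + k + m. tc d h' z)" by (simp add: taylor_poly_tc m algebra_simps)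
 also have "\<dots> = (\<Sum>d\<in>{m..K + k + m}. tc d h' z)"
  by (rule sum.mono_neutral_right) (auto intro: low)
 also have "\<dots> = (\<Sum>d\<le>K + k. tc (d + m) h' z)"
  using sum.shift_bounds_cl_nat_ivl[of "\<lambda>d. tc d h' z" 0 m "K + k"] by (simp add: atLeast0AtMost)
 finally have "lprod ks z * taylor_poly (K + k') h' z = (\<Sum>d\<le>K + k. lprod ks' z * tc d h z)"
  by (simp add: sum_distrib_left high)
 then have "lprod ks z * taylor_poly (K + k') h' z = lprod ks' z * taylor_poly (K + k) h z"
  by (simp add: taylor_poly_tc sum_distrib_left)
 then show ?thesis using nz by (simp add: k_def k'_def field_simps)
qed

lemma germ_truncation:
 assumes "germ_quot \<Delta> ks h g" "germ_quot \<Delta> ks' h' g"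
 shows "quot \<Delta> ks (taylor_poly (K + length ks) h) = quot \<Delta> ks' (taylor_poly (K + length ks') h')"
proof
 fix z show "quot \<Delta> ks (taylor_poly (K + length ks) h) z = quot \<Delta> ks' (taylor_poly (K + length ks') h') z"
 proof (cases "regular \<Delta> z")
  case True
  then show ?thesis
   using germ_truncation_aux[OF assms True] germ_truncation_aux[OF assms(2,1) True]
   by (cases "length ks \<le> length ks'") (simp_all add: quot_regular)
 qed (simp add: quot_not_regular)
qed

text \<open>Any other presentation of the germ has the same truncations in matching degrees; at a
  degree beyond both thresholds its limit value must agree with \<open>c\<close>, so the description
  by \<open>THE\<close> is justified.\<close>

lemma taylor_extension_eqI:
 assumes "germ_quot \<Delta> ks h g" "\<And>K. K \<ge> K0 \<Longrightarrow> L (quot \<Delta> ks (taylor_poly K h)) = c"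
 shows "taylor_extension \<Delta> L g = c"
 unfolding taylor_extension_def
proof (rule the_equality)
 show "\<exists>ks h. germ_quot \<Delta> ks h g \<and> (\<forall>\<^sub>F K in sequentially. L (quot \<Delta> ks (taylor_poly K h)) = c)"
  using assms eventually_sequentially by blast
 fix c' assume "\<exists>ks h. germ_quot \<Delta> ks h g \<and> (\<forall>\<^sub>F K in sequentially. L (quot \<Delta> ks (taylor_poly K h)) = c')"
 then obtain ks' h' N where *: "germ_quot \<Delta> ks' h' g" "\<And>K. K \<ge> N \<Longrightarrow> L (quot \<Delta> ks' (taylor_poly K h')) = c'"
  unfolding eventually_sequentially by blast
 have "c' = L (quot \<Delta> ks' (taylor_poly (N + K0 + length ks') h'))" using * by simp
 also have "\<dots> = L (quot \<Delta> ks (taylor_poly (N + K0 + length ks) h))"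
  using germ_truncation[OF *(1) assms(1), of "N + K0"] by simp
 also have "\<dots> = c" using assms by simp
 finally show "c' = c" .
qed

lemma nice_taylor_poly: "nice h \<Longrightarrow> poly_fun (taylor_poly K h)"
 unfolding taylor_poly_tc[abs_def] by (intro poly_fun_sum) (rule hom_poly_poly_fun[OF nice_tc])

lemma Res_rat_hom:
 fixes \<Delta> :: "(real^'n) set"
 assumes "finite \<Delta>" "0 \<notin> \<Delta>" "set ks \<subseteq> \<Delta>" "q \<in> hom_poly d" "d + CARD('n) \<noteq> length ks"
 shows "Res_rat \<Delta> (quot \<Delta> ks q) = (\<lambda>z. 0)"
 by (rule Res_rat_derivative[OF assms(1,2) quot_hom_derivative[OF assms(1,3-)]])

lemma Res_rat_taylor:
 fixes \<Delta> :: "(real^'n) set"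
 assumes "finite \<Delta>" "0 \<notin> \<Delta>" "set ks \<subseteq> \<Delta>" "nice h"
 shows "Res_rat \<Delta> (quot \<Delta> ks (taylor_poly K h)) =
  (\<lambda>z. \<Sum>d\<le>K. if d + CARD('n) = length ks then Res_rat \<Delta> (quot \<Delta> ks (tc d h)) z else 0)"
proof -
 have "Res_rat \<Delta> (quot \<Delta> ks (taylor_poly K h)) = (\<lambda>z. \<Sum>d\<le>K. Res_rat \<Delta> (quot \<Delta> ks (tc d h)) z)"
  unfolding taylor_poly_tc[abs_def] quot_sum
  by (rule Res_rat_sum[OF assms(1,2)]) (intro R_quot assms hom_poly_poly_fun[OF nice_tc[OF assms(4)]])
 also have "\<dots> = (\<lambda>z. \<Sum>d\<le>K. if d + CARD('n) = length ks then Res_rat \<Delta> (quot \<Delta> ks (tc d h)) z else 0)"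
  using Res_rat_hom[OF assms(1-3) nice_tc[OF assms(4)]] by (intro ext sum.cong) auto
 finally show ?thesis .
qed

text \<open>Only the component of degree \<open>length ks - CARD('n)\<close> of the numerator
  contributes, so all truncations from \<open>length ks\<close> on have the same residue.\<close>

lemma Res_germ:
 fixes \<Delta> :: "(real^'n) set"
 assumes "finite \<Delta>" "0 \<notin> \<Delta>" "germ_quot \<Delta> ks h g" "nice h" "K \<ge> length ks"
 shows "Res \<Delta> g = Res_rat \<Delta> (quot \<Delta> ks (taylor_poly K h))"
 unfolding Res_def
proof (rule taylor_extension_eqI[OF assms(3)])
 have ks: "set ks \<subseteq> \<Delta>" using assms(3) by (simp add: germ_quot_def)
 fix K' assume K': "length ks \<le> K'"
 show "Res_rat \<Delta> (quot \<Delta> ks (taylor_poly K' h)) = Res_rat \<Delta> (quot \<Delta> ks (taylor_poly K h))"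
  unfolding Res_rat_taylor[OF assms(1,2) ks assms(4)]
 proof
  fix z
  have *: "(\<Sum>d\<le>L. if d + CARD('n) = length ks then Res_rat \<Delta> (quot \<Delta> ks (tc d h)) z else 0)
   = (\<Sum>d\<le>length ks. if d + CARD('n) = length ks then Res_rat \<Delta> (quot \<Delta> ks (tc d h)) z else 0)" if "L \<ge> length ks" for L
   using that by (intro sum.mono_neutral_right) auto
  show "(\<Sum>d\<le>K'. if d + CARD('n) = length ks then Res_rat \<Delta> (quot \<Delta> ks (tc d h)) z else 0)
   = (\<Sum>d\<le>K. if d + CARD('n) = length ks then Res_rat \<Delta> (quot \<Delta> ks (tc d h)) z else 0)"
   using *[OF K'] *[OF assms(5)] by simp
 qed
qed

lemma Res_germ_degree:
 fixes \<Delta> :: "(real^'n) set"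
 assumes "finite \<Delta>" "0 \<notin> \<Delta>" "germ_quot \<Delta> ks h g" "nice h" "length ks = D + CARD('n)"
 shows "Res \<Delta> g = Res_rat \<Delta> (quot \<Delta> ks (tc D h))"
proof -
 have ks: "set ks \<subseteq> \<Delta>" using assms(3) by (simp add: germ_quot_def)
 show ?thesis
  unfolding Res_germ[OF assms(1-4) order.refl] Res_rat_taylor[OF assms(1,2) ks assms(4)]
  using assms(5) by (simp add: if_distrib cong: if_cong)
qed

lemma Res_germ_S:
 fixes \<Delta> :: "(real^'n) set"
 assumes "finite \<Delta>" "0 \<notin> \<Delta>" "germ_quot \<Delta> ks h g" "nice h"
 shows "Res \<Delta> g \<in> S_space \<Delta>"
 unfolding Res_germ[OF assms order.refl]
 using assms by (intro Res_rat_props R_quot nice_taylor_poly) (auto simp: germ_quot_def)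

lemma germ_quot_add_denom:
 assumes "germ_quot \<Delta> ks h g" "set ks' \<subseteq> \<Delta>"
 shows "germ_quot \<Delta> (ks @ ks') (\<lambda>z. h z * lprod ks' z) g"
proof -
 obtain U where U: "0 \<in> U" "holo_on U h" "\<And>z. z \<in> U \<Longrightarrow> regular \<Delta> z \<Longrightarrow> g z = h z / lprod ks z"
  using assms(1) by (auto simp: germ_quot_def)
 have "holo_at0 (\<lambda>z. h z * lprod ks' z)"
  using U nice_holo[OF nice_lprod] by (intro holo_at0_mult) (auto simp: holo_at0_def)
 then obtain V where V: "0 \<in> V" "holo_on V (\<lambda>z. h z * lprod ks' z)" by (auto simp: holo_at0_def)
 have "holo_on (U \<inter> V) (\<lambda>z. h z * lprod ks' z)" using U V by (auto simp: holo_on_def)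
 moreover have "g z = (h z * lprod ks' z) / lprod (ks @ ks') z" if "z \<in> U \<inter> V" "regular \<Delta> z" for z
  using U(3)[of z] that prod_list_pairing_nz[OF assms(2) that(2)] by simp
 ultimately show ?thesis using U V assms unfolding germ_quot_def by (intro conjI exI[of _ "U \<inter> V"]) auto
qed

lemma Res_linear:
 fixes \<Delta> :: "(real^'n) set"
 assumes "finite \<Delta>" "0 \<notin> \<Delta>" "germ_quot \<Delta> ks1 h1 g1" "nice h1" "germ_quot \<Delta> ks2 h2 g2" "nice h2"
 shows "Res \<Delta> (\<lambda>z. a * g1 z + b * g2 z) = (\<lambda>z. a * Res \<Delta> g1 z + b * Res \<Delta> g2 z)"
  and "\<exists>ks h. germ_quot \<Delta> ks h (\<lambda>z. a * g1 z + b * g2 z) \<and> nice h"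
proof -
 define ks where "ks = ks1 @ ks2"
 define H1 where "H1 = (\<lambda>z. h1 z * lprod ks2 z)"
 define H2 where "H2 = (\<lambda>z. h2 z * lprod ks1 z)"
 have ks: "set ks1 \<subseteq> \<Delta>" "set ks2 \<subseteq> \<Delta>" using assms by (auto simp: germ_quot_def)
 have n: "nice H1" "nice H2" unfolding H1_def H2_def by (intro nice_mult nice_lprod assms)+
 have 1: "germ_quot \<Delta> ks H1 g1" unfolding ks_def H1_def by (rule germ_quot_add_denom[OF assms(3) ks(2)])
 have 2: "germ_quot \<Delta> ks H2 g2"
  using germ_quot_add_denom[OF assms(5) ks(1)] unfolding germ_quot_def ks_def H2_def by (simp add: mult.commute Un_commute conj_commute)
 have n3: "nice (\<lambda>z. a * H1 z + b * H2 z)" by (intro nice_add nice_scale n)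
 have 3: "germ_quot \<Delta> ks (\<lambda>z. a * H1 z + b * H2 z) (\<lambda>z. a * g1 z + b * g2 z)"
 proof -
  obtain U where U: "0 \<in> U" "holo_on U H1" "\<And>z. z \<in> U \<Longrightarrow> regular \<Delta> z \<Longrightarrow> g1 z = H1 z / lprod ks z"
   using 1 by (auto simp: germ_quot_def)
  obtain V where V: "0 \<in> V" "holo_on V H2" "\<And>z. z \<in> V \<Longrightarrow> regular \<Delta> z \<Longrightarrow> g2 z = H2 z / lprod ks z"
   using 2 by (auto simp: germ_quot_def)
  obtain W where W: "0 \<in> W" "holo_on W (\<lambda>z. a * H1 z + b * H2 z)"
   using nice_holo[OF n3] by (auto simp: holo_at0_def)
  have "holo_on (U \<inter> V \<inter> W) (\<lambda>z. a * H1 z + b * H2 z)" using U V W by (auto simp: holo_on_def)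
  then show ?thesis using U V W 1 unfolding germ_quot_def
   by (intro conjI exI[of _ "U \<inter> V \<inter> W"]) (auto simp: add_divide_distrib)
 qed
 show "\<exists>ks h. germ_quot \<Delta> ks h (\<lambda>z. a * g1 z + b * g2 z) \<and> nice h" using 3 n3 by blast
 have k: "set ks \<subseteq> \<Delta>" using ks by (simp add: ks_def)
 have "taylor_poly (length ks) (\<lambda>z. a * H1 z + b * H2 z) = (\<lambda>z. a * taylor_poly (length ks) H1 z + b * taylor_poly (length ks) H2 z)"
  using n[THEN nice_holo] n[THEN nice_scale, THEN nice_holo]
  by (simp add: taylor_poly_tc[abs_def] tc_add tc_scale sum.distrib sum_distrib_left)
 then have "quot \<Delta> ks (taylor_poly (length ks) (\<lambda>z. a * H1 z + b * H2 z)) =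
  (\<lambda>z. a * quot \<Delta> ks (taylor_poly (length ks) H1) z + b * quot \<Delta> ks (taylor_poly (length ks) H2) z)"
  by (simp add: quot_add quot_scale)
 then show "Res \<Delta> (\<lambda>z. a * g1 z + b * g2 z) = (\<lambda>z. a * Res \<Delta> g1 z + b * Res \<Delta> g2 z)"
  unfolding Res_germ[OF assms(1,2) 1 n(1) order.refl] Res_germ[OF assms(1,2) 2 n(2) order.refl] Res_germ[OF assms(1,2) 3 n3 order.refl]
  using Res_rat_linear[OF assms(1,2) R_quot[OF k nice_taylor_poly[OF n(1)]] R_quot[OF k nice_taylor_poly[OF n(2)]], where a = a and b = b]
  by simp
qed

text \<open>A rational function differs from its total residue by derivatives, which iterated
  residues kill. So the iterated residue factors through \<open>Res\<close>, and the diagonal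
  formula becomes linear algebra on \<open>S_space \<Delta>\<close>.\<close>

lemma IRes_germ:
 fixes \<Delta> :: "(real^'n) set"
 assumes "finite \<Delta>" "0 \<notin> \<Delta>" "germ_quot \<Delta> ks h g" "nice h" "os \<in> ordered_bases \<Delta>"
 shows "IRes \<Delta> os g = IRes_rat os (Res \<Delta> g)"
 unfolding IRes_def
proof (rule taylor_extension_eqI[OF assms(3)])
 obtain e where "flag os e" using flag_exists[OF assms(5)] by blast
 then interpret flag os e .
 have ks: "set ks \<subseteq> \<Delta>" using assms(3) by (simp add: germ_quot_def)
 fix K assume K: "length ks \<le> K"
 define q where "q = quot \<Delta> ks (taylor_poly K h)"
 have qR: "q \<in> R_space \<Delta>" unfolding q_def by (intro R_quot ks nice_taylor_poly assms)
 note r = Res_rat_props[OF assms(1,2) qR]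
 have rR: "Res_rat \<Delta> q \<in> R_space \<Delta>" using r(1) S_space_R[OF assms(1)] by blast
 have "q = (\<lambda>z. 1 * (q - Res_rat \<Delta> q) z + 1 * Res_rat \<Delta> q z)" by simp
 then have "IRes_rat os q = 1 * IRes_rat os (q - Res_rat \<Delta> q) + 1 * IRes_rat os (Res_rat \<Delta> q)"
  using IRes_linear[OF assms(1,2) IRes_derivative_space(2)[OF assms(1,2) r(2)] rR, of 1 1] by simp
 also have "\<dots> = IRes_rat os (Res \<Delta> g)"
  using IRes_derivative_space(1)[OF assms(1,2) r(2)] Res_germ[OF assms(1-4) K] by (simp add: q_def)
 finally show "IRes_rat os (quot \<Delta> ks (taylor_poly K h)) = IRes_rat os (Res \<Delta> g)" by (simp add: q_def)
qed

section \<open>The reproducing kernel\<close>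

lemma basis_of_bases_finite: "finite \<Delta> \<Longrightarrow> basis_of_bases \<Delta> B \<Longrightarrow> finite B"
 by (rule finite_subset[of B "Pow \<Delta>"]) (auto simp: basis_of_bases_def bases_def)

lemma dual_family_linear:
 assumes "dual_family \<Delta> B d" "\<sigma> \<in> B" "g \<in> S_space \<Delta>" "h \<in> S_space \<Delta>"
 shows "d \<sigma> (\<lambda>z. a * g z + b * h z) = a * d \<sigma> g + b * d \<sigma> h"
 using assms unfolding dual_family_def by blast

lemma S_space_sum: "(\<And>x. x \<in> A \<Longrightarrow> g x \<in> S_space \<Delta>) \<Longrightarrow> (\<lambda>z. \<Sum>x\<in>A. c x * g x z) \<in> S_space \<Delta>"
 unfolding S_space_def by (intro cfun_span_sum cfun_span_scale)

lemma dual_family_sum: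
 assumes "dual_family \<Delta> B d" "\<sigma> \<in> B" "finite A" "\<And>x. x \<in> A \<Longrightarrow> g x \<in> S_space \<Delta>"
 shows "d \<sigma> (\<lambda>z. \<Sum>x\<in>A. c x * g x z) = (\<Sum>x\<in>A. c x * d \<sigma> (g x))"
 using assms(3,4)
proof (induction A rule: finite_induct)
 case empty
 have "(\<lambda>z. 0) \<in> S_space \<Delta>" unfolding S_space_def by (rule cfun_span_zero)
 from dual_family_linear[OF assms(1,2) this this, of 0 0] show ?case by simp
next
 case (insert x A)
 have "(\<lambda>z. \<Sum>x\<in>A. c x * g x z) \<in> S_space \<Delta>" using insert by (intro S_space_sum) auto
 from dual_family_linear[OF assms(1,2) _ this, of "g x" "c x" 1] show ?case using insert by simp
qed

lemma phi_in_S: "\<sigma> \<in> bases \<Delta> \<Longrightarrow> phi \<Delta> \<sigma> \<in> S_space \<Delta>"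
 unfolding S_space_def by (rule cfun.span_base) auto

lemma S_expand:
 assumes "finite \<Delta>" "basis_of_bases \<Delta> B" "dual_family \<Delta> B d" "s \<in> S_space \<Delta>"
 shows "s = (\<lambda>z. \<Sum>\<sigma>\<in>B. d \<sigma> s * phi \<Delta> \<sigma> z)"
proof -
 have fin: "finite B" using basis_of_bases_finite assms by blast
 have "s \<in> cfun.span (phi \<Delta> ` B)" using assms by (simp add: basis_of_bases_def)
 moreover have "cfun.span (phi \<Delta> ` B) = S_space \<Delta>" using assms by (simp add: basis_of_bases_def)
 ultimately have "s = (\<lambda>z. \<Sum>\<sigma>\<in>B. d \<sigma> s * phi \<Delta> \<sigma> z) \<and> s \<in> S_space \<Delta>"
 proof (induction s rule: cfun_span_induct)
  case zero
  have z: "(\<lambda>z. 0) \<in> S_space \<Delta>" unfolding S_space_def by (rule cfun_span_zero)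
  have "d \<sigma> (\<lambda>z. 0) = 0" if "\<sigma> \<in> B" for \<sigma> using dual_family_linear[OF assms(3) that z z, of 0 0] by simp
  then show ?case using z by simp
 next
  case (add g h)
  then have gh: "g \<in> S_space \<Delta>" "h \<in> S_space \<Delta>" "\<And>z. g z = (\<Sum>\<sigma>\<in>B. d \<sigma> g * phi \<Delta> \<sigma> z)" "\<And>z. h z = (\<Sum>\<sigma>\<in>B. d \<sigma> h * phi \<Delta> \<sigma> z)"
   by (auto simp: fun_eq_iff)
  have "d \<sigma> (\<lambda>z. g z + h z) = d \<sigma> g + d \<sigma> h" if "\<sigma> \<in> B" for \<sigma>
   using dual_family_linear[OF assms(3) that gh(1,2), of 1 1] by simp
  then have "(\<Sum>\<sigma>\<in>B. d \<sigma> (\<lambda>z. g z + h z) * phi \<Delta> \<sigma> z) = g z + h z" for z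
   unfolding gh(3)[of z] gh(4)[of z] by (simp add: algebra_simps sum.distrib)
  moreover have "(\<lambda>z. g z + h z) \<in> S_space \<Delta>" using gh unfolding S_space_def by (intro cfun_span_add)
  ultimately show ?case by simp
 next
  case (scale c g)
  then have g: "g \<in> S_space \<Delta>" "\<And>z. g z = (\<Sum>\<sigma>\<in>B. d \<sigma> g * phi \<Delta> \<sigma> z)" by (auto simp: fun_eq_iff)
  have "d \<sigma> (\<lambda>z. c * g z) = c * d \<sigma> g" if "\<sigma> \<in> B" for \<sigma>
   using dual_family_linear[OF assms(3) that g(1,1), of c 0] by simp
  then have "(\<Sum>\<sigma>\<in>B. d \<sigma> (\<lambda>z. c * g z) * phi \<Delta> \<sigma> z) = c * g z" for z
   unfolding g(2)[of z] by (simp add: sum_distrib_left mult.assoc)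
  moreover have "(\<lambda>z. c * g z) \<in> S_space \<Delta>" using g unfolding S_space_def by (intro cfun_span_scale)
  ultimately show ?case by simp
 next
  case (base x)
  then obtain \<tau> where t: "\<tau> \<in> B" "x = phi \<Delta> \<tau>" by auto
  have "(\<Sum>\<sigma>\<in>B. d \<sigma> x * phi \<Delta> \<sigma> z) = x z" for z
  proof -
   have "(\<Sum>\<sigma>\<in>B. d \<sigma> x * phi \<Delta> \<sigma> z) = (\<Sum>\<sigma>\<in>B. if \<sigma> = \<tau> then phi \<Delta> \<tau> z else 0)"
    using assms(3) t unfolding dual_family_def by (intro sum.cong) auto
   then show ?thesis using t fin by simp
  qed
  then have "x = (\<lambda>z. \<Sum>\<sigma>\<in>B. d \<sigma> x * phi \<Delta> \<sigma> z)" by simp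
  moreover have "x \<in> S_space \<Delta>" using t assms(2) by (auto simp: basis_of_bases_def intro: phi_in_S)
  ultimately show ?case by simp
 qed
 then show ?thesis by simp
qed

text \<open>\<open>kernel_coeff \<alpha>s D z w\<close> is the component of degree \<open>D\<close> in \<open>z\<close> of the Taylor expansion of
 \<open>\<Prod>\<alpha>. 1 / \<langle>\<alpha>, w - z\<rangle>\<close>.\<close>

primrec kernel_coeff :: "(real^'n) list \<Rightarrow> nat \<Rightarrow> complex^'n \<Rightarrow> complex^'n \<Rightarrow> complex" where
 "kernel_coeff [] D z w = (if D = 0 then 1 else 0)"
| "kernel_coeff (\<alpha> # as) D z w = (\<Sum>k\<le>D. pairing \<alpha> z ^ k / pairing \<alpha> w ^ Suc k * kernel_coeff as (D - k) z w)"

lemma kernel_coeff_hom: "(\<lambda>z. kernel_coeff as D z w) \<in> hom_poly D"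
proof (induction as arbitrary: D)
 case Nil then show ?case by (cases "D = 0") (simp_all add: hom_poly_const hom_poly_zero)
next
 case (Cons a as)
 show ?case unfolding kernel_coeff.simps
 proof (rule hom_poly_sum)
  fix k assume k: "k \<in> {..D}"
  have 1: "(\<lambda>z. pairing a z ^ k) \<in> hom_poly k" using hom_poly_power[OF hom_poly_pairing[of a], of k] by simp
  have "(\<lambda>z. (1 / pairing a w ^ Suc k) * (pairing a z ^ k * kernel_coeff as (D - k) z w)) \<in> hom_poly (k + (D - k))"
   by (intro hom_poly_scale hom_poly_mult 1 Cons)
  then show "(\<lambda>z. pairing a z ^ k / pairing a w ^ Suc k * kernel_coeff as (D - k) z w) \<in> hom_poly D"
   using k by (simp add: algebra_simps)
 qed
qed

lemma kernel_coeff_0: "kernel_coeff as 0 z w = (\<Prod>\<alpha>\<leftarrow>as. 1 / pairing \<alpha> w)"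
 by (induction as) auto

text \<open>A product of geometric series, one for each linear form, in the parameter of the
  line.\<close>

lemma kernel_coeff_fps:
 assumes "\<And>\<alpha>. \<alpha> \<in> set as \<Longrightarrow> pairing \<alpha> w \<noteq> 0"
 shows "(\<lambda>s. \<Prod>\<alpha>\<leftarrow>as. 1 / pairing \<alpha> (w - s *s z)) has_fps_expansion Abs_fps (\<lambda>D. kernel_coeff as D z w)"
 using assms
proof (induction as)
 case Nil
 have "Abs_fps (\<lambda>D. kernel_coeff [] D z w) = 1" by (simp add: fps_eq_iff)
 then show ?case by simp
next
 case (Cons a as)
 have nz: "pairing a w \<noteq> 0" using Cons by simp
 define F where "F = Abs_fps (\<lambda>k. pairing a z ^ k / pairing a w ^ Suc k)"
 have "(\<lambda>s. 1 / pairing a (w - s *s z)) has_fps_expansion F"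
 proof -
  have "(\<lambda>s. pairing a w - pairing a z * s) has_fps_expansion (fps_const (pairing a w) - fps_const (pairing a z) * fps_X)"
   by (intro has_fps_expansion_diff has_fps_expansion_const has_fps_expansion_cmult_left has_fps_expansion_fps_X)
  then have "(\<lambda>s. inverse (pairing a w - pairing a z * s)) has_fps_expansion inverse (fps_const (pairing a w) - fps_const (pairing a z) * fps_X)"
   by (rule has_fps_expansion_inverse) (simp add: nz)
  moreover have "inverse (fps_const (pairing a w) - fps_const (pairing a z) * fps_X) = F"
  proof (rule fps_inverse_unique[symmetric, THEN sym])
   show "(fps_const (pairing a w) - fps_const (pairing a z) * fps_X) * F = 1"
   proof (rule fps_ext)
    fix n
    have "fps_nth ((fps_const (pairing a w) - fps_const (pairing a z) * fps_X) * F) n =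
     pairing a w * fps_nth F n - pairing a z * (if n = 0 then 0 else fps_nth F (n - 1))"
     by (simp add: left_diff_distrib mult.assoc)
    also have "\<dots> = fps_nth 1 n" using nz by (cases n) (auto simp: F_def field_simps)
    finally show "fps_nth ((fps_const (pairing a w) - fps_const (pairing a z) * fps_X) * F) n = fps_nth 1 n" .
   qed
  qed
  ultimately show ?thesis by (simp add: pairing_diff_right pairing_smult_right inverse_eq_divide mult.commute)
 qed
 moreover have "(\<lambda>s. \<Prod>\<alpha>\<leftarrow>as. 1 / pairing \<alpha> (w - s *s z)) has_fps_expansion Abs_fps (\<lambda>D. kernel_coeff as D z w)"
  using Cons by auto
 ultimately have "(\<lambda>s. 1 / pairing a (w - s *s z) * (\<Prod>\<alpha>\<leftarrow>as. 1 / pairing \<alpha> (w - s *s z))) has_fps_expansion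
   F * Abs_fps (\<lambda>D. kernel_coeff as D z w)" by (rule has_fps_expansion_mult)
 moreover have "F * Abs_fps (\<lambda>D. kernel_coeff as D z w) = Abs_fps (\<lambda>D. kernel_coeff (a # as) D z w)"
  by (simp add: fps_eq_iff fps_mult_nth F_def atLeast0AtMost)
 ultimately show ?case by simp
qed

text \<open>Moving \<open>w\<close> by \<open>v\<close> has the same effect on a function of \<open>w - z\<close> as moving \<open>z\<close> by \<open>-v\<close>.\<close>

lemma kernel_coeff_deriv:
 assumes "\<And>\<alpha>. \<alpha> \<in> set as \<Longrightarrow> pairing \<alpha> w \<noteq> 0"
 shows "((\<lambda>s. kernel_coeff as D z (w + s *s cvec v)) has_field_derivative
   - pd v (\<lambda>z. kernel_coeff as (Suc D) z w) z) (at 0)"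
 using assms
proof (induction as arbitrary: D)
 case Nil
 then show ?case by (simp add: pd_const)
next
 case (Cons a as)
 define c where "c = complex_of_real (a \<bullet> v)"
 define T where "T = (\<lambda>D z. kernel_coeff as D z w)"
 define p where "p = (\<lambda>k z. pairing a z ^ k / pairing a w ^ Suc k)"
 have nz: "pairing a w \<noteq> 0" using Cons by simp
 have IH: "((\<lambda>s. kernel_coeff as D z (w + s *s cvec v)) has_field_derivative - pd v (T (Suc D)) z) (at 0)" for D
  using Cons unfolding T_def by auto
 have pT: "poly_fun (T D)" for D unfolding T_def by (rule hom_poly_poly_fun[OF kernel_coeff_hom])
 have p_d: "((\<lambda>s. p k (z + s *s cvec v)) has_field_derivative (if k = 0 then 0 else of_nat k * c * pairing a z ^ (k - 1) / pairing a w ^ Suc k)) (at 0)" for k z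
  unfolding p_def c_def
  by (auto intro!: derivative_eq_intros simp: pairing_simps nz)
 have pp: "poly_fun (p k)" for k
  unfolding p_def using hom_poly_poly_fun[OF hom_poly_scale[OF hom_poly_power[OF hom_poly_pairing[of a]], of "1 / pairing a w ^ Suc k"], of k] by simp
 have pdp: "pd v (p k) = (\<lambda>z. if k = 0 then 0 else of_nat k * c * pairing a z ^ (k - 1) / pairing a w ^ Suc k)" for k
  by (rule pd_eqI) (rule p_d)
 \<comment> \<open>The case of a single factor: with \<open>c\<close> the value of \<open>a\<close>
   on \<open>v\<close>, both sides equal
   \<open>- (k + 1) * c * pairing a z ^ k / pairing a w ^ (k + 2)\<close>.\<close>
 have q_d: "((\<lambda>s. pairing a z ^ k / pairing a (w + s *s cvec v) ^ Suc k) has_field_derivative - pd v (p (Suc k)) z) (at 0)" for k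
 proof -
  have "((\<lambda>s. pairing a z ^ k / (pairing a w + s * c) ^ Suc k) has_field_derivative
   - (pairing a z ^ k * (of_nat (Suc k) * (pairing a w ^ k) * c)) / (pairing a w ^ Suc k * pairing a w ^ Suc k)) (at 0)"
   using nz by (auto intro!: derivative_eq_intros simp del: power_Suc of_nat_Suc)
  moreover have "- (pairing a z ^ k * (of_nat (Suc k) * (pairing a w ^ k) * c)) / (pairing a w ^ Suc k * pairing a w ^ Suc k) = - pd v (p (Suc k)) z"
   unfolding pdp using nz by (simp add: field_simps)
  ultimately show ?thesis by (simp add: pairing_simps c_def)
 qed
 have "((\<lambda>s. \<Sum>k\<le>D. pairing a z ^ k / pairing a (w + s *s cvec v) ^ Suc k * kernel_coeff as (D - k) z (w + s *s cvec v)) has_field_derivative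
  (\<Sum>k\<le>D. (- pd v (p (Suc k)) z) * kernel_coeff as (D - k) z (w + 0 *s cvec v) + (- pd v (T (Suc (D - k))) z) * (pairing a z ^ k / pairing a (w + 0 *s cvec v) ^ Suc k))) (at 0)"
  by (intro DERIV_sum DERIV_mult q_d IH)
 moreover have "(\<Sum>k\<le>D. (- pd v (p (Suc k)) z) * kernel_coeff as (D - k) z (w + 0 *s cvec v) + (- pd v (T (Suc (D - k))) z) * (pairing a z ^ k / pairing a (w + 0 *s cvec v) ^ Suc k))
  = - (\<Sum>k\<le>D. pd v (p (Suc k)) z * T (D - k) z) - (\<Sum>k\<le>D. p k z * pd v (T (Suc D - k)) z)"
  unfolding sum_negf[symmetric] sum_subtractf[symmetric] by (rule sum.cong) (auto simp: p_def T_def Suc_diff_le)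
 also have "\<dots> = - pd v (\<lambda>z. kernel_coeff (a # as) (Suc D) z w) z"
 proof -
  have pdsum: "pd v (\<lambda>z. \<Sum>k\<in>A. p k z * T (Suc D - k) z) z = (\<Sum>k\<in>A. pd v (p k) z * T (Suc D - k) z + p k z * pd v (T (Suc D - k)) z)" if "finite A" for A
   using that
  proof (induction A rule: finite_induct)
   case empty then show ?case by (simp add: pd_const)
  next
   case (insert x A)
   then show ?case
    by (simp add: pd_add poly_fun.mult pp pT poly_fun_sum pd_mult)
  qed
  \<comment> \<open>In the Leibniz sum of degree \<open>Suc D\<close> one end term vanishes because
    \<open>T 0\<close> is constant in \<open>z\<close> and the other because \<open>p 0\<close> is;
    this aligns it with the two sums up to \<open>D\<close>.\<close>
  have "pd v (T 0) = (\<lambda>z. 0)" unfolding T_def by (rule pd_hom_poly_0[OF kernel_coeff_hom])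
  moreover have "(\<Sum>k\<le>Suc D. pd v (p k) z * T (Suc D - k) z) = (\<Sum>k\<le>D. pd v (p (Suc k)) z * T (D - k) z)"
   by (subst sum.atMost_Suc_shift) (simp add: pdp)
  moreover have "(\<Sum>k\<le>Suc D. p k z * pd v (T (Suc D - k)) z) = (\<Sum>k\<le>D. p k z * pd v (T (Suc D - k)) z) + p (Suc D) z * pd v (T 0) z"
   by simp
  ultimately have "pd v (\<lambda>z. \<Sum>k\<le>Suc D. p k z * T (Suc D - k) z) z = (\<Sum>k\<le>D. pd v (p (Suc k)) z * T (D - k) z) + (\<Sum>k\<le>D. p k z * pd v (T (Suc D - k)) z)"
   unfolding pdsum[OF finite_atMost] sum.distrib by simp
  then have "pd v (\<lambda>z. kernel_coeff (a # as) (Suc D) z w) z = (\<Sum>k\<le>D. pd v (p (Suc k)) z * T (D - k) z) + (\<Sum>k\<le>D. p k z * pd v (T (Suc D - k)) z)"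
   by (simp only: kernel_coeff.simps p_def T_def)
  then show ?thesis by (simp only: minus_add_distrib diff_conv_add_uminus)
 qed
 finally show ?case by simp
qed

definition list_of :: "(real^'n) set \<Rightarrow> (real^'n) list" where
 "list_of \<sigma> = (SOME xs. set xs = \<sigma> \<and> distinct xs)"

lemma list_of: "finite \<sigma> \<Longrightarrow> set (list_of \<sigma>) = \<sigma> \<and> distinct (list_of \<sigma>)"
 unfolding list_of_def by (rule someI_ex) (rule finite_distinct_list)

lemma phi_kernel_0:
 assumes "\<sigma> \<in> bases \<Delta>" "regular \<Delta> w" "set l = \<sigma>" "distinct l"
 shows "kernel_coeff l 0 z w = phi \<Delta> \<sigma> w"
proof -
 have "(\<Prod>\<alpha>\<leftarrow>l. 1 / pairing \<alpha> w) = 1 / lprod l w" for l by (induction l) auto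
 then show ?thesis using assms lprod_distinct[OF assms(4), of w]
  by (simp add: kernel_coeff_0 phi_def off_hyperplanes_def)
qed

section \<open>The reproducing formula for a fixed basis of simple fractions\<close>

context
 fixes \<Delta> :: "(real^'n) set" and B d
 assumes fin: "finite \<Delta>" and z: "0 \<notin> \<Delta>" and B: "basis_of_bases \<Delta> B" and d: "dual_family \<Delta> B d"
begin

lemma B_basis: "\<sigma> \<in> B \<Longrightarrow> \<sigma> \<in> bases \<Delta>" using B by (auto simp: basis_of_bases_def)

lemma list_of_B: "\<sigma> \<in> B \<Longrightarrow> set (list_of \<sigma>) = \<sigma>" "\<sigma> \<in> B \<Longrightarrow> distinct (list_of \<sigma>)"
 using list_of[OF basis_finite[OF B_basis]] by auto

lemma d_Res_linear:
 assumes "\<sigma> \<in> B" "g \<in> R_space \<Delta>" "h \<in> R_space \<Delta>"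
 shows "d \<sigma> (Res_rat \<Delta> (\<lambda>z. a * g z + b * h z)) = a * d \<sigma> (Res_rat \<Delta> g) + b * d \<sigma> (Res_rat \<Delta> h)"
 unfolding Res_rat_linear[OF fin z assms(2,3)]
 by (rule dual_family_linear[OF d assms(1) Res_rat_props(1)[OF fin z assms(2)] Res_rat_props(1)[OF fin z assms(3)]])

lemma R_mult_poly: "f \<in> R_space \<Delta> \<Longrightarrow> poly_fun q \<Longrightarrow> (\<lambda>z. f z * q z) \<in> R_space \<Delta>"
proof -
 assume f: "f \<in> R_space \<Delta>" and q: "poly_fun q"
 obtain ks p where k: "set ks \<subseteq> \<Delta>" "poly_fun p" "f = quot \<Delta> ks p" using f by (auto simp: R_space_def)
 have "(\<lambda>z. f z * q z) = quot \<Delta> ks (\<lambda>z. p z * q z)" unfolding k(3) by (auto simp: quot_def off_hyperplanes_def)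
 then show ?thesis using k q by (simp add: R_quot poly_fun.mult)
qed

text \<open>Supplies the evaluation points through which kernel sums are differentiated in
  \<open>w\<close>, and later represented by series over the lattice.\<close>

lemma functional_ev:
 assumes "\<sigma> \<in> B" "f \<in> R_space \<Delta>"
 shows "\<exists>l. \<forall>q\<in>hom_poly D. d \<sigma> (Res_rat \<Delta> (\<lambda>z. f z * q z)) = ev l q"
proof (rule hom_poly_functional)
 fix p q :: "complex^'n \<Rightarrow> complex" and a b assume pq: "p \<in> hom_poly D" "q \<in> hom_poly D"
 have "(\<lambda>z. f z * (a * p z + b * q z)) = (\<lambda>z. a * (f z * p z) + b * (f z * q z))" by (simp add: algebra_simps)
 then show "d \<sigma> (Res_rat \<Delta> (\<lambda>z. f z * (a * p z + b * q z))) = a * d \<sigma> (Res_rat \<Delta> (\<lambda>z. f z * p z)) + b * d \<sigma> (Res_rat \<Delta> (\<lambda>z. f z * q z))"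
  using d_Res_linear[OF assms(1) R_mult_poly[OF assms(2) hom_poly_poly_fun[OF pq(1)]] R_mult_poly[OF assms(2) hom_poly_poly_fun[OF pq(2)]]] by simp
qed

definition kernel_sum where
 "kernel_sum f K w = (\<Sum>\<sigma>\<in>B. \<Sum>D\<le>K. d \<sigma> (Res_rat \<Delta> (\<lambda>z. f z * kernel_coeff (list_of \<sigma>) D z w)))"

text \<open>Requiring the formula for all large \<open>K\<close>, not for the degree fixed by
  \<open>f\<close>, makes the property linear and stable under differentiation, which raises the
  threshold by one.\<close>

definition reproduced where
 "reproduced f \<longleftrightarrow> f \<in> R_space \<Delta> \<and> (\<exists>K0. \<forall>K\<ge>K0. \<forall>w. regular \<Delta> w \<longrightarrow> f w = kernel_sum f K w)"

lemma R_kernel: "f \<in> R_space \<Delta> \<Longrightarrow> (\<lambda>z. f z * kernel_coeff as D z w) \<in> R_space \<Delta>"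
 by (rule R_mult_poly) (auto intro: hom_poly_poly_fun[OF kernel_coeff_hom])

lemma reproduced_linear:
 assumes "reproduced f" "reproduced g"
 shows "reproduced (\<lambda>z. a * f z + b * g z)"
proof -
 obtain K1 K2 where K: "\<And>K w. K \<ge> K1 \<Longrightarrow> regular \<Delta> w \<Longrightarrow> f w = kernel_sum f K w" "\<And>K w. K \<ge> K2 \<Longrightarrow> regular \<Delta> w \<Longrightarrow> g w = kernel_sum g K w"
  and R: "f \<in> R_space \<Delta>" "g \<in> R_space \<Delta>"
  using assms unfolding reproduced_def by blast
 have "kernel_sum (\<lambda>z. a * f z + b * g z) K w = a * kernel_sum f K w + b * kernel_sum g K w" for K w
 proof -
  have "d \<sigma> (Res_rat \<Delta> (\<lambda>z. (a * f z + b * g z) * kernel_coeff (list_of \<sigma>) D z w)) =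
   a * d \<sigma> (Res_rat \<Delta> (\<lambda>z. f z * kernel_coeff (list_of \<sigma>) D z w)) + b * d \<sigma> (Res_rat \<Delta> (\<lambda>z. g z * kernel_coeff (list_of \<sigma>) D z w))"
   if "\<sigma> \<in> B" for \<sigma> D
   using d_Res_linear[OF that R_kernel[OF R(1), of "list_of \<sigma>" D w] R_kernel[OF R(2), of "list_of \<sigma>" D w], of a b]
   by (simp add: algebra_simps)
  then show ?thesis by (simp add: kernel_sum_def sum.distrib sum_distrib_left)
 qed
 then have "\<forall>K\<ge>max K1 K2. \<forall>w. regular \<Delta> w \<longrightarrow> a * f w + b * g w = kernel_sum (\<lambda>z. a * f z + b * g z) K w"
  using K(1) K(2) by (metis max.bounded_iff)
 then show ?thesis unfolding reproduced_def using R R_add R_scale by blast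
qed

text \<open>The formula is differentiated in \<open>w\<close>; on the kernel this is minus the
  derivative in \<open>z\<close> of the next degree. Since the residue kills derivatives,
  integration by parts moves it onto \<open>f\<close>, and the two signs cancel.\<close>

lemma reproduced_deriv:
 assumes "reproduced f" shows "reproduced (dir_deriv \<Delta> v f)"
proof -
 obtain K0 where K0: "\<And>K w. K \<ge> K0 \<Longrightarrow> regular \<Delta> w \<Longrightarrow> f w = kernel_sum f K w" and R: "f \<in> R_space \<Delta>"
  using assms unfolding reproduced_def by blast
 have dR: "dir_deriv \<Delta> v f \<in> R_space \<Delta>" by (rule R_dir_deriv[OF fin R])
 have "dir_deriv \<Delta> v f w = kernel_sum (dir_deriv \<Delta> v f) (Suc K) w" if K: "K \<ge> K0" and w: "regular \<Delta> w" for K w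
 proof -
  have nzw: "\<alpha> \<in> set (list_of \<sigma>) \<Longrightarrow> pairing \<alpha> w \<noteq> 0" if "\<sigma> \<in> B" for \<sigma> \<alpha>
   using w B_basis[OF that] list_of_B(1)[OF that] by (auto simp: regular_def bases_def)
  have ibp: "d \<sigma> (Res_rat \<Delta> (\<lambda>z. dir_deriv \<Delta> v f z * q z)) = - d \<sigma> (Res_rat \<Delta> (\<lambda>z. f z * pd v q z))"
   if "\<sigma> \<in> B" "poly_fun q" for \<sigma> q
  proof -
   define Q where "Q = quot \<Delta> [] q"
   have Q: "Q \<in> R_space \<Delta>" unfolding Q_def by (intro R_quot that) simp
   have dQ: "dir_deriv \<Delta> v Q = quot \<Delta> [] (pd v q)"
    unfolding Q_def using dir_deriv_quot[OF fin _ that(2), of "[]" v] by (simp add: quot_deriv_num_def pd_const)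
   have fq: "(\<lambda>z. g z * quot \<Delta> [] p z) = (\<lambda>z. g z * p z)" if "g \<in> R_space \<Delta>" for g p
    using R_not_regular[OF that] by (auto simp: quot_def off_hyperplanes_def fun_eq_iff)
   have "dir_deriv \<Delta> v (\<lambda>z. f z * Q z) = (\<lambda>z. dir_deriv \<Delta> v f z * q z + f z * pd v q z)"
    unfolding dir_deriv_mult[OF fin R Q] dQ
    by (rule ext) (simp only: Q_def fun_cong[OF fq[OF dR]] fun_cong[OF fq[OF R]])
   then have "(\<lambda>z. dir_deriv \<Delta> v f z * q z + f z * pd v q z) \<in> derivative_space \<Delta>"
    using derivative_space_base[OF R_mult[OF R Q], of v] by simp
   then have "Res_rat \<Delta> (\<lambda>z. dir_deriv \<Delta> v f z * q z + f z * pd v q z) = (\<lambda>z. 0)"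
    by (rule Res_rat_derivative[OF fin z])
   then have "d \<sigma> (\<lambda>z. 0) = d \<sigma> (Res_rat \<Delta> (\<lambda>z. dir_deriv \<Delta> v f z * q z)) + d \<sigma> (Res_rat \<Delta> (\<lambda>z. f z * pd v q z))"
    using d_Res_linear[OF that(1) R_mult_poly[OF dR that(2)] R_mult_poly[OF R poly_fun_pd_poly[OF that(2), of v]], of 1 1] by simp
   moreover have "d \<sigma> (\<lambda>z. 0) = 0" using dual_family_sum[OF d that(1), of "{}"] by simp
   ultimately show ?thesis by (simp add: eq_neg_iff_add_eq_0)
  qed
  \<comment> \<open>With evaluations in place of \<open>d \<sigma>\<close> and the residue, the
    derivative in \<open>w\<close> passes under the functional term by term.\<close>
  have "\<exists>l. \<forall>\<sigma>\<in>B. \<forall>D. \<forall>q\<in>hom_poly D. d \<sigma> (Res_rat \<Delta> (\<lambda>z. f z * q z)) = ev (l \<sigma> D) q"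
  proof -
   have "\<forall>\<sigma>\<in>B. \<exists>l. \<forall>D. \<forall>q\<in>hom_poly D. d \<sigma> (Res_rat \<Delta> (\<lambda>z. f z * q z)) = ev (l D) q"
    using functional_ev[OF _ R] by (intro ballI choice allI) auto
   then show ?thesis by (rule bchoice)
  qed
  then obtain l where l: "\<And>\<sigma> D q. \<sigma> \<in> B \<Longrightarrow> q \<in> hom_poly D \<Longrightarrow> d \<sigma> (Res_rat \<Delta> (\<lambda>z. f z * q z)) = ev (l \<sigma> D) q"
   by blast
  have evd: "((\<lambda>s. ev L (\<lambda>z. kernel_coeff as D z (w + s *s cvec v))) has_field_derivative
    ev L (\<lambda>z. - pd v (\<lambda>z. kernel_coeff as (Suc D) z w) z)) (at 0)"
   if "\<And>\<alpha>. \<alpha> \<in> set as \<Longrightarrow> pairing \<alpha> w \<noteq> 0" for L as D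
  proof (induction L)
   case Nil then show ?case by (simp add: ev_def)
  next
   case (Cons xa L)
   obtain x a where xa: "xa = (x, a)" by force
   have "((\<lambda>s. a * kernel_coeff as D x (w + s *s cvec v) + ev L (\<lambda>z. kernel_coeff as D z (w + s *s cvec v))) has_field_derivative
    a * (- pd v (\<lambda>z. kernel_coeff as (Suc D) z w) x) + ev L (\<lambda>z. - pd v (\<lambda>z. kernel_coeff as (Suc D) z w) z)) (at 0)"
    by (intro DERIV_add DERIV_cmult kernel_coeff_deriv Cons that)
   then show ?case by (simp add: ev_def xa)
  qed
  have ks: "kernel_sum f K w' = (\<Sum>\<sigma>\<in>B. \<Sum>D\<le>K. ev (l \<sigma> D) (\<lambda>z. kernel_coeff (list_of \<sigma>) D z w'))" for w'
   unfolding kernel_sum_def by (intro sum.cong refl l kernel_coeff_hom)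
  have 1: "((\<lambda>s. kernel_sum f K (w + s *s cvec v)) has_field_derivative
    (\<Sum>\<sigma>\<in>B. \<Sum>D\<le>K. ev (l \<sigma> D) (\<lambda>z. - pd v (\<lambda>z. kernel_coeff (list_of \<sigma>) (Suc D) z w) z))) (at 0)"
   unfolding ks by (intro DERIV_sum evd nzw)
  have "\<forall>\<^sub>F s in nhds 0. kernel_sum f K (w + s *s cvec v) = f (w + s *s cvec v)"
   using regular_eventually[OF fin w, of "cvec v"] by (rule eventually_mono) (use K0 K in auto)
  from DERIV_cong_ev[OF refl this refl] 1
  have "((\<lambda>s. f (w + s *s cvec v)) has_field_derivative
    (\<Sum>\<sigma>\<in>B. \<Sum>D\<le>K. ev (l \<sigma> D) (\<lambda>z. - pd v (\<lambda>z. kernel_coeff (list_of \<sigma>) (Suc D) z w) z))) (at 0)" by blast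
  then have "dir_deriv \<Delta> v f w = (\<Sum>\<sigma>\<in>B. \<Sum>D\<le>K. ev (l \<sigma> D) (\<lambda>z. - pd v (\<lambda>z. kernel_coeff (list_of \<sigma>) (Suc D) z w) z))"
   by (rule DERIV_unique[OF R_has_deriv[OF fin R w]])
  also have "\<dots> = kernel_sum (dir_deriv \<Delta> v f) (Suc K) w"
   unfolding kernel_sum_def
  proof (rule sum.cong[OF refl])
   fix \<sigma> assume s: "\<sigma> \<in> B"
   have a: "d \<sigma> (Res_rat \<Delta> (\<lambda>z. dir_deriv \<Delta> v f z * kernel_coeff (list_of \<sigma>) D z w)) = - d \<sigma> (Res_rat \<Delta> (\<lambda>z. f z * pd v (\<lambda>z. kernel_coeff (list_of \<sigma>) D z w) z))" for D
    by (rule ibp[OF s hom_poly_poly_fun[OF kernel_coeff_hom]])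
   \<comment> \<open>The kernel of degree 0 is constant in \<open>z\<close>, so the lowest term of
     the new sum is empty; this absorbs the shift from \<open>K\<close> to
     \<open>Suc K\<close>.\<close>
   have zero: "d \<sigma> (Res_rat \<Delta> (\<lambda>z. f z * pd v (\<lambda>z. kernel_coeff (list_of \<sigma>) 0 z w) z)) = 0"
    unfolding pd_hom_poly_0[OF kernel_coeff_hom] using l[OF s hom_poly_zero, of 0] by (simp add: ev_zero)
   have b: "- d \<sigma> (Res_rat \<Delta> (\<lambda>z. f z * pd v (\<lambda>z. kernel_coeff (list_of \<sigma>) (Suc D) z w) z)) = ev (l \<sigma> D) (\<lambda>z. - pd v (\<lambda>z. kernel_coeff (list_of \<sigma>) (Suc D) z w) z)" for D
    unfolding l[OF s hom_poly_pd[OF kernel_coeff_hom]]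
    using ev_scale[of "l \<sigma> D" "-1" "pd v (\<lambda>z. kernel_coeff (list_of \<sigma>) (Suc D) z w)"] by simp
   show "(\<Sum>D\<le>K. ev (l \<sigma> D) (\<lambda>z. - pd v (\<lambda>z. kernel_coeff (list_of \<sigma>) (Suc D) z w) z)) =
    (\<Sum>D\<le>Suc K. d \<sigma> (Res_rat \<Delta> (\<lambda>z. dir_deriv \<Delta> v f z * kernel_coeff (list_of \<sigma>) D z w)))"
    unfolding a sum.atMost_Suc_shift zero b by simp
  qed
  finally show ?thesis .
 qed
 then have "\<forall>K\<ge>Suc K0. \<forall>w. regular \<Delta> w \<longrightarrow> dir_deriv \<Delta> v f w = kernel_sum (dir_deriv \<Delta> v f) K w"
  by (metis Suc_le_D Suc_le_mono)
 then show ?thesis unfolding reproduced_def using dR by blast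
qed

text \<open>For degree reasons only the kernel of degree 0 survives the residue; it is the constant
  \<open>phi \<Delta> \<sigma> w\<close>, and the formula becomes the expansion in the
  basis.\<close>

lemma reproduced_phi:
 assumes "\<tau> \<in> bases \<Delta>" shows "reproduced (phi \<Delta> \<tau>)"
proof -
 have S: "phi \<Delta> \<tau> \<in> S_space \<Delta>" by (rule phi_in_S[OF assms])
 then have R: "phi \<Delta> \<tau> \<in> R_space \<Delta>" using S_space_R[OF fin] by blast
 define ks where "ks = list_of \<tau>"
 have ks: "set ks = \<tau>" "distinct ks" using list_of[OF basis_finite[OF assms]] by (auto simp: ks_def)
 have len: "length ks = CARD('n)" using ks basis_card[OF assms] distinct_card by force
 have sub: "set ks \<subseteq> \<Delta>" using ks assms by (auto simp: bases_def)
 have "phi \<Delta> \<tau> w = kernel_sum (phi \<Delta> \<tau>) K w" if w: "regular \<Delta> w" for K w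
 proof -
  have "d \<sigma> (Res_rat \<Delta> (\<lambda>z. phi \<Delta> \<tau> z * kernel_coeff (list_of \<sigma>) D z w)) = (if D = 0 then d \<sigma> (phi \<Delta> \<tau>) * phi \<Delta> \<sigma> w else 0)"
   if s: "\<sigma> \<in> B" for \<sigma> D
  proof (cases "D = 0")
   case True
   have "kernel_coeff (list_of \<sigma>) 0 z w = phi \<Delta> \<sigma> w" for z
    by (rule phi_kernel_0[OF B_basis[OF s] w list_of_B[OF s]])
   then have "(\<lambda>z. phi \<Delta> \<tau> z * kernel_coeff (list_of \<sigma>) D z w) = (\<lambda>z. phi \<Delta> \<sigma> w * phi \<Delta> \<tau> z + 0 * phi \<Delta> \<tau> z)" using True by (simp add: mult.commute)
   then have "d \<sigma> (Res_rat \<Delta> (\<lambda>z. phi \<Delta> \<tau> z * kernel_coeff (list_of \<sigma>) D z w)) = phi \<Delta> \<sigma> w * d \<sigma> (phi \<Delta> \<tau>)"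
    using d_Res_linear[OF s R R, of "phi \<Delta> \<sigma> w" 0] Res_rat_S[OF fin z S] by simp
   then show ?thesis using True by simp
  next
   case False
   have "(\<lambda>z. phi \<Delta> \<tau> z * kernel_coeff (list_of \<sigma>) D z w) = quot \<Delta> ks (\<lambda>z. kernel_coeff (list_of \<sigma>) D z w)"
    unfolding ks(1)[symmetric] phi_quot[OF ks(2)] by (auto simp: quot_def off_hyperplanes_def)
   then have "Res_rat \<Delta> (\<lambda>z. phi \<Delta> \<tau> z * kernel_coeff (list_of \<sigma>) D z w) = (\<lambda>z. 0)"
    using Res_rat_hom[OF fin z sub kernel_coeff_hom, of D] len False by simp
   then show ?thesis using False dual_family_sum[OF d s, of "{}"] by simp
  qed
  then have "kernel_sum (phi \<Delta> \<tau>) K w = (\<Sum>\<sigma>\<in>B. d \<sigma> (phi \<Delta> \<tau>) * phi \<Delta> \<sigma> w)"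
   unfolding kernel_sum_def by (intro sum.cong) simp_all
  then show ?thesis using S_expand[OF fin B d S] by (metis (no_types))
 qed
 then show ?thesis unfolding reproduced_def using R by blast
qed

lemma distinct_count_list: "(\<And>x. x \<in> set xs \<Longrightarrow> count_list xs x = 1) \<Longrightarrow> distinct xs"
proof (induction xs)
 case (Cons a xs)
 have a: "a \<notin> set xs" using Cons.prems[of a] count_list_0_iff[of xs a] by simp
 moreover have "count_list xs x = 1" if "x \<in> set xs" for x
  using Cons.prems[of x] that a by (auto split: if_splits)
 ultimately show ?case using Cons.IH by simp
qed simp

text \<open>A repeated \<beta> is produced by differentiation: with one occurrence removed and a
  direction dual to \<beta>, the derivative restores the factor up to minus the remaining
  multiplicity. The induction on the length ends at a \<open>phi\<close>.\<close>

lemma reproduced_simple: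
 assumes "set ks \<in> bases \<Delta>" shows "reproduced (quot \<Delta> ks (\<lambda>z. 1))"
 using assms
proof (induction "length ks" arbitrary: ks rule: less_induct)
 case less
 have sub: "set ks \<subseteq> \<Delta>" and ind: "independent (set ks)" using less.prems by (auto simp: bases_def)
 show ?case
 proof (cases "distinct ks")
  case True
  then show ?thesis using reproduced_phi[OF less.prems] phi_quot[OF True] by simp
 next
  case False
  then obtain \<beta> where b: "count_list ks \<beta> \<noteq> 1" "\<beta> \<in> set ks"
   using distinct_count_list[of ks] by blast
  define ks' where "ks' = remove1 \<beta> ks"
  have cnt: "count_list ks \<gamma> = count_list ks' \<gamma> + (if \<gamma> = \<beta> then 1 else 0)" for \<gamma>
   using b(2) unfolding ks'_def by (induction ks) auto
  have b': "\<beta> \<in> set ks'" using b cnt[of \<beta>] count_list_0_iff[of ks' \<beta>] by auto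
  have s': "set ks' = set ks" using b' set_remove1_subset[of \<beta> ks] set_remove1_supset[of ks \<beta>] unfolding ks'_def by auto
  have l': "length ks' < length ks" using b(2) unfolding ks'_def by (simp add: length_remove1) (use length_pos_if_in_set in fastforce)
  have IH: "reproduced (quot \<Delta> ks' (\<lambda>z. 1))" using less l' s' by simp
  obtain dv where dv: "\<And>\<beta> \<gamma>. \<beta> \<in> set ks \<Longrightarrow> \<gamma> \<in> set ks \<Longrightarrow> \<beta> \<bullet> dv \<gamma> = (if \<beta> = \<gamma> then 1 else 0)"
   using dual_vectors[OF ind] by blast
  define c :: complex where "c = of_nat (count_list ks' \<beta>)"
  have c: "c \<noteq> 0" unfolding c_def using b' count_list_0_iff[of ks' \<beta>] by simp
  have eq: "dir_deriv \<Delta> (dv \<beta>) (quot \<Delta> ks' (\<lambda>z. 1)) = (\<lambda>z. (- c) * quot \<Delta> ks (\<lambda>z. 1) z)"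
  proof
   fix z
   show "dir_deriv \<Delta> (dv \<beta>) (quot \<Delta> ks' (\<lambda>z. 1)) z = (- c) * quot \<Delta> ks (\<lambda>z. 1) z"
   proof (cases "regular \<Delta> z")
    case True
    have nb: "pairing \<beta> z \<noteq> 0" "lprod ks' z \<noteq> 0"
     using True b(2) sub s' prod_list_pairing_nz[of ks' \<Delta> z] by (auto simp: regular_def)
    have "pairing \<beta> z * pd (dv \<beta>) (lprod ks') z = c * lprod ks' z"
     unfolding c_def by (rule pd_lprod) (use dv b(2) s' in auto)
    then have pdl: "pd (dv \<beta>) (lprod ks') z = c * lprod ks' z / pairing \<beta> z" using nb by (simp add: field_simps)
    have "lprod ks z = pairing \<beta> z * lprod ks' z" unfolding ks'_def by (rule lprod_remove1[OF b(2)])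
    moreover have "dir_deriv \<Delta> (dv \<beta>) (quot \<Delta> ks' (\<lambda>z. 1)) z = (- pd (dv \<beta>) (lprod ks') z) / (lprod ks' z * lprod ks' z)"
     using dir_deriv_quot[OF fin _ poly_fun.const, of ks' "dv \<beta>" 1] sub s' True
     by (simp add: quot_regular quot_deriv_num_def pd_const)
    ultimately show ?thesis using nb True by (simp add: pdl quot_regular field_simps)
   qed (simp add: dir_deriv_not_regular quot_not_regular)
  qed
  have "reproduced (\<lambda>z. (- c) * quot \<Delta> ks (\<lambda>z. 1) z)" using reproduced_deriv[OF IH, of "dv \<beta>"] unfolding eq .
  from reproduced_linear[OF this this, of "- 1 / c" 0] show ?thesis using c by simp
 qed
qed

text \<open>Straightening preserves the span of the denominator, so a spanning denominator is
  reduced to denominators supported on bases. This is where generation of the whole dual space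
  enters.\<close>

lemma reproduced_span:
 assumes "set ks \<subseteq> \<Delta>" "span (set ks) = UNIV"
 shows "reproduced (quot \<Delta> ks (\<lambda>z. 1))"
proof -
 obtain rk :: "real^'n \<Rightarrow> nat" where rk: "inj_on rk \<Delta>" using finite_imp_inj_to_nat_seg[OF fin] by metis
 from quot_unbroken[OF fin rk z assms(1), of "\<lambda>z. 1"]
 show ?thesis
 proof (induction rule: cfun_span_induct)
  case zero
  have "d \<sigma> (Res_rat \<Delta> (\<lambda>z. 0)) = 0" if "\<sigma> \<in> B" for \<sigma>
   using d_Res_linear[OF that R_zero R_zero, of 0 0] by simp
  then have "kernel_sum (\<lambda>z. 0) K w = 0" for K w by (simp add: kernel_sum_def)
  then show ?case by (simp add: reproduced_def R_zero)
 next
  case (add g h) then show ?case using reproduced_linear[OF add, of 1 1] by simp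
 next
  case (scale c g) then show ?case using reproduced_linear[OF scale scale, of c 0] by simp
 next
  case (base x)
  then obtain ks' where k: "x = quot \<Delta> ks' (\<lambda>z. 1)" "set ks' \<subseteq> \<Delta>" "span (set ks') = span (set ks)" "unbroken \<Delta> rk (set ks')" by auto
  have "set ks' \<in> bases \<Delta>" using k assms(2) unbroken_independent[OF rk k(2) _ k(4)] by (auto simp: bases_def)
  then show ?case unfolding k(1) by (rule reproduced_simple)
 qed
qed

theorem kernel_formula:
 assumes "set ks \<subseteq> \<Delta>" "span (set ks) = UNIV" "length ks = D + CARD('n)" "regular \<Delta> w"
 shows "quot \<Delta> ks (\<lambda>z. 1) w = (\<Sum>\<sigma>\<in>B. d \<sigma> (Res_rat \<Delta> (quot \<Delta> ks (\<lambda>z. kernel_coeff (list_of \<sigma>) D z w))))"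
proof -
 obtain K0 where K0: "\<And>K. K \<ge> K0 \<Longrightarrow> quot \<Delta> ks (\<lambda>z. 1) w = kernel_sum (quot \<Delta> ks (\<lambda>z. 1)) K w"
  using reproduced_span[OF assms(1,2)] assms(4) unfolding reproduced_def by blast
 have q: "(\<lambda>z. quot \<Delta> ks (\<lambda>z. 1) z * kernel_coeff as e z w) = quot \<Delta> ks (\<lambda>z. kernel_coeff as e z w)" for as e
  by (auto simp: quot_def off_hyperplanes_def)
 have "d \<sigma> (Res_rat \<Delta> (quot \<Delta> ks (\<lambda>z. kernel_coeff (list_of \<sigma>) e z w))) = (if e = D then d \<sigma> (Res_rat \<Delta> (quot \<Delta> ks (\<lambda>z. kernel_coeff (list_of \<sigma>) D z w))) else 0)"
  if "\<sigma> \<in> B" for \<sigma> e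
  using Res_rat_hom[OF fin z assms(1) kernel_coeff_hom, of e] assms(3) dual_family_sum[OF d that, of "{}"] by auto
 then have "kernel_sum (quot \<Delta> ks (\<lambda>z. 1)) (max K0 D) w = (\<Sum>\<sigma>\<in>B. \<Sum>e\<le>max K0 D. if e = D then d \<sigma> (Res_rat \<Delta> (quot \<Delta> ks (\<lambda>z. kernel_coeff (list_of \<sigma>) D z w))) else 0)"
  unfolding kernel_sum_def q by (intro sum.cong refl) auto
 then show ?thesis using K0[of "max K0 D"] by simp
qed

end

section \<open>Smooth functions\<close>

lemma Ck_on_cong:
 fixes u w :: "real^'n \<Rightarrow> complex"
 assumes "open S" "\<And>x. x \<in> S \<Longrightarrow> u x = w x" "Ck_on k S u"
 shows "Ck_on k S w"
proof (cases k)
 case 0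
 then show ?thesis using assms continuous_on_cong[of S S u w] by simp
next
 case (Suc j)
 then obtain u' where u': "\<forall>x\<in>S. (u has_derivative u' x) (at x)" "\<forall>v. Ck_on j S (\<lambda>x. u' x v)"
  using assms(3) by auto
 have "(w has_derivative u' x) (at x)" if "x \<in> S" for x
  using has_derivative_transform_within_open[of u "u' x" x UNIV S w] u'(1) assms(1,2) that by auto
 then show ?thesis using u'(2) Suc by auto
qed

lemma Ck_on_subset: "T \<subseteq> S \<Longrightarrow> Ck_on k S u \<Longrightarrow> Ck_on k T (u :: real^'n \<Rightarrow> complex)"
 by (induction k arbitrary: u) (auto intro: continuous_on_subset, blast)

lemma Ck_on_SucD: "Ck_on (Suc k) S u \<Longrightarrow> Ck_on k S (u :: real^'n \<Rightarrow> complex)"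
proof (induction k arbitrary: u)
 case 0
 then obtain u' where "\<forall>x\<in>S. (u has_derivative u' x) (at x)" by auto
 then show ?case by (auto intro!: continuous_at_imp_continuous_on dest: has_derivative_continuous)
next
 case (Suc k)
 then obtain u' where "\<forall>x\<in>S. (u has_derivative u' x) (at x)" "\<forall>v. Ck_on (Suc k) S (\<lambda>x. u' x v)" by auto
 then show ?case using Suc.IH unfolding Ck_on.simps(2)[of k S u] by blast
qed

lemma Ck_on_const: "Ck_on k S (\<lambda>x. c :: complex)" for S :: "(real^'n) set"
proof (induction k arbitrary: c)
 case (Suc k)
 have "\<forall>x\<in>S. ((\<lambda>x. c) has_derivative (\<lambda>v. 0)) (at x)" by auto
 then show ?case unfolding Ck_on.simps using Suc[of 0] by (intro exI[of _ "\<lambda>x v. 0"]) auto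
qed simp

lemma Ck_on_add: "Ck_on k S u \<Longrightarrow> Ck_on k S w \<Longrightarrow> Ck_on k S (\<lambda>x. u x + w x :: complex)" for S :: "(real^'n) set"
proof (induction k arbitrary: u w)
 case 0 then show ?case by (simp add: continuous_on_add)
next
 case (Suc k)
 obtain u' where u': "\<forall>x\<in>S. (u has_derivative u' x) (at x)" "\<forall>v. Ck_on k S (\<lambda>x. u' x v)" using Suc.prems(1) by auto
 obtain w' where w': "\<forall>x\<in>S. (w has_derivative w' x) (at x)" "\<forall>v. Ck_on k S (\<lambda>x. w' x v)" using Suc.prems(2) by auto
 have 1: "\<forall>x\<in>S. ((\<lambda>x. u x + w x) has_derivative (\<lambda>v. u' x v + w' x v)) (at x)"
  using u' w' by (auto intro: has_derivative_add)
 have 2: "\<forall>v. Ck_on k S (\<lambda>x. u' x v + w' x v)" using u' w' Suc.IH by auto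
 show ?case unfolding Ck_on.simps by (rule exI[of _ "\<lambda>x v. u' x v + w' x v"]) (use 1 2 in auto)
qed

lemma Ck_on_mult: "Ck_on k S u \<Longrightarrow> Ck_on k S w \<Longrightarrow> Ck_on k S (\<lambda>x. u x * w x :: complex)" for S :: "(real^'n) set"
proof (induction k arbitrary: u w)
 case 0 then show ?case by (simp add: continuous_on_mult)
next
 case (Suc k)
 obtain u' where u': "\<forall>x\<in>S. (u has_derivative u' x) (at x)" "\<forall>v. Ck_on k S (\<lambda>x. u' x v)" using Suc.prems(1) by auto
 obtain w' where w': "\<forall>x\<in>S. (w has_derivative w' x) (at x)" "\<forall>v. Ck_on k S (\<lambda>x. w' x v)" using Suc.prems(2) by auto
 have 1: "\<forall>x\<in>S. ((\<lambda>x. u x * w x) has_derivative (\<lambda>v. u x * w' x v + u' x v * w x)) (at x)"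
  using u' w' by (auto intro: has_derivative_mult)
 have 2: "\<forall>v. Ck_on k S (\<lambda>x. u x * w' x v + u' x v * w x)"
  using u' w' Suc.IH Ck_on_SucD[OF Suc.prems(1)] Ck_on_SucD[OF Suc.prems(2)] by (intro allI Ck_on_add) auto
 show ?case unfolding Ck_on.simps by (rule exI[of _ "\<lambda>x v. u x * w' x v + u' x v * w x"]) (use 1 2 in auto)
qed

lemma Ck_on_linear:
 fixes u :: "real^'n \<Rightarrow> complex"
 assumes "bounded_linear u" shows "Ck_on k S u"
proof (cases k)
 case 0 then show ?thesis using assms by (simp add: linear_continuous_on)
next
 case (Suc j)
 show ?thesis unfolding Suc Ck_on.simps
  by (rule exI[of _ "\<lambda>x. u"]) (auto intro: bounded_linear_imp_has_derivative[OF assms] Ck_on_const)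
qed

lemma bounded_linear_pairing_left: "bounded_linear (\<lambda>t. pairing t z)"
 by (rule linear_conv_bounded_linear[THEN iffD1], rule linearI)
  (simp add: pairing_add_left, simp only: pairing_scaleR_left, simp add: scaleR_conv_of_real)

lemma Ck_on_exp: "Ck_on k S (\<lambda>t. exp (pairing t z))" for S :: "(real^'n) set"
proof (induction k)
 case 0
 show ?case unfolding Ck_on.simps
  by (rule continuous_on_exp[OF linear_continuous_on[OF bounded_linear_pairing_left]])
next
 case (Suc k)
 have 1: "((\<lambda>t. exp (pairing t z)) has_derivative (\<lambda>v. exp (pairing t z) * pairing v z)) (at t)" for t
  using has_derivative_compose[OF bounded_linear_imp_has_derivative[OF bounded_linear_pairing_left[of z]] DERIV_exp[unfolded has_field_derivative_def], of t UNIV]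
  by simp
 show ?case unfolding Ck_on.simps
  by (rule exI[of _ "\<lambda>t v. exp (pairing t z) * pairing v z"]) (auto intro!: 1 Ck_on_mult Suc Ck_on_const)
qed

lemma Ck_on_power: "Ck_on k S u \<Longrightarrow> Ck_on k S (\<lambda>x. u x ^ j :: complex)" for S :: "(real^'n) set"
 by (induction j) (auto intro: Ck_on_const Ck_on_mult)

lemma Ck_on_sum: "(\<And>i. i \<in> A \<Longrightarrow> Ck_on k S (u i)) \<Longrightarrow> Ck_on k S (\<lambda>x. \<Sum>i\<in>A. u i x :: complex)" for S :: "(real^'n) set"
 by (induction A rule: infinite_finite_induct) (auto intro: Ck_on_const Ck_on_add)

lemma Ck_on_prod: "(\<And>i. i \<in> A \<Longrightarrow> Ck_on k S (u i)) \<Longrightarrow> Ck_on k S (\<lambda>x. \<Prod>i\<in>A. u i x :: complex)" for S :: "(real^'n) set"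
 by (induction A rule: infinite_finite_induct) (auto intro: Ck_on_const Ck_on_mult)

text \<open>The local derivatives all agree with the Frechet derivative, which therefore serves as
  one derivative on the whole set.\<close>

lemma Ck_on_local:
 fixes u :: "real^'n \<Rightarrow> complex"
 assumes "open S" "\<And>x. x \<in> S \<Longrightarrow> \<exists>W. open W \<and> x \<in> W \<and> W \<subseteq> S \<and> Ck_on k W u"
 shows "Ck_on k S u"
 using assms(2)
proof (induction k arbitrary: u)
 case 0
 then have "isCont u x" if "x \<in> S" for x
  using that by (metis Ck_on.simps(1) continuous_on_eq_continuous_at)
 then show ?case by (simp add: continuous_at_imp_continuous_on)
next
 case (Suc k)
 define u' where "u' = (\<lambda>x. frechet_derivative u (at x))"
 have loc: "\<exists>W. open W \<and> x \<in> W \<and> W \<subseteq> S \<and> (\<forall>x\<in>W. (u has_derivative u' x) (at x)) \<and> (\<forall>v. Ck_on k W (\<lambda>x. u' x v))"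
  if x: "x \<in> S" for x
 proof -
  obtain W where W: "open W" "x \<in> W" "W \<subseteq> S" "Ck_on (Suc k) W u" using Suc.prems[OF x] by blast
  then obtain w' where w': "\<forall>x\<in>W. (u has_derivative w' x) (at x)" "\<forall>v. Ck_on k W (\<lambda>x. w' x v)" by auto
  have eq: "w' x = u' x" if "x \<in> W" for x using w'(1) that unfolding u'_def by (metis frechet_derivative_at)
  have "\<forall>x\<in>W. (u has_derivative u' x) (at x)" using w'(1) eq by auto
  moreover have "\<forall>v. Ck_on k W (\<lambda>x. u' x v)" using w'(2) Ck_on_cong[OF W(1)] eq by metis
  ultimately show ?thesis using W by blast
 qed
 have 1: "\<forall>x\<in>S. (u has_derivative u' x) (at x)" using loc by blast
 have 2: "\<forall>v. Ck_on k S (\<lambda>x. u' x v)"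
 proof
  fix v show "Ck_on k S (\<lambda>x. u' x v)"
  proof (rule Suc.IH)
   fix x assume "x \<in> S"
   from loc[OF this] obtain W where "open W" "x \<in> W" "W \<subseteq> S" "\<forall>v. Ck_on k W (\<lambda>x. u' x v)" by blast
   then show "\<exists>W. open W \<and> x \<in> W \<and> W \<subseteq> S \<and> Ck_on k W (\<lambda>x. u' x v)" by (intro exI[of _ W]) simp
  qed
 qed
 show ?case unfolding Ck_on.simps by (rule exI[of _ u']) (use 1 2 in auto)
qed

section \<open>Test functions and their integrals\<close>

definition dirD :: "real^'n \<Rightarrow> (real^'n \<Rightarrow> complex) \<Rightarrow> real^'n \<Rightarrow> complex" where
 "dirD v u = (\<lambda>x. frechet_derivative u (at x) v)"

lemma smooth_on_UNIV_D:
 assumes "smooth_on UNIV u"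
 shows "(u has_derivative (\<lambda>v. dirD v u x)) (at x)" "smooth_on UNIV (dirD v u)"
proof -
 have der: "(u has_derivative frechet_derivative u (at x)) (at x)" for x
 proof -
  have "Ck_on (Suc 0) UNIV u" using assms unfolding smooth_on_def by blast
  then obtain u' where "\<forall>x. (u has_derivative u' x) (at x)" by auto
  then show ?thesis by (metis frechet_derivative_at)
 qed
 then show "(u has_derivative (\<lambda>v. dirD v u x)) (at x)" unfolding dirD_def .
 show "smooth_on UNIV (dirD v u)" unfolding smooth_on_def
 proof
  fix k
  have "Ck_on (Suc k) UNIV u" using assms unfolding smooth_on_def by blast
  then obtain u' where u': "\<forall>x. (u has_derivative u' x) (at x)" "\<forall>v. Ck_on k UNIV (\<lambda>x. u' x v)" by auto
  have "(\<lambda>x. u' x v) = dirD v u" unfolding dirD_def using u'(1) frechet_derivative_at by metis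
  then show "Ck_on k UNIV (dirD v u)" using u'(2) by metis
 qed
qed

lemma smooth_on_continuous: "smooth_on S u \<Longrightarrow> continuous_on S u"
 unfolding smooth_on_def using Ck_on.simps(1) by metis

lemma smooth_on_mult: "smooth_on S u \<Longrightarrow> smooth_on S w \<Longrightarrow> smooth_on S (\<lambda>x. u x * w x)"
 unfolding smooth_on_def by (auto intro: Ck_on_mult)

lemma smooth_on_add: "smooth_on S u \<Longrightarrow> smooth_on S w \<Longrightarrow> smooth_on S (\<lambda>x. u x + w x)"
 unfolding smooth_on_def by (auto intro: Ck_on_add)

lemma smooth_on_const: "smooth_on S (\<lambda>x. c)"
 unfolding smooth_on_def by (auto intro: Ck_on_const)

lemma smooth_on_exp: "smooth_on S (\<lambda>t. exp (pairing t z))"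
 unfolding smooth_on_def by (auto intro: Ck_on_exp)

lemma test_fun_support:
 assumes "test_fun S \<psi>"
 obtains K where "compact K" "K \<subseteq> S" "\<And>t. t \<notin> K \<Longrightarrow> \<psi> t = 0" "smooth_on UNIV \<psi>"
 using assms unfolding test_fun_def by blast

lemma test_fun_mono: "test_fun S \<psi> \<Longrightarrow> S \<subseteq> T \<Longrightarrow> test_fun T \<psi>"
 unfolding test_fun_def by blast

lemma test_fun_mult: "test_fun S \<psi> \<Longrightarrow> smooth_on UNIV u \<Longrightarrow> test_fun S (\<lambda>t. u t * \<psi> t)"
 unfolding test_fun_def by (auto intro: smooth_on_mult)

lemma test_fun_dirD: "test_fun S \<psi> \<Longrightarrow> test_fun S (dirD v \<psi>)"
proof -
 assume "test_fun S \<psi>"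
 then obtain K where K: "compact K" "K \<subseteq> S" "\<And>t. t \<notin> K \<Longrightarrow> \<psi> t = 0" and s: "smooth_on UNIV \<psi>"
  by (rule test_fun_support) blast
 have "dirD v \<psi> t = 0" if t: "t \<notin> K" for t
 proof -
  have "open (- K)" using K(1) by (simp add: compact_imp_closed open_Compl)
  then have "(\<psi> has_derivative (\<lambda>v. 0)) (at t)"
   using has_derivative_transform_within_open[of "\<lambda>_. 0" "\<lambda>_. 0" t UNIV "- K" \<psi>] t K(3) by auto
  then show ?thesis using smooth_on_UNIV_D(1)[OF s, of t] has_derivative_unique by metis
 qed
 then show ?thesis unfolding test_fun_def using K smooth_on_UNIV_D(2)[OF s] by blast
qed

lemma test_fun_continuous: "test_fun S \<psi> \<Longrightarrow> continuous_on UNIV \<psi>"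
 using smooth_on_continuous unfolding test_fun_def by blast

lemma integrable_compact_support:
 fixes f :: "real^'n \<Rightarrow> complex"
 assumes "compact K" "continuous_on K f" "\<And>t. t \<notin> K \<Longrightarrow> f t = 0"
 shows "integrable lborel f"
proof -
 have "integrable lborel (\<lambda>x. indicator K x *\<^sub>R f x)" by (rule borel_integrable_compact[OF assms(1,2)])
 moreover have "(\<lambda>x. indicator K x *\<^sub>R f x) = f" using assms(3) by (auto simp: fun_eq_iff indicator_def)
 ultimately show ?thesis by simp
qed

lemma integrable_test_fun: "test_fun S \<psi> \<Longrightarrow> integrable lborel \<psi>" for S :: "(real^'n) set"
 by (metis test_fun_support test_fun_continuous continuous_on_subset subset_UNIV integrable_compact_support)

lemma integral_shift:
 fixes f :: "real^'n \<Rightarrow> complex"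
 assumes "f \<in> borel_measurable borel"
 shows "(LINT t|lborel. f (t + m)) = integral\<^sup>L lborel f"
proof -
 have "integral\<^sup>L lborel f = integral\<^sup>L (distr lborel borel ((+) m)) f" by (simp add: lborel_distr_plus)
 also have "\<dots> = (LINT t|lborel. f (m + t))" by (rule integral_distr) (use assms in auto)
 finally show ?thesis by (simp add: add.commute)
qed

lemma continuous_bounded_on:
 fixes f :: "real^'n \<Rightarrow> complex"
 assumes "continuous_on UNIV f" "bounded Q" obtains B where "\<And>q. q \<in> Q \<Longrightarrow> norm (f q) \<le> B"
proof -
 have "compact (f ` closure Q)"
  by (rule compact_continuous_image) (use assms in \<open>auto intro: continuous_on_subset\<close>)
 from compact_imp_bounded[OF this] obtain B where B: "\<forall>y\<in>f ` closure Q. norm y \<le> B" unfolding bounded_iff by blast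
 show ?thesis
 proof (rule that)
  fix q assume "q \<in> Q"
  then have "f q \<in> f ` closure Q" using closure_subset by blast
  then show "norm (f q) \<le> B" using B by blast
 qed
qed

lemma test_fun_radius:
 assumes "test_fun S g" obtains R where "\<And>t. norm t > R \<Longrightarrow> g t = 0"
proof -
 obtain K where K: "compact K" "\<And>t. t \<notin> K \<Longrightarrow> g t = 0" using assms by (rule test_fun_support) blast
 obtain R where "\<And>t. t \<in> K \<Longrightarrow> norm t \<le> R" using compact_imp_bounded[OF K(1)] unfolding bounded_iff by blast
 then show ?thesis using K(2) by (intro that[of R]) (meson not_le)
qed

text \<open>By translation invariance the integral of \<eta> shifted by \<open>s *\<^sub>R v\<close>
  is constant in \<open>s\<close>; differentiating under the integral at \<open>s = 0\<close> gives
  the claim.\<close>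

lemma integral_dirD:
 fixes \<eta> :: "real^'n \<Rightarrow> complex"
 assumes "test_fun UNIV \<eta>"
 shows "(LINT t|lborel. dirD v \<eta> t) = 0"
proof -
 have sm: "smooth_on UNIV \<eta>" using assms by (simp add: test_fun_def)
 obtain R1 where R1: "\<And>t. norm t > R1 \<Longrightarrow> \<eta> t = 0" using test_fun_radius[OF assms] by blast
 obtain R2 where R2: "\<And>t. norm t > R2 \<Longrightarrow> dirD v \<eta> t = 0" using test_fun_radius[OF test_fun_dirD[OF assms]] by blast
 have cont: "continuous_on UNIV \<eta>" "continuous_on UNIV (dirD v \<eta>)"
  by (rule test_fun_continuous[OF assms], rule test_fun_continuous[OF test_fun_dirD[OF assms]])
 \<comment> \<open>The margin \<open>norm v\<close> keeps every translate with parameter between -1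
   and 1 zero outside the box.\<close>
 obtain a :: "real^'n" where a: "cball 0 (max R1 R2 + norm v) \<subseteq> cbox (- a) a" using bounded_subset_cbox_symmetric[OF bounded_cball] by blast
 have far: "norm t > max R1 R2 + norm v" if "t \<notin> cbox (- a) a" for t
 proof -
  have "t \<notin> cball 0 (max R1 R2 + norm v)" using a that by blast
  then show ?thesis by simp
 qed
 have vanish: "\<eta> (t + s *\<^sub>R v) = 0" "dirD v \<eta> t = 0" if "t \<notin> cbox (- a) a" "s \<in> {-1..1}" for t :: "real^'n" and s :: real
 proof -
  have "\<bar>s\<bar> * norm v \<le> norm v" using that(2) by (simp add: mult_left_le_one_le abs_le_iff)
  moreover have "norm t \<le> norm (t + s *\<^sub>R v) + norm (s *\<^sub>R v)" using norm_triangle_ineq4[of "t + s *\<^sub>R v" "s *\<^sub>R v"] by simp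
  ultimately have "norm (t + s *\<^sub>R v) > R1" using far[OF that(1)] by simp
  then show "\<eta> (t + s *\<^sub>R v) = 0" by (rule R1)
  have "norm t > R2" using far[OF that(1)] norm_ge_zero[of v] by linarith
  then show "dirD v \<eta> t = 0" by (rule R2)
 qed
 have box: "integral (cbox (- a) a) g = integral\<^sup>L lborel g"
  if g: "continuous_on UNIV g" "\<And>t. t \<notin> cbox (- a) a \<Longrightarrow> g t = 0" for g :: "real^'n \<Rightarrow> complex"
 proof -
  have "integrable lborel g" by (rule integrable_compact_support[OF compact_cbox]) (use g in \<open>auto intro: continuous_on_subset\<close>)
  then have "integral UNIV g = integral\<^sup>L lborel g" by (rule integral_lborel)
  moreover have "(\<lambda>t. if t \<in> cbox (- a) a then g t else 0) = g" using g(2) by auto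
  ultimately show ?thesis using Henstock_Kurzweil_Integration.integral_restrict_UNIV[of "cbox (- a) a" g] by simp
 qed
 have shifted: "continuous_on UNIV (\<lambda>t. \<eta> (t + s *\<^sub>R v))" for s
  by (rule continuous_on_compose2[OF cont(1)]) (auto intro!: continuous_intros)
 have deriv: "((\<lambda>s. integral (cbox (- a) a) (\<lambda>t. \<eta> (t + s *\<^sub>R v))) has_vector_derivative
   integral (cbox (- a) a) (\<lambda>t. dirD v \<eta> (t + 0 *\<^sub>R v))) (at 0 within {-1..1})"
 proof (rule leibniz_rule_vector_derivative)
  fix s :: real and t :: "real^'n"
  have 1: "((\<lambda>s. t + s *\<^sub>R v) has_derivative (\<lambda>s. s *\<^sub>R v)) (at s within {-1..1})" by (auto intro!: derivative_eq_intros)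
  have "((\<lambda>s. \<eta> (t + s *\<^sub>R v)) has_derivative (\<lambda>r. dirD (r *\<^sub>R v) \<eta> (t + s *\<^sub>R v))) (at s within {-1..1})"
   by (rule has_derivative_compose[OF 1 smooth_on_UNIV_D(1)[OF sm]])
  moreover have "dirD (r *\<^sub>R v) \<eta> x = r *\<^sub>R dirD v \<eta> x" for r x
   using has_derivative_linear[OF smooth_on_UNIV_D(1)[OF sm, of x]] by (rule linear_cmul)
  ultimately show "((\<lambda>s. \<eta> (t + s *\<^sub>R v)) has_vector_derivative dirD v \<eta> (t + s *\<^sub>R v)) (at s within {-1..1})"
   unfolding has_vector_derivative_def by simp
 next
  show "(\<lambda>t. \<eta> (t + s *\<^sub>R v)) integrable_on cbox (- a) a" for s
   by (rule integrable_continuous[OF continuous_on_subset[OF shifted subset_UNIV]])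
  show "continuous_on ({-1..1} \<times> cbox (- a) a) (\<lambda>(s, t). dirD v \<eta> (t + s *\<^sub>R v))"
   unfolding split_beta by (rule continuous_on_compose2[OF cont(2)]) (auto intro!: continuous_intros)
 qed auto
 have e: "at (0::real) within {-1..1} = at 0" by (rule at_within_interior) (simp add: interior_atLeastAtMost_real)
 have "integral (cbox (- a) a) (\<lambda>t. dirD v \<eta> (t + 0 *\<^sub>R v)) = integral\<^sup>L lborel (dirD v \<eta>)"
  unfolding scaleR_zero_left add_0_right by (rule box[OF cont(2) vanish(2)[of _ 0]]) auto
 from deriv[unfolded e this]
 have "((\<lambda>s. integral\<^sup>L lborel \<eta>) has_vector_derivative integral\<^sup>L lborel (dirD v \<eta>)) (at 0)"
 proof (rule has_vector_derivative_transform_within_open[where S = "{-1<..<1}"])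
  fix s :: real assume "s \<in> {-1<..<1}"
  then have "integral (cbox (- a) a) (\<lambda>t. \<eta> (t + s *\<^sub>R v)) = (LINT t|lborel. \<eta> (t + s *\<^sub>R v))"
   by (intro box[OF shifted] vanish(1)) auto
  then show "integral (cbox (- a) a) (\<lambda>t. \<eta> (t + s *\<^sub>R v)) = integral\<^sup>L lborel \<eta>"
   using integral_shift[OF borel_measurable_continuous_onI[OF cont(1)], of "s *\<^sub>R v"] by simp
 qed auto
 from vector_derivative_unique_at[OF this has_vector_derivative_const] show ?thesis .
qed

section \<open>Bump functions\<close>

text \<open>All derivatives of \<open>exp (- (1 / x))\<close>, extended by 0, have this shape; with
  the polynomial as a parameter, smoothness is a single induction.\<close>

definition flat :: "real poly \<Rightarrow> real \<Rightarrow> real" where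
 "flat p x = (if x > 0 then poly p (1 / x) * exp (- (1 / x)) else 0)"

lemma poly_exp_tendsto_0: "((\<lambda>x. x ^ k * poly p x * exp (- x)) \<longlongrightarrow> 0) at_top" for p :: "real poly"
proof (induction p arbitrary: k)
 case (pCons a p)
 have "((\<lambda>x. a * (x ^ k / exp x) + x ^ Suc k * poly p x * exp (- x)) \<longlongrightarrow> a * 0 + 0) at_top"
  by (intro tendsto_intros tendsto_power_div_exp_0 pCons)
 moreover have "(\<lambda>x. a * (x ^ k / exp x) + x ^ Suc k * poly p x * exp (- x)) = (\<lambda>x. x ^ k * poly (pCons a p) x * exp (- x))"
  by (auto simp: fun_eq_iff exp_minus field_simps)
 ultimately show ?case by simp
qed simp

text \<open>With \<open>u = 1 / x\<close>, the derivative of \<open>p(u) exp(-u)\<close> in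
  \<open>x\<close> is \<open>u^2 (p - p')(u) exp(-u)\<close>; the factor \<open>[:0, 0, 1:]\<close>
  is \<open>u^2\<close>. At 0 the right difference quotient is \<open>u p(u) exp(-u)\<close>, which
  tends to 0.\<close>

lemma flat_deriv: "(flat p has_real_derivative flat ([:0, 0, 1:] * (p - pderiv p)) x) (at x)"
proof -
 consider "x > 0" | "x < 0" | "x = 0" by linarith
 then show ?thesis
 proof cases
  case 1
  have "((\<lambda>x. poly p (1 / x) * exp (- (1 / x))) has_real_derivative flat ([:0, 0, 1:] * (p - pderiv p)) x) (at x)"
  proof -
   have i: "((\<lambda>x. 1 / x) has_real_derivative - (1 / x ^ 2)) (at x)"
    using 1 by (auto intro!: derivative_eq_intros simp: power2_eq_square)
   have "((\<lambda>x. poly p (1 / x)) has_real_derivative poly (pderiv p) (1 / x) * - (1 / x ^ 2)) (at x)"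
    by (rule DERIV_chain2[OF poly_DERIV i])
   moreover have "((\<lambda>x. exp (- (1 / x))) has_real_derivative exp (- (1 / x)) * (1 / x ^ 2)) (at x)"
    using DERIV_chain2[OF DERIV_exp DERIV_minus[OF i]] by simp
   ultimately have "((\<lambda>x. poly p (1 / x) * exp (- (1 / x))) has_real_derivative
    poly (pderiv p) (1 / x) * - (1 / x ^ 2) * exp (- (1 / x)) + exp (- (1 / x)) * (1 / x ^ 2) * poly p (1 / x)) (at x)"
    by (rule DERIV_mult)
   then show ?thesis using 1 by (simp add: flat_def algebra_simps power2_eq_square)
  qed
  moreover have "\<forall>\<^sub>F y in nhds x. poly p (1 / y) * exp (- (1 / y)) = flat p y"
   using eventually_nhds_in_open[of "{0<..}" x] 1 by (auto elim!: eventually_mono simp: flat_def)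
  from DERIV_cong_ev[OF refl this refl] calculation show ?thesis by blast
 next
  case 2
  have "\<forall>\<^sub>F y in nhds x. 0 = flat p y"
   using eventually_nhds_in_open[of "{..<0}" x] 2 by (auto elim!: eventually_mono simp: flat_def)
  from DERIV_cong_ev[OF refl this refl, of 0] have "(flat p has_real_derivative 0) (at x)" by simp
  then show ?thesis using 2 by (simp add: flat_def)
 next
  case 3
  have "((\<lambda>y. flat p y / y) \<longlongrightarrow> 0) (at 0)"
  proof (rule filterlim_split_at)
   have "\<forall>\<^sub>F y in at_left 0. 0 = flat p y / (y::real)"
    by (auto simp: eventually_at_filter flat_def)
   then show "((\<lambda>y. flat p y / y) \<longlongrightarrow> 0) (at_left 0)"
    by (rule Lim_transform_eventually[OF tendsto_const])
   have "((\<lambda>y. inverse y ^ 1 * poly p (inverse y) * exp (- inverse y)) \<longlongrightarrow> 0) (at_right (0::real))"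
    by (rule filterlim_compose[OF poly_exp_tendsto_0 filterlim_inverse_at_top_right])
   moreover have "\<forall>\<^sub>F y in at_right (0::real). inverse y ^ 1 * poly p (inverse y) * exp (- inverse y) = flat p y / y"
    by (auto simp: eventually_at_filter flat_def field_simps)
   ultimately show "((\<lambda>y. flat p y / y) \<longlongrightarrow> 0) (at_right 0)"
    by (rule Lim_transform_eventually)
  qed
  then show ?thesis using 3 unfolding has_field_derivative_iff by (simp add: flat_def)
 qed
qed

lemma smooth_on_flat: "smooth_on UNIV (\<lambda>x::real^'n. complex_of_real (flat p (a + b * x $ i)))"
 unfolding smooth_on_def
proof
 fix k
 show "Ck_on k UNIV (\<lambda>x::real^'n. complex_of_real (flat p (a + b * x $ i)))"
 proof (induction k arbitrary: p)
  case 0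
  have "continuous_on UNIV (flat p)" using flat_deriv DERIV_isCont by (blast intro: continuous_at_imp_continuous_on)
  then have "continuous_on UNIV (\<lambda>x::real^'n. flat p (a + b * x $ i))"
   by (rule continuous_on_compose2) (auto intro!: continuous_intros)
  then show ?case by (auto intro: continuous_intros)
 next
  case (Suc k)
  define q where "q = [:0, 0, 1:] * (p - pderiv p)"
  have 1: "((\<lambda>x::real^'n. complex_of_real (flat p (a + b * x $ i))) has_derivative
    (\<lambda>v. complex_of_real (flat q (a + b * x $ i)) * of_real (b * v $ i))) (at x)" for x
  proof -
   have a: "((\<lambda>x::real^'n. a + b * x $ i) has_derivative (\<lambda>v. b * v $ i)) (at x)"
    by (auto intro!: derivative_eq_intros bounded_linear_imp_has_derivative bounded_linear_vec_nth)
   have "((\<lambda>x. flat p (a + b * x $ i)) has_derivative (\<lambda>v. flat q (a + b * x $ i) * (b * v $ i))) (at x)"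
    by (rule has_derivative_compose[OF a flat_deriv[of p, folded q_def, unfolded has_field_derivative_def]])
   from has_derivative_of_real[OF this] show ?thesis by simp
  qed
  have 2: "Ck_on k UNIV (\<lambda>x::real^'n. complex_of_real (flat q (a + b * x $ i)) * of_real (b * v $ i))" for v :: "real^'n"
   by (intro Ck_on_mult Suc Ck_on_const)
  show ?case unfolding Ck_on.simps
   by (rule exI[of _ "\<lambda>x v. complex_of_real (flat q (a + b * x $ i)) * of_real (b * v $ i)"]) (use 1 2 in auto)
 qed
qed

lemma bump_exists:
 fixes a b t0 :: "real^'n"
 assumes "t0 \<in> box a b"
 obtains \<beta> :: "real^'n \<Rightarrow> real" where "smooth_on UNIV (\<lambda>t. complex_of_real (\<beta> t))" "\<And>t. \<beta> t \<ge> 0" "\<beta> t0 > 0"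
  "\<And>t. t \<notin> cbox a b \<Longrightarrow> \<beta> t = 0"
proof -
 define \<beta> where "\<beta> = (\<lambda>t::real^'n. \<Prod>i\<in>UNIV. flat 1 (- a $ i + 1 * t $ i) * flat 1 (b $ i + (-1) * t $ i))"
 have "smooth_on UNIV (\<lambda>t::real^'n. \<Prod>i\<in>UNIV. complex_of_real (flat 1 (- a $ i + 1 * t $ i)) * complex_of_real (flat 1 (b $ i + (-1) * t $ i)))"
  unfolding smooth_on_def
  by (intro allI Ck_on_prod Ck_on_mult smooth_on_flat[unfolded smooth_on_def, rule_format])
 then have "smooth_on UNIV (\<lambda>t. complex_of_real (\<beta> t))" by (simp add: \<beta>_def)
 moreover have "\<beta> t \<ge> 0" for t unfolding \<beta>_def by (intro prod_nonneg) (auto simp: flat_def)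
 moreover have "\<beta> t0 > 0" unfolding \<beta>_def by (intro prod_pos) (use assms in \<open>auto simp: flat_def mem_box_cart\<close>)
 moreover have "\<beta> t = 0" if "t \<notin> cbox a b" for t
 proof -
  have "\<exists>i. t $ i < a $ i \<or> t $ i > b $ i" using that by (simp add: mem_box_cart) (meson not_le)
  then obtain i where i: "t $ i < a $ i \<or> t $ i > b $ i" by blast
  have "flat 1 (- a $ i + 1 * t $ i) * flat 1 (b $ i + (-1) * t $ i) = 0"
   using i by (auto simp: flat_def)
  then show ?thesis unfolding \<beta>_def by (intro prod_zero bexI[of _ i]) auto
 qed
 ultimately show ?thesis by (rule that)
qed

text \<open>The fundamental lemma of the calculus of variations. Multiplied by the conjugate of its
  value at \<open>t0\<close>, the difference has positive real part near \<open>t0\<close>, which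
  contradicts a zero integral against a nonnegative bump there.\<close>

lemma test_fun_determines:
 fixes u w :: "real^'n \<Rightarrow> complex"
 assumes "open S" "continuous_on S u" "continuous_on S w" "t0 \<in> S"
  "\<And>\<psi>. test_fun S \<psi> \<Longrightarrow> (LINT t|lborel. u t * \<psi> t) = (LINT t|lborel. w t * \<psi> t)"
 shows "u t0 = w t0"
proof (rule ccontr)
 assume ne: "u t0 \<noteq> w t0"
 define c where "c = cnj (u t0 - w t0)"
 define g where "g = (\<lambda>t. Re (c * (u t - w t)))"
 have "c * (u t0 - w t0) = of_real ((norm (u t0 - w t0))\<^sup>2)"
  unfolding c_def by (metis complex_norm_square mult.commute)
 then have g0: "g t0 > 0" unfolding g_def using ne by simp
 have cg: "continuous_on S g" unfolding g_def using assms(2,3) by (intro continuous_intros)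
 have "open (S \<inter> g -` {0<..})" by (rule continuous_open_preimage[OF cg assms(1)]) simp
 moreover have "t0 \<in> S \<inter> g -` {0<..}" using g0 assms(4) by simp
 ultimately obtain a b where ab: "cbox a b \<subseteq> S \<inter> g -` {0<..}" "t0 \<in> box a b"
  using open_contains_cbox by metis
 obtain \<beta> where \<beta>: "smooth_on UNIV (\<lambda>t. complex_of_real (\<beta> t))" "\<And>t. \<beta> t \<ge> 0" "\<beta> t0 > 0" "\<And>t. t \<notin> cbox a b \<Longrightarrow> \<beta> t = 0"
  using bump_exists[OF ab(2)] by blast
 define \<psi> where "\<psi> = (\<lambda>t. complex_of_real (\<beta> t))"
 have tf: "test_fun S \<psi>"
  unfolding test_fun_def \<psi>_def using \<beta> ab by (intro conjI exI[of _ "cbox a b"]) (auto simp: compact_cbox)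
 have cont\<psi>: "continuous_on UNIV \<psi>" by (rule test_fun_continuous[OF tf])
 have c\<psi>: "continuous_on (cbox a b) \<psi>" by (rule continuous_on_subset[OF cont\<psi>]) simp
 have cu: "continuous_on (cbox a b) u" "continuous_on (cbox a b) w"
  using assms(2,3) ab(1) continuous_on_subset by (metis le_inf_iff)+
 have i1: "integrable lborel (\<lambda>t. u t * \<psi> t)" and i2: "integrable lborel (\<lambda>t. w t * \<psi> t)"
  using cu c\<psi> \<beta>(4) by (auto intro!: integrable_compact_support[OF compact_cbox[of a b]] continuous_on_mult simp: \<psi>_def)
 have int0: "(LINT t|lborel. c * (u t * \<psi> t - w t * \<psi> t)) = 0"
  using i1 i2 assms(5)[OF tf] by simp
 have int: "integrable lborel (\<lambda>t. c * (u t * \<psi> t - w t * \<psi> t))" using i1 i2 by simp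
 have "(LINT t|lborel. Re (c * (u t * \<psi> t - w t * \<psi> t))) = 0"
  by (subst integral_Re[OF int], subst int0) simp
 moreover have re: "Re (c * (u t * \<psi> t - w t * \<psi> t)) = g t * \<beta> t" for t
  unfolding g_def \<psi>_def by (simp add: algebra_simps)
 ultimately have z: "(LINT t|lborel. g t * \<beta> t) = 0" by simp
 have ig: "integrable lborel (\<lambda>t. g t * \<beta> t)" using integrable_Re[OF int] by (simp only: re)
 have "((\<lambda>t. g t * \<beta> t) has_integral 0) UNIV" using has_integral_integral_lborel[OF ig] z by simp
 then have "((\<lambda>t. g t * \<beta> t) has_integral 0) (cbox a b)"
  using has_integral_restrict_UNIV[of "cbox a b" "\<lambda>t. g t * \<beta> t" 0] \<beta>(4)
  by (subst (asm) has_integral_cong[of UNIV _ "\<lambda>t. g t * \<beta> t"]) auto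
 moreover have "continuous_on (cbox a b) (\<lambda>t. g t * \<beta> t)"
 proof -
  have "continuous_on (cbox a b) (\<lambda>t. Re (c * (u t * \<psi> t - w t * \<psi> t)))"
   using cu c\<psi> by (intro continuous_intros)
  then show ?thesis by (simp only: re)
 qed
 moreover have "0 \<le> g t * \<beta> t" if "t \<in> box a b" for t
 proof -
  have "t \<in> cbox a b" using that box_subset_cbox by blast
  then have "g t > 0" using ab(1) by auto
  then show ?thesis using \<beta>(2)[of t] by simp
 qed
 ultimately have "g t0 * \<beta> t0 = 0"
  using has_integral_0_cbox_imp_0[of a b "\<lambda>t. g t * \<beta> t" t0] ab(2) box_subset_cbox by blast
 then show False using g0 \<beta>(3) by simp
qed

section \<open>Sums and integrals\<close>

lemma infsum_continuous:
 fixes f :: "'a \<Rightarrow> real^'n \<Rightarrow> complex"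
 assumes "\<And>n. n \<in> A \<Longrightarrow> continuous_on UNIV (f n)" "\<And>n t. n \<in> A \<Longrightarrow> norm (f n t) \<le> B n" "B summable_on A"
 shows "continuous_on UNIV (\<lambda>t. \<Sum>\<^sub>\<infinity>n\<in>A. f n t)"
proof (rule uniform_limit_theorem)
 show "uniform_limit UNIV (\<lambda>X t. \<Sum>n\<in>X. f n t) (\<lambda>t. \<Sum>\<^sub>\<infinity>n\<in>A. f n t) (finite_subsets_at_top A)"
  by (rule Weierstrass_m_test_general) (use assms in auto)
 show "\<forall>\<^sub>F X in finite_subsets_at_top A. continuous_on UNIV (\<lambda>t. \<Sum>n\<in>X. f n t)"
  using assms(1) by (auto simp: eventually_finite_subsets_at_top intro!: exI[of _ "{}"] continuous_on_sum)
qed simp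

lemma integrable_mult_bounded:
 fixes h f :: "real^'n \<Rightarrow> complex"
 assumes "integrable lborel h" "f \<in> borel_measurable borel" "\<And>t. norm (f t) \<le> B"
 shows "integrable lborel (\<lambda>t. h t * f t)"
proof (rule Bochner_Integration.integrable_bound)
 show "integrable lborel (\<lambda>t. B * norm (h t))" using assms(1) by simp
 show "(\<lambda>t. h t * f t) \<in> borel_measurable lborel" using assms(1,2) by measurable
 have "0 \<le> B" using assms(3)[of 0] norm_ge_zero order_trans by blast
 then show "AE t in lborel. norm (h t * f t) \<le> norm (B * norm (h t))"
  using assms(3) by (intro AE_I2) (auto simp: norm_mult mult.commute intro!: mult_right_mono)
qed

text \<open>The partial sums converge uniformly by the summable majorant, and a uniform error costs
  at most that error times the integral of \<open>norm (h t)\<close>.\<close>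

lemma infsum_integral_swap:
 fixes f :: "'a \<Rightarrow> real^'n \<Rightarrow> complex"
 assumes f: "\<And>n. n \<in> A \<Longrightarrow> continuous_on UNIV (f n)" "\<And>n t. n \<in> A \<Longrightarrow> norm (f n t) \<le> B n" "B summable_on A"
  and h: "integrable lborel h"
 shows "((\<lambda>n. LINT t|lborel. h t * f n t) has_sum (LINT t|lborel. h t * (\<Sum>\<^sub>\<infinity>n\<in>A. f n t))) A"
proof -
 define S where "S = (\<lambda>t. \<Sum>\<^sub>\<infinity>n\<in>A. f n t)"
 have Scont: "continuous_on UNIV S" unfolding S_def by (rule infsum_continuous[OF f])
 have sm: "(\<lambda>n. f n t) summable_on A" for t
  by (rule Infinite_Sum.abs_summable_summable, rule Infinite_Sum.abs_summable_on_comparison_test'[OF f(3)]) (use f(2) in auto)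
 have nm: "(\<lambda>n. norm (f n t)) summable_on A" for t
  by (rule Infinite_Sum.abs_summable_on_comparison_test'[OF f(3)]) (use f(2) in auto)
 have Sb: "norm (S t) \<le> (\<Sum>\<^sub>\<infinity>n\<in>A. B n)" for t
  unfolding S_def by (rule order_trans[OF norm_infsum_bound[OF nm] infsum_mono[OF nm f(3) f(2)]])
 have ul: "uniform_limit UNIV (\<lambda>X t. \<Sum>n\<in>X. f n t) S (finite_subsets_at_top A)"
  unfolding S_def by (rule Weierstrass_m_test_general) (use f in auto)
 have intS: "integrable lborel (\<lambda>t. h t * S t)"
  by (rule integrable_mult_bounded[OF h _ Sb]) (use Scont borel_measurable_continuous_onI in blast)
 have intf: "integrable lborel (\<lambda>t. h t * f n t)" if "n \<in> A" for n
  by (rule integrable_mult_bounded[OF h _ f(2)[OF that]]) (use f(1)[OF that] borel_measurable_continuous_onI in blast)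
 define I where "I = (LINT t|lborel. norm (h t))"
 have I: "I \<ge> 0" unfolding I_def by simp
 have "((\<lambda>X. \<Sum>n\<in>X. LINT t|lborel. h t * f n t) \<longlongrightarrow> (LINT t|lborel. h t * S t)) (finite_subsets_at_top A)"
 proof (rule tendstoI)
  fix \<epsilon> :: real assume e: "\<epsilon> > 0"
  \<comment> \<open>The summand 1 keeps the quotient defined when \<open>h\<close> is almost
    everywhere zero.\<close>
  define \<delta> where "\<delta> = \<epsilon> / (I + 1)"
  have d: "\<delta> > 0" using e I by (simp add: \<delta>_def)
  have "\<forall>\<^sub>F X in finite_subsets_at_top A. X \<subseteq> A \<and> (\<forall>t. dist (\<Sum>n\<in>X. f n t) (S t) < \<delta>)"
   using uniform_limitD[OF ul d] eventually_finite_subsets_at_top_weakI[of A "\<lambda>X. X \<subseteq> A"]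
   by (auto elim: eventually_elim2)
  then show "\<forall>\<^sub>F X in finite_subsets_at_top A. dist (\<Sum>n\<in>X. LINT t|lborel. h t * f n t) (LINT t|lborel. h t * S t) < \<epsilon>"
  proof (rule eventually_mono)
   fix X assume X: "X \<subseteq> A \<and> (\<forall>t. dist (\<Sum>n\<in>X. f n t) (S t) < \<delta>)"
   have int1: "integrable lborel (\<lambda>t. \<Sum>n\<in>X. h t * f n t)" using X intf by (intro Bochner_Integration.integrable_sum) auto
   have "(\<Sum>n\<in>X. LINT t|lborel. h t * f n t) - (LINT t|lborel. h t * S t) = (LINT t|lborel. (\<Sum>n\<in>X. h t * f n t) - h t * S t)"
    using X intf int1 intS by (subst Bochner_Integration.integral_diff) (auto intro!: Bochner_Integration.integral_sum[symmetric])
   also have "norm \<dots> \<le> (LINT t|lborel. \<delta> * norm (h t))"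
   proof (rule Bochner_Integration.integral_norm_bound_integral)
    show "integrable lborel (\<lambda>t. (\<Sum>n\<in>X. h t * f n t) - h t * S t)" using int1 intS by simp
    show "integrable lborel (\<lambda>t. \<delta> * norm (h t))" using h by simp
    fix t
    have "(\<Sum>n\<in>X. h t * f n t) - h t * S t = h t * ((\<Sum>n\<in>X. f n t) - S t)" by (simp add: sum_distrib_left algebra_simps)
    moreover have "norm ((\<Sum>n\<in>X. f n t) - S t) \<le> \<delta>" using X by (auto simp: dist_norm less_imp_le)
    ultimately show "norm ((\<Sum>n\<in>X. h t * f n t) - h t * S t) \<le> \<delta> * norm (h t)"
     using mult_left_mono[of "norm ((\<Sum>n\<in>X. f n t) - S t)" \<delta> "norm (h t)"] by (simp add: norm_mult mult.commute[of \<delta>])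
   qed
   also have "\<dots> = \<delta> * I" unfolding I_def by simp
   also have "\<dots> < \<epsilon>" using e I by (simp add: \<delta>_def field_simps)
   finally show "dist (\<Sum>n\<in>X. LINT t|lborel. h t * f n t) (LINT t|lborel. h t * S t) < \<epsilon>" by (simp add: dist_norm)
  qed
 qed
 then show ?thesis unfolding has_sum_def S_def .
qed

section \<open>The Fourier transform of a box\<close>

definition slab_factor :: "complex \<Rightarrow> complex" where
 "slab_factor a = (LINT s|lborel. indicator {0..<1::real} s * exp (- (a * of_real s)))"

lemma slab_factor_eq: assumes "a \<noteq> 0" shows "slab_factor a = (1 - exp (- a)) / a"
proof -
 have "(LINT s|lborel. indicator {0..1::real} s *\<^sub>R exp (- (a * of_real s))) = - exp (- (a * of_real 1)) / a - (- exp (- (a * of_real 0)) / a)"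
 proof (rule integral_FTC_atLeastAtMost)
  fix x :: real
  have "((\<lambda>x. - exp (- (a * x)) / a) has_field_derivative exp (- (a * of_real x))) (at (of_real x))"
   using assms by (auto intro!: derivative_eq_intros)
  then show "((\<lambda>x. - exp (- (a * of_real x)) / a) has_vector_derivative exp (- (a * of_real x))) (at x within {0..1})"
   by (rule has_vector_derivative_real_field[THEN has_vector_derivative_at_within])
  show "continuous_on {0..1} (\<lambda>x. exp (- (a * complex_of_real x)))" by (intro continuous_intros)
 qed simp
 moreover have "slab_factor a = (LINT s|lborel. indicator {0..1::real} s *\<^sub>R exp (- (a * of_real s)))"
  unfolding slab_factor_def
 proof (rule integral_cong_AE)
  have "AE s in lborel. s \<noteq> (1::real)" by (rule AE_lborel_singleton)
  then show "AE s in lborel. indicator {0..<1} s * exp (- (a * complex_of_real s)) = indicator {0..1} s *\<^sub>R exp (- (a * complex_of_real s))"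
   by (rule AE_mp) (auto simp: indicator_def)
 qed measurable
 ultimately show ?thesis by (simp add: diff_divide_distrib)
qed

lemma integrable_pair_bounded:
 fixes G :: "real^'n \<Rightarrow> real \<Rightarrow> complex"
 assumes "case_prod G \<in> borel_measurable (lborel \<Otimes>\<^sub>M lborel)" "Q \<in> sets borel" "bounded Q"
  "\<And>q s. norm (G q s) \<le> B" "\<And>q s. G q s \<noteq> 0 \<Longrightarrow> q \<in> Q \<and> \<bar>s\<bar> \<le> 1"
 shows "integrable (lborel \<Otimes>\<^sub>M lborel) (case_prod G)"
proof (rule Bochner_Integration.integrable_bound)
 have "emeasure (lborel \<Otimes>\<^sub>M lborel) (Q \<times> {-1..1::real}) = emeasure lborel Q * emeasure lborel {-1..1::real}"
  using assms(2) by (intro lborel.emeasure_pair_measure_Times) auto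
 also have "\<dots> < \<infinity>" using emeasure_bounded_finite[OF assms(3)] by (simp add: ennreal_mult_less_top)
 finally show "integrable (lborel \<Otimes>\<^sub>M lborel) (\<lambda>x. \<bar>B\<bar> * indicator (Q \<times> {-1..1::real}) x)"
  using assms(2) by (intro integrable_mult_right integrable_real_indicator) auto
 show "case_prod G \<in> borel_measurable (lborel \<Otimes>\<^sub>M lborel)" by (rule assms(1))
 show "AE x in lborel \<Otimes>\<^sub>M lborel. norm (case_prod G x) \<le> norm (\<bar>B\<bar> * indicator (Q \<times> {-1..1}) x :: real)"
 proof (intro AE_I2)
  fix x :: "(real^'n) \<times> real"
  obtain q s where x: "x = (q, s)" by force
  show "norm (case_prod G x) \<le> norm (\<bar>B\<bar> * indicator (Q \<times> {-1..1}) x :: real)"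
  proof (cases "G q s = 0")
   case False
   then show ?thesis using assms(5)[OF False] assms(4)[of q s] x by (auto simp: indicator_def abs_le_iff)
  qed (simp add: x)
 qed
qed

text \<open>Splits one coordinate off an integral over a skew box without a linear change of
  variables. \<open>Q'\<close> and \<open>F\<close> are invariant along \<alpha>, on which
  \<open>v\<close> has value 1; an auxiliary integral over \<open>s\<close> and the shift of
  \<open>q\<close> by \<open>- s *\<^sub>R \<alpha>\<close> turn \<open>K\<close> into
  \<open>L\<close>, and Fubini evaluates either side in \<open>s\<close> first.\<close>

lemma slab_average:
 fixes F :: "real^'n \<Rightarrow> complex" and \<alpha> v :: "real^'n"
 assumes \<alpha>v: "\<alpha> \<bullet> v = 1" and Q': "Q' \<in> sets borel" "\<And>q s. q + s *\<^sub>R \<alpha> \<in> Q' \<longleftrightarrow> q \<in> Q'"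
  and F: "F \<in> borel_measurable borel" "\<And>q s. F (q + s *\<^sub>R \<alpha>) = F q"
  and Q: "Q = {q\<in>Q'. 0 \<le> q \<bullet> v \<and> q \<bullet> v < 1}" "bounded Q" "\<And>q. q \<in> Q \<Longrightarrow> norm (F q) \<le> B"
 shows "(LINT q|lborel. indicator Q q * (exp (- (a * of_real (q \<bullet> v))) * F q)) = slab_factor a * (LINT q|lborel. indicator Q q * F q)"
proof -
 define I where "I = (indicator {0..<1} :: real \<Rightarrow> complex)"
 define K where "K = (\<lambda>q s. indicator Q q * (I (s + q \<bullet> v) * exp (- (a * of_real (s + q \<bullet> v)))) * F q)"
 define L where "L = (\<lambda>q s. indicator Q q * (exp (- (a * of_real (q \<bullet> v))) * F q) * I (q \<bullet> v - s))"
 have Im[measurable]: "I \<in> borel_measurable borel" unfolding I_def by measurable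
 have Qm[measurable]: "Q \<in> sets borel"
 proof -
  have "Q = Q' \<inter> {q. 0 \<le> q \<bullet> v} \<inter> {q. q \<bullet> v < 1}" using Q(1) by auto
  moreover have "{q. 0 \<le> q \<bullet> v} \<in> sets borel" "{q. q \<bullet> v < 1} \<in> sets borel"
   by (intro borel_closed closed_Collect_le borel_open open_Collect_less continuous_intros)+
  ultimately show ?thesis using Q'(1) by auto
 qed
 note [measurable] = F(1)
 have eb: "norm (exp (- (a * of_real x))) \<le> exp (norm a)" if "0 \<le> x" "x < 1" for x
 proof -
  have "norm (exp (- (a * of_real x))) \<le> exp (norm (- (a * of_real x)))" by (rule norm_exp)
  also have "\<dots> \<le> exp (norm a)" using that by (simp add: norm_mult mult_left_le)
  finally show ?thesis .
 qed
 have B0: "norm (F q) \<le> \<bar>B\<bar>" if "q \<in> Q" for q using Q(3)[OF that] by linarith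
 have Kint: "integrable (lborel \<Otimes>\<^sub>M lborel) (case_prod K)"
 proof (rule integrable_pair_bounded[OF _ Qm Q(2), where B = "exp (norm a) * \<bar>B\<bar>"])
  show "case_prod K \<in> borel_measurable (lborel \<Otimes>\<^sub>M lborel)" unfolding K_def by measurable
  fix q s
  show "norm (K q s) \<le> exp (norm a) * \<bar>B\<bar>"
  proof (cases "q \<in> Q \<and> 0 \<le> s + q \<bullet> v \<and> s + q \<bullet> v < 1")
   case True
   then show ?thesis unfolding K_def I_def using eb[of "s + q \<bullet> v"] B0[of q] by (simp add: norm_mult mult_mono)
  qed (auto simp: K_def I_def indicator_def)
  show "q \<in> Q \<and> \<bar>s\<bar> \<le> 1" if "K q s \<noteq> 0"
   using that Q(1) by (auto simp: K_def I_def indicator_def split: if_splits)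
 qed
 have Lint: "integrable (lborel \<Otimes>\<^sub>M lborel) (case_prod L)"
 proof (rule integrable_pair_bounded[OF _ Qm Q(2), where B = "exp (norm a) * \<bar>B\<bar>"])
  show "case_prod L \<in> borel_measurable (lborel \<Otimes>\<^sub>M lborel)" unfolding L_def by measurable
  fix q s
  show "norm (L q s) \<le> exp (norm a) * \<bar>B\<bar>"
  proof (cases "q \<in> Q")
   case True
   then have "norm (exp (- (a * of_real (q \<bullet> v)))) * norm (F q) \<le> exp (norm a) * \<bar>B\<bar>"
    using eb[of "q \<bullet> v"] B0 Q(1) by (intro mult_mono) auto
   then show ?thesis unfolding L_def I_def using True by (simp add: norm_mult indicator_def)
  qed (simp add: L_def)
  show "q \<in> Q \<and> \<bar>s\<bar> \<le> 1" if "L q s \<noteq> 0"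
   using that Q(1) by (auto simp: L_def I_def indicator_def split: if_splits)
 qed
 have Ks: "(LINT s|lborel. K q s) = slab_factor a * (indicator Q q * F q)" for q
 proof -
  have "slab_factor a = (LINT s|lborel. I (s + q \<bullet> v) * exp (- (a * of_real (s + q \<bullet> v))))"
   using lborel_integral_real_affine[of 1 "\<lambda>s. I s * exp (- (a * of_real s))" "q \<bullet> v"]
   by (simp add: slab_factor_def I_def add.commute)
  then show ?thesis by (simp add: K_def mult.commute mult.left_commute)
 qed
 have Ls: "(LINT s|lborel. L q s) = indicator Q q * (exp (- (a * of_real (q \<bullet> v))) * F q)" for q
 proof -
  have "(LINT s|lborel. I s) = 1"
  proof -
   have "I = (\<lambda>s. complex_of_real (indicator {0..<1} s))"
    by (auto simp: I_def indicator_def fun_eq_iff)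
   then have "(LINT s|lborel. I s) = (LINT s|lborel. complex_of_real (indicator {0..<1::real} s))" by (simp only:)
   also have "\<dots> = complex_of_real (LINT s|lborel. indicator {0..<1::real} s)" by (rule integral_complex_of_real)
   finally show ?thesis using measure_lborel_Ico[of 0 "1::real"] by simp
  qed
  then have "(LINT s|lborel. I (q \<bullet> v - s)) = 1"
   using lborel_integral_real_affine[of "-1" I "q \<bullet> v"] by simp
  then show ?thesis by (simp add: L_def)
 qed
 have KL: "(LINT q|lborel. K q s) = (LINT q|lborel. L q s)" for s
 proof -
  have "(\<lambda>q. K q s) \<in> borel_measurable borel" unfolding K_def by measurable
  from integral_shift[OF this, of "- s *\<^sub>R \<alpha>"]
  have "(LINT q|lborel. K q s) = (LINT q|lborel. K (q + - s *\<^sub>R \<alpha>) s)" by simp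
  also have "\<dots> = (LINT q|lborel. L q s)"
  proof (rule int_cong)
   fix q
   have v: "(q + - s *\<^sub>R \<alpha>) \<bullet> v = q \<bullet> v - s" using \<alpha>v by (simp add: inner_add_left inner_diff_left)
   \<comment> \<open>Both products say that \<open>q\<close> lies in \<open>Q'\<close> and that the
     two numbers \<open>q \<bullet> v\<close> and \<open>q \<bullet> v - s\<close> lie in the unit
     interval; only their roles are exchanged.\<close>
   have "(indicator Q (q + - s *\<^sub>R \<alpha>) :: complex) * I (q \<bullet> v) = indicator Q q * I (q \<bullet> v - s)"
    unfolding Q(1) I_def indicator_def mem_Collect_eq v Q'(2) by auto
   then show "K (q + - s *\<^sub>R \<alpha>) s = L q s"
    unfolding K_def L_def v F(2) by (simp add: mult.assoc[symmetric])
  qed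
  finally show ?thesis .
 qed
 have "slab_factor a * (LINT q|lborel. indicator Q q * F q) = (LINT q|lborel. LINT s|lborel. K q s)"
  unfolding Ks by simp
 also have "\<dots> = (LINT s|lborel. LINT q|lborel. K q s)" by (rule lborel_pair.Fubini_integral[OF Kint, symmetric])
 also have "\<dots> = (LINT s|lborel. LINT q|lborel. L q s)" unfolding KL ..
 also have "\<dots> = (LINT q|lborel. LINT s|lborel. L q s)" by (rule lborel_pair.Fubini_integral[OF Lint])
 also have "\<dots> = (LINT q|lborel. indicator Q q * (exp (- (a * of_real (q \<bullet> v))) * F q))" unfolding Ls ..
 finally show ?thesis ..
qed

section \<open>Lattices\<close>

text \<open>\<open>b\<close> is an integral basis of \<open>N\<close>, and its dual basis
  \<open>bs\<close> will be one of the dual lattice. Indexing by the coordinate type parametrizes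
  both lattices by \<open>int^'n\<close>.\<close>

locale lattice =
 fixes N :: "(real^'n) set" and b bs :: "'n \<Rightarrow> real^'n"
 assumes dual: "b i \<bullet> bs j = (if i = j then 1 else 0)"
  and expand: "x = (\<Sum>i\<in>UNIV. (x \<bullet> bs i) *\<^sub>R b i)"
  and N_eq: "N = {\<Sum>i\<in>UNIV. of_int (k $ i) *\<^sub>R b i | k :: int^'n. True}"

lemma lattice_exists:
 fixes N :: "(real^'n) set"
 assumes "is_lattice N" obtains b bs where "lattice N b bs"
proof -
 obtain S where S: "independent S" "span S = UNIV" "N = int_span S" using assms by (auto simp: is_lattice_def)
 have fin: "finite S" using S(1) by (rule independent_imp_finite)
 have "card S = CARD('n)" using dim_eq_card[of S UNIV] S by (simp add: dim_UNIV)
 then obtain h where h: "bij_betw h (UNIV :: 'n set) S" using finite_same_card_bij[of "UNIV :: 'n set" S] fin by auto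
 obtain dv where dv: "\<And>\<beta> \<gamma>. \<beta> \<in> S \<Longrightarrow> \<gamma> \<in> S \<Longrightarrow> \<beta> \<bullet> dv \<gamma> = (if \<beta> = \<gamma> then 1 else 0)"
  using dual_vectors[OF S(1)] by blast
 have hS: "h i \<in> S" for i using h by (auto simp: bij_betw_def)
 have inj: "h i = h j \<longleftrightarrow> i = j" for i j using h by (auto simp: bij_betw_def inj_eq)
 have "lattice N h (\<lambda>i. dv (h i))"
 proof
  show "h i \<bullet> dv (h j) = (if i = j then 1 else 0)" for i j using dv[OF hS hS] inj by simp
  show "x = (\<Sum>i\<in>UNIV. (x \<bullet> dv (h i)) *\<^sub>R h i)" for x
  proof -
   have "x = (\<Sum>\<beta>\<in>S. (x \<bullet> dv \<beta>) *\<^sub>R \<beta>)" by (rule dual_expand[OF S(1) dv]) (use S(2) in auto)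
   then show ?thesis using sum.reindex_bij_betw[OF h, of "\<lambda>\<beta>. (x \<bullet> dv \<beta>) *\<^sub>R \<beta>"] by simp
  qed
  have re: "(\<Sum>\<beta>\<in>S. of_int (c \<beta>) *\<^sub>R \<beta>) = (\<Sum>i\<in>UNIV. of_int (c (h i)) *\<^sub>R h i)" for c :: "real^'n \<Rightarrow> int"
   using sum.reindex_bij_betw[OF h, of "\<lambda>\<beta>. of_int (c \<beta>) *\<^sub>R \<beta>"] by simp
  have "N = {\<Sum>i\<in>UNIV. of_int (c (h i)) *\<^sub>R h i | c :: real^'n \<Rightarrow> int. True}"
   unfolding S(3) int_span_def re ..
  also have "\<dots> = {\<Sum>i\<in>UNIV. of_int (k $ i) *\<^sub>R h i | k :: int^'n. True}"
  proof safe
   fix c :: "real^'n \<Rightarrow> int"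
   show "\<exists>k::int^'n. (\<Sum>i\<in>UNIV. of_int (c (h i)) *\<^sub>R h i) = (\<Sum>i\<in>UNIV. of_int (k $ i) *\<^sub>R h i) \<and> True"
    by (intro exI[of _ "\<chi> i. c (h i)"]) simp
  next
   fix k :: "int^'n"
   show "\<exists>c :: real^'n \<Rightarrow> int. (\<Sum>i\<in>UNIV. of_int (k $ i) *\<^sub>R h i) = (\<Sum>i\<in>UNIV. of_int (c (h i)) *\<^sub>R h i) \<and> True"
    by (intro exI[of _ "\<lambda>\<beta>. k $ (inv h \<beta>)"]) (use inj in \<open>simp add: inv_f_f inj_def\<close>)
  qed
  finally show "N = {\<Sum>i\<in>UNIV. of_int (k $ i) *\<^sub>R h i | k :: int^'n. True}" .
 qed
 then show ?thesis by (rule that)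
qed

section \<open>The dual lattice, its fundamental domain and its characters\<close>

context lattice
begin

abbreviation M :: "(real^'n) set" where "M \<equiv> dual_lattice N"

definition nvec :: "int^'n \<Rightarrow> real^'n" where "nvec k = (\<Sum>i\<in>UNIV. of_int (k $ i) *\<^sub>R b i)"
definition mvec :: "int^'n \<Rightarrow> real^'n" where "mvec k = (\<Sum>i\<in>UNIV. of_int (k $ i) *\<^sub>R bs i)"

lemma inner_eqI: "(\<And>i. x \<bullet> b i = y \<bullet> b i) \<Longrightarrow> x = y"
proof -
 assume *: "\<And>i. x \<bullet> b i = y \<bullet> b i"
 have "x \<bullet> v = y \<bullet> v" for v
 proof -
  have "u \<bullet> v = (\<Sum>i\<in>UNIV. (v \<bullet> bs i) * (u \<bullet> b i))" for u
   by (subst expand[of v]) (simp add: inner_sum_right)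
  then show ?thesis by (simp add: *)
 qed
 then show ?thesis using vector_eq_rdot[of x y] by blast
qed

lemma expand': "x = (\<Sum>i\<in>UNIV. (x \<bullet> b i) *\<^sub>R bs i)"
 by (rule inner_eqI) (simp add: inner_sum_left dual inner_commute[of "bs _"] if_distrib cong: if_cong)

lemma nvec_inner: "nvec k \<bullet> bs i = of_int (k $ i)"
 by (simp add: nvec_def inner_sum_left dual if_distrib cong: if_cong)
lemma mvec_inner: "mvec k \<bullet> b i = of_int (k $ i)"
 by (simp add: mvec_def inner_sum_left dual inner_commute[of "bs _"] if_distrib cong: if_cong)

lemma nvec_bij: "bij_betw nvec UNIV N"
 unfolding bij_betw_def
proof
 show "inj nvec" by (rule injI) (metis nvec_inner of_int_eq_iff vec_eq_iff)
 show "range nvec = N" unfolding N_eq nvec_def by auto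
qed

lemma b_in_N: "b i \<in> N"
proof -
 have "nvec (axis i 1) = (\<Sum>j\<in>UNIV. if j = i then b i else 0)"
  unfolding nvec_def by (intro sum.cong) (auto simp: axis_def)
 then have "b i = nvec (axis i 1)" by simp
 then show ?thesis using nvec_bij by (auto simp: bij_betw_def)
qed

lemma M_iff: "m \<in> M \<longleftrightarrow> (\<forall>i. m \<bullet> b i \<in> \<int>)"
proof
 show "m \<in> M \<Longrightarrow> \<forall>i. m \<bullet> b i \<in> \<int>" using b_in_N by (auto simp: dual_lattice_def)
 assume "\<forall>i. m \<bullet> b i \<in> \<int>"
 then show "m \<in> M" unfolding dual_lattice_def N_eq by (auto simp: inner_sum_right intro!: Ints_sum)
qed

lemma mvec_bij: "bij_betw mvec UNIV M"
 unfolding bij_betw_def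
proof
 show "inj mvec" by (rule injI) (metis mvec_inner of_int_eq_iff vec_eq_iff)
 show "range mvec = M"
 proof safe
  fix k show "mvec k \<in> M" by (simp add: M_iff mvec_inner)
 next
  fix m assume "m \<in> M"
  then have "\<forall>i. \<exists>k::int. m \<bullet> b i = of_int k" by (auto simp: M_iff Ints_def)
  then obtain k where k: "\<And>i. m \<bullet> b i = of_int (k i)" by metis
  have "m = mvec (\<chi> i. k i)" by (rule inner_eqI) (simp add: mvec_inner k)
  then show "m \<in> range mvec" by blast
 qed
qed

lemma M_inner_N: "m \<in> M \<Longrightarrow> n \<in> N \<Longrightarrow> m \<bullet> n \<in> \<int>"
 by (auto simp: dual_lattice_def)
lemma M_0: "0 \<in> M" by (simp add: M_iff)
lemma M_add: "m \<in> M \<Longrightarrow> m' \<in> M \<Longrightarrow> m + m' \<in> M" by (simp add: M_iff inner_add_left)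
lemma M_diff: "m \<in> M \<Longrightarrow> m' \<in> M \<Longrightarrow> m - m' \<in> M" by (simp add: M_iff inner_diff_left)
lemma M_minus: "m \<in> M \<Longrightarrow> - m \<in> M" by (simp add: M_iff)
lemma M_scale_int: "m \<in> M \<Longrightarrow> of_int k *\<^sub>R m \<in> M" by (simp add: M_iff)
lemma M_sum: "(\<And>x. x \<in> A \<Longrightarrow> f x \<in> M) \<Longrightarrow> sum f A \<in> M"
 by (induction A rule: infinite_finite_induct) (auto intro: M_0 M_add)
lemma N_minus: "n \<in> N \<Longrightarrow> - n \<in> N"
proof -
 assume "n \<in> N"
 then obtain k where "n = nvec k" using nvec_bij by (auto simp: bij_betw_def)
 then have "- n = nvec (- k)" by (simp add: nvec_def sum_negf)
 then show ?thesis using nvec_bij by (auto simp: bij_betw_def)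
qed
lemma N_add: "n \<in> N \<Longrightarrow> n' \<in> N \<Longrightarrow> n + n' \<in> N"
proof -
 assume "n \<in> N" "n' \<in> N"
 then obtain k k' where "n = nvec k" "n' = nvec k'" using nvec_bij by (auto simp: bij_betw_def)
 then have "n + n' = nvec (k + k')" by (simp add: nvec_def sum.distrib scaleR_add_left)
 then show ?thesis using nvec_bij by (auto simp: bij_betw_def)
qed
lemma N_0: "0 \<in> N"
 using N_add[OF b_in_N[of undefined] N_minus[OF b_in_N[of undefined]]] by simp

lemma finite_int_box: "finite {k :: int^'n. \<forall>i. \<bar>k $ i\<bar> \<le> L i}"
proof -
 have "{k :: int^'n. \<forall>i. \<bar>k $ i\<bar> \<le> L i} \<subseteq> vec_lambda ` (PiE UNIV (\<lambda>i. {- L i..L i}))"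
 proof
  fix k :: "int^'n" assume "k \<in> {k. \<forall>i. \<bar>k $ i\<bar> \<le> L i}"
  then have "vec_nth k \<in> PiE UNIV (\<lambda>i. {- L i..L i})" by (auto simp: abs_le_iff) (metis minus_le_iff)
  then show "k \<in> vec_lambda ` (PiE UNIV (\<lambda>i. {- L i..L i}))" by (metis image_eqI vec_nth_inverse)
 qed
 then show ?thesis by (rule finite_subset) (intro finite_imageI finite_PiE, auto)
qed

lemma finite_M_ball: "finite {m\<in>M. norm m \<le> R}"
proof -
 have "{m\<in>M. norm m \<le> R} \<subseteq> mvec ` {k. \<forall>i. \<bar>k $ i\<bar> \<le> \<lceil>R * norm (b i)\<rceil>}"
 proof safe
  fix m assume m: "m \<in> M" "norm m \<le> R"
  then obtain k where k: "m = mvec k" using mvec_bij by (auto simp: bij_betw_def)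
  have "\<bar>k $ i\<bar> \<le> \<lceil>R * norm (b i)\<rceil>" for i
  proof -
   have "\<bar>m \<bullet> b i\<bar> \<le> norm m * norm (b i)" by (rule Cauchy_Schwarz_ineq2)
   also have "\<dots> \<le> R * norm (b i)" using m by (intro mult_right_mono) auto
   finally show ?thesis unfolding k mvec_inner by linarith
  qed
  then show "m \<in> mvec ` {k. \<forall>i. \<bar>k $ i\<bar> \<le> \<lceil>R * norm (b i)\<rceil>}" using k by auto
 qed
 then show ?thesis by (rule finite_subset) (intro finite_imageI finite_int_box)
qed

text \<open>The half-open fundamental cell of \<open>M\<close>, in the coordinates with respect to
  \<open>bs\<close>; \<open>fl\<close> gives the lattice part of a point.\<close>

definition C :: "(real^'n) set" where "C = {t. \<forall>i. 0 \<le> t \<bullet> b i \<and> t \<bullet> b i < 1}"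

definition fl :: "real^'n \<Rightarrow> real^'n" where "fl t = mvec (\<chi> i. \<lfloor>t \<bullet> b i\<rfloor>)"

lemma fl_M: "fl t \<in> M" using mvec_bij by (auto simp: fl_def bij_betw_def)
lemma fl_C: "t - fl t \<in> C"
 unfolding C_def fl_def
 by (simp add: inner_diff_left mvec_inner) linarith
lemma fl_unique: "m \<in> M \<Longrightarrow> t - m \<in> C \<Longrightarrow> m = fl t"
proof (rule inner_eqI)
 fix i assume m: "m \<in> M" "t - m \<in> C"
 then obtain k where k: "m = mvec k" using mvec_bij by (auto simp: bij_betw_def)
 have "0 \<le> t \<bullet> b i - of_int (k $ i)" "t \<bullet> b i - of_int (k $ i) < 1" using m(2) by (auto simp: C_def inner_diff_left k mvec_inner)
 then have "\<lfloor>t \<bullet> b i\<rfloor> = k $ i" by linarith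
 then show "m \<bullet> b i = fl t \<bullet> b i" by (simp add: k fl_def mvec_inner)
qed

lemma C_meas [measurable]: "C \<in> sets borel"
proof -
 have "C = (\<Inter>i. {t. 0 \<le> t \<bullet> b i} \<inter> {t. t \<bullet> b i < 1})" by (auto simp: C_def)
 moreover have "{t. 0 \<le> t \<bullet> b i} \<in> sets borel" "{t. t \<bullet> b i < 1} \<in> sets borel" for i
  by (intro borel_closed closed_Collect_le borel_open open_Collect_less continuous_intros)+
 ultimately show ?thesis by (auto intro!: sets.countable_INT'')
qed

lemma C_bounded: "bounded C"
 unfolding bounded_iff
proof (intro exI ballI)
 fix t assume t: "t \<in> C"
 have "norm t \<le> (\<Sum>i\<in>UNIV. norm ((t \<bullet> b i) *\<^sub>R bs i))" by (subst expand'[of t]) (rule norm_sum)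
 also have "\<dots> \<le> (\<Sum>i\<in>UNIV. norm (bs i))"
  using t by (intro sum_mono) (auto simp: C_def less_imp_le intro!: mult_left_le_one_le)
 finally show "norm t \<le> (\<Sum>i\<in>UNIV. norm (bs i))" .
qed

lemma bounded_indicator_integrable:
 fixes f :: "real^'n \<Rightarrow> complex"
 assumes "Q \<in> sets borel" "bounded Q" "f \<in> borel_measurable borel" "\<And>t. t \<in> Q \<Longrightarrow> norm (f t) \<le> B"
 shows "integrable lborel (\<lambda>t. indicator Q t * f t)"
proof (rule Bochner_Integration.integrable_bound)
 show "integrable lborel (\<lambda>t. indicator Q t * \<bar>B\<bar> :: real)"
  using assms(1,2) emeasure_bounded_finite[OF assms(2)] by (intro integrable_mult_left integrable_real_indicator) auto
 show "(\<lambda>t. indicator Q t * f t) \<in> borel_measurable lborel" using assms(1,3) by measurable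
 show "AE t in lborel. norm (indicator Q t * f t) \<le> norm (indicator Q t * \<bar>B\<bar>)"
 proof (intro AE_I2)
  fix t show "norm (indicator Q t * f t) \<le> norm (indicator Q t * \<bar>B\<bar>)"
   using assms(4)[of t] by (cases "t \<in> Q") auto
 qed
qed

definition vol :: "(real^'n) set \<Rightarrow> complex" where "vol Q = (LINT t|lborel. indicator Q t)"

lemma integrable_indicator_bounded: "Q \<in> sets borel \<Longrightarrow> bounded Q \<Longrightarrow> integrable lborel (indicator Q :: real^'n \<Rightarrow> complex)"
 using bounded_indicator_integrable[of Q "\<lambda>_. 1" 1] by simp

text \<open>The translates of \<open>C\<close> by \<open>M\<close> tile the space; only those
  indexed by the finite set \<open>F\<close> meet the points where \<open>g\<close> is nonzero, so
  the unfolding is a finite sum of shifts.\<close>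

lemma unfold_integral:
 fixes g :: "real^'n \<Rightarrow> complex"
 assumes "integrable lborel g" "finite F" "F \<subseteq> M" "\<And>t m. t \<in> C \<Longrightarrow> m \<in> M \<Longrightarrow> m \<notin> F \<Longrightarrow> g (t + m) = 0"
 shows "integral\<^sup>L lborel g = (LINT t|lborel. indicator C t * (\<Sum>m\<in>F. g (t + m)))"
proof -
 have gm: "g \<in> borel_measurable borel" using assms(1) by simp
 have eq: "g t = (\<Sum>m\<in>F. indicator C (t - m) * g t)" for t
 proof (cases "fl t \<in> F")
  case True
  have "(\<Sum>m\<in>F. indicator C (t - m) * g t) = (\<Sum>m\<in>F. if m = fl t then g t else 0)"
   using fl_unique fl_C assms(3) by (intro sum.cong) (auto simp: indicator_def)
  then show ?thesis using True assms(2) by simp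
 next
  case False
  have "g t = 0" using assms(4)[OF fl_C[of t] fl_M False] by simp
  then show ?thesis by simp
 qed
 have int: "integrable lborel (\<lambda>t. indicator C (t - m) * g t)" for m
 proof (rule Bochner_Integration.integrable_bound[OF assms(1)])
  have "(\<lambda>t. indicator C (t - m) :: complex) \<in> borel_measurable borel" by measurable
  then show "(\<lambda>t. indicator C (t - m) * g t) \<in> borel_measurable lborel" using gm by simp
  show "AE t in lborel. norm (indicator C (t - m) * g t) \<le> norm (g t)" by (auto simp: indicator_def)
 qed
 have meas: "(\<lambda>t. indicator C (t - m) * g t) \<in> borel_measurable borel" for m using int[of m] by simp
 have sh: "(LINT t|lborel. indicator C t * g (t + m)) = (LINT t|lborel. indicator C (t - m) * g t)" for m
  using integral_shift[OF meas[of m], of m] by simp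
 have int2: "integrable lborel (\<lambda>t. indicator C t * g (t + m))" for m
 proof -
  have "integrable (distr lborel borel ((+) m)) (\<lambda>t. indicator C (t - m) * g t)"
   using int[of m] by (simp add: lborel_distr_plus)
  then show ?thesis by (subst (asm) integrable_distr_eq) (use meas[of m] in \<open>simp_all add: add.commute\<close>)
 qed
 have "integral\<^sup>L lborel g = (LINT t|lborel. (\<Sum>m\<in>F. indicator C (t - m) * g t))" using eq by simp
 also have "\<dots> = (\<Sum>m\<in>F. LINT t|lborel. indicator C (t - m) * g t)" by (rule Bochner_Integration.integral_sum) (rule int)
 also have "\<dots> = (\<Sum>m\<in>F. LINT t|lborel. indicator C t * g (t + m))" by (simp add: sh)
 also have "\<dots> = (LINT t|lborel. (\<Sum>m\<in>F. indicator C t * g (t + m)))" by (rule Bochner_Integration.integral_sum[symmetric]) (rule int2)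
 finally show ?thesis by (simp add: sum_distrib_left)
qed

text \<open>For \<open>n\<close> in \<open>N\<close> these are the characters of the torus obtained
  by dividing by \<open>M\<close>.\<close>

definition ech :: "real^'n \<Rightarrow> real^'n \<Rightarrow> complex" where
 "ech n t = exp (2 * of_real pi * \<i> * of_real (t \<bullet> n))"

lemma ech_add: "ech (n + n') t = ech n t * ech n' t"
 by (simp add: ech_def inner_add_right exp_add[symmetric] algebra_simps)
lemma ech_add_left: "ech n (t + s) = ech n t * ech n s"
 by (simp add: ech_def inner_add_left exp_add[symmetric] algebra_simps)
lemma ech_0: "ech 0 t = 1" by (simp add: ech_def)
lemma norm_ech: "norm (ech n t) = 1"
 by (simp add: ech_def norm_exp_eq_Re)
lemma ech_cont: "continuous_on A (ech n)"
 unfolding ech_def by (intro continuous_intros)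
lemma ech_M: "n \<in> N \<Longrightarrow> m \<in> M \<Longrightarrow> ech n m = 1"
proof -
 assume "n \<in> N" "m \<in> M"
 then obtain k where "m \<bullet> n = of_int k" using M_inner_N Ints_cases by metis
 then show ?thesis unfolding ech_def by (simp add: exp_eq_1 algebra_simps)
qed
lemma ech_periodic: "n \<in> N \<Longrightarrow> m \<in> M \<Longrightarrow> ech n (t + m) = ech n t"
 by (simp add: ech_add_left ech_M)

text \<open>For \<open>n\<close> nonzero some coordinate \<open>k $ i\<close> is nonzero. Splitting
  off that coordinate by \<open>slab_average\<close> produces the slab factor of a nonzero multiple
  of \<open>2 * pi * \<i>\<close>, which vanishes; the rest of the character is invariant along
  \<open>bs i\<close>.\<close>

lemma ech_orthogonal: "n \<in> N \<Longrightarrow> (LINT t|lborel. indicator C t * ech n t) = (if n = 0 then vol C else 0)"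
proof (cases "n = 0")
 case False
 assume n: "n \<in> N"
 then obtain k where k: "n = nvec k" using nvec_bij by (auto simp: bij_betw_def)
 have "k \<noteq> 0" using False k by (auto simp: nvec_def)
 then obtain i where i: "k $ i \<noteq> 0" by (auto simp: vec_eq_iff)
 define a where "a = - (2 * of_real pi * \<i> * complex_of_int (k $ i))"
 define F where "F = ech (n - of_int (k $ i) *\<^sub>R b i)"
 define Q' where "Q' = (\<Inter>j\<in>-{i}. {t. 0 \<le> t \<bullet> b j} \<inter> {t. t \<bullet> b j < 1})"
 have o: "bs i \<bullet> b j = (if i = j then 1 else 0)" for j using dual[of j i] by (auto simp: inner_commute)
 have slab: "{t. 0 \<le> t \<bullet> b j} \<in> sets borel" "{t. t \<bullet> b j < 1} \<in> sets borel" for j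
  by (intro borel_closed closed_Collect_le borel_open open_Collect_less continuous_intros)+
 have "exp (- a) = 1" unfolding exp_eq_1 a_def by simp
 then have "slab_factor a = 0" using i by (subst slab_factor_eq) (auto simp: a_def)
 moreover have "(LINT t|lborel. indicator C t * (exp (- (a * of_real (t \<bullet> b i))) * F t)) = slab_factor a * (LINT t|lborel. indicator C t * F t)"
 proof (rule slab_average[where Q' = Q' and \<alpha> = "bs i" and B = 1])
  show "Q' \<in> sets borel" unfolding Q'_def using slab by (intro sets.countable_INT'') auto
  show "q + s *\<^sub>R bs i \<in> Q' \<longleftrightarrow> q \<in> Q'" for q s by (auto simp: Q'_def inner_add_left o)
  show "F \<in> borel_measurable borel" unfolding F_def by (rule borel_measurable_continuous_onI[OF ech_cont])
  show "F (q + s *\<^sub>R bs i) = F q" for q s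
   using nvec_inner[of k i] by (simp add: F_def ech_def inner_add_left inner_diff_right inner_commute[of "bs i"] dual k algebra_simps)
  show "C = {q \<in> Q'. 0 \<le> q \<bullet> b i \<and> q \<bullet> b i < 1}" by (auto simp: C_def Q'_def)
 qed (simp_all add: o C_bounded F_def norm_ech)
 moreover have "exp (- (a * of_real (t \<bullet> b i))) * F t = ech n t" for t
  unfolding F_def ech_def exp_add[symmetric] a_def by (simp add: inner_diff_right algebra_simps)
 ultimately show ?thesis using False by simp
qed (simp add: ech_0 vol_def)

end

text \<open>If the open set were null, the constants 1 and 0 would have the same integrals against
  test functions supported in it, hence the same value at \<open>t0\<close>.\<close>

lemma open_not_AE_avoided:
 fixes S :: "(real^'n) set"
 assumes "open S" "t0 \<in> S" "AE t in lborel. t \<notin> S"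
 shows False
proof -
 have "(1::complex) = 0"
 proof (rule test_fun_determines[OF assms(1) _ _ assms(2), of "\<lambda>_. 1" "\<lambda>_. 0"])
  fix \<psi> assume "test_fun S \<psi>"
  then obtain K where K: "K \<subseteq> S" "\<And>t. t \<notin> K \<Longrightarrow> \<psi> t = 0" by (rule test_fun_support) blast
  have "AE t in lborel. \<psi> t = 0" using assms(3) by (rule AE_mp) (use K in auto)
  then show "(LINT t|lborel. 1 * \<psi> t) = (LINT t|lborel. 0 * \<psi> t)" by (simp add: integral_eq_zero_AE)
 qed auto
 then show False by simp
qed

lemma dirD_eqI: "(u has_derivative D) (at x) \<Longrightarrow> dirD v u x = D v"
 unfolding dirD_def using frechet_derivative_at by metis

lemma pairing_lat_shift: "pairing t (lat_shift z n) = pairing t z + 2 * of_real pi * \<i> * of_real (t \<bullet> n)"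
 by (simp add: lat_shift_def pairing_add_right pairing_smult_right)

text \<open>The bound is exact for \<open>L = 0\<close> and telescopes: with
  \<open>x = L + 1\<close>, a step adds \<open>2 / x^2\<close>, at most
  \<open>4 / x - 4 / (x + 1)\<close>.\<close>

lemma inverse_square_sum: "(\<Sum>j\<in>{- int L..int L}. 1 / max 1 \<bar>real_of_int j\<bar> ^ 2) \<le> 5 - 4 / real (Suc L)"
proof (induction L)
 case (Suc L)
 have st: "{- int (Suc L)..int (Suc L)} = insert (int (Suc L)) (insert (- int (Suc L)) {- int L..int L})" by auto
 have mx: "1 / max 1 \<bar>real_of_int (int (Suc L))\<bar> ^ 2 = 1 / (real (Suc L))^2"
  "1 / max 1 \<bar>real_of_int (- int (Suc L))\<bar> ^ 2 = 1 / (real (Suc L))^2" by (simp_all add: max_def)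
 have "(\<Sum>j\<in>{- int (Suc L)..int (Suc L)}. 1 / max 1 \<bar>real_of_int j\<bar> ^ 2)
  = 1 / (real (Suc L))^2 + (1 / (real (Suc L))^2 + (\<Sum>j\<in>{- int L..int L}. 1 / max 1 \<bar>real_of_int j\<bar> ^ 2))"
  unfolding st by (subst sum.insert, simp, simp, subst sum.insert, simp, simp) (simp only: mx)
 also have "\<dots> \<le> 1 / (real (Suc L))^2 + (1 / (real (Suc L))^2 + (5 - 4 / real (Suc L)))" using Suc by simp
 also have "\<dots> \<le> 5 - 4 / real (Suc (Suc L))"
 proof -
  define x where "x = real (Suc L)"
  have x: "x \<ge> 1" by (simp add: x_def)
  have "1 / x\<^sup>2 \<le> 2 / (x * (x + 1))"
   using x by (simp add: power2_eq_square divide_simps)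
  also have "\<dots> = 2 * (1 / x) - 2 * (1 / (x + 1))" using x by (simp add: field_simps)
  finally have "1 / x\<^sup>2 \<le> 2 * (1 / x) - 2 * (1 / (x + 1))" .
  moreover have "4 / x = 4 * (1 / x)" "4 / (x + 1) = 4 * (1 / (x + 1))" by simp_all
  ultimately have "1 / x\<^sup>2 + (1 / x\<^sup>2 + (5 - 4 / x)) \<le> 5 - 4 / (x + 1)" by linarith
  then show ?thesis by (simp add: x_def add.commute)
 qed
 finally show ?case .
qed simp

text \<open>A finite set of indices lies in a cube, where the sum of products is a product of
  one-dimensional sums, each at most 5. The maximum with 1 takes care of vanishing
  coordinates.\<close>

lemma summable_inverse_squares:
 "(\<lambda>k::int^'n. \<Prod>i\<in>UNIV. 1 / max 1 \<bar>real_of_int (k $ i)\<bar> ^ 2) summable_on UNIV"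
proof (rule nonneg_bdd_above_summable_on)
 let ?f = "\<lambda>j::int. 1 / max 1 \<bar>real_of_int j\<bar> ^ 2"
 show "0 \<le> (\<Prod>i\<in>UNIV. ?f (k $ i))" for k :: "int^'n" by (intro prod_nonneg) auto
 show "bdd_above (sum (\<lambda>k::int^'n. \<Prod>i\<in>UNIV. ?f (k $ i)) ` {F. F \<subseteq> UNIV \<and> finite F})"
 proof (rule bdd_aboveI2)
  fix F :: "(int^'n) set" assume "F \<in> {F. F \<subseteq> UNIV \<and> finite F}"
  then have F: "finite F" by simp
  define L where "L = nat (\<Sum>k\<in>F. \<Sum>i\<in>UNIV. \<bar>k $ i\<bar>)"
  have Fs: "F \<subseteq> vec_lambda ` (PiE UNIV (\<lambda>i. {- int L..int L}))"
  proof
   fix k assume k: "k \<in> F"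
   have "\<bar>k $ i\<bar> \<le> int L" for i
   proof -
    have "\<bar>k $ i\<bar> \<le> (\<Sum>i\<in>UNIV. \<bar>k $ i\<bar>)" by (rule member_le_sum) auto
    also have "\<dots> \<le> (\<Sum>k\<in>F. \<Sum>i\<in>UNIV. \<bar>k $ i\<bar>)"
     using k F by (intro member_le_sum[of k F "\<lambda>k :: int^'n. \<Sum>i\<in>UNIV. \<bar>k $ i\<bar>"]) (auto intro: sum_nonneg)
    finally have "\<bar>k $ i\<bar> \<le> (\<Sum>k\<in>F. \<Sum>i\<in>UNIV. \<bar>k $ i\<bar>)" .
    moreover have "0 \<le> (\<Sum>k\<in>F. \<Sum>i\<in>UNIV. \<bar>k $ i\<bar>)" by (intro sum_nonneg) auto
    ultimately show ?thesis unfolding L_def by linarith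
   qed
   then have "vec_nth k \<in> PiE UNIV (\<lambda>i. {- int L..int L})" by (auto simp: abs_le_iff) (metis minus_le_iff)
   then show "k \<in> vec_lambda ` (PiE UNIV (\<lambda>i. {- int L..int L}))" by (metis image_eqI vec_nth_inverse)
  qed
  have inj: "inj_on vec_lambda (PiE UNIV (\<lambda>i::'n. {- int L..int L}))" by (auto simp: inj_on_def vec_lambda_inject)
  have "(\<Sum>k\<in>F. \<Prod>i\<in>UNIV. ?f (k $ i)) \<le> (\<Sum>k\<in>vec_lambda ` (PiE UNIV (\<lambda>i::'n. {- int L..int L})). \<Prod>i\<in>UNIV. ?f (k $ i))"
   by (rule sum_mono2[OF _ Fs]) (auto intro!: finite_imageI finite_PiE prod_nonneg)
  also have "\<dots> = (\<Sum>g\<in>PiE UNIV (\<lambda>i::'n. {- int L..int L}). \<Prod>i\<in>UNIV. ?f (g i))"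
   by (subst sum.reindex[OF inj]) simp
  also have "\<dots> = (\<Prod>i\<in>(UNIV::'n set). \<Sum>j\<in>{- int L..int L}. ?f j)"
   by (rule prod_sum_PiE[symmetric]) auto
  also have "\<dots> \<le> (\<Prod>i\<in>(UNIV::'n set). 5)"
  proof (rule prod_mono)
   have "5 - 4 / real (Suc L) \<le> 5" by simp
   then have "(\<Sum>j\<in>{- int L..int L}. ?f j) \<le> 5" using inverse_square_sum[of L] by (rule order_trans[rotated])
   then show "0 \<le> (\<Sum>j\<in>{- int L..int L}. ?f j) \<and> (\<Sum>j\<in>{- int L..int L}. ?f j) \<le> 5"
    by (auto intro!: sum_nonneg)
  qed
  finally show "(\<Sum>k\<in>F. \<Prod>i\<in>UNIV. ?f (k $ i)) \<le> (\<Prod>i\<in>(UNIV::'n set). 5)" .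
 qed
qed

context lattice
begin

section \<open>Fourier series on a lattice torus\<close>

lemma integrable_C:
 fixes h :: "real^'n \<Rightarrow> complex"
 assumes "continuous_on UNIV h" shows "integrable lborel (\<lambda>t. indicator C t * h t)"
 using continuous_bounded_on[OF assms C_bounded]
  bounded_indicator_integrable[OF C_meas C_bounded borel_measurable_continuous_onI[OF assms]] by blast

definition trigs :: "(real^'n \<Rightarrow> complex) set" where
 "trigs = {f. \<exists>l. snd ` set l \<subseteq> N \<and> f = (\<lambda>t. \<Sum>(c, n)\<leftarrow>l. c * ech n t)}"

lemma trigs_base: "n \<in> N \<Longrightarrow> (\<lambda>t. c * ech n t) \<in> trigs"
 unfolding trigs_def by (intro CollectI exI[of _ "[(c, n)]"]) auto

lemma trigs_add: "f \<in> trigs \<Longrightarrow> g \<in> trigs \<Longrightarrow> (\<lambda>t. f t + g t) \<in> trigs"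
proof -
 assume "f \<in> trigs" "g \<in> trigs"
 then obtain l l' where l: "snd ` set l \<subseteq> N" "f = (\<lambda>t. \<Sum>(c, n)\<leftarrow>l. c * ech n t)"
  "snd ` set l' \<subseteq> N" "g = (\<lambda>t. \<Sum>(c, n)\<leftarrow>l'. c * ech n t)"
  unfolding trigs_def by blast
 show ?thesis unfolding trigs_def by (intro CollectI exI[of _ "l @ l'"]) (use l in auto)
qed

lemma trigs_const: "(\<lambda>t. c) \<in> trigs"
 using trigs_base[OF N_0, of c] by (simp add: ech_0)

lemma trigs_induct [consumes 1, case_names zero step]:
 assumes "f \<in> trigs" "P (\<lambda>t. 0)" "\<And>c n f. n \<in> N \<Longrightarrow> f \<in> trigs \<Longrightarrow> P f \<Longrightarrow> P (\<lambda>t. c * ech n t + f t)"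
 shows "P f"
proof -
 obtain l where l: "snd ` set l \<subseteq> N" "f = (\<lambda>t. \<Sum>(c, n)\<leftarrow>l. c * ech n t)" using assms(1) unfolding trigs_def by blast
 have "snd ` set l \<subseteq> N \<Longrightarrow> P (\<lambda>t. \<Sum>(c, n)\<leftarrow>l. c * ech n t)"
 proof (induction l)
  case Nil then show ?case using assms(2) by simp
 next
  case (Cons x l)
  obtain c n where x: "x = (c, n)" by force
  have "P (\<lambda>t. c * ech n t + (\<Sum>(c, n)\<leftarrow>l. c * ech n t))"
   by (rule assms(3)) (use Cons x in \<open>auto simp: trigs_def\<close>)
  then show ?case by (simp add: x)
 qed
 then show ?thesis using l by simp
qed

lemma trigs_mult: assumes "f \<in> trigs" "g \<in> trigs" shows "(\<lambda>t. f t * g t) \<in> trigs"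
 using assms(1)
proof (induction rule: trigs_induct)
 case zero then show ?case using trigs_const[of 0] by simp
next
 case (step c n f)
 have "(\<lambda>t. c * ech n t * g t) \<in> trigs" using assms(2)
 proof (induction rule: trigs_induct)
  case zero then show ?case using trigs_const[of 0] by simp
 next
  case (step c' n' g)
  from trigs_add[OF trigs_base[OF N_add[OF \<open>n \<in> N\<close> step(1)], of "c * c'"] step(3)]
  show ?case by (simp add: ech_add algebra_simps)
 qed
 from trigs_add[OF this step(3)] show ?case by (simp add: algebra_simps)
qed

lemma trigs_cont: "f \<in> trigs \<Longrightarrow> continuous_on UNIV f"
 by (induction rule: trigs_induct) (auto intro!: continuous_intros ech_cont)

text \<open>The torus is mapped into a Euclidean space by the characters of the basis, so that
  Stone-Weierstrass for polynomial functions can be used; real polynomials in the coordinates pull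
  back to trigonometric ones.\<close>

definition zeta :: "real^'n \<Rightarrow> complex^'n" where "zeta t = (\<chi> i. ech (b i) t)"

lemma trigs_scale: "f \<in> trigs \<Longrightarrow> (\<lambda>t. c * f t) \<in> trigs"
 using trigs_mult[OF trigs_const] by simp

lemma trigs_sum: "(\<And>i. i \<in> A \<Longrightarrow> f i \<in> trigs) \<Longrightarrow> (\<lambda>t. \<Sum>i\<in>A. f i t) \<in> trigs"
 by (induction A rule: infinite_finite_induct) (auto intro: trigs_const trigs_add)

lemma ech_cnj: "cnj (ech n t) = ech (- n) t"
 by (simp add: ech_def exp_cnj)

lemma real_polynomial_trigs: "real_polynomial_function p \<Longrightarrow> (\<lambda>t. complex_of_real (p (zeta t))) \<in> trigs"
proof (induction rule: real_polynomial_function.induct)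
 case (linear p)
 have re: "(\<lambda>t. complex_of_real (Re (ech n t))) \<in> trigs" if "n \<in> N" for n
 proof -
  have "(\<lambda>t. (1/2) * ech n t + (1/2) * ech (- n) t) \<in> trigs" by (intro trigs_add trigs_base N_minus that)
  moreover have "complex_of_real (Re (ech n t)) = (1/2) * ech n t + (1/2) * ech (- n) t" for t
   unfolding ech_cnj[symmetric] by (simp add: complex_eq_iff)
  ultimately show ?thesis by simp
 qed
 have im: "(\<lambda>t. complex_of_real (Im (ech n t))) \<in> trigs" if "n \<in> N" for n
 proof -
  have "(\<lambda>t. (-\<i>/2) * ech n t + (\<i>/2) * ech (- n) t) \<in> trigs" by (intro trigs_add trigs_base N_minus that)
  moreover have "complex_of_real (Im (ech n t)) = (-\<i>/2) * ech n t + (\<i>/2) * ech (- n) t" for t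
   unfolding ech_cnj[symmetric] by (simp add: complex_eq_iff)
  ultimately show ?thesis by simp
 qed
 have lin: "linear p" using linear by (rule bounded_linear.linear)
 have px: "p y = (\<Sum>i\<in>UNIV. Re (y $ i) * p (axis i 1) + Im (y $ i) * p (axis i \<i>))" for y
 proof -
  have "y = (\<Sum>i\<in>UNIV. Re (y $ i) *\<^sub>R axis i 1 + Im (y $ i) *\<^sub>R axis i \<i>)"
  proof (rule vec_eq_iff[THEN iffD2], rule allI)
   fix j
   have "(\<Sum>i\<in>UNIV. Re (y $ i) *\<^sub>R axis i 1 + Im (y $ i) *\<^sub>R axis i \<i>) $ j = (\<Sum>i\<in>UNIV. if i = j then y $ j else 0)"
    unfolding sum_component by (intro sum.cong) (auto simp: axis_def complex_eq_iff)
   then show "y $ j = (\<Sum>i\<in>UNIV. Re (y $ i) *\<^sub>R axis i 1 + Im (y $ i) *\<^sub>R axis i \<i>) $ j" by simp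
  qed
  then have "p y = p (\<Sum>i\<in>UNIV. Re (y $ i) *\<^sub>R axis i 1 + Im (y $ i) *\<^sub>R axis i \<i>)" by simp
  then show ?thesis by (simp add: linear_sum[OF lin] linear_add[OF lin] linear_cmul[OF lin])
 qed
 have "(\<lambda>t. \<Sum>i\<in>UNIV. of_real (p (axis i 1)) * of_real (Re (ech (b i) t)) + of_real (p (axis i \<i>)) * of_real (Im (ech (b i) t))) \<in> trigs"
  by (intro trigs_sum trigs_add trigs_scale re im b_in_N)
 moreover have "complex_of_real (p (zeta t)) = (\<Sum>i\<in>UNIV. of_real (p (axis i 1)) * of_real (Re (ech (b i) t)) + of_real (p (axis i \<i>)) * of_real (Im (ech (b i) t)))" for t
  by (subst px) (simp add: zeta_def mult.commute)
 ultimately show ?case by simp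
next
 case (const c) show ?case by (rule trigs_const)
next
 case (add f g) then show ?case by (simp add: trigs_add)
next
 case (mult f g) then show ?case by (simp add: trigs_mult)
qed

lemma polynomial_trigs:
 fixes p :: "complex^'n \<Rightarrow> complex"
 assumes "polynomial_function p" shows "(\<lambda>t. p (zeta t)) \<in> trigs"
proof -
 have "real_polynomial_function (Re \<circ> p)" "real_polynomial_function (Im \<circ> p)"
  using assms bounded_linear_Re bounded_linear_Im unfolding polynomial_function_def by blast+
 from this[THEN real_polynomial_trigs]
 have "(\<lambda>t. complex_of_real (Re (p (zeta t))) + \<i> * complex_of_real (Im (p (zeta t)))) \<in> trigs"
  by (intro trigs_add trigs_scale) (simp_all add: o_def)
 then show ?thesis by (simp add: complex_eq[symmetric])
qed

lemma ech_eqD: "ech n t = ech n s \<Longrightarrow> (t - s) \<bullet> n \<in> \<int>"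
proof -
 assume "ech n t = ech n s"
 then have "ech n (t - s) * ech n s = 1 * ech n s" by (simp add: ech_add_left[symmetric])
 moreover have "ech n s \<noteq> 0" by (simp add: ech_def)
 ultimately have "ech n (t - s) = 1" by simp
 then obtain k :: int where "2 * pi * ((t - s) \<bullet> n) = of_int (2 * k) * pi"
  unfolding ech_def exp_eq_1 by auto
 then have "(t - s) \<bullet> n = of_int k" by simp
 then show ?thesis by simp
qed

lemma zeta_eqD: "zeta t = zeta s \<Longrightarrow> t - s \<in> M"
 unfolding M_iff zeta_def vec_eq_iff using ech_eqD by simp

lemma zeta_cont: "continuous_on A zeta"
 unfolding zeta_def by (intro continuous_on_vec_lambda ech_cont)

text \<open>By periodicity \<open>D\<close> factors through \<open>zeta\<close> as \<open>E\<close>.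
  On the compact image of the closed cell \<open>E\<close> is continuous, since preimages of closed
  sets are images of compact sets; a polynomial approximation of \<open>E\<close> is pulled
  back.\<close>

lemma periodic_approx:
 fixes D :: "real^'n \<Rightarrow> complex"
 assumes "continuous_on UNIV D" "\<And>t m. m \<in> M \<Longrightarrow> D (t + m) = D t" "\<epsilon> > 0"
 obtains f where "f \<in> trigs" "\<And>t. t \<in> C \<Longrightarrow> norm (D t - f t) < \<epsilon>"
proof -
 define T where "T = zeta ` closure C"
 have cC: "compact (closure C)" using C_bounded by (simp add: compact_closure)
 then have cT: "compact T" unfolding T_def using zeta_cont by (rule compact_continuous_image[rotated])
 define E where "E y = D (SOME t. t \<in> closure C \<and> zeta t = y)" for y
 have E: "E (zeta t) = D t" if "t \<in> closure C" for t
 proof -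
  define s where "s = (SOME s. s \<in> closure C \<and> zeta s = zeta t)"
  have "s \<in> closure C \<and> zeta s = zeta t" unfolding s_def by (rule someI[of _ t]) (use that in auto)
  then have "D (t + (s - t)) = D t" using zeta_eqD by (intro assms(2)) auto
  then show ?thesis by (simp add: E_def s_def[symmetric])
 qed
 have "continuous_on T E"
  unfolding continuous_on_closed_vimage[OF compact_imp_closed[OF cT]]
 proof (intro allI impI)
  fix B :: "complex set" assume B: "closed B"
  have "E -` B \<inter> T = zeta ` (D -` B \<inter> closure C)" using E by (auto simp: T_def)
  moreover have "closed (D -` B)" using B assms(1) by (simp add: continuous_on_closed_vimage[of UNIV] closed_vimage)
  then have "compact (D -` B \<inter> closure C)" using cC by (simp add: closed_Int_compact)
  then have "compact (zeta ` (D -` B \<inter> closure C))" using zeta_cont by (rule compact_continuous_image[rotated])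
  ultimately show "closed (E -` B \<inter> T)" by (simp add: compact_imp_closed)
 qed
 from Stone_Weierstrass_polynomial_function[OF cT this assms(3)]
 obtain p where p: "polynomial_function p" "\<forall>y\<in>T. norm (E y - p y) < \<epsilon>" by (elim exE conjE)
 show ?thesis
 proof (rule that[OF polynomial_trigs[OF p(1)]])
  fix t assume "t \<in> C"
  then have "t \<in> closure C" using closure_subset by blast
  then show "norm (D t - p (zeta t)) < \<epsilon>" using bspec[OF p(2), of "zeta t"] E by (auto simp: T_def)
 qed
qed

lemma C_open_part: "open {t. \<forall>i. 0 < t \<bullet> b i \<and> t \<bullet> b i < 1}"
proof -
 have "{t. \<forall>i. 0 < t \<bullet> b i \<and> t \<bullet> b i < 1} = (\<Inter>i. {t. 0 < t \<bullet> b i} \<inter> {t. t \<bullet> b i < 1})" by auto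
 moreover have "open ({t. 0 < t \<bullet> b i} \<inter> {t. t \<bullet> b i < 1})" for i
  by (intro open_Int open_Collect_less continuous_intros)
 ultimately show ?thesis by (auto intro!: open_INT)
qed

lemma C_open_part_subset: "{t. \<forall>i. 0 < t \<bullet> b i \<and> t \<bullet> b i < 1} \<subseteq> C"
 unfolding C_def using less_imp_le by blast

text \<open>Approximating the conjugate of the function by trigonometric polynomials bounds its
  squared norm over \<open>C\<close> by an arbitrarily small multiple of its integral norm. So it is
  zero almost everywhere on \<open>C\<close>, and by continuity at all interior points.\<close>

lemma fourier_unique:
 fixes D :: "real^'n \<Rightarrow> complex"
 assumes "continuous_on UNIV D" "\<And>t m. m \<in> M \<Longrightarrow> D (t + m) = D t"
  "\<And>n. n \<in> N \<Longrightarrow> (LINT t|lborel. indicator C t * (D t * ech n t)) = 0"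
 shows "D t0 = 0"
proof -
 have main: "E p = 0" if E: "continuous_on UNIV E" "\<And>t m. m \<in> M \<Longrightarrow> E (t + m) = E t"
  "\<And>n. n \<in> N \<Longrightarrow> (LINT t|lborel. indicator C t * (E t * ech n t)) = 0"
  and p: "p \<in> {t. \<forall>i. 0 < t \<bullet> b i \<and> t \<bullet> b i < 1}" for E :: "real^'n \<Rightarrow> complex" and p
 proof (rule ccontr)
  assume Ep: "E p \<noteq> 0"
  have zero: "(LINT t|lborel. indicator C t * (E t * f t)) = 0" if "f \<in> trigs" for f using that
  proof (induction rule: trigs_induct)
   case (step c n f)
   have i1: "integrable lborel (\<lambda>t. indicator C t * (E t * ech n t))" by (intro integrable_C continuous_on_mult E(1) ech_cont)
   have i2: "integrable lborel (\<lambda>t. indicator C t * (E t * f t))" by (intro integrable_C continuous_on_mult E(1) trigs_cont step)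
   have "(\<lambda>t. indicator C t * (E t * (c * ech n t + f t))) = (\<lambda>t. c * (indicator C t * (E t * ech n t)) + indicator C t * (E t * f t))"
    by (simp add: algebra_simps)
   then show ?case using i1 i2 E(3)[OF step(1)] step(3) by simp
  qed simp
  have cE: "continuous_on UNIV (\<lambda>t. cnj (E t))" by (intro continuous_intros E(1))
  define I where "I = (LINT t|lborel. norm (indicator C t * E t))"
  define J where "J = (LINT t|lborel. indicator C t * (norm (E t))\<^sup>2)"
  have iE: "integrable lborel (\<lambda>t. indicator C t * E t)" by (rule integrable_C[OF E(1)])
  have iEE: "integrable lborel (\<lambda>t. indicator C t * (E t * cnj (E t)))" by (intro integrable_C continuous_on_mult E(1) cE)
  have eqEE: "indicator C t * (E t * cnj (E t)) = complex_of_real (indicator C t * (norm (E t))\<^sup>2)" for t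
   using complex_norm_square[of "E t"] by (cases "t \<in> C") simp_all
  have iJ: "integrable lborel (\<lambda>t. indicator C t * (norm (E t))\<^sup>2)"
   using iEE unfolding eqEE complex_of_real_integrable_eq .
  have JJ: "(LINT t|lborel. indicator C t * (E t * cnj (E t))) = complex_of_real J"
   unfolding eqEE J_def by (rule integral_complex_of_real)
  have "J \<le> \<epsilon> * I" if e: "\<epsilon> > 0" for \<epsilon>
  proof -
   obtain f where f: "f \<in> trigs" "\<And>t. t \<in> C \<Longrightarrow> norm (cnj (E t) - f t) < \<epsilon>"
    using periodic_approx[OF cE _ e] E(2) by auto
   have if1: "integrable lborel (\<lambda>t. indicator C t * (E t * f t))" by (intro integrable_C continuous_on_mult E(1) trigs_cont f)
   have "complex_of_real J = (LINT t|lborel. indicator C t * (E t * cnj (E t)) - indicator C t * (E t * f t))"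
    using iEE if1 zero[OF f(1)] JJ by simp
   also have "norm \<dots> \<le> (LINT t|lborel. \<epsilon> * norm (indicator C t * E t))"
   proof (rule Bochner_Integration.integral_norm_bound_integral)
    show "integrable lborel (\<lambda>t. indicator C t * (E t * cnj (E t)) - indicator C t * (E t * f t))" using iEE if1 by simp
    show "integrable lborel (\<lambda>t. \<epsilon> * norm (indicator C t * E t))" using iE by simp
    fix t
    have eq: "indicator C t * (E t * cnj (E t)) - indicator C t * (E t * f t) = (indicator C t * E t) * (cnj (E t) - f t)"
     by (simp add: algebra_simps)
    show "norm (indicator C t * (E t * cnj (E t)) - indicator C t * (E t * f t)) \<le> \<epsilon> * norm (indicator C t * E t)"
    proof (cases "t \<in> C")
     case True
     have "norm (E t) * norm (cnj (E t) - f t) \<le> norm (E t) * \<epsilon>" using f(2)[OF True] by (intro mult_left_mono) auto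
     then show ?thesis unfolding eq using True by (simp add: norm_mult mult.commute)
    qed simp
   qed
   also have "\<dots> = \<epsilon> * I" unfolding I_def by simp
   finally show ?thesis by simp
  qed
  note le = this
  have I0: "I \<ge> 0" unfolding I_def by simp
  have "J \<le> 0"
  proof (rule field_le_epsilon)
   fix e :: real assume "e > 0"
   then have "J \<le> e / (I + 1) * I" using I0 by (intro le) auto
   also have "\<dots> \<le> e" using I0 \<open>e > 0\<close> by (simp add: field_simps)
   finally show "J \<le> 0 + e" by simp
  qed
  moreover have "J \<ge> 0" unfolding J_def by simp
  ultimately have "J = 0" by simp
  then have ae: "AE t in lborel. indicator C t * (norm (E t))\<^sup>2 = (0::real)"
   unfolding J_def using integral_nonneg_eq_0_iff_AE[OF iJ] by simp
  define S where "S = {t. \<forall>i. 0 < t \<bullet> b i \<and> t \<bullet> b i < 1} \<inter> E -` (- {0})"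
  have "open (E -` (- {0}))" using E(1) by (intro open_vimage) auto
  then have "open S" unfolding S_def using C_open_part by (rule open_Int[rotated])
  moreover have "p \<in> S" using p Ep by (simp add: S_def)
  moreover have "AE t in lborel. t \<notin> S"
   using ae
  proof (rule AE_mp, intro AE_I2 impI notI)
   fix t assume t: "indicator C t * (norm (E t))\<^sup>2 = (0::real)" "t \<in> S"
   then have "t \<in> C" "E t \<noteq> 0" using C_open_part_subset by (auto simp: S_def)
   then show False using t(1) by simp
  qed
  ultimately show False by (rule open_not_AE_avoided)
 qed
 \<comment> \<open>The centre of the cell. The segment from a point of \<open>C\<close> to the
   centre enters the interior at once, so continuity also reaches the boundary points.\<close>
 define p where "p = (\<Sum>i\<in>UNIV. (1/2) *\<^sub>R bs i)"
 have pb: "p \<bullet> b i = 1 / 2" for i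
  by (simp add: p_def inner_sum_left dual inner_commute[of "bs _"] if_distrib cong: if_cong)
 define q where "q = t0 - fl t0"
 have q: "0 \<le> q \<bullet> b i" "q \<bullet> b i < 1" for i using fl_C[of t0] by (auto simp: C_def q_def)
 have zero: "D ((1 - s) *\<^sub>R q + s *\<^sub>R p) = 0" if s: "s \<in> {0<..1}" for s :: real
 proof (rule main[OF assms])
  have "0 < (1 - s) * (q \<bullet> b i) + s / 2 \<and> (1 - s) * (q \<bullet> b i) + s / 2 < 1" for i
  proof -
   have "0 \<le> (1 - s) * (q \<bullet> b i)" "(1 - s) * (q \<bullet> b i) \<le> (1 - s) * 1"
    using s q[of i] mult_left_mono[of "q \<bullet> b i" 1 "1 - s"] by simp_all
   then show ?thesis using s by auto
  qed
  then show "(1 - s) *\<^sub>R q + s *\<^sub>R p \<in> {t. \<forall>i. 0 < t \<bullet> b i \<and> t \<bullet> b i < 1}" by (simp add: inner_add_left pb)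
 qed
 have "continuous_on (closure {0<..1}) (\<lambda>s::real. D ((1 - s) *\<^sub>R q + s *\<^sub>R p))"
  by (rule continuous_on_compose2[OF assms(1)]) (auto intro!: continuous_intros)
 from continuous_constant_on_closure[OF this zero, of 0] have "D q = 0" by simp
 then show ?thesis using assms(2)[OF fl_M[of t0], of q] by (simp add: q_def)
qed

lemma vol_C_nonzero: "vol C \<noteq> 0"
proof
 assume "vol C = 0"
 moreover have "vol C = complex_of_real (LINT t|lborel. indicator C t)"
 proof -
  have "vol C = (LINT t|lborel. complex_of_real (indicator C t))"
   unfolding vol_def by (intro Bochner_Integration.integral_cong refl) (simp add: indicator_def)
  also have "\<dots> = complex_of_real (LINT t|lborel. indicator C t)" by (rule integral_complex_of_real)
  finally show ?thesis .
 qed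
 ultimately have "complex_of_real (LINT t|lborel. indicator C t) = 0" by (simp only:)
 then have "(LINT t|lborel. indicator C t :: real) = 0" by (simp only: of_real_eq_0_iff)
 moreover have "integrable lborel (indicator C :: real^'n \<Rightarrow> real)"
  using C_bounded emeasure_bounded_finite by (intro integrable_real_indicator) auto
 ultimately have "AE t in lborel. indicator C t = (0::real)"
  using integral_nonneg_eq_0_iff_AE[of lborel "indicator C :: real^'n \<Rightarrow> real"] by simp
 then have "AE t in lborel. t \<notin> {t. \<forall>i. 0 < t \<bullet> b i \<and> t \<bullet> b i < 1}"
 proof (rule AE_mp, intro AE_I2 impI notI)
  fix t assume t: "indicator C t = (0::real)" "t \<in> {t. \<forall>i. 0 < t \<bullet> b i \<and> t \<bullet> b i < 1}"
  then have "t \<in> C" using C_open_part_subset by blast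
  then show False using t(1) by simp
 qed
 moreover have "(\<Sum>i\<in>UNIV. (1/2) *\<^sub>R bs i) \<bullet> b i = 1 / 2" for i
  by (simp add: inner_sum_left dual inner_commute[of "bs _"] if_distrib cong: if_cong)
 then have "(\<Sum>i\<in>UNIV. (1/2) *\<^sub>R bs i) \<in> {t. \<forall>i. 0 < t \<bullet> b i \<and> t \<bullet> b i < 1}" by (simp only: mem_Collect_eq) simp
 ultimately show False using open_not_AE_avoided[OF C_open_part] by blast
qed

end

section \<open>Half-open boxes spanned by a basis\<close>

locale dual_basis =
 fixes \<sigma> :: "(real^'n) set" and dv :: "real^'n \<Rightarrow> real^'n"
 assumes ind: "independent \<sigma>" and sp: "span \<sigma> = UNIV"
  and dv: "\<And>\<alpha> \<beta>. \<alpha> \<in> \<sigma> \<Longrightarrow> \<beta> \<in> \<sigma> \<Longrightarrow> \<alpha> \<bullet> dv \<beta> = (if \<alpha> = \<beta> then 1 else 0)"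
begin

lemma fin: "finite \<sigma>" using ind by (rule independent_imp_finite)

lemma dv_expand: "x = (\<Sum>\<alpha>\<in>\<sigma>. (x \<bullet> dv \<alpha>) *\<^sub>R \<alpha>)"
 by (rule dual_expand[OF ind dv]) (use sp in auto)

lemma dv_sum: "\<beta> \<in> \<sigma> \<Longrightarrow> (\<Sum>\<alpha>\<in>\<sigma>. u \<alpha> *\<^sub>R \<alpha>) \<bullet> dv \<beta> = u \<beta>"
proof -
 assume b: "\<beta> \<in> \<sigma>"
 have "(\<Sum>\<alpha>\<in>\<sigma>. u \<alpha> *\<^sub>R \<alpha>) \<bullet> dv \<beta> = (\<Sum>\<alpha>\<in>\<sigma>. if \<alpha> = \<beta> then u \<alpha> else 0)"
  unfolding inner_sum_left using b dv by (intro sum.cong) auto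
 then show ?thesis using b fin by simp
qed

lemma dv_eqI: "(\<And>\<alpha>. \<alpha> \<in> \<sigma> \<Longrightarrow> x \<bullet> dv \<alpha> = y \<bullet> dv \<alpha>) \<Longrightarrow> x = y"
 using dv_expand[of x] dv_expand[of y] by simp

lemma Q_box_iff: "q \<in> Q_box \<sigma> \<longleftrightarrow> (\<forall>\<alpha>\<in>\<sigma>. 0 \<le> q \<bullet> dv \<alpha> \<and> q \<bullet> dv \<alpha> < 1)"
proof
 assume "q \<in> Q_box \<sigma>"
 then show "\<forall>\<alpha>\<in>\<sigma>. 0 \<le> q \<bullet> dv \<alpha> \<and> q \<bullet> dv \<alpha> < 1" by (auto simp: Q_box_def dv_sum)
next
 assume "\<forall>\<alpha>\<in>\<sigma>. 0 \<le> q \<bullet> dv \<alpha> \<and> q \<bullet> dv \<alpha> < 1"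
 then show "q \<in> Q_box \<sigma>" unfolding Q_box_def
  by (intro CollectI exI[of _ "\<lambda>\<alpha>. q \<bullet> dv \<alpha>"]) (simp flip: dv_expand)
qed

lemma int_span_iff: "x \<in> int_span \<sigma> \<longleftrightarrow> (\<forall>\<alpha>\<in>\<sigma>. x \<bullet> dv \<alpha> \<in> \<int>)"
proof
 assume "x \<in> int_span \<sigma>"
 then show "\<forall>\<alpha>\<in>\<sigma>. x \<bullet> dv \<alpha> \<in> \<int>" by (auto simp: int_span_def dv_sum)
next
 assume "\<forall>\<alpha>\<in>\<sigma>. x \<bullet> dv \<alpha> \<in> \<int>"
 then have "x = (\<Sum>\<alpha>\<in>\<sigma>. of_int \<lfloor>x \<bullet> dv \<alpha>\<rfloor> *\<^sub>R \<alpha>)"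
  by (subst dv_expand[of x]) (intro sum.cong refl, auto simp: of_int_floor_cancel)
 then show "x \<in> int_span \<sigma>" unfolding int_span_def
  by (intro CollectI exI[of _ "\<lambda>\<alpha>. \<lfloor>x \<bullet> dv \<alpha>\<rfloor>"] conjI TrueI)
qed

lemma Q_box_bounded: "bounded (Q_box \<sigma>)"
 unfolding bounded_iff
proof (intro exI ballI)
 fix t assume t: "t \<in> Q_box \<sigma>"
 have "norm t \<le> (\<Sum>\<alpha>\<in>\<sigma>. norm ((t \<bullet> dv \<alpha>) *\<^sub>R \<alpha>))" by (subst dv_expand[of t]) (rule norm_sum)
 also have "\<dots> \<le> (\<Sum>\<alpha>\<in>\<sigma>. norm \<alpha>)"
  using t by (intro sum_mono) (auto simp: Q_box_iff less_imp_le intro!: mult_left_le_one_le)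
 finally show "norm t \<le> (\<Sum>\<alpha>\<in>\<sigma>. norm \<alpha>)" .
qed

lemma slab_meas: "{q. 0 \<le> q \<bullet> v \<and> q \<bullet> v < 1} \<in> sets borel" for v :: "real^'n"
proof -
 have "{q. 0 \<le> q \<bullet> v \<and> q \<bullet> v < 1} = {q. 0 \<le> q \<bullet> v} \<inter> {q. q \<bullet> v < 1}" by auto
 moreover have "{q. 0 \<le> q \<bullet> v} \<in> sets borel" "{q. q \<bullet> v < 1} \<in> sets borel"
  by (intro borel_closed closed_Collect_le borel_open open_Collect_less continuous_intros)+
 ultimately show ?thesis by auto
qed

lemma slabs_meas: "A \<subseteq> \<sigma> \<Longrightarrow> {q. \<forall>\<alpha>\<in>A. 0 \<le> q \<bullet> dv \<alpha> \<and> q \<bullet> dv \<alpha> < 1} \<in> sets borel"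
proof -
 assume "A \<subseteq> \<sigma>"
 then have fA: "finite A" using fin finite_subset by blast
 have "{q. \<forall>\<alpha>\<in>A. 0 \<le> q \<bullet> dv \<alpha> \<and> q \<bullet> dv \<alpha> < 1} = (\<Inter>\<alpha>\<in>A. {q. 0 \<le> q \<bullet> dv \<alpha> \<and> q \<bullet> dv \<alpha> < 1})" by auto
 then show ?thesis using fA slab_meas by (cases "A = {}") (auto intro!: sets.finite_INT)
qed

lemma Q_box_meas [measurable]: "Q_box \<sigma> \<in> sets borel"
proof -
 have "Q_box \<sigma> = {q. \<forall>\<alpha>\<in>\<sigma>. 0 \<le> q \<bullet> dv \<alpha> \<and> q \<bullet> dv \<alpha> < 1}" using Q_box_iff by auto
 then show ?thesis using slabs_meas[of \<sigma>] by simp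
qed

text \<open>Coordinates are split off one at a time; the exponential of those already treated is
  invariant along the next basis vector. The volume of the box remains as a factor, so no
  determinant is computed.\<close>

lemma box_integral:
 fixes a :: "real^'n \<Rightarrow> complex"
 assumes "\<And>\<alpha>. \<alpha> \<in> \<sigma> \<Longrightarrow> a \<alpha> \<noteq> 0"
 shows "(LINT q|lborel. indicator (Q_box \<sigma>) q * exp (- (\<Sum>\<alpha>\<in>\<sigma>. a \<alpha> * of_real (q \<bullet> dv \<alpha>))))
  = (\<Prod>\<alpha>\<in>\<sigma>. (1 - exp (- a \<alpha>)) / a \<alpha>) * (LINT q|lborel. indicator (Q_box \<sigma>) q)"
proof -
 have "(LINT q|lborel. indicator (Q_box \<sigma>) q * exp (- (\<Sum>\<alpha>\<in>A. a \<alpha> * of_real (q \<bullet> dv \<alpha>))))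
  = (\<Prod>\<alpha>\<in>A. (1 - exp (- a \<alpha>)) / a \<alpha>) * (LINT q|lborel. indicator (Q_box \<sigma>) q)"
  if "finite A" "A \<subseteq> \<sigma>" for A
  using that
 proof (induction A rule: finite_induct)
  case (insert \<beta> A)
  have b: "\<beta> \<in> \<sigma>" and A: "A \<subseteq> \<sigma>" using insert by auto
  define F where "F = (\<lambda>q. exp (- (\<Sum>\<alpha>\<in>A. a \<alpha> * of_real (q \<bullet> dv \<alpha>))))"
  define Q' where "Q' = {q. \<forall>\<alpha>\<in>\<sigma>-{\<beta>}. 0 \<le> q \<bullet> dv \<alpha> \<and> q \<bullet> dv \<alpha> < 1}"
  have inv: "(q + s *\<^sub>R \<beta>) \<bullet> dv \<alpha> = q \<bullet> dv \<alpha>" if "\<alpha> \<in> \<sigma>" "\<alpha> \<noteq> \<beta>" for q s \<alpha>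
   using dv[OF b that(1)] that(2) by (auto simp: inner_add_left)
  have Fcont: "continuous_on UNIV F" unfolding F_def
   by (intro continuous_on_exp continuous_on_minus continuous_on_sum continuous_on_mult continuous_on_const
    continuous_on_of_real continuous_on_inner continuous_on_id)
  have "compact (F ` closure (Q_box \<sigma>))"
   using Q_box_bounded Fcont continuous_on_subset by (blast intro: compact_continuous_image compact_closure[THEN iffD2])
  then obtain B where B: "\<And>q. q \<in> closure (Q_box \<sigma>) \<Longrightarrow> norm (F q) \<le> B"
   using compact_imp_bounded bounded_iff by (metis image_eqI)
  have Fb: "\<And>q. q \<in> Q_box \<sigma> \<Longrightarrow> norm (F q) \<le> B" using B closure_subset by blast
  have Finv: "F (q + s *\<^sub>R \<beta>) = F q" for q s
  proof -
   have "(\<Sum>\<alpha>\<in>A. a \<alpha> * of_real ((q + s *\<^sub>R \<beta>) \<bullet> dv \<alpha>)) = (\<Sum>\<alpha>\<in>A. a \<alpha> * of_real (q \<bullet> dv \<alpha>))"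
   proof (rule sum.cong[OF refl])
    fix \<alpha> assume "\<alpha> \<in> A"
    then have "\<alpha> \<in> \<sigma>" "\<alpha> \<noteq> \<beta>" using A insert by auto
    then show "a \<alpha> * of_real ((q + s *\<^sub>R \<beta>) \<bullet> dv \<alpha>) = a \<alpha> * of_real (q \<bullet> dv \<alpha>)" using inv by simp
   qed
   then show ?thesis by (simp add: F_def)
  qed
  have "(LINT q|lborel. indicator (Q_box \<sigma>) q * (exp (- (a \<beta> * of_real (q \<bullet> dv \<beta>))) * F q)) = slab_factor (a \<beta>) * (LINT q|lborel. indicator (Q_box \<sigma>) q * F q)"
  proof (rule slab_average[where Q' = Q' and \<alpha> = \<beta> and B = B, OF _ _ _ _ Finv])
   show "\<beta> \<bullet> dv \<beta> = 1" using dv[OF b b] by simp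
   show "Q' \<in> sets borel" unfolding Q'_def by (rule slabs_meas) auto
   show "(q + s *\<^sub>R \<beta> \<in> Q') = (q \<in> Q')" for q s unfolding Q'_def using inv by simp
   show "F \<in> borel_measurable borel" using Fcont by (rule borel_measurable_continuous_onI)
   show "Q_box \<sigma> = {q \<in> Q'. 0 \<le> q \<bullet> dv \<beta> \<and> q \<bullet> dv \<beta> < 1}" unfolding Q'_def using b Q_box_iff by blast
  qed (use Q_box_bounded Fb in auto)
  moreover have "exp (- (a \<beta> * of_real (q \<bullet> dv \<beta>))) * F q = exp (- (\<Sum>\<alpha>\<in>insert \<beta> A. a \<alpha> * of_real (q \<bullet> dv \<alpha>)))" for q
   unfolding F_def exp_add[symmetric] using insert by simp
  ultimately show ?case using insert assms[OF b] slab_factor_eq[of "a \<beta>"] by (simp add: F_def)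
 qed simp
 from this[OF fin order.refl] show ?thesis .
qed

end

lemma dual_basis_exists:
 assumes "\<sigma> \<in> bases \<Delta>" obtains dv where "dual_basis \<sigma> dv"
proof -
 have s: "independent \<sigma>" "span \<sigma> = UNIV" using assms by (auto simp: bases_def)
 obtain dv where "\<And>\<beta> \<gamma>. \<beta> \<in> \<sigma> \<Longrightarrow> \<gamma> \<in> \<sigma> \<Longrightarrow> \<beta> \<bullet> dv \<gamma> = (if \<beta> = \<gamma> then 1 else 0)" using dual_vectors[OF s(1)] by blast
 then have "dual_basis \<sigma> dv" using s by unfold_locales auto
 then show ?thesis by (rule that)
qed

context lattice
begin

section \<open>Fourier inversion\<close>

text \<open>The character enters without conjugation because
  \<open>exp (pairing t (lat_shift z n))\<close> contains \<open>ech n t\<close>; the inversion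
  formula therefore carries \<open>ech (- n)\<close>.\<close>

definition fhat :: "(real^'n \<Rightarrow> complex) \<Rightarrow> real^'n \<Rightarrow> complex" where
 "fhat g n = (LINT t|lborel. g t * ech n t)"

lemma ech_pairing: "ech n t = exp (pairing t ((2 * of_real pi * \<i>) *s cvec n))"
 by (simp add: ech_def pairing_smult_right)

lemma smooth_ech: "smooth_on S (ech n)"
 unfolding ech_pairing[abs_def] by (rule smooth_on_exp)

lemma ech_has_derivative: "(ech n has_derivative (\<lambda>v. ech n t * (2 * of_real pi * \<i> * of_real (v \<bullet> n)))) (at t)"
 unfolding ech_pairing[abs_def]
 using has_derivative_compose[OF bounded_linear_imp_has_derivative[OF bounded_linear_pairing_left[of "(2 * of_real pi * \<i>) *s cvec n"]] DERIV_exp[unfolded has_field_derivative_def], of t UNIV]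
 by (simp add: pairing_smult_right)

lemma integrable_test_ech: "test_fun UNIV g \<Longrightarrow> integrable lborel (\<lambda>t. g t * ech n t)"
 using integrable_test_fun[OF test_fun_mult[OF _ smooth_ech, of UNIV g n]] by (simp add: mult.commute)

lemma fhat_deriv:
 assumes "test_fun UNIV g"
 shows "fhat (dirD v g) n = - (2 * of_real pi * \<i> * of_real (v \<bullet> n)) * fhat g n"
proof -
 define c where "c = 2 * of_real pi * \<i> * complex_of_real (v \<bullet> n)"
 have sm: "smooth_on UNIV g" using assms by (auto simp: test_fun_def)
 have tf: "test_fun UNIV (\<lambda>t. g t * ech n t)" using test_fun_mult[OF assms smooth_ech, of n] by (simp add: mult.commute)
 have "dirD v (\<lambda>t. g t * ech n t) t = g t * (ech n t * c) + dirD v g t * ech n t" for t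
  by (rule trans[OF dirD_eqI[OF has_derivative_mult[OF smooth_on_UNIV_D(1)[OF sm] ech_has_derivative]]]) (simp add: c_def)
 then have "(LINT t|lborel. c * (g t * ech n t) + dirD v g t * ech n t) = 0"
  using integral_dirD[OF tf, of v] by (simp add: algebra_simps)
 then have "c * fhat g n + fhat (dirD v g) n = 0"
  using integrable_test_ech[OF assms] integrable_test_ech[OF test_fun_dirD[OF assms]] by (simp add: fhat_def)
 then show ?thesis by (simp add: c_def eq_neg_iff_add_eq_0 add.commute)
qed

text \<open>Each integration by parts gains the factor
  \<open>2 * pi * \<bar>v \<bullet> n\<bar>\<close>, which is at least
  \<open>\<bar>v \<bullet> n\<bar>\<close>.\<close>

lemma fhat_decay:
 "test_fun UNIV g \<Longrightarrow> \<exists>A\<ge>0. \<forall>n. \<bar>v \<bullet> n\<bar> ^ p * norm (fhat g n) \<le> A"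
proof (induction p arbitrary: g)
 case 0
 have "norm (fhat g n) \<le> (LINT t|lborel. norm (g t))" for n
  unfolding fhat_def using integral_norm_bound[of lborel "\<lambda>t. g t * ech n t"] by (simp add: norm_mult norm_ech)
 moreover have "0 \<le> (LINT t|lborel. norm (g t))" by simp
 ultimately show ?case by (intro exI[of _ "LINT t|lborel. norm (g t)"]) simp
next
 case (Suc p)
 obtain A where A: "A \<ge> 0" "\<And>n. \<bar>v \<bullet> n\<bar> ^ p * norm (fhat (dirD v g) n) \<le> A"
  using Suc.IH[OF test_fun_dirD[OF Suc.prems]] by blast
 have "\<bar>v \<bullet> n\<bar> ^ Suc p * norm (fhat g n) \<le> A" for n
 proof -
  have "norm (fhat (dirD v g) n) = 2 * pi * \<bar>v \<bullet> n\<bar> * norm (fhat g n)"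
   unfolding fhat_deriv[OF Suc.prems] by (simp add: norm_mult)
  then have "2 * pi * (\<bar>v \<bullet> n\<bar> ^ Suc p * norm (fhat g n)) \<le> A" using A(2)[of n] by (simp add: algebra_simps)
  moreover have "1 * (\<bar>v \<bullet> n\<bar> ^ Suc p * norm (fhat g n)) \<le> 2 * pi * (\<bar>v \<bullet> n\<bar> ^ Suc p * norm (fhat g n))"
   using pi_gt3 by (intro mult_right_mono) auto
  ultimately show ?thesis by simp
 qed
 then show ?case using A(1) by blast
qed

text \<open>Decay of order \<open>2 * CARD('n)\<close> in every single coordinate is multiplied over
  all coordinates; taking the \<open>CARD('n)\<close>-th root gives the product of inverse squares
  as majorant.\<close>

lemma fhat_summable:
 assumes "test_fun UNIV g" shows "(\<lambda>n. norm (fhat g n)) summable_on N"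
proof -
 let ?r = "CARD('n)"
 obtain A0 where A0: "A0 \<ge> 0" "\<And>n. norm (fhat g n) \<le> A0"
  using fhat_decay[OF assms, of 0 0] by auto
 have "\<forall>i. \<exists>A\<ge>0. \<forall>n. \<bar>bs i \<bullet> n\<bar> ^ (2 * ?r) * norm (fhat g n) \<le> A" using fhat_decay[OF assms] by blast
 then obtain A where A: "\<And>i. A i \<ge> 0" "\<And>i n. \<bar>bs i \<bullet> n\<bar> ^ (2 * ?r) * norm (fhat g n) \<le> A i" by metis
 define K where "K = A0 + (\<Sum>i\<in>UNIV. A i)"
 have K: "K \<ge> 0" "A0 \<le> K" "A i \<le> K" for i
  using A0 A(1) member_le_sum[of i UNIV A] by (auto simp: K_def sum_nonneg intro: add_increasing)
 have bound: "norm (fhat g (nvec k)) \<le> K * (\<Prod>i\<in>UNIV. 1 / max 1 \<bar>real_of_int (k $ i)\<bar> ^ 2)" for k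
 proof -
  define x where "x = norm (fhat g (nvec k))"
  define c where "c = (\<lambda>i. max 1 \<bar>real_of_int (k $ i)\<bar> ^ 2)"
  have c: "c i \<ge> 1" for i unfolding c_def by (rule one_le_power) simp
  have "c i ^ ?r * x \<le> K" for i
  proof (cases "\<bar>real_of_int (k $ i)\<bar> \<le> 1")
   case True
   then have "c i = 1" by (simp add: c_def max_def)
   then show ?thesis using A0(2)[of "nvec k"] K(2) by (simp add: x_def)
  next
   case False
   then have "c i ^ ?r = \<bar>real_of_int (k $ i)\<bar> ^ (2 * ?r)" unfolding c_def power_mult[symmetric] by (simp add: max_def)
   then show ?thesis using A(2)[of i "nvec k"] K(3)[of i] nvec_inner[of k i] by (simp add: x_def inner_commute)
  qed
  then have "(\<Prod>i\<in>(UNIV :: 'n set). c i ^ ?r * x) \<le> (\<Prod>i\<in>(UNIV :: 'n set). K)"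
  proof (intro prod_mono conjI)
   fix i show "0 \<le> c i ^ ?r * x" using order_trans[OF zero_le_one c[of i]] by (simp add: x_def)
  qed
  then have "((\<Prod>i\<in>UNIV. c i) * x) ^ ?r \<le> K ^ ?r"
   by (simp add: prod.distrib prod_power_distrib power_mult_distrib)
  then have le: "(\<Prod>i\<in>UNIV. c i) * x \<le> K"
  proof -
   have "0 \<le> (\<Prod>i\<in>UNIV. c i) * x"
    using order_trans[OF zero_le_one c] by (intro mult_nonneg_nonneg prod_nonneg) (auto simp: x_def)
   moreover have "0 < ?r" by simp
   ultimately show ?thesis using power_mono_iff[of "(\<Prod>i\<in>UNIV. c i) * x" K ?r] K(1) \<open>(_ * x) ^ _ \<le> _\<close> by blast
  qed
  have pos: "(\<Prod>i\<in>UNIV. c i) > 0" using c by (intro prod_pos) (auto intro: less_le_trans[OF zero_less_one])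
  then have "x \<le> K / (\<Prod>i\<in>UNIV. c i)" using le by (simp add: field_simps)
  then show ?thesis by (simp add: x_def c_def prod_dividef)
 qed
 have "(\<lambda>k. K * (\<Prod>i\<in>UNIV. 1 / max 1 \<bar>real_of_int (k $ i)\<bar> ^ 2)) summable_on (UNIV :: (int^'n) set)"
  by (intro summable_on_cmult_right summable_inverse_squares)
 then have "(\<lambda>k. norm (fhat g (nvec k))) summable_on UNIV"
  by (rule Infinite_Sum.abs_summable_on_comparison_test') (rule bound)
 then show ?thesis using summable_on_reindex_bij_betw[OF nvec_bij, of "\<lambda>n. norm (fhat g n)"] by simp
qed

text \<open>The sum over \<open>M\<close> is restricted to its nonzero terms, which makes it a
  finite sum for functions with bounded support.\<close>

definition per :: "(real^'n \<Rightarrow> complex) \<Rightarrow> real^'n \<Rightarrow> complex" where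
 "per g t = (\<Sum>m\<in>{m\<in>M. g (t + m) \<noteq> 0}. g (t + m))"

lemma per_eq:
 assumes "finite F" "F \<subseteq> M" "\<And>m. m \<in> M \<Longrightarrow> m \<notin> F \<Longrightarrow> g (t + m) = 0"
 shows "per g t = (\<Sum>m\<in>F. g (t + m))"
 unfolding per_def by (rule sum.mono_neutral_left) (use assms in auto)

lemma per_ball:
 assumes "\<And>t. norm t > R \<Longrightarrow> g t = 0" "norm t \<le> R'"
 shows "per g t = (\<Sum>m\<in>{m\<in>M. norm m \<le> R + R'}. g (t + m))"
proof (rule per_eq)
 fix m assume "m \<in> M" "m \<notin> {m \<in> M. norm m \<le> R + R'}"
 then have "norm m > R + R'" by simp
 moreover have "norm m \<le> norm (t + m) + norm t" by (metis add_diff_cancel_left' norm_triangle_ineq4)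
 ultimately show "g (t + m) = 0" using assms by (intro assms(1)) linarith
qed (auto simp: finite_M_ball)

lemma per_periodic: "m0 \<in> M \<Longrightarrow> per g (t + m0) = per g t"
 unfolding per_def
 by (rule sum.reindex_bij_witness[where i = "\<lambda>m. m - m0" and j = "\<lambda>m. m + m0"])
  (auto simp: M_add M_diff algebra_simps)

lemma per_continuous:
 assumes "test_fun S g" shows "continuous_on UNIV (per g)"
proof (rule continuous_at_imp_continuous_on, rule ballI)
 fix t0 :: "real^'n"
 obtain R where R: "\<And>t. norm t > R \<Longrightarrow> g t = 0" using test_fun_radius[OF assms] by blast
 define F where "F = {m\<in>M. norm m \<le> R + (norm t0 + 1)}"
 have gc: "continuous_on UNIV g" by (rule test_fun_continuous[OF assms])
 have "continuous_on UNIV (\<lambda>t. \<Sum>m\<in>F. g (t + m))"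
  by (intro continuous_on_sum continuous_on_compose2[OF gc] continuous_intros) auto
 then have c: "isCont (\<lambda>t. \<Sum>m\<in>F. g (t + m)) t0" by (simp add: continuous_on_eq_continuous_at)
 have "\<forall>\<^sub>F t in nhds t0. t \<in> ball t0 1" by (intro eventually_nhds_in_open) auto
 then have "\<forall>\<^sub>F t in nhds t0. (\<Sum>m\<in>F. g (t + m)) = per g t"
 proof (rule eventually_mono)
  fix t assume "t \<in> ball t0 1"
  then have "dist t0 t < 1" by simp
  then have "norm t \<le> norm t0 + 1" using norm_triangle_ineq2[of t t0] by (simp add: dist_norm norm_minus_commute)
  then show "(\<Sum>m\<in>F. g (t + m)) = per g t" using per_ball[OF R] by (simp add: F_def)
 qed
 from isCont_cong[OF this] c show "isCont (per g) t0" by blast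
qed

text \<open>Both sides are continuous and periodic under \<open>M\<close> with the same Fourier
  coefficients over \<open>C\<close>: on the left by unfolding, on the right by orthogonality. The
  factor \<open>vol C\<close> is the normalization of the characters.\<close>

theorem fourier_inversion:
 assumes "test_fun UNIV g"
 shows "vol C * per g t = (\<Sum>\<^sub>\<infinity>n\<in>N. fhat g n * ech (- n) t)"
proof -
 define S where "S = (\<lambda>t. \<Sum>\<^sub>\<infinity>n\<in>N. fhat g n * ech (- n) t)"
 define D where "D = (\<lambda>t. vol C * per g t - S t)"
 have cont_term: "continuous_on UNIV (\<lambda>t. fhat g n * ech (- n) t)" for n by (intro continuous_intros ech_cont)
 have nrm: "norm (fhat g n * ech (- n) t) \<le> norm (fhat g n)" for n t by (simp add: norm_mult norm_ech)
 have Sc: "continuous_on UNIV S" unfolding S_def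
  by (rule infsum_continuous[OF cont_term nrm fhat_summable[OF assms]])
 have pc: "continuous_on UNIV (per g)" by (rule per_continuous[OF assms])
 have Dc: "continuous_on UNIV D" unfolding D_def by (intro continuous_intros Sc pc)
 have "D t = 0"
 proof (rule fourier_unique[OF Dc])
  show "D (t + m) = D t" if "m \<in> M" for t m
   unfolding D_def S_def using that by (simp add: per_periodic ech_periodic N_minus cong: infsum_cong)
  fix n' assume n': "n' \<in> N"
  have pp: "(LINT t|lborel. indicator C t * (per g t * ech n' t)) = fhat g n'"
  proof -
   obtain R where R: "\<And>t. norm t > R \<Longrightarrow> g t = 0" using test_fun_radius[OF assms] by blast
   obtain R' where R': "\<And>t. t \<in> C \<Longrightarrow> norm t \<le> R'" using C_bounded unfolding bounded_iff by blast
   define F where "F = {m\<in>M. norm m \<le> R + R'}"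
   have "fhat g n' = (LINT t|lborel. indicator C t * (\<Sum>m\<in>F. g (t + m) * ech n' (t + m)))"
    unfolding fhat_def
   proof (rule unfold_integral[OF integrable_test_ech[OF assms]])
    show "finite F" "F \<subseteq> M" by (auto simp: F_def finite_M_ball)
    fix t m assume tm: "t \<in> C" "m \<in> M" "m \<notin> F"
    then have "norm m > R + R'" by (simp add: F_def)
    moreover have "norm m \<le> norm (t + m) + norm t" by (metis add_diff_cancel_left' norm_triangle_ineq4)
    ultimately have "norm (t + m) > R" using R'[OF tm(1)] by linarith
    then show "g (t + m) * ech n' (t + m) = 0" using R by simp
   qed
   also have "\<dots> = (LINT t|lborel. indicator C t * (per g t * ech n' t))"
   proof (rule int_cong)
    fix t show "indicator C t * (\<Sum>m\<in>F. g (t + m) * ech n' (t + m)) = indicator C t * (per g t * ech n' t)"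
    proof (cases "t \<in> C")
     case True
     have "(\<Sum>m\<in>F. g (t + m) * ech n' (t + m)) = (\<Sum>m\<in>F. g (t + m)) * ech n' t"
      unfolding sum_distrib_right by (intro sum.cong refl) (auto simp: F_def ech_periodic[OF n'])
     then show ?thesis using per_ball[OF R R'[OF True]] by (simp add: F_def)
    qed simp
   qed
   finally show ?thesis ..
  qed
  have ss: "(LINT t|lborel. indicator C t * (S t * ech n' t)) = vol C * fhat g n'"
  proof -
   have "((\<lambda>n. LINT t|lborel. (indicator C t * ech n' t) * (fhat g n * ech (- n) t)) has_sum
     (LINT t|lborel. (indicator C t * ech n' t) * (\<Sum>\<^sub>\<infinity>n\<in>N. fhat g n * ech (- n) t))) N"
    by (rule infsum_integral_swap[OF cont_term nrm fhat_summable[OF assms] integrable_C[OF ech_cont]])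
   moreover have "(LINT t|lborel. (indicator C t * ech n' t) * (fhat g n * ech (- n) t)) = (if n = n' then vol C * fhat g n' else 0)"
    if n: "n \<in> N" for n
   proof -
    have "(LINT t|lborel. (indicator C t * ech n' t) * (fhat g n * ech (- n) t)) = fhat g n * (LINT t|lborel. indicator C t * ech (n' + - n) t)"
     unfolding integral_mult_right_zero[symmetric] ech_add
     by (rule int_cong) (simp only: mult.assoc mult.commute mult.left_commute)
    also have "\<dots> = fhat g n * (if n' + - n = 0 then vol C else 0)"
     by (subst ech_orthogonal) (rule N_add[OF n' N_minus[OF n]], rule refl)
    finally show ?thesis by auto
   qed
   ultimately have "(\<Sum>\<^sub>\<infinity>n\<in>N. if n = n' then vol C * fhat g n' else 0) = (LINT t|lborel. (indicator C t * ech n' t) * (\<Sum>\<^sub>\<infinity>n\<in>N. fhat g n * ech (- n) t))"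
    by (subst infsum_cong[symmetric, where f = "\<lambda>n. LINT t|lborel. (indicator C t * ech n' t) * (fhat g n * ech (- n) t)"]) (auto intro: infsumI)
   moreover have "(\<Sum>\<^sub>\<infinity>n\<in>N. if n = n' then vol C * fhat g n' else 0) = vol C * fhat g n'"
    using infsum_cong_neutral[of "{n'}" N "\<lambda>n. if n = n' then vol C * fhat g n' else 0" "\<lambda>n. if n = n' then vol C * fhat g n' else 0"] n' by simp
   ultimately show ?thesis by (simp add: S_def mult.assoc mult.commute mult.left_commute)
  qed
  have "(LINT t|lborel. indicator C t * (D t * ech n' t)) =
   (LINT t|lborel. vol C * (indicator C t * (per g t * ech n' t)) - indicator C t * (S t * ech n' t))"
   by (simp add: D_def algebra_simps)
  also have "\<dots> = vol C * fhat g n' - vol C * fhat g n'"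
   using integrable_C[OF continuous_on_mult[OF pc ech_cont, of n']] integrable_C[OF continuous_on_mult[OF Sc ech_cont, of n']] pp ss
   by simp
  finally show "(LINT t|lborel. indicator C t * (D t * ech n' t)) = 0" by simp
 qed
 then show ?thesis by (simp add: D_def S_def)
qed

end

context lattice
begin

text \<open>The least positive value \<open>g\<close> of \<alpha> on \<open>N\<close> divides its
  values on the basis, by division with remainder. So \<alpha> divided by \<open>g\<close> is again
  in \<open>M\<close>, and indivisibility gives \<open>g = 1\<close>.\<close>

lemma indivisible_unit:
 assumes "\<alpha> \<in> M" "\<alpha> \<noteq> 0" "indivisible_in M \<alpha>"
 obtains n where "n \<in> N" "\<alpha> \<bullet> n = 1"
proof -
 have ex: "\<exists>k. \<alpha> \<bullet> n = of_int k" if "n \<in> N" for n using M_inner_N[OF assms(1) that] by (auto elim: Ints_cases)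
 have "\<exists>i. \<alpha> \<bullet> b i \<noteq> 0" using inner_eqI[of \<alpha> 0] assms(2) by auto
 then obtain i0 where i0: "\<alpha> \<bullet> b i0 \<noteq> 0" ..
 define P where "P = (\<lambda>p::nat. p > 0 \<and> (\<exists>n\<in>N. \<alpha> \<bullet> n = of_nat p))"
 have Pabs: "P (nat \<bar>k\<bar>)" if "n \<in> N" "\<alpha> \<bullet> n = of_int k" "k \<noteq> 0" for n k
 proof (cases "k > 0")
  case True then show ?thesis using that by (auto simp: P_def)
 next
  case False then show ?thesis using that N_minus[OF that(1)] by (auto simp: P_def intro!: bexI[of _ "- n"])
 qed
 obtain k0 where "\<alpha> \<bullet> b i0 = of_int k0" using ex[OF b_in_N] by blast
 then have "P (nat \<bar>k0\<bar>)" using Pabs[OF b_in_N] i0 by auto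
 then have Pl: "P (LEAST p. P p)" by (rule LeastI)
 define g where "g = (LEAST p. P p)"
 obtain n0 where n0: "n0 \<in> N" "\<alpha> \<bullet> n0 = of_nat g" and g: "g > 0" using Pl by (auto simp: P_def g_def)
 have scale: "of_int j *\<^sub>R n0 \<in> N" for j
 proof -
  obtain k where "n0 = nvec k" using n0 nvec_bij by (auto simp: bij_betw_def)
  then have "of_int j *\<^sub>R n0 = nvec (\<chi> i. j * k $ i)" by (simp add: nvec_def scaleR_sum_right)
  then show ?thesis using nvec_bij by (auto simp: bij_betw_def)
 qed
 have "(1 / real g) *\<^sub>R \<alpha> \<in> M"
  unfolding M_iff
 proof
  fix i
  obtain k where k: "\<alpha> \<bullet> b i = of_int k" using ex[OF b_in_N] by blast
  have "k mod int g = 0"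
  proof (rule ccontr)
   assume nz: "k mod int g \<noteq> 0"
   have N': "b i + - (of_int (k div int g) *\<^sub>R n0) \<in> N" by (intro N_add N_minus b_in_N scale)
   have "\<alpha> \<bullet> (b i + - (of_int (k div int g) *\<^sub>R n0)) = of_int (k - (k div int g) * int g)"
    using k n0(2) by (simp add: inner_add_right inner_diff_right)
   then have "\<alpha> \<bullet> (b i + - (of_int (k div int g) *\<^sub>R n0)) = of_int (k mod int g)"
    by (simp add: minus_div_mult_eq_mod)
   from Pabs[OF N' this nz] have "g \<le> nat \<bar>k mod int g\<bar>" unfolding g_def by (rule Least_le)
   moreover have "\<bar>k mod int g\<bar> < int g" using g by simp
   ultimately show False by linarith
  qed
  then obtain j where "k = int g * j" by (auto simp: mod_eq_0_iff_dvd dvd_def)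
  then show "(1 / real g) *\<^sub>R \<alpha> \<bullet> b i \<in> \<int>" using k g by simp
 qed
 moreover have "\<alpha> = of_int (int g) *\<^sub>R ((1 / real g) *\<^sub>R \<alpha>)" using g by simp
 ultimately have "\<bar>int g\<bar> = 1" using assms(3) unfolding indivisible_in_def by blast
 then show ?thesis using n0 by (intro that[of n0]) auto
qed

end

text \<open>The Fourier-Laplace transform of the test function: tested against \<psi>, the term of
  the Eisenstein series at \<open>w = lat_shift z n\<close> is \<open>f w * psihat \<psi> w\<close>,
  and its decay in \<open>n\<close> carries all the convergence.\<close>

definition psihat :: "(real^'n \<Rightarrow> complex) \<Rightarrow> complex^'n \<Rightarrow> complex" where
 "psihat \<psi> w = (LINT t|lborel. exp (pairing t w) * \<psi> t)"

section \<open>Index sets and the functions attached to a point and a basis\<close>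

locale lattice_basis = lattice N b bs + dual_basis \<sigma> dv for N :: "(real^'n) set" and b bs \<sigma> dv +
 assumes \<sigma>M: "\<sigma> \<subseteq> dual_lattice N"
begin

abbreviation idx :: nat where "idx \<equiv> lattice_index M (int_span \<sigma>)"

text \<open>The index set of an alcove taken at a single point \<open>t\<close>. It and
  \<open>FF\<close> make sense for every \<open>t\<close>, on walls too, so they can be integrated
  against test functions on the whole space.\<close>

definition RR :: "real^'n \<Rightarrow> (real^'n) set" where "RR t = {m\<in>M. t - m \<in> Q_box \<sigma>}"

definition FF :: "real^'n \<Rightarrow> complex^'n \<Rightarrow> complex" where
 "FF t z = 1 / of_nat idx * ((\<Sum>m\<in>RR t. exp (pairing m z)) / (\<Prod>\<alpha>\<in>\<sigma>. 1 - exp (- pairing \<alpha> z)))"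

definition generic :: "complex^'n \<Rightarrow> bool" where
 "generic z \<longleftrightarrow> (\<forall>\<alpha>\<in>\<sigma>. \<forall>n\<in>N. pairing \<alpha> (lat_shift z n) \<noteq> 0)"

lemma Q_box_radius: obtains R where "\<And>q. q \<in> Q_box \<sigma> \<Longrightarrow> norm q \<le> R"
 using Q_box_bounded unfolding bounded_iff by blast

lemma RR_finite: "finite (RR t)"
proof -
 obtain R where R: "\<And>q. q \<in> Q_box \<sigma> \<Longrightarrow> norm q \<le> R" using Q_box_radius by blast
 have "RR t \<subseteq> {m\<in>M. norm m \<le> norm t + R}"
 proof
  fix m assume m: "m \<in> RR t"
  then have "norm (t - m) \<le> R" using R by (simp add: RR_def)
  then have "norm m \<le> norm t + R" using norm_triangle_ineq2[of m t] by (simp add: norm_minus_commute)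
  then show "m \<in> {m\<in>M. norm m \<le> norm t + R}" using m by (simp add: RR_def)
 qed
 then show ?thesis using finite_M_ball finite_subset by blast
qed

lemma RR_subset:
 assumes "\<And>q. q \<in> Q_box \<sigma> \<Longrightarrow> norm q \<le> RQ" "norm t \<le> R"
 shows "RR t \<subseteq> {m\<in>M. norm m \<le> R + RQ}"
proof
 fix m assume m: "m \<in> RR t"
 then have "norm (t - m) \<le> RQ" using assms(1) by (simp add: RR_def)
 then show "m \<in> {m\<in>M. norm m \<le> R + RQ}" using norm_triangle_ineq2[of m t] assms(2) m
  by (simp add: norm_minus_commute RR_def)
qed

text \<open>For bounded \<open>t\<close> the varying index set is replaced by a fixed finite set
  with indicator weights, a form that can be integrated in \<open>t\<close>.\<close>

lemma RR_sum_indicator: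
 assumes "\<And>q. q \<in> Q_box \<sigma> \<Longrightarrow> norm q \<le> RQ" "norm t \<le> R"
 shows "(\<Sum>m\<in>{m\<in>M. norm m \<le> R + RQ}. h m * indicator (Q_box \<sigma>) (t - m)) = (\<Sum>m\<in>RR t. h m :: complex)"
 using RR_subset[of RQ t R] assms
 by (intro sum.mono_neutral_cong_right) (auto simp: RR_def finite_M_ball indicator_def)

lemma RR_rep:
 assumes x: "x \<in> M" shows "\<exists>m\<in>RR t. x - m \<in> int_span \<sigma>"
proof -
 define m where "m = x + (\<Sum>\<alpha>\<in>\<sigma>. of_int \<lfloor>(t - x) \<bullet> dv \<alpha>\<rfloor> *\<^sub>R \<alpha>)"
 have mM: "m \<in> M" unfolding m_def using \<sigma>M by (intro M_add x M_sum M_scale_int) auto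
 have d: "m \<bullet> dv \<alpha> = x \<bullet> dv \<alpha> + of_int \<lfloor>(t - x) \<bullet> dv \<alpha>\<rfloor>" if "\<alpha> \<in> \<sigma>" for \<alpha>
  unfolding m_def inner_add_left dv_sum[OF that] ..
 have "t - m \<in> Q_box \<sigma>" unfolding Q_box_iff
 proof
  fix \<alpha> assume "\<alpha> \<in> \<sigma>"
  from d[OF this] show "0 \<le> (t - m) \<bullet> dv \<alpha> \<and> (t - m) \<bullet> dv \<alpha> < 1"
   using of_int_floor_le[of "(t - x) \<bullet> dv \<alpha>"] floor_correct[of "(t - x) \<bullet> dv \<alpha>"]
   by (simp add: inner_diff_left) linarith
 qed
 then have "m \<in> RR t" using mM by (simp add: RR_def)
 moreover have "x - m \<in> int_span \<sigma>" using d by (simp add: int_span_iff inner_diff_left)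
 ultimately show ?thesis by blast
qed

text \<open>\<open>Q_box \<sigma>\<close> is a half-open fundamental cell of
  \<open>int_span \<sigma>\<close>, so \<open>RR t\<close> contains exactly one representative of
  each class of \<open>M\<close> modulo it; hence the cardinality does not depend on
  \<open>t\<close>.\<close>

lemma RR_card: "card (RR t) = idx" and idx_pos: "idx > 0"
proof -
 define r where "r = {(x, y). x \<in> M \<and> y \<in> M \<and> x - y \<in> int_span \<sigma>}"
 have eq: "equiv M r"
 proof (rule equivI)
  show "r \<subseteq> M \<times> M" by (auto simp: r_def)
  show "refl_on M r" by (auto simp: r_def refl_on_def int_span_iff)
  show "sym r"
  proof (rule symI)
   fix x y assume "(x, y) \<in> r"
   then have xy: "x \<in> M" "y \<in> M" "\<And>\<alpha>. \<alpha> \<in> \<sigma> \<Longrightarrow> (x - y) \<bullet> dv \<alpha> \<in> \<int>" by (auto simp: r_def int_span_iff)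
   have "(y - x) \<bullet> dv \<alpha> \<in> \<int>" if "\<alpha> \<in> \<sigma>" for \<alpha>
    using Ints_minus[OF xy(3)[OF that]] by (simp add: inner_diff_left)
   then show "(y, x) \<in> r" using xy by (simp add: r_def int_span_iff)
  qed
  show "trans r"
  proof (rule transI)
   fix x y z assume "(x, y) \<in> r" "(y, z) \<in> r"
   then have xy: "x \<in> M" "z \<in> M" "\<And>\<alpha>. \<alpha> \<in> \<sigma> \<Longrightarrow> (x - y) \<bullet> dv \<alpha> \<in> \<int>" "\<And>\<alpha>. \<alpha> \<in> \<sigma> \<Longrightarrow> (y - z) \<bullet> dv \<alpha> \<in> \<int>"
    by (auto simp: r_def int_span_iff)
   have "(x - z) \<bullet> dv \<alpha> \<in> \<int>" if "\<alpha> \<in> \<sigma>" for \<alpha>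
    using Ints_add[OF xy(3)[OF that] xy(4)[OF that]] by (simp add: inner_diff_left)
   then show "(x, z) \<in> r" using xy by (simp add: r_def int_span_iff)
  qed
 qed
 have surj: "\<exists>m\<in>RR t. (x, m) \<in> r" if "x \<in> M" for x t
  using RR_rep[OF that, of t] that by (auto simp: r_def RR_def)
 have "bij_betw (\<lambda>m. r `` {m}) (RR t) (M // r)" for t
  unfolding bij_betw_def
 proof
  show "inj_on (\<lambda>m. r `` {m}) (RR t)"
  proof (rule inj_onI)
   fix m m' assume m: "m \<in> RR t" "m' \<in> RR t" and "r `` {m} = r `` {m'}"
   moreover have "m' \<in> M" using m by (simp add: RR_def)
   ultimately have "(m, m') \<in> r" using eq_equiv_class[OF _ eq] by blast
   then have I: "m - m' \<in> int_span \<sigma>" by (simp add: r_def)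
   show "m = m'"
   proof (rule dv_eqI)
    fix \<alpha> assume a: "\<alpha> \<in> \<sigma>"
    then obtain k where k: "(m - m') \<bullet> dv \<alpha> = of_int k" using I by (auto simp: int_span_iff elim: Ints_cases)
    have "0 \<le> (t - m) \<bullet> dv \<alpha>" "(t - m) \<bullet> dv \<alpha> < 1" "0 \<le> (t - m') \<bullet> dv \<alpha>" "(t - m') \<bullet> dv \<alpha> < 1"
     using m a by (auto simp: RR_def Q_box_iff)
    then have "\<bar>real_of_int k\<bar> < 1" using k by (simp add: inner_diff_left)
    then have "k = 0" by linarith
    then show "m \<bullet> dv \<alpha> = m' \<bullet> dv \<alpha>" using k by (simp add: inner_diff_left)
   qed
  qed
  show "(\<lambda>m. r `` {m}) ` RR t = M // r"
  proof
   show "(\<lambda>m. r `` {m}) ` RR t \<subseteq> M // r" by (auto simp: RR_def quotient_def)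
   show "M // r \<subseteq> (\<lambda>m. r `` {m}) ` RR t"
   proof
    fix X assume "X \<in> M // r"
    then obtain x where x: "x \<in> M" "X = r `` {x}" by (auto simp: quotient_def)
    obtain m where "m \<in> RR t" "(x, m) \<in> r" using surj[OF x(1)] by blast
    then show "X \<in> (\<lambda>m. r `` {m}) ` RR t" using equiv_class_eq[OF eq] x(2) by blast
   qed
  qed
 qed
 from bij_betw_same_card[OF this] show c: "card (RR t) = idx" for t by (simp add: lattice_index_def r_def)
 have "RR 0 \<noteq> {}" using surj[OF M_0, of 0] by blast
 then show "idx > 0" using c[of 0] RR_finite[of 0] card_gt_0_iff by metis
qed

text \<open>The indicator of the box is unfolded over \<open>M\<close>: every point of
  \<open>C\<close> has exactly \<open>idx\<close> translates in the box.\<close>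

lemma vol_Q: "vol (Q_box \<sigma>) = of_nat idx * vol C"
proof -
 obtain R where R: "\<And>q. q \<in> Q_box \<sigma> \<Longrightarrow> norm q \<le> R" using Q_box_radius by blast
 obtain R' where R': "\<And>t. t \<in> C \<Longrightarrow> norm t \<le> R'" using C_bounded unfolding bounded_iff by blast
 define F where "F = {m\<in>M. norm m \<le> R + R'}"
 have far: "norm m \<le> R + R'" if "t \<in> C" "t + m \<in> Q_box \<sigma>" for t m
  using R[OF that(2)] R'[OF that(1)] norm_triangle_ineq4[of "t + m" t] by simp
 have "vol (Q_box \<sigma>) = (LINT t|lborel. indicator C t * (\<Sum>m\<in>F. indicator (Q_box \<sigma>) (t + m)))"
  unfolding vol_def
 proof (rule unfold_integral)
  show "integrable lborel (indicator (Q_box \<sigma>) :: _ \<Rightarrow> complex)"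
   by (rule integrable_indicator_bounded[OF Q_box_meas Q_box_bounded])
  show "finite F" "F \<subseteq> M" by (auto simp: F_def finite_M_ball)
  show "indicator (Q_box \<sigma>) (t + m) = (0::complex)" if "t \<in> C" "m \<in> M" "m \<notin> F" for t m
   using far[OF that(1)] that by (auto simp: F_def indicator_def)
 qed
 also have "\<dots> = (LINT t|lborel. of_nat idx * indicator C t)"
 proof (rule int_cong)
  fix t show "indicator C t * (\<Sum>m\<in>F. indicator (Q_box \<sigma>) (t + m)) = (of_nat idx * indicator C t :: complex)"
  proof (cases "t \<in> C")
   case True
   have "(\<Sum>m\<in>F. indicator (Q_box \<sigma>) (t + m)) = (\<Sum>m\<in>F \<inter> {m. t + m \<in> Q_box \<sigma>}. 1 :: complex)"
    by (rule sum.mono_neutral_cong_right) (auto simp: F_def finite_M_ball)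
   also have "\<dots> = (\<Sum>m\<in>RR t. 1)"
    using far[OF True, of "- _"] M_minus norm_minus_cancel
    by (intro sum.reindex_bij_witness[where i = uminus and j = uminus]) (auto simp: F_def RR_def)
   finally show ?thesis by (simp add: RR_card)
  qed simp
 qed
 finally show ?thesis by (simp add: vol_def)
qed

lemma pairing_dv: "pairing q w = (\<Sum>\<alpha>\<in>\<sigma>. pairing \<alpha> w * of_real (q \<bullet> dv \<alpha>))"
proof -
 have "pairing q w = pairing (\<Sum>\<alpha>\<in>\<sigma>. (q \<bullet> dv \<alpha>) *\<^sub>R \<alpha>) w" using dv_expand[of q] by simp
 then show ?thesis by (simp add: pairing_sum_left pairing_scaleR_left mult.commute)
qed

lemma exp_lat_shift: "n \<in> N \<Longrightarrow> \<alpha> \<in> M \<Longrightarrow> exp (pairing \<alpha> (lat_shift z n)) = exp (pairing \<alpha> z)"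
 unfolding pairing_lat_shift exp_add using ech_M[of n \<alpha>] by (simp add: ech_def)

end

section \<open>Poisson summation for simple fractions\<close>

locale primitive_basis = lattice_basis N b bs \<sigma> dv for N :: "(real^'n) set" and b bs \<sigma> dv +
 assumes unit: "\<And>\<alpha>. \<alpha> \<in> \<sigma> \<Longrightarrow> \<exists>n\<in>N. \<alpha> \<bullet> n = 1"
begin

text \<open>If the exponential is 1, then \<open>pairing \<alpha> z\<close> is an integer multiple
  of \<open>2 * pi * \<i>\<close>. Since \<alpha> takes the value 1 on \<open>N\<close>, some
  lattice translate of \<open>z\<close> then lies on the hyperplane of \<alpha>.\<close>

lemma generic_exp:
 assumes "generic z" "\<alpha> \<in> \<sigma>" shows "exp (- pairing \<alpha> z) \<noteq> 1"
proof
 assume "exp (- pairing \<alpha> z) = 1"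
 then obtain k :: int where k: "Re (- pairing \<alpha> z) = 0" "Im (- pairing \<alpha> z) = of_int (2 * k) * pi" by (auto simp: exp_eq_1)
 obtain n where n: "n \<in> N" "\<alpha> \<bullet> n = 1" using unit[OF assms(2)] by blast
 have kN: "of_int k *\<^sub>R n \<in> N"
 proof -
  obtain j where "n = nvec j" using n nvec_bij by (auto simp: bij_betw_def)
  then have "of_int k *\<^sub>R n = nvec (\<chi> i. k * j $ i)" by (simp add: nvec_def scaleR_sum_right)
  then show ?thesis using nvec_bij by (auto simp: bij_betw_def)
 qed
 have "pairing \<alpha> (lat_shift z (of_int k *\<^sub>R n)) = 0"
  unfolding pairing_lat_shift using k n by (simp add: complex_eq_iff algebra_simps)
 then show False using assms kN by (auto simp: generic_def)
qed

lemma psihat_fhat: "psihat \<psi> (lat_shift z n) = fhat (\<lambda>t. exp (pairing t z) * \<psi> t) n"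
 unfolding psihat_def fhat_def ech_def pairing_lat_shift exp_add by (simp add: mult.assoc mult.commute mult.left_commute)

lemma psihat_summable: "test_fun UNIV \<psi> \<Longrightarrow> (\<lambda>n. norm (psihat \<psi> (lat_shift z n))) summable_on N"
 unfolding psihat_fhat by (rule fhat_summable[OF test_fun_mult[OF _ smooth_on_exp]])

text \<open>The Fourier inversion of the periodized \<open>g\<close> is integrated against
  \<open>h\<close>. One side collects to the sum over \<open>RR t\<close>; on the other, each
  Fourier term is a box integral, which yields the product of \<open>1 / pairing \<alpha>\<close> at
  the lattice translate. Since \<open>vol (Q_box \<sigma>)\<close> is \<open>idx\<close> times
  \<open>vol C\<close>, the cell volumes cancel and leave the index.\<close>

theorem phi_identity:
 assumes z: "generic z" and \<psi>: "test_fun UNIV \<psi>"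
 shows "((\<lambda>n. 1 / (\<Prod>\<alpha>\<in>\<sigma>. pairing \<alpha> (lat_shift z n)) * psihat \<psi> (lat_shift z n)) has_sum (LINT t|lborel. FF t z * \<psi> t)) N"
proof -
 let ?t = "\<lambda>n. 1 / (\<Prod>\<alpha>\<in>\<sigma>. pairing \<alpha> (lat_shift z n)) * psihat \<psi> (lat_shift z n)"
 let ?I = "LINT t|lborel. (\<Sum>m\<in>RR t. exp (pairing m z)) * \<psi> t"
 define g where "g = (\<lambda>t. exp (pairing t z) * \<psi> t)"
 \<comment> \<open>Chosen so that on the box \<open>h q * g (q + m)\<close> equals
   \<open>exp (pairing m z) * \<psi> (q + m)\<close>: the exponential in \<open>q\<close>
   cancels.\<close>
 define h where "h = (\<lambda>q. indicator (Q_box \<sigma>) q * exp (- pairing q z))"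
 define P where "P = (\<Prod>\<alpha>\<in>\<sigma>. 1 - exp (- pairing \<alpha> z))"
 have P: "P \<noteq> 0" unfolding P_def using generic_exp[OF z] fin by auto
 have tg: "test_fun UNIV g" unfolding g_def by (rule test_fun_mult[OF \<psi> smooth_on_exp])
 have ec: "continuous_on UNIV (\<lambda>q. exp (- pairing q z))"
  using linear_continuous_on[OF bounded_linear_pairing_left] by (intro continuous_intros)
 obtain RQ where RQ: "\<And>q. q \<in> Q_box \<sigma> \<Longrightarrow> norm q \<le> RQ" using Q_box_radius by blast
 obtain R where R: "\<And>t. norm t > R \<Longrightarrow> \<psi> t = 0" using test_fun_radius[OF \<psi>] by blast
 define F where "F = {m\<in>M. norm m \<le> R + RQ}"
 have finF: "finite F" by (auto simp: F_def finite_M_ball)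
 obtain B where B: "\<And>q. q \<in> Q_box \<sigma> \<Longrightarrow> norm (exp (- pairing q z)) \<le> B"
  using continuous_bounded_on[OF ec Q_box_bounded] by blast
 have hint: "integrable lborel h" unfolding h_def
  by (intro bounded_indicator_integrable[where B = B] Q_box_meas Q_box_bounded borel_measurable_continuous_onI ec B)
 have one: "(LINT q|lborel. h q * per g q) = ?I"
 proof -
  have int: "integrable lborel (\<lambda>t. indicator (Q_box \<sigma>) (t - m) * \<psi> t)" for m
  proof (rule Bochner_Integration.integrable_bound[OF integrable_test_fun[OF \<psi>]])
   have [measurable]: "\<psi> \<in> borel_measurable borel" by (rule borel_measurable_continuous_onI[OF test_fun_continuous[OF \<psi>]])
   show "(\<lambda>t. indicator (Q_box \<sigma>) (t - m) * \<psi> t) \<in> borel_measurable lborel" by measurable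
  qed (auto simp: indicator_def norm_mult)
  have "(LINT q|lborel. h q * per g q) = (LINT q|lborel. (\<Sum>m\<in>F. exp (pairing m z) * (indicator (Q_box \<sigma>) q * \<psi> (q + m))))"
  proof (rule int_cong)
   fix q
   have gR: "g t = 0" if "norm t > R" for t using R[OF that] by (simp add: g_def)
   have e: "exp (- pairing q z) * g (q + m) = exp (pairing m z) * \<psi> (q + m)" for m
    by (simp add: g_def pairing_simps exp_add exp_minus)
   show "h q * per g q = (\<Sum>m\<in>F. exp (pairing m z) * (indicator (Q_box \<sigma>) q * \<psi> (q + m)))"
   proof (cases "q \<in> Q_box \<sigma>")
    case True
    have "per g q = (\<Sum>m\<in>F. g (q + m))" unfolding F_def by (rule per_ball) (use gR RQ[OF True] in auto)
    then have "h q * per g q = (\<Sum>m\<in>F. exp (- pairing q z) * g (q + m))"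
     using True by (simp add: h_def sum_distrib_left)
    then show ?thesis unfolding e using True by simp
   qed (simp add: h_def)
  qed
  also have "\<dots> = (\<Sum>m\<in>F. exp (pairing m z) * (LINT q|lborel. indicator (Q_box \<sigma>) q * \<psi> (q + m)))"
  proof (subst Bochner_Integration.integral_sum)
   fix m
   have c: "continuous_on UNIV (\<lambda>q. \<psi> (q + m))"
    by (rule continuous_on_compose2[OF test_fun_continuous[OF \<psi>]]) (auto intro!: continuous_intros)
   obtain B where "\<And>q. q \<in> Q_box \<sigma> \<Longrightarrow> norm (\<psi> (q + m)) \<le> B" using continuous_bounded_on[OF c Q_box_bounded] by blast
   then have "integrable lborel (\<lambda>q. indicator (Q_box \<sigma>) q * \<psi> (q + m))"
    by (intro bounded_indicator_integrable Q_box_meas Q_box_bounded borel_measurable_continuous_onI c)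
   then show "integrable lborel (\<lambda>q. exp (pairing m z) * (indicator (Q_box \<sigma>) q * \<psi> (q + m)))" by simp
  qed simp
  also have "\<dots> = (\<Sum>m\<in>F. exp (pairing m z) * (LINT t|lborel. indicator (Q_box \<sigma>) (t - m) * \<psi> t))"
  proof (intro sum.cong refl arg_cong2[where f = "(*)"])
   fix m
   have "(\<lambda>t. indicator (Q_box \<sigma>) (t - m) * \<psi> t) \<in> borel_measurable borel" using int[of m] by auto
   from integral_shift[OF this, of m]
   show "(LINT q|lborel. indicator (Q_box \<sigma>) q * \<psi> (q + m)) = (LINT t|lborel. indicator (Q_box \<sigma>) (t - m) * \<psi> t)" by simp
  qed
  also have "\<dots> = (LINT t|lborel. (\<Sum>m\<in>F. exp (pairing m z) * (indicator (Q_box \<sigma>) (t - m) * \<psi> t)))"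
   using int by (subst Bochner_Integration.integral_sum) auto
  also have "\<dots> = ?I"
  proof (rule int_cong)
   fix t
   show "(\<Sum>m\<in>F. exp (pairing m z) * (indicator (Q_box \<sigma>) (t - m) * \<psi> t)) = (\<Sum>m\<in>RR t. exp (pairing m z)) * \<psi> t"
   proof (cases "norm t > R")
    case False
    have "(\<Sum>m\<in>F. exp (pairing m z) * (indicator (Q_box \<sigma>) (t - m) * \<psi> t)) = (\<Sum>m\<in>F. exp (pairing m z) * indicator (Q_box \<sigma>) (t - m)) * \<psi> t"
     by (simp add: sum_distrib_right mult.assoc)
    then show ?thesis using RR_sum_indicator[OF RQ, of t R] False by (simp add: F_def)
   qed (simp add: R)
  qed
  finally show ?thesis .
 qed
 have "((\<lambda>n. LINT q|lborel. h q * (fhat g n * ech (- n) q)) has_sum (LINT q|lborel. h q * (\<Sum>\<^sub>\<infinity>n\<in>N. fhat g n * ech (- n) q))) N"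
  by (rule infsum_integral_swap[OF _ _ fhat_summable[OF tg] hint])
   (auto simp: norm_mult norm_ech intro!: continuous_intros ech_cont)
 then have S: "((\<lambda>n. LINT q|lborel. h q * (fhat g n * ech (- n) q)) has_sum (vol C * ?I)) N"
  unfolding fourier_inversion[OF tg, symmetric] one[symmetric] integral_mult_right_zero[symmetric] mult.left_commute[of _ "vol C"] .
 have trm: "(LINT q|lborel. h q * (fhat g n * ech (- n) q)) =
   (P * vol (Q_box \<sigma>)) * ?t n" if n: "n \<in> N" for n
 proof -
  have "(LINT q|lborel. h q * (fhat g n * ech (- n) q)) =
   (LINT q|lborel. fhat g n * (indicator (Q_box \<sigma>) q * exp (- (\<Sum>\<alpha>\<in>\<sigma>. pairing \<alpha> (lat_shift z n) * of_real (q \<bullet> dv \<alpha>)))))"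
   unfolding h_def pairing_dv[symmetric] unfolding pairing_lat_shift
   by (rule int_cong) (simp add: ech_def exp_minus exp_add exp_diff field_simps)
  also have "\<dots> = fhat g n * ((\<Prod>\<alpha>\<in>\<sigma>. (1 - exp (- pairing \<alpha> (lat_shift z n))) / pairing \<alpha> (lat_shift z n)) * vol (Q_box \<sigma>))"
   unfolding integral_mult_right_zero vol_def
   by (subst box_integral) (use z n in \<open>auto simp: generic_def\<close>)
  \<comment> \<open>The numerators do not depend on \<open>n\<close>, because \<alpha> is integral
    on \<open>N\<close>; they form the common factor \<open>P\<close>, which is the denominator of
    \<open>FF\<close>.\<close>
  also have "(\<Prod>\<alpha>\<in>\<sigma>. (1 - exp (- pairing \<alpha> (lat_shift z n))) / pairing \<alpha> (lat_shift z n)) = P / (\<Prod>\<alpha>\<in>\<sigma>. pairing \<alpha> (lat_shift z n))"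
   unfolding prod_dividef P_def exp_minus using exp_lat_shift[OF n] \<sigma>M by (auto intro!: prod.cong arg_cong2[where f = "(/)"])
  finally show ?thesis by (simp add: psihat_fhat g_def)
 qed
 have "((\<lambda>n. (P * vol (Q_box \<sigma>)) * ?t n) has_sum
   (vol C * ?I)) N"
  by (rule has_sum_cong[of N, OF trm, THEN iffD1, OF _ S])
 then have "((\<lambda>n. (1 / (P * vol (Q_box \<sigma>))) * ((P * vol (Q_box \<sigma>)) * ?t n)) has_sum
   (1 / (P * vol (Q_box \<sigma>))) * (vol C * ?I)) N"
  by (rule has_sum_cmult_right)
 moreover have nz: "P * vol (Q_box \<sigma>) \<noteq> 0" using P vol_Q idx_pos vol_C_nonzero by simp
 moreover have "(1 / (P * vol (Q_box \<sigma>))) * ((P * vol (Q_box \<sigma>)) * x) = x" for x using nz by simp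
 moreover have "(1 / (P * vol (Q_box \<sigma>))) * (vol C * ?I) = (LINT t|lborel. FF t z * \<psi> t)"
 proof -
  have "FF t z * \<psi> t = (1 / (of_nat idx * P)) * ((\<Sum>m\<in>RR t. exp (pairing m z)) * \<psi> t)" for t
   by (simp add: FF_def P_def)
  then have "(LINT t|lborel. FF t z * \<psi> t) = (1 / (of_nat idx * P)) * ?I"
   by (simp only: integral_mult_right_zero)
  then show ?thesis using vol_C_nonzero by (simp add: vol_Q)
 qed
 ultimately show ?thesis by (simp only:)
qed

end

section \<open>Taylor coefficients of integrals\<close>

text \<open>Cauchy's inequality on the circle of radius \<open>\<rho> / 2\<close> bounds the
  coefficients by \<open>g\<close> times powers of \<open>2 / \<rho>\<close>. For
  \<open>norm s < \<rho> / 4\<close> the power series is then dominated by a geometric one, and sum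
  and integral can be exchanged. The measure is left open so that lattice sums are covered by the
  counting measure.\<close>

lemma integral_coeff:
 fixes f :: "'a \<Rightarrow> complex \<Rightarrow> complex"
 assumes \<rho>: "\<rho> > 0" and hol: "\<And>\<omega>. f \<omega> holomorphic_on ball 0 \<rho>"
  and bd: "\<And>\<omega> s. norm s < \<rho> \<Longrightarrow> norm (f \<omega> s) \<le> g \<omega>"
  and fps: "\<And>\<omega>. f \<omega> has_fps_expansion F \<omega>"
  and meas: "\<And>D. (\<lambda>\<omega>. fps_nth (F \<omega>) D) \<in> borel_measurable M'" and g: "integrable M' g"
 shows "integrable M' (\<lambda>\<omega>. fps_nth (F \<omega>) D)"
  and "(\<lambda>s. LINT \<omega>|M'. f \<omega> s) has_fps_expansion Abs_fps (\<lambda>D. LINT \<omega>|M'. fps_nth (F \<omega>) D)"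
proof -
 have g0: "0 \<le> g \<omega>" for \<omega>
  using order_trans[OF norm_ge_zero bd[of 0 \<omega>]] \<rho> by simp
 have cb: "norm (fps_nth (F \<omega>) D) \<le> g \<omega> * (2 / \<rho>) ^ D" for \<omega> D
 proof -
  have "norm ((deriv ^^ D) (f \<omega>) 0) \<le> fact D * g \<omega> / (\<rho> / 2) ^ D"
  proof (rule Cauchy_inequality)
   show "f \<omega> holomorphic_on ball 0 (\<rho> / 2)" by (rule holomorphic_on_subset[OF hol]) (use \<rho> in auto)
   show "continuous_on (cball 0 (\<rho> / 2)) (f \<omega>)"
    by (rule continuous_on_subset[OF holomorphic_on_imp_continuous_on[OF hol]]) (use \<rho> in auto)
   show "norm (f \<omega> x) \<le> g \<omega>" if "norm (0 - x) = \<rho> / 2" for x by (rule bd) (use that \<rho> in auto)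
  qed (use \<rho> in simp)
  then show ?thesis unfolding fps_nth_fps_expansion[OF fps] by (simp add: norm_divide field_simps power_divide)
 qed
 show int: "integrable M' (\<lambda>\<omega>. fps_nth (F \<omega>) D)" for D
 proof (rule Bochner_Integration.integrable_bound)
  show "integrable M' (\<lambda>\<omega>. g \<omega> * (2 / \<rho>) ^ D)" using g by simp
  show "AE \<omega> in M'. norm (fps_nth (F \<omega>) D) \<le> norm (g \<omega> * (2 / \<rho>) ^ D)"
   using cb g0 \<rho> by (intro AE_I2) (simp add: abs_mult)
 qed (rule meas)
 show "(\<lambda>s. LINT \<omega>|M'. f \<omega> s) has_fps_expansion Abs_fps (\<lambda>D. LINT \<omega>|M'. fps_nth (F \<omega>) D)"
 proof (rule has_fps_expansionI)
  have "\<forall>\<^sub>F s in nhds 0. s \<in> ball (0::complex) (\<rho> / 4)" using \<rho> by (intro eventually_nhds_in_open) auto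
  then show "\<forall>\<^sub>F s in nhds 0. (\<lambda>D. fps_nth (Abs_fps (\<lambda>D. LINT \<omega>|M'. fps_nth (F \<omega>) D)) D * s ^ D) sums (LINT \<omega>|M'. f \<omega> s)"
  proof (rule eventually_mono)
   fix s :: complex assume "s \<in> ball 0 (\<rho> / 4)"
   then have s: "norm s < \<rho> / 4" by simp
   define q where "q = 2 / \<rho> * norm s"
   have q: "0 \<le> q" "q < 1" using s \<rho> by (auto simp: q_def field_simps)
   have tb: "norm (fps_nth (F \<omega>) D * s ^ D) \<le> g \<omega> * q ^ D" for \<omega> D
    using mult_right_mono[OF cb[of \<omega> D], of "norm s ^ D"]
    by (simp add: norm_mult norm_power q_def power_mult_distrib power_divide mult.assoc)
   have sg: "summable (\<lambda>D. c * q ^ D)" for c using q by (intro summable_mult summable_geometric) simp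
   have sum: "(\<Sum>D. fps_nth (F \<omega>) D * s ^ D) = f \<omega> s" for \<omega>
   proof -
    have "s \<in> ball 0 \<rho>" using s \<rho> by simp
    from holomorphic_power_series[OF hol this, of \<omega>]
    show ?thesis unfolding fps_nth_fps_expansion[OF fps] by (simp add: sums_iff)
   qed
   have "(\<lambda>D. LINT \<omega>|M'. fps_nth (F \<omega>) D * s ^ D) sums (LINT \<omega>|M'. (\<Sum>D. fps_nth (F \<omega>) D * s ^ D))"
   proof (rule sums_integral)
    show ints: "integrable M' (\<lambda>\<omega>. fps_nth (F \<omega>) D * s ^ D)" for D using int by simp
    show "AE \<omega> in M'. summable (\<lambda>D. norm (fps_nth (F \<omega>) D * s ^ D))"
    proof (rule AE_I2)
     fix \<omega> show "summable (\<lambda>D. norm (fps_nth (F \<omega>) D * s ^ D))"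
      by (rule summable_comparison_test[OF _ sg[of "g \<omega>"]]) (use tb in auto)
    qed
    show "summable (\<lambda>D. LINT \<omega>|M'. norm (fps_nth (F \<omega>) D * s ^ D))"
    proof (rule summable_comparison_test[OF _ sg[of "integral\<^sup>L M' g"]], intro exI allI impI)
     fix D
     have "norm (LINT \<omega>|M'. norm (fps_nth (F \<omega>) D * s ^ D)) = (LINT \<omega>|M'. norm (fps_nth (F \<omega>) D * s ^ D))"
      by simp
     also have "\<dots> \<le> (LINT \<omega>|M'. g \<omega> * q ^ D)"
      by (rule integral_mono) (use ints g tb in auto)
     finally show "norm (LINT \<omega>|M'. norm (fps_nth (F \<omega>) D * s ^ D)) \<le> integral\<^sup>L M' g * q ^ D" by simp
    qed
   qed
   then show "(\<lambda>D. fps_nth (Abs_fps (\<lambda>D. LINT \<omega>|M'. fps_nth (F \<omega>) D)) D * s ^ D) sums (LINT \<omega>|M'. f \<omega> s)"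
    by (simp add: sum)
  qed
 qed
qed

lemma tc_sum:
 assumes "\<And>i. i \<in> A \<Longrightarrow> nice (g i)"
 shows "tc d (\<lambda>z. \<Sum>i\<in>A. g i z) z = (\<Sum>i\<in>A. tc d (g i) z)"
 using assms
proof (induction A rule: infinite_finite_induct)
 case (insert a A)
 then show ?case by (simp add: tc_add nice_holo nice_sum)
qed (simp_all add: tc_const)

text \<open>Outside a finite range of \<open>k\<close> the translate has modulus at least 1; inside,
  a minimum over finitely many nonzero values remains.\<close>

lemma int_shift_gap:
 fixes p :: complex
 obtains \<delta> where "\<delta> > 0" "\<And>k::int. p + 2 * of_real pi * \<i> * of_int k \<noteq> 0 \<Longrightarrow> \<delta> \<le> norm (p + 2 * of_real pi * \<i> * of_int k)"
proof -
 define h where "h = (\<lambda>k::int. p + 2 * of_real pi * \<i> * of_int k)"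
 define F where "F = {k\<in>{- \<lceil>norm p + 1\<rceil>..\<lceil>norm p + 1\<rceil>}. h k \<noteq> 0}"
 have fin: "finite F" by (rule finite_subset[of _ "{- \<lceil>norm p + 1\<rceil>..\<lceil>norm p + 1\<rceil>}"]) (auto simp: F_def)
 define \<delta> where "\<delta> = Min (insert 1 ((\<lambda>k. norm (h k)) ` F))"
 have "\<delta> > 0" unfolding \<delta>_def using fin by (subst Min_gr_iff) (auto simp: F_def)
 moreover have "\<delta> \<le> norm (h k)" if nz: "h k \<noteq> 0" for k
 proof (cases "k \<in> F")
  case True then show ?thesis unfolding \<delta>_def using fin by (intro Min_le) auto
 next
  case False
  then have "\<not> \<bar>k\<bar> \<le> \<lceil>norm p + 1\<rceil>" using nz by (auto simp: F_def abs_le_iff)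
  then have "norm p + 1 < \<bar>real_of_int k\<bar>" by (simp add: not_le less_ceiling_iff ceiling_less_iff) linarith
  moreover have "1 * \<bar>real_of_int k\<bar> \<le> (2 * pi) * \<bar>real_of_int k\<bar>" using pi_gt3 by (intro mult_right_mono) auto
  moreover have "norm (2 * of_real pi * \<i> * of_int k :: complex) = 2 * pi * \<bar>real_of_int k\<bar>" by (simp add: norm_mult)
  moreover have "norm (2 * of_real pi * \<i> * of_int k :: complex) \<le> norm (h k) + norm p"
   using norm_triangle_ineq4[of "h k" p] by (simp add: h_def)
  ultimately have "1 \<le> norm (h k)" by linarith
  moreover have "\<delta> \<le> 1" unfolding \<delta>_def using fin by (intro Min_le) auto
  ultimately show ?thesis by linarith
 qed
 ultimately show ?thesis by (intro that[of \<delta>]) (simp_all add: h_def)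
qed

lemma lat_shift_diff: "lat_shift (y - z) n = lat_shift y n - z"
 by (simp add: lat_shift_def)

section \<open>Uniform distance of lattice translates from the hyperplanes\<close>

context lattice
begin

lemma shift_gap:
 assumes "finite A" "A \<subseteq> M" "\<And>\<alpha> n. \<alpha> \<in> A \<Longrightarrow> n \<in> N \<Longrightarrow> pairing \<alpha> (lat_shift y n) \<noteq> 0"
 obtains \<delta> where "\<delta> > 0" "\<And>\<alpha> n. \<alpha> \<in> A \<Longrightarrow> n \<in> N \<Longrightarrow> \<delta> \<le> norm (pairing \<alpha> (lat_shift y n))"
proof -
 have "\<exists>\<delta>>0. \<forall>n\<in>N. \<delta> \<le> norm (pairing \<alpha> (lat_shift y n))" if a: "\<alpha> \<in> A" for \<alpha>
 proof -
  obtain \<delta> where \<delta>: "\<delta> > 0" "\<And>k::int. pairing \<alpha> y + 2 * of_real pi * \<i> * of_int k \<noteq> 0 \<Longrightarrow> \<delta> \<le> norm (pairing \<alpha> y + 2 * of_real pi * \<i> * of_int k)"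
   by (rule int_shift_gap) blast
  have "\<delta> \<le> norm (pairing \<alpha> (lat_shift y n))" if n: "n \<in> N" for n
  proof -
   have "\<alpha> \<bullet> n \<in> \<int>" using M_inner_N n a assms(2) by blast
   then obtain k where "\<alpha> \<bullet> n = of_int k" by (auto elim: Ints_cases)
   then have "pairing \<alpha> (lat_shift y n) = pairing \<alpha> y + 2 * of_real pi * \<i> * of_int k" by (simp add: pairing_lat_shift)
   then show ?thesis using \<delta>(2) assms(3)[OF a n] by simp
  qed
  then show ?thesis using \<delta>(1) by blast
 qed
 then obtain \<delta> where \<delta>: "\<And>\<alpha>. \<alpha> \<in> A \<Longrightarrow> \<delta> \<alpha> > 0" "\<And>\<alpha> n. \<alpha> \<in> A \<Longrightarrow> n \<in> N \<Longrightarrow> \<delta> \<alpha> \<le> norm (pairing \<alpha> (lat_shift y n))"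
  by metis
 show ?thesis
 proof (rule that)
  show "Min (insert 1 (\<delta> ` A)) > 0" using assms(1) \<delta>(1) by (subst Min_gr_iff) auto
  show "Min (insert 1 (\<delta> ` A)) \<le> norm (pairing \<alpha> (lat_shift y n))" if "\<alpha> \<in> A" "n \<in> N" for \<alpha> n
   by (rule order_trans[OF _ \<delta>(2)[OF that]]) (use assms(1) that in \<open>auto intro: Min_le\<close>)
 qed
qed

text \<open>Half of the gap at \<open>y\<close> is kept: the radius is small enough for the
  displacement along \<open>x\<close> to change each form by at most the other half.\<close>

lemma shift_gap_line:
 assumes "finite A" "A \<subseteq> M" "\<And>\<alpha> n. \<alpha> \<in> A \<Longrightarrow> n \<in> N \<Longrightarrow> pairing \<alpha> (lat_shift y n) \<noteq> 0"
 obtains \<delta> \<rho> where "\<delta> > 0" "\<rho> > 0"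
  "\<And>\<alpha> n s. \<alpha> \<in> A \<Longrightarrow> n \<in> N \<Longrightarrow> norm s \<le> \<rho> \<Longrightarrow> \<delta> \<le> norm (pairing \<alpha> (lat_shift y n - s *s x))"
proof -
 obtain \<delta> where \<delta>: "\<delta> > 0" "\<And>\<alpha> n. \<alpha> \<in> A \<Longrightarrow> n \<in> N \<Longrightarrow> \<delta> \<le> norm (pairing \<alpha> (lat_shift y n))"
  using shift_gap[OF assms] by blast
 define X where "X = 1 + (\<Sum>\<alpha>\<in>A. norm (pairing \<alpha> x))"
 have X: "X \<ge> 1" by (simp add: X_def sum_nonneg)
 have Xa: "norm (pairing \<alpha> x) \<le> X" if "\<alpha> \<in> A" for \<alpha>
  using member_le_sum[OF that, of "\<lambda>\<alpha>. norm (pairing \<alpha> x)"] assms(1) by (simp add: X_def)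
 show ?thesis
 proof (rule that[of "\<delta> / 2" "\<delta> / (2 * X)"])
  fix \<alpha> n and s :: complex assume a: "\<alpha> \<in> A" "n \<in> N" "norm s \<le> \<delta> / (2 * X)"
  have "norm (s * pairing \<alpha> x) \<le> \<delta> / (2 * X) * X" unfolding norm_mult using a Xa[OF a(1)] \<delta>(1) X by (intro mult_mono) auto
  then have "norm (s * pairing \<alpha> x) \<le> \<delta> / 2" using X by simp
  moreover have "norm (pairing \<alpha> (lat_shift y n)) \<le> norm (pairing \<alpha> (lat_shift y n - s *s x)) + norm (s * pairing \<alpha> x)"
   using norm_triangle_ineq[of "pairing \<alpha> (lat_shift y n - s *s x)" "s * pairing \<alpha> x"] by (simp add: pairing_diff_right pairing_smult_right)
  ultimately show "\<delta> / 2 \<le> norm (pairing \<alpha> (lat_shift y n - s *s x))" using \<delta>(2)[OF a(1,2)] by linarith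
 qed (use \<delta> X in auto)
qed

end

section \<open>The regular factor under the residue\<close>

context primitive_basis
begin

text \<open>The part of \<open>qq\<close> that does not involve \<open>t\<close>: the denominators
  of \<open>FF\<close> at \<open>y - z\<close>, invertible near \<open>z = 0\<close> for generic
  \<open>y\<close>, together with the index.\<close>

definition gq :: "complex^'n \<Rightarrow> complex^'n \<Rightarrow> complex" where
 "gq y z = 1 / of_nat idx * (\<Prod>\<alpha>\<in>\<sigma>. inverse (1 + (- exp (- pairing \<alpha> y)) * exp (pairing \<alpha> z)))"

text \<open>The holomorphic factor of the germ whose residue is taken, that is, its numerator once
  \<open>f\<close> is a fraction with numerator 1. In \<open>qq_expand\<close> the point
  \<open>t\<close> enters the factors depending on \<open>z\<close> only through
  \<open>t - m\<close>, which stays in the box.\<close>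

definition qq :: "complex^'n \<Rightarrow> real^'n \<Rightarrow> complex^'n \<Rightarrow> complex" where
 "qq y t z = exp (pairing t z) * FF t (y - z)"

lemma qq_expand: "qq y t z = (\<Sum>m\<in>RR t. exp (pairing m y) * (exp (pairing (t - m) z) * gq y z))"
proof -
 have "exp (pairing t z) * exp (pairing m (y - z)) = exp (pairing m y) * exp (pairing (t - m) z)" for m
  unfolding exp_add[symmetric] by (simp add: pairing_simps algebra_simps)
 then have "exp (pairing t z) * (\<Sum>m\<in>RR t. exp (pairing m (y - z))) = (\<Sum>m\<in>RR t. exp (pairing m y) * exp (pairing (t - m) z))"
  by (simp add: sum_distrib_left)
 moreover have "(\<Prod>\<alpha>\<in>\<sigma>. 1 - exp (- pairing \<alpha> (y - z))) = (\<Prod>\<alpha>\<in>\<sigma>. 1 + (- exp (- pairing \<alpha> y)) * exp (pairing \<alpha> z))"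
  by (simp add: pairing_simps exp_diff exp_minus field_simps)
 ultimately have "qq y t z = (\<Sum>m\<in>RR t. exp (pairing m y) * exp (pairing (t - m) z)) * gq y z"
  unfolding qq_def FF_def gq_def by (simp add: divide_inverse prod_inversef[unfolded o_def, symmetric])
 then show ?thesis by (simp add: sum_distrib_right mult.assoc)
qed

lemma nice_gq: assumes "generic y" shows "nice (gq y)"
 unfolding gq_def[abs_def]
proof (intro nice_scale nice_prod nice_inverse nice_add nice_const nice_exp)
 fix \<alpha> assume "\<alpha> \<in> \<sigma>"
 then show "1 + - exp (- pairing \<alpha> y) * exp (pairing \<alpha> 0) \<noteq> 0" using generic_exp[OF assms] by simp
qed

lemma nice_qq: "generic y \<Longrightarrow> nice (qq y t)"
 unfolding qq_expand[abs_def] by (intro nice_sum nice_scale nice_mult nice_exp nice_gq)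

lemma tc_qq:
 assumes "generic y"
 shows "tc D (qq y t) x = (\<Sum>m\<in>RR t. exp (pairing m y) * (\<Sum>i\<le>D. pairing (t - m) x ^ i / fact i * tc (D - i) (gq y) x))"
 unfolding qq_expand[abs_def]
 by (simp add: tc_sum tc_scale tc_mult tc_exp nice_holo nice_scale nice_mult nice_exp nice_gq[OF assms])

lemma FF_generic_line:
 assumes "generic y" obtains \<delta> \<rho> where "\<delta> > 0" "\<rho> > 0"
  "\<And>\<alpha> n s. \<alpha> \<in> \<sigma> \<Longrightarrow> n \<in> N \<Longrightarrow> norm s \<le> \<rho> \<Longrightarrow> \<delta> \<le> norm (pairing \<alpha> (lat_shift y n - s *s x))"
  "\<And>s. norm s \<le> \<rho> \<Longrightarrow> generic (y - s *s x)"
proof -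
 obtain \<delta> \<rho> where *: "\<delta> > 0" "\<rho> > 0" "\<And>\<alpha> n s. \<alpha> \<in> \<sigma> \<Longrightarrow> n \<in> N \<Longrightarrow> norm s \<le> \<rho> \<Longrightarrow> \<delta> \<le> norm (pairing \<alpha> (lat_shift y n - s *s x))"
  using shift_gap_line[OF fin \<sigma>M, of y x] assms unfolding generic_def by blast
 have "generic (y - s *s x)" if "norm s \<le> \<rho>" for s
  unfolding generic_def lat_shift_diff using *(3)[OF _ _ that] *(1) by force
 with * show ?thesis by (rule that)
qed

lemma gq_line:
 assumes "\<And>s. norm s \<le> \<rho> \<Longrightarrow> generic (y - s *s x)"
 shows "continuous_on (cball 0 \<rho>) (\<lambda>s. gq y (s *s x))" "(\<lambda>s. gq y (s *s x)) holomorphic_on ball 0 \<rho>"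
proof -
 have nz: "1 + - exp (- pairing \<alpha> y) * exp (s * pairing \<alpha> x) \<noteq> 0" if "norm s \<le> \<rho>" "\<alpha> \<in> \<sigma>" for s \<alpha>
 proof -
  have "exp (- pairing \<alpha> (y - s *s x)) \<noteq> 1" by (rule generic_exp[OF assms[OF that(1)] that(2)])
  then show ?thesis by (simp add: pairing_diff_right pairing_smult_right exp_diff exp_minus field_simps)
 qed
 show "continuous_on (cball 0 \<rho>) (\<lambda>s. gq y (s *s x))" unfolding gq_def pairing_smult_right
  using nz by (intro continuous_on_mult continuous_on_prod continuous_on_inverse continuous_on_add continuous_on_exp continuous_on_const continuous_on_id) auto
 show "(\<lambda>s. gq y (s *s x)) holomorphic_on ball 0 \<rho>" unfolding gq_def pairing_smult_right
  using nz by (intro holomorphic_on_mult holomorphic_on_prod holomorphic_on_inverse holomorphic_on_add holomorphic_on_const holomorphic_on_exp' holomorphic_on_ident) auto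
qed

lemma qq_line_holomorphic:
 assumes "\<And>s. norm s \<le> \<rho> \<Longrightarrow> generic (y - s *s x)"
 shows "(\<lambda>s. qq y t (s *s x)) holomorphic_on ball 0 \<rho>"
 unfolding qq_expand
 by (intro holomorphic_on_sum holomorphic_on_mult holomorphic_on_const gq_line(2)[OF assms])
  (auto simp: pairing_smult_right intro!: holomorphic_intros)

text \<open>For indices in \<open>RR t\<close> the difference \<open>t - m\<close> lies in the
  bounded box, and for bounded \<open>t\<close> the indices lie in a fixed finite set; so one bound
  serves all \<open>t\<close> and \<open>s\<close>.\<close>

lemma qq_line_bound:
 assumes "\<And>s. norm s \<le> \<rho> \<Longrightarrow> generic (y - s *s x)"
 obtains B where "\<And>t s. norm t \<le> R \<Longrightarrow> norm s \<le> \<rho> \<Longrightarrow> norm (qq y t (s *s x)) \<le> B"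
proof -
 obtain RQ where RQ: "\<And>q. q \<in> Q_box \<sigma> \<Longrightarrow> norm q \<le> RQ" using Q_box_radius by blast
 define F where "F = {m\<in>M. norm m \<le> R + RQ}"
 have finF: "finite F" by (auto simp: F_def finite_M_ball)
 have "compact ((\<lambda>s. gq y (s *s x)) ` cball 0 \<rho>)"
  by (rule compact_continuous_image[OF gq_line(1)[OF assms]]) auto
 from compact_imp_bounded[OF this] obtain G where "\<forall>z\<in>(\<lambda>s. gq y (s *s x)) ` cball 0 \<rho>. norm z \<le> G" unfolding bounded_iff by blast
 then have G: "norm (gq y (s *s x)) \<le> G" if "norm s \<le> \<rho>" for s using that by auto
 obtain P where P: "\<And>q. q \<in> Q_box \<sigma> \<Longrightarrow> norm (pairing q x) \<le> P"
  using continuous_bounded_on[OF linear_continuous_on[OF bounded_linear_pairing_left[of x]] Q_box_bounded] by blast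
 show ?thesis
 proof (rule that)
  fix t :: "real^'n" and s :: complex assume t: "norm t \<le> R" and s: "norm s \<le> \<rho>"
  have term_le: "norm (exp (pairing m y) * (exp (pairing (t - m) (s *s x)) * gq y (s *s x))) \<le> norm (exp (pairing m y)) * (exp (\<rho> * P) * G)"
   if m: "m \<in> RR t" for m
   unfolding norm_mult
  proof (intro mult_left_mono mult_mono)
   have "norm (exp (pairing (t - m) (s *s x))) \<le> exp (norm (pairing (t - m) (s *s x)))" by (rule norm_exp)
   also have "\<dots> \<le> exp (\<rho> * P)"
    using P[of "t - m"] m s order_trans[OF norm_ge_zero s] by (auto simp: RR_def pairing_smult_right norm_mult intro!: mult_mono)
   finally show "norm (exp (pairing (t - m) (s *s x))) \<le> exp (\<rho> * P)" .
  qed (use G[OF s] in auto)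
  have G0: "0 \<le> G" using G[OF s] norm_ge_zero order_trans by blast
  have "norm (qq y t (s *s x)) \<le> (\<Sum>m\<in>RR t. norm (exp (pairing m y)) * (exp (\<rho> * P) * G))"
   unfolding qq_expand by (rule order_trans[OF norm_sum sum_mono[OF term_le]])
  also have "\<dots> \<le> (\<Sum>m\<in>F. norm (exp (pairing m y)) * (exp (\<rho> * P) * G))"
   using RR_subset[OF RQ t] finF G0 by (intro sum_mono2) (auto simp: F_def)
  finally show "norm (qq y t (s *s x)) \<le> (\<Sum>m\<in>F. norm (exp (pairing m y)) * (exp (\<rho> * P) * G))" .
 qed
qed

text \<open>Where \<psi> is nonzero, \<open>t\<close> is bounded, so the index set can be made fixed
  and finite with measurable indicators.\<close>

lemma RR_sum_measurable:
 assumes "\<And>m. h m \<in> borel_measurable borel" "\<psi> \<in> borel_measurable borel" "\<And>t. norm t > R \<Longrightarrow> \<psi> t = (0::complex)"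
 shows "(\<lambda>t. (\<Sum>m\<in>RR t. h m t) * \<psi> t) \<in> borel_measurable borel"
proof -
 obtain RQ where RQ: "\<And>q. q \<in> Q_box \<sigma> \<Longrightarrow> norm q \<le> RQ" using Q_box_radius by blast
 define F where "F = {m\<in>M. norm m \<le> R + RQ}"
 have "(\<lambda>t. (\<Sum>m\<in>RR t. h m t) * \<psi> t) = (\<lambda>t. (\<Sum>m\<in>F. h m t * indicator (Q_box \<sigma>) (t - m)) * \<psi> t)"
 proof
  fix t show "(\<Sum>m\<in>RR t. h m t) * \<psi> t = (\<Sum>m\<in>F. h m t * indicator (Q_box \<sigma>) (t - m)) * \<psi> t"
  proof (cases "norm t > R")
  case False
  then show ?thesis using RR_sum_indicator[OF RQ, of t R "\<lambda>m. h m t"] by (simp add: F_def)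
  qed (simp add: assms(3))
 qed
 moreover note [measurable] = assms(1,2)
 have "(\<lambda>t. (\<Sum>m\<in>F. h m t * indicator (Q_box \<sigma>) (t - m)) * \<psi> t) \<in> borel_measurable borel" by measurable
 ultimately show ?thesis by (simp only:)
qed

text \<open>
 Both sides are the coefficient of \<open>s\<^sup>D\<close> in the integral of \<open>qq y t (s x) \<psi>(t)\<close>, by \<open>phi_identity\<close> at \<open>y - s x\<close>
 for the test function \<open>exp \<langle>t, s x\<rangle> \<psi>(t)\<close>.
\<close>

theorem exchange:
 assumes y: "generic y" and \<psi>: "test_fun UNIV \<psi>" and as: "set as = \<sigma>" "distinct as"
 shows "integrable lborel (\<lambda>t. tc D (qq y t) x * \<psi> t)"
  and "((\<lambda>n. kernel_coeff as D x (lat_shift y n) * psihat \<psi> (lat_shift y n)) has_sum (LINT t|lborel. tc D (qq y t) x * \<psi> t)) N"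
proof -
 obtain \<delta> \<rho> where \<delta>: "\<delta> > 0" "\<rho> > 0"
  and gap: "\<And>\<alpha> n s. \<alpha> \<in> \<sigma> \<Longrightarrow> n \<in> N \<Longrightarrow> norm s \<le> \<rho> \<Longrightarrow> \<delta> \<le> norm (pairing \<alpha> (lat_shift y n - s *s x))"
  and gen: "\<And>s. norm s \<le> \<rho> \<Longrightarrow> generic (y - s *s x)"
  using FF_generic_line[OF y] by blast
 obtain R where R: "\<And>t. norm t > R \<Longrightarrow> \<psi> t = 0" using test_fun_radius[OF \<psi>] by blast
 obtain B where B: "\<And>t s. norm t \<le> R \<Longrightarrow> norm s \<le> \<rho> \<Longrightarrow> norm (qq y t (s *s x)) \<le> B" using qq_line_bound[OF gen] by blast
 have \<psi>m[measurable]: "\<psi> \<in> borel_measurable borel" by (rule borel_measurable_continuous_onI[OF test_fun_continuous[OF \<psi>]])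
 have m1: "(\<lambda>t. fps_nth (tfps (qq y t) x * fps_const (\<psi> t)) D) \<in> borel_measurable lborel" for D
 proof -
  have pm: "(\<lambda>t. pairing (t - m) x) \<in> borel_measurable borel" for m
   by (intro borel_measurable_continuous_onI continuous_on_compose2[OF linear_continuous_on[OF bounded_linear_pairing_left[of x]], of UNIV]) (auto intro!: continuous_intros)
  note [measurable] = pm
  have "(\<lambda>t. tc D (qq y t) x * \<psi> t) \<in> borel_measurable borel"
   unfolding tc_qq[OF y] by (rule RR_sum_measurable[OF _ \<psi>m R]) measurable
  then show ?thesis by simp
 qed
 have gi: "integrable lborel (\<lambda>t. B * norm (\<psi> t))" using integrable_test_fun[OF \<psi>] by simp
 have hol1: "(\<lambda>s. qq y t (s *s x) * \<psi> t) holomorphic_on ball 0 \<rho>" for t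
  by (intro holomorphic_on_mult qq_line_holomorphic[OF gen] holomorphic_on_const)
 have fps1: "(\<lambda>s. qq y t (s *s x) * \<psi> t) has_fps_expansion tfps (qq y t) x * fps_const (\<psi> t)" for t
  by (intro has_fps_expansion_cmult_right holo_at0_fps nice_holo nice_qq y)
 have bd1: "norm (qq y t (s *s x) * \<psi> t) \<le> B * norm (\<psi> t)" if "norm s < \<rho>" for t s
  using B[of t s] R[of t] that by (cases "norm t > R") (auto simp: norm_mult intro!: mult_right_mono)
 note f1 = integral_coeff[where \<rho> = \<rho> and M' = lborel, OF \<delta>(2) hol1 bd1 fps1 m1 gi]
 from f1(1)[of D] show "integrable lborel (\<lambda>t. tc D (qq y t) x * \<psi> t)" by simp
 \<comment> \<open>\<open>integral_coeff\<close> asks for its hypotheses at every index, not only on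
   \<open>N\<close>; outside \<open>N\<close> the weight is 0 and the base point is a harmless one
   that keeps the gap.\<close>
 define c where "c = (\<lambda>n. if n \<in> N then psihat \<psi> (lat_shift y n) else 0)"
 define w where "w = (\<lambda>n. if n \<in> N then lat_shift y n else lat_shift y 0)"
 let ?K = "\<lambda>n s. (\<Prod>\<alpha>\<leftarrow>as. 1 / pairing \<alpha> (w n - s *s x)) * c n"
 have gapw: "\<delta> \<le> norm (pairing \<alpha> (w n - s *s x))" if "\<alpha> \<in> \<sigma>" "norm s \<le> \<rho>" for \<alpha> n s
  using gap[OF that(1) _ that(2)] N_0 by (simp add: w_def)
 have cs: "(\<lambda>n. norm (c n)) summable_on N"
  by (rule summable_on_cong[THEN iffD2, OF _ psihat_summable[OF \<psi>]]) (simp add: c_def)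
 have nz: "pairing \<alpha> (w n - s *s x) \<noteq> 0" if "\<alpha> \<in> set as" "norm s \<le> \<rho>" for \<alpha> n s
  using gapw[of \<alpha> s n] that as \<delta>(1) by auto
 have gi2: "integrable (count_space N) (\<lambda>n. (1 / \<delta>) ^ length as * norm (c n))"
  using cs abs_summable_equivalent[of c N] by (simp add: abs_summable_on_def integrable_norm)
 have hol2: "(\<lambda>s. ?K n s) holomorphic_on ball 0 \<rho>" for n
 proof -
  have "(\<lambda>s. \<Prod>\<alpha>\<leftarrow>bs. 1 / pairing \<alpha> (w n - s *s x)) holomorphic_on ball 0 \<rho>" if "set bs \<subseteq> set as" for bs
   using that
  proof (induction bs)
   case (Cons a bs)
   have "(\<lambda>s. 1 / pairing a (w n - s *s x)) holomorphic_on ball 0 \<rho>"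
    using nz[of a _ n] Cons.prems unfolding pairing_diff_right pairing_smult_right by (intro holomorphic_intros) auto
   moreover have "(\<lambda>s. \<Prod>\<alpha>\<leftarrow>bs. 1 / pairing \<alpha> (w n - s *s x)) holomorphic_on ball 0 \<rho>" using Cons by simp
   ultimately show ?case unfolding list.map prod_list.Cons by (rule holomorphic_on_mult)
  qed (simp add: holomorphic_on_const)
  then show ?thesis by (intro holomorphic_on_mult holomorphic_on_const) auto
 qed
 have bd2: "norm (?K n s) \<le> (1 / \<delta>) ^ length as * norm (c n)" if s: "norm s < \<rho>" for n s
 proof -
  have "norm (\<Prod>\<alpha>\<leftarrow>bs. 1 / pairing \<alpha> (w n - s *s x)) \<le> (1 / \<delta>) ^ length bs" if "set bs \<subseteq> set as" for bs
   using that
  proof (induction bs)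
   case (Cons a bs)
   have "norm (1 / pairing a (w n - s *s x)) \<le> 1 / \<delta>"
    using gapw[of a s n] Cons.prems as s \<delta>(1) by (auto simp: norm_divide intro!: divide_left_mono mult_pos_pos)
   then show ?case using Cons \<delta>(1) by (simp add: norm_mult del: times_divide_eq_left) (intro mult_mono, auto)
  qed simp
  then show ?thesis unfolding norm_mult by (intro mult_right_mono) auto
 qed
 have fps2: "(\<lambda>s. ?K n s) has_fps_expansion Abs_fps (\<lambda>D. kernel_coeff as D x (w n)) * fps_const (c n)" for n
  using nz[of _ 0 n] \<delta>(2) by (intro has_fps_expansion_cmult_right kernel_coeff_fps) auto
 note f2 = integral_coeff[where \<rho> = \<rho> and M' = "count_space N", OF \<delta>(2) hol2 bd2 fps2 _ gi2, simplified]
 have "\<forall>\<^sub>F s in nhds 0. s \<in> ball (0::complex) \<rho>" using \<delta> by (intro eventually_nhds_in_open) auto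
 then have "\<forall>\<^sub>F s in nhds 0. (LINT n|count_space N. ?K n s) = (LINT t|lborel. qq y t (s *s x) * \<psi> t)"
 proof (rule eventually_mono)
  fix s :: complex assume "s \<in> ball 0 \<rho>"
  then have s: "norm s < \<rho>" by simp
  \<comment> \<open>The exponential absorbed into the test function compensates the displacement:
    the transform of \<eta> at the moved point is that of \<psi> at the original one, so only the
    fractions depend on \<open>s\<close>.\<close>
  define \<eta> where "\<eta> = (\<lambda>t. exp (pairing t (s *s x)) * \<psi> t)"
  have t\<eta>: "test_fun UNIV \<eta>" unfolding \<eta>_def by (rule test_fun_mult[OF \<psi> smooth_on_exp])
  have ph: "psihat \<eta> (lat_shift y n - s *s x) = psihat \<psi> (lat_shift y n)" for n
   unfolding psihat_def \<eta>_def mult.assoc[symmetric] exp_add[symmetric] by (simp add: pairing_diff_right)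
  have pl: "1 / (\<Prod>\<alpha>\<in>\<sigma>. pairing \<alpha> u) = (\<Prod>\<alpha>\<leftarrow>as. 1 / pairing \<alpha> u)" for u
  proof -
   have "(\<Prod>\<alpha>\<leftarrow>as. 1 / pairing \<alpha> u) = (\<Prod>\<alpha>\<in>\<sigma>. 1 / pairing \<alpha> u)" using prod.distinct_set_conv_list[OF as(2), of "\<lambda>\<alpha>. 1 / pairing \<alpha> u"] as(1) by simp
   then show ?thesis by (simp add: prod_dividef)
  qed
  have "((\<lambda>n. (\<Prod>\<alpha>\<leftarrow>as. 1 / pairing \<alpha> (lat_shift y n - s *s x)) * psihat \<psi> (lat_shift y n)) has_sum (LINT t|lborel. FF t (y - s *s x) * \<eta> t)) N"
   using phi_identity[OF gen[OF less_imp_le[OF s]] t\<eta>] unfolding lat_shift_diff ph pl .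
  then have hs: "((\<lambda>n. ?K n s) has_sum (LINT t|lborel. FF t (y - s *s x) * \<eta> t)) N"
   by (rule has_sum_cong[THEN iffD1, rotated]) (simp add: w_def c_def)
  have "Infinite_Set_Sum.abs_summable_on (\<lambda>n. ?K n s) N"
   unfolding abs_summable_on_def
   by (rule Bochner_Integration.integrable_bound[OF gi2]) (use bd2[OF s] \<delta>(1) in \<open>auto simp: abs_mult\<close>)
  from infsetsum_infsum[OF this]
  have "(LINT n|count_space N. ?K n s) = (LINT t|lborel. FF t (y - s *s x) * \<eta> t)"
   using infsumI[OF hs] by (simp add: infsetsum_def)
  then show "(LINT n|count_space N. ?K n s) = (LINT t|lborel. qq y t (s *s x) * \<psi> t)"
   by (simp add: qq_def \<eta>_def mult.assoc mult.left_commute)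
 qed
 then have "(deriv ^^ D) (\<lambda>s. LINT n|count_space N. ?K n s) 0 = (deriv ^^ D) (\<lambda>s. LINT t|lborel. qq y t (s *s x) * \<psi> t) 0"
  by (rule higher_deriv_cong_ev) simp
 then have eq: "(LINT n|count_space N. kernel_coeff as D x (w n) * c n) = (LINT t|lborel. tc D (qq y t) x * \<psi> t)"
  using fps_nth_fps_expansion[OF f1(2), of D] fps_nth_fps_expansion[OF f2(2), of D] by simp
 have a2: "Infinite_Set_Sum.abs_summable_on (\<lambda>n. kernel_coeff as D x (w n) * c n) N" using f2(1)[of D] by (simp add: abs_summable_on_def)
 have "((\<lambda>n. kernel_coeff as D x (w n) * c n) has_sum (LINT t|lborel. tc D (qq y t) x * \<psi> t)) N"
  using has_sum_infsum[OF abs_summable_summable[OF abs_summable_equivalent[THEN iffD2, OF a2]]] infsetsum_infsum[OF a2] eq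
  by (simp add: infsetsum_def)
 then show "((\<lambda>n. kernel_coeff as D x (lat_shift y n) * psihat \<psi> (lat_shift y n)) has_sum (LINT t|lborel. tc D (qq y t) x * \<psi> t)) N"
  by (rule has_sum_cong[THEN iffD1, rotated]) (simp add: w_def c_def)
qed

end

section \<open>Alcoves\<close>

lemma eventually_inner_less: "a < (t0 - m) \<bullet> v \<Longrightarrow> \<forall>\<^sub>F t in nhds t0. a < (t - m) \<bullet> v"
 and eventually_inner_greater: "(t0 - m) \<bullet> v < a \<Longrightarrow> \<forall>\<^sub>F t in nhds t0. (t - m) \<bullet> v < a"
 for t0 :: "real^'n"
proof -
 have o: "open {t. a < (t - m) \<bullet> v}" "open {t. (t - m) \<bullet> v < a}" by (intro open_Collect_less continuous_intros)+
 show "\<forall>\<^sub>F t in nhds t0. a < (t - m) \<bullet> v" if "a < (t0 - m) \<bullet> v"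
  using eventually_nhds_in_open[OF o(1), of t0] that by simp
 show "\<forall>\<^sub>F t in nhds t0. (t - m) \<bullet> v < a" if "(t0 - m) \<bullet> v < a"
  using eventually_nhds_in_open[OF o(2), of t0] that by simp
qed

context lattice_basis
begin

text \<open>Near \<open>t0\<close> only finitely many lattice points can enter, and membership in
  the box is decided by coordinates that are neither 0 nor 1 at \<open>t0\<close>, hence by open
  conditions.\<close>

lemma RR_locally_constant:
 assumes nw: "\<And>\<alpha> m. \<alpha> \<in> \<sigma> \<Longrightarrow> m \<in> M \<Longrightarrow> (t0 - m) \<bullet> dv \<alpha> \<notin> \<int>"
 shows "\<forall>\<^sub>F t in nhds t0. RR t = RR t0"
proof -
 obtain RQ where RQ: "\<And>q. q \<in> Q_box \<sigma> \<Longrightarrow> norm q \<le> RQ" using Q_box_radius by blast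
 define F where "F = {m\<in>M. norm m \<le> (norm t0 + 1) + RQ}"
 have "\<forall>\<^sub>F t in nhds t0. (0 \<le> (t - m) \<bullet> dv \<alpha> \<and> (t - m) \<bullet> dv \<alpha> < 1) \<longleftrightarrow> (0 \<le> (t0 - m) \<bullet> dv \<alpha> \<and> (t0 - m) \<bullet> dv \<alpha> < 1)"
  if "m \<in> F" "\<alpha> \<in> \<sigma>" for m \<alpha>
 proof -
  have "(t0 - m) \<bullet> dv \<alpha> \<notin> \<int>" using nw that by (auto simp: F_def)
  then have "(t0 - m) \<bullet> dv \<alpha> \<noteq> 0" "(t0 - m) \<bullet> dv \<alpha> \<noteq> 1" by auto
  then consider "(t0 - m) \<bullet> dv \<alpha> < 0" | "0 < (t0 - m) \<bullet> dv \<alpha>" "(t0 - m) \<bullet> dv \<alpha> < 1" | "1 < (t0 - m) \<bullet> dv \<alpha>" by linarith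
  then show ?thesis
  proof cases
   case 1
   show ?thesis by (rule eventually_mono[OF eventually_inner_greater[OF 1]]) (use 1 in auto)
  next
   case 2
   show ?thesis
    by (rule eventually_mono[OF eventually_conj[OF eventually_inner_less[OF 2(1)] eventually_inner_greater[OF 2(2)]]]) (use 2 in auto)
  next
   case 3
   show ?thesis by (rule eventually_mono[OF eventually_inner_less[OF 3]]) (use 3 in auto)
  qed
 qed
 then have "\<forall>\<^sub>F t in nhds t0. \<forall>m\<in>F. \<forall>\<alpha>\<in>\<sigma>. (0 \<le> (t - m) \<bullet> dv \<alpha> \<and> (t - m) \<bullet> dv \<alpha> < 1) \<longleftrightarrow> (0 \<le> (t0 - m) \<bullet> dv \<alpha> \<and> (t0 - m) \<bullet> dv \<alpha> < 1)"
  by (intro eventually_ball_finite ballI fin) (auto simp: F_def finite_M_ball)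
 moreover have "\<forall>\<^sub>F t in nhds t0. t \<in> ball t0 1" by (intro eventually_nhds_in_open) auto
 ultimately show ?thesis
 proof eventually_elim
  case (elim t)
  have Q: "t - m \<in> Q_box \<sigma> \<longleftrightarrow> t0 - m \<in> Q_box \<sigma>" if "m \<in> F" for m
   using elim(1) that unfolding Q_box_iff by blast
  have "norm t \<le> norm t0 + 1" using elim(2) norm_triangle_ineq2[of t t0] by (simp add: dist_norm norm_minus_commute)
  then have "RR t \<subseteq> F" "RR t0 \<subseteq> F" using RR_subset[OF RQ] by (simp_all add: F_def)
  then show ?case using Q by (auto simp: RR_def)
 qed
qed

text \<open>An integral coordinate along \<alpha> would place \<open>t\<close> on a lattice
  translate of the wall spanned by the other elements of \<sigma>.\<close>

lemma areg_coordinates: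
 assumes "\<sigma> \<in> bases \<Delta>" "t \<in> areg N \<Delta>" "\<alpha> \<in> \<sigma>" "m \<in> M"
 shows "(t - m) \<bullet> dv \<alpha> \<notin> \<int>"
proof
 assume "(t - m) \<bullet> dv \<alpha> \<in> \<int>"
 then obtain k where k: "(t - m) \<bullet> dv \<alpha> = of_int k" by (auto elim: Ints_cases)
 have "t - m = (\<Sum>\<beta>\<in>\<sigma>. ((t - m) \<bullet> dv \<beta>) *\<^sub>R \<beta>)" by (rule dv_expand)
 also have "\<dots> = of_int k *\<^sub>R \<alpha> + (\<Sum>\<beta>\<in>\<sigma> - {\<alpha>}. ((t - m) \<bullet> dv \<beta>) *\<^sub>R \<beta>)"
  using fin assms(3) k by (simp add: sum.remove)
 finally have t: "t = (m + of_int k *\<^sub>R \<alpha>) + (\<Sum>\<beta>\<in>\<sigma> - {\<alpha>}. ((t - m) \<bullet> dv \<beta>) *\<^sub>R \<beta>)" by (simp add: algebra_simps)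
 have "span (\<sigma> - {\<alpha>}) \<in> walls \<Delta>" unfolding walls_def
 proof (intro CollectI exI[of _ "\<sigma> - {\<alpha>}"] conjI refl)
  show "\<sigma> - {\<alpha>} \<subseteq> \<Delta>" using assms(1) by (auto simp: bases_def)
  show "independent (\<sigma> - {\<alpha>})" using ind by (rule independent_mono) auto
  show "card (\<sigma> - {\<alpha>}) = CARD('n) - 1" using fin assms(3) basis_card[OF assms(1)] by simp
 qed
 moreover have "m + of_int k *\<^sub>R \<alpha> \<in> M" using assms(3,4) \<sigma>M by (intro M_add M_scale_int) auto
 moreover have "(\<Sum>\<beta>\<in>\<sigma> - {\<alpha>}. ((t - m) \<bullet> dv \<beta>) *\<^sub>R \<beta>) \<in> span (\<sigma> - {\<alpha>})"
  by (intro span_sum span_scale span_base)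
 ultimately have "t \<in> (\<Union>H\<in>walls \<Delta>. \<Union>m\<in>M. (\<lambda>x. m + x) ` H)" by (subst t) blast
 then show False using assms(2) by (simp add: areg_def)
qed

lemma RR_areg: "\<sigma> \<in> bases \<Delta> \<Longrightarrow> t0 \<in> areg N \<Delta> \<Longrightarrow> \<forall>\<^sub>F t in nhds t0. RR t = RR t0"
 by (rule RR_locally_constant) (rule areg_coordinates)

lemma RR_alcove:
 assumes "\<sigma> \<in> bases \<Delta>" "a \<in> alcoves N \<Delta>" "t \<in> a" "t' \<in> a" shows "RR t = RR t'"
proof (rule connected_local_const[OF _ assms(3,4)])
 have a: "a \<in> components (areg N \<Delta>)" using assms(2) by (simp add: alcoves_def)
 show "connected a" by (rule in_components_connected[OF a])
 show "\<forall>s\<in>a. \<forall>\<^sub>F s' in at s within a. RR s = RR s'"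
 proof
  fix s assume "s \<in> a"
  then have "s \<in> areg N \<Delta>" using in_components_subset[OF a] by blast
  from RR_areg[OF assms(1) this] show "\<forall>\<^sub>F s' in at s within a. RR s = RR s'"
   unfolding eventually_at_filter by (rule eventually_mono) simp
 qed
qed

lemma F_fun_alcove:
 assumes "\<sigma> \<in> bases \<Delta>" "a \<in> alcoves N \<Delta>" "t \<in> a" shows "F_fun N a \<sigma> = FF t"
proof -
 have "(SOME t. t \<in> a) \<in> a" using assms(3) by (rule someI)
 then have "RR (SOME t. t \<in> a) = RR t" by (rule RR_alcove[OF assms(1,2) _ assms(3)])
 moreover have "R_set N a \<sigma> = RR (SOME t. t \<in> a)"
 proof -
  have "m \<in> (\<lambda>q. s - q) ` Q_box \<sigma> \<longleftrightarrow> s - m \<in> Q_box \<sigma>" for s m :: "real^'n"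
   by (auto intro: image_eqI[of _ _ "s - m"])
  then show ?thesis unfolding R_set_def RR_def by blast
 qed
 ultimately show ?thesis by (simp add: F_fun_def FF_def fun_eq_iff)
qed

lemma smooth_RR_sum:
 assumes "\<sigma> \<in> bases \<Delta>" "open (areg N \<Delta>)" "\<And>m k. Ck_on k UNIV (h m)"
 shows "smooth_on (areg N \<Delta>) (\<lambda>t. \<Sum>m\<in>RR t. h m t)"
 unfolding smooth_on_def
proof
 fix k
 show "Ck_on k (areg N \<Delta>) (\<lambda>t. \<Sum>m\<in>RR t. h m t)"
 proof (rule Ck_on_local[OF assms(2)])
  fix t0 assume t0: "t0 \<in> areg N \<Delta>"
  from RR_areg[OF assms(1) this] obtain W where W: "open W" "t0 \<in> W" "\<And>t. t \<in> W \<Longrightarrow> RR t = RR t0"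
   unfolding eventually_nhds by blast
  have "Ck_on k (W \<inter> areg N \<Delta>) (\<lambda>t. \<Sum>m\<in>RR t. h m t)"
  proof (rule Ck_on_cong)
   show "open (W \<inter> areg N \<Delta>)" using W assms(2) by auto
   show "(\<Sum>m\<in>RR t0. h m t) = (\<Sum>m\<in>RR t. h m t)" if "t \<in> W \<inter> areg N \<Delta>" for t using W(3) that by simp
   show "Ck_on k (W \<inter> areg N \<Delta>) (\<lambda>t. \<Sum>m\<in>RR t0. h m t)"
    by (rule Ck_on_subset[OF subset_UNIV]) (intro Ck_on_sum assms(3))
  qed
  then show "\<exists>W. open W \<and> t0 \<in> W \<and> W \<subseteq> areg N \<Delta> \<and> Ck_on k W (\<lambda>t. \<Sum>m\<in>RR t. h m t)"
   using W assms(2) t0 by (intro exI[of _ "W \<inter> areg N \<Delta>"]) auto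
 qed
qed

end

section \<open>Openness of the complement of the translated walls\<close>

context lattice
begin

text \<open>The union of translates is infinite, so closedness needs discreteness. A lattice vector
  \<beta> outside the wall completes \<open>A\<close> to a basis, and the union is the set of points
  whose \<beta>-coordinate is one taken on \<open>M\<close>.\<close>

lemma closed_wall_translates:
 assumes "A \<subseteq> M" "independent A" "card A = CARD('n) - 1"
 shows "closed (\<Union>m\<in>M. (\<lambda>x. m + x) ` span A)"
proof -
 have fA: "finite A" using assms(2) by (rule independent_imp_finite)
 have "\<exists>i. bs i \<notin> span A"
 proof (rule ccontr)
  assume "\<not> (\<exists>i. bs i \<notin> span A)"
  then have "x \<in> span A" for x by (subst expand'[of x]) (intro span_sum span_scale, auto)
  then have "span A = UNIV" by auto
  then have "CARD('n) = card A" using dim_eq_card[of A UNIV] assms(2) by (simp add: dim_UNIV)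
  then show False using assms(3) zero_less_card_finite[where 'a = 'n] by linarith
 qed
 then obtain i where i: "bs i \<notin> span A" ..
 define \<beta> where "\<beta> = bs i"
 define \<sigma> where "\<sigma> = insert \<beta> A"
 have bA: "\<beta> \<notin> A" using i span_base by (auto simp: \<beta>_def)
 have ind: "independent \<sigma>" unfolding \<sigma>_def \<beta>_def using i assms(2) by (simp add: independent_insertI)
 have "card \<sigma> = CARD('n)" unfolding \<sigma>_def using bA fA assms(3) by simp
 then have sp: "span \<sigma> = UNIV" using dim_eq_full[of \<sigma>] dim_eq_card_independent[OF ind] by simp
 obtain dv where dv: "\<And>\<alpha> \<gamma>. \<alpha> \<in> \<sigma> \<Longrightarrow> \<gamma> \<in> \<sigma> \<Longrightarrow> \<alpha> \<bullet> dv \<gamma> = (if \<alpha> = \<gamma> then 1 else 0)"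
  using dual_vectors[OF ind] by blast
 have bM: "\<beta> \<in> M" unfolding \<beta>_def M_iff by (simp add: inner_commute[of "bs i"] dual)
 interpret lattice_basis N b bs \<sigma> dv
  by unfold_locales (use ind sp dv assms(1) bM in \<open>auto simp: \<sigma>_def\<close>)
 have b\<sigma>: "\<beta> \<in> \<sigma>" by (simp add: \<sigma>_def)
 have span_iff: "x \<in> span A \<longleftrightarrow> x \<bullet> dv \<beta> = 0" for x
 proof
  have "subspace {x. x \<bullet> dv \<beta> = 0}" by (auto simp: subspace_def inner_add_left)
  moreover have "A \<subseteq> {x. x \<bullet> dv \<beta> = 0}" using dv[OF _ b\<sigma>] bA by (auto simp: \<sigma>_def)
  ultimately have "span A \<subseteq> {x. x \<bullet> dv \<beta> = 0}" by (intro span_minimal)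
  then show "x \<in> span A \<Longrightarrow> x \<bullet> dv \<beta> = 0" by auto
 next
  assume "x \<bullet> dv \<beta> = 0"
  then have "x = (\<Sum>\<alpha>\<in>A. (x \<bullet> dv \<alpha>) *\<^sub>R \<alpha>)" using dv_expand[of x] bA fA by (simp add: \<sigma>_def)
  then show "x \<in> span A" by (metis (no_types, lifting) span_base span_scale span_sum)
 qed
 \<comment> \<open>The coordinates along \<beta> taken on \<open>M\<close>: representatives modulo
   \<open>int_span \<sigma>\<close> are finite in number and the rest contributes integers, so this
   is a finite union of cosets of the integers.\<close>
 define D where "D = (\<Union>c\<in>(\<lambda>m. m \<bullet> dv \<beta>) ` RR 0. (\<lambda>k. c + k) ` \<int>)"
 have D: "(\<exists>m\<in>M. m \<bullet> dv \<beta> = u) \<longleftrightarrow> u \<in> D" for u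
 proof
  assume "\<exists>m\<in>M. m \<bullet> dv \<beta> = u"
  then obtain m where m: "m \<in> M" "m \<bullet> dv \<beta> = u" by (elim bexE)
  obtain m' where m': "m' \<in> RR 0" "m - m' \<in> int_span \<sigma>" using RR_rep[OF m(1)] by blast
  then have "(m - m') \<bullet> dv \<beta> \<in> \<int>" using b\<sigma> by (simp add: int_span_iff)
  moreover have "u = m' \<bullet> dv \<beta> + (m - m') \<bullet> dv \<beta>" using m(2) by (simp add: inner_diff_left)
  ultimately show "u \<in> D" unfolding D_def using m'(1) by blast
 next
  assume "u \<in> D"
  then obtain m k where "m \<in> RR 0" "k \<in> \<int>" "u = m \<bullet> dv \<beta> + k" unfolding D_def by blast
  then obtain j where "m \<in> M" "u = m \<bullet> dv \<beta> + of_int j" by (auto simp: RR_def elim: Ints_cases)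
  then show "\<exists>m\<in>M. m \<bullet> dv \<beta> = u" using bM dv[OF b\<sigma> b\<sigma>]
   by (intro bexI[of _ "m + of_int j *\<^sub>R \<beta>"] M_add M_scale_int) (auto simp: inner_add_left)
 qed
 have "(\<Union>m\<in>M. (\<lambda>x. m + x) ` span A) = (\<lambda>x. x \<bullet> dv \<beta>) -` D"
 proof (intro set_eqI iffI)
  fix x assume "x \<in> (\<Union>m\<in>M. (\<lambda>x. m + x) ` span A)"
  then obtain m u where "m \<in> M" "u \<in> span A" "x = m + u" by blast
  then have "m \<in> M" "m \<bullet> dv \<beta> = x \<bullet> dv \<beta>" using span_iff by (auto simp: inner_add_left)
  then show "x \<in> (\<lambda>x. x \<bullet> dv \<beta>) -` D" using D by blast
 next
  fix x assume "x \<in> (\<lambda>x. x \<bullet> dv \<beta>) -` D"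
  then obtain m where m: "m \<in> M" "m \<bullet> dv \<beta> = x \<bullet> dv \<beta>" using D[of "x \<bullet> dv \<beta>"] by auto
  then have "x - m \<in> span A" by (simp add: span_iff inner_diff_left)
  then have "x \<in> (\<lambda>x. m + x) ` span A" by (intro image_eqI[of _ _ "x - m"]) auto
  then show "x \<in> (\<Union>m\<in>M. (\<lambda>x. m + x) ` span A)" using m(1) by blast
 qed
 moreover have "closed D" unfolding D_def using RR_finite by (intro closed_UN) (auto intro: closed_translation)
 ultimately show ?thesis by (simp add: closed_vimage continuous_on_inner continuous_on_id continuous_on_const)
qed

lemma open_areg:
 assumes "finite \<Delta>" "\<Delta> \<subseteq> M" shows "open (areg N \<Delta>)"
proof -
 have "finite (walls \<Delta>)"
  by (rule finite_subset[of _ "span ` Pow \<Delta>"]) (use assms(1) in \<open>auto simp: walls_def\<close>)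
 then have "closed (\<Union>H\<in>walls \<Delta>. \<Union>m\<in>M. (\<lambda>x. m + x) ` H)"
 proof (rule closed_UN, intro ballI)
  fix H assume "H \<in> walls \<Delta>"
  then obtain A where "H = span A" "A \<subseteq> \<Delta>" "independent A" "card A = CARD('n) - 1" by (auto simp: walls_def)
  then show "closed (\<Union>m\<in>M. (\<lambda>x. m + x) ` H)" using closed_wall_translates[of A] assms(2) by auto
 qed
 then show ?thesis unfolding areg_def by (rule open_Compl)
qed

end

section \<open>Representation of the Eisenstein series by smooth functions\<close>

lemma smooth_on_lincomb:
 "smooth_on S u \<Longrightarrow> smooth_on S u' \<Longrightarrow> smooth_on S (\<lambda>t. c * u t + c' * u' t)"
 by (intro smooth_on_add smooth_on_mult smooth_on_const)

locale eisenstein = lattice N b bs for N :: "(real^'n) set" and b bs +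
 fixes \<Delta> :: "(real^'n) set"
 assumes fin\<Delta>: "finite \<Delta>" and \<Delta>M: "\<Delta> \<subseteq> dual_lattice N" and z\<Delta>: "0 \<notin> \<Delta>"
  and indiv: "\<And>\<alpha>. \<alpha> \<in> \<Delta> \<Longrightarrow> indivisible_in (dual_lattice N) \<alpha>"
begin

abbreviation "FFs \<equiv> lattice_basis.FF N"
abbreviation "qqs \<equiv> primitive_basis.qq N"

definition dvs :: "(real^'n) set \<Rightarrow> real^'n \<Rightarrow> real^'n" where
 "dvs \<sigma> = (SOME dv. primitive_basis N b bs \<sigma> dv)"

lemma prim: assumes "\<sigma> \<in> bases \<Delta>" shows "primitive_basis N b bs \<sigma> (dvs \<sigma>)"
proof -
 obtain dv where "dual_basis \<sigma> dv" using dual_basis_exists[OF assms] by blast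
 then interpret dual_basis \<sigma> dv .
 have sub: "\<sigma> \<subseteq> \<Delta>" using assms by (auto simp: bases_def)
 have "primitive_basis N b bs \<sigma> dv"
 proof unfold_locales
  show "\<sigma> \<subseteq> M" using sub \<Delta>M by blast
  fix \<alpha> assume "\<alpha> \<in> \<sigma>"
  then have a: "\<alpha> \<in> \<Delta>" using sub by blast
  obtain n where "n \<in> N" "\<alpha> \<bullet> n = 1" using indivisible_unit[of \<alpha>] a \<Delta>M z\<Delta> indiv by blast
  then show "\<exists>n\<in>N. \<alpha> \<bullet> n = 1" by blast
 qed
 then show ?thesis unfolding dvs_def by (rule someI[of "primitive_basis N b bs \<sigma>"])
qed

lemma lbasis: "\<sigma> \<in> bases \<Delta> \<Longrightarrow> lattice_basis N b bs \<sigma> (dvs \<sigma>)"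
 using prim primitive_basis.axioms(1) by blast

lemma U_generic: "y \<in> U_set N \<Delta> \<Longrightarrow> \<sigma> \<in> bases \<Delta> \<Longrightarrow> lattice_basis.generic N \<sigma> y"
 by (subst lattice_basis.generic_def[OF lbasis]) (auto simp: U_set_def bases_def)

lemma U_regular: "y \<in> U_set N \<Delta> \<Longrightarrow> n \<in> N \<Longrightarrow> regular \<Delta> (lat_shift y n)"
 by (auto simp: U_set_def regular_def)

lemma areg_open: "open (areg N \<Delta>)" by (rule open_areg[OF fin\<Delta> \<Delta>M])

text \<open>\<open>u\<close> represents, off the walls, the generalized function with terms
  \<open>k n * exp (pairing t (lat_shift y n))\<close>. The coefficients are arbitrary so that
  kernel coefficients fit as well; integrability is included so that linear combinations can be
  formed.\<close>

definition rep :: "complex^'n \<Rightarrow> (real^'n \<Rightarrow> complex) \<Rightarrow> (real^'n \<Rightarrow> complex) \<Rightarrow> bool" where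
 "rep y u k \<longleftrightarrow> smooth_on (areg N \<Delta>) u \<and> (\<forall>\<psi>. test_fun (areg N \<Delta>) \<psi> \<longrightarrow>
   integrable lborel (\<lambda>t. u t * \<psi> t) \<and> ((\<lambda>n. k n * psihat \<psi> (lat_shift y n)) has_sum (LINT t|lborel. u t * \<psi> t)) N)"

text \<open>Smooth representatives are unique on the open regular set because test functions
  determine continuous functions; this settles the definite description in
  \<open>Eis\<close>.\<close>

lemma rep_Eis:
 assumes "rep y u (\<lambda>n. f (lat_shift y n))" "t \<in> areg N \<Delta>" shows "Eis N \<Delta> t f y = u t"
 unfolding Eis_def
proof (rule the_equality)
 have e: "Eis_dist N f y \<psi> = (LINT s|lborel. u s * \<psi> s)" if "test_fun (areg N \<Delta>) \<psi>" for \<psi>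
 proof -
  have "(LINT t|lborel. exp (pairing t (lat_shift y n)) * f (lat_shift y n) * \<psi> t) = f (lat_shift y n) * psihat \<psi> (lat_shift y n)" for n
   unfolding psihat_def integral_mult_right_zero[symmetric] by (simp add: mult.assoc mult.commute mult.left_commute)
  moreover have "((\<lambda>n. f (lat_shift y n) * psihat \<psi> (lat_shift y n)) has_sum (LINT s|lborel. u s * \<psi> s)) N"
   using assms(1) that by (simp add: rep_def)
  ultimately show ?thesis unfolding Eis_dist_def by (simp add: infsumI)
 qed
 have s: "smooth_on (areg N \<Delta>) u" using assms(1) by (simp add: rep_def)
 then show "\<exists>w. smooth_on (areg N \<Delta>) w \<and> (\<forall>\<psi>. test_fun (areg N \<Delta>) \<psi> \<longrightarrow> Eis_dist N f y \<psi> = (LINT s|lborel. w s * \<psi> s)) \<and> w t = u t"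
  using e by blast
 fix c assume "\<exists>w. smooth_on (areg N \<Delta>) w \<and> (\<forall>\<psi>. test_fun (areg N \<Delta>) \<psi> \<longrightarrow> Eis_dist N f y \<psi> = (LINT s|lborel. w s * \<psi> s)) \<and> w t = c"
 then obtain w where w: "smooth_on (areg N \<Delta>) w" "\<And>\<psi>. test_fun (areg N \<Delta>) \<psi> \<Longrightarrow> Eis_dist N f y \<psi> = (LINT s|lborel. w s * \<psi> s)" "w t = c" by blast
 have "w t = u t"
  by (rule test_fun_determines[OF areg_open smooth_on_continuous[OF w(1)] smooth_on_continuous[OF s] assms(2)])
   (simp add: w(2)[symmetric] e)
 then show "c = u t" using w(3) by simp
qed

lemma rep_zero: "rep y (\<lambda>t. 0) (\<lambda>n. 0)"
 unfolding rep_def by (simp add: smooth_on_const)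

lemma rep_lincomb:
 assumes "rep y u k" "rep y u' k'" shows "rep y (\<lambda>t. c * u t + c' * u' t) (\<lambda>n. c * k n + c' * k' n)"
 unfolding rep_def
proof (intro conjI allI impI)
 show "smooth_on (areg N \<Delta>) (\<lambda>t. c * u t + c' * u' t)" using assms by (intro smooth_on_lincomb) (auto simp: rep_def)
 fix \<psi> assume \<psi>: "test_fun (areg N \<Delta>) \<psi>"
 have i: "integrable lborel (\<lambda>t. u t * \<psi> t)" "integrable lborel (\<lambda>t. u' t * \<psi> t)"
  and h: "((\<lambda>n. k n * psihat \<psi> (lat_shift y n)) has_sum (LINT t|lborel. u t * \<psi> t)) N" "((\<lambda>n. k' n * psihat \<psi> (lat_shift y n)) has_sum (LINT t|lborel. u' t * \<psi> t)) N"
  using assms \<psi> by (auto simp: rep_def)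
 have e: "(c * u t + c' * u' t) * \<psi> t = c * (u t * \<psi> t) + c' * (u' t * \<psi> t)" for t by (simp add: algebra_simps)
 show "integrable lborel (\<lambda>t. (c * u t + c' * u' t) * \<psi> t)" unfolding e using i by simp
 have "((\<lambda>n. c * (k n * psihat \<psi> (lat_shift y n)) + c' * (k' n * psihat \<psi> (lat_shift y n))) has_sum
   (c * (LINT t|lborel. u t * \<psi> t) + c' * (LINT t|lborel. u' t * \<psi> t))) N"
  by (intro has_sum_add has_sum_cmult_right h)
 moreover have "c * (k n * psihat \<psi> (lat_shift y n)) + c' * (k' n * psihat \<psi> (lat_shift y n)) = (c * k n + c' * k' n) * psihat \<psi> (lat_shift y n)" for n
  by (simp add: algebra_simps)
 moreover have "(LINT t|lborel. (c * u t + c' * u' t) * \<psi> t) = c * (LINT t|lborel. u t * \<psi> t) + c' * (LINT t|lborel. u' t * \<psi> t)"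
  unfolding e using i by simp
 ultimately show "((\<lambda>n. (c * k n + c' * k' n) * psihat \<psi> (lat_shift y n)) has_sum (LINT t|lborel. (c * u t + c' * u' t) * \<psi> t)) N" by simp
qed

lemma rep_sum: "finite A \<Longrightarrow> (\<And>x. x \<in> A \<Longrightarrow> rep y (u x) (k x)) \<Longrightarrow> rep y (\<lambda>t. \<Sum>x\<in>A. c x * u x t) (\<lambda>n. \<Sum>x\<in>A. c x * k x n)"
proof (induction A rule: finite_induct)
 case (insert x A)
 then show ?case using rep_lincomb[of y "u x" "k x" "\<lambda>t. \<Sum>x\<in>A. c x * u x t" "\<lambda>n. \<Sum>x\<in>A. c x * k x n" "c x" 1] by simp
qed (simp add: rep_zero)

text \<open>The gain from point evaluations: a functional in the variable \<open>x\<close> passes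
  through the lattice sum and the integral as a finite linear combination.\<close>

lemma rep_ev: "(\<And>x. rep y (\<lambda>t. h t x) (\<lambda>n. k n x)) \<Longrightarrow> rep y (\<lambda>t. ev l (h t)) (\<lambda>n. ev l (k n))"
proof (induction l)
 case (Cons p l)
 obtain x a where "p = (x, a)" by force
 then show ?case using rep_lincomb[OF Cons.prems[of x] Cons.IH[OF Cons.prems], of a 1] by (simp add: ev_def)
qed (simp add: ev_def rep_zero)

lemma rep_cong:
 assumes "rep y u k" "\<And>n. n \<in> N \<Longrightarrow> k n = k' n" shows "rep y u k'"
 unfolding rep_def
proof (intro conjI allI impI)
 fix \<psi> assume \<psi>: "test_fun (areg N \<Delta>) \<psi>"
 have "((\<lambda>n. k n * psihat \<psi> (lat_shift y n)) has_sum (LINT t|lborel. u t * \<psi> t)) N" using assms(1) \<psi> by (simp add: rep_def)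
 then show "((\<lambda>n. k' n * psihat \<psi> (lat_shift y n)) has_sum (LINT t|lborel. u t * \<psi> t)) N"
  by (rule has_sum_cong[THEN iffD1, rotated]) (simp add: assms(2))
qed (use assms(1) in \<open>auto simp: rep_def\<close>)

text \<open>Smoothness in \<open>t\<close> comes from exponential and polynomial terms over a
  locally constant index set; the representation itself is \<open>exchange\<close>.\<close>

lemma rep_kernel:
 assumes \<sigma>: "\<sigma> \<in> bases \<Delta>" and y: "y \<in> U_set N \<Delta>" and as: "set as = \<sigma>" "distinct as"
 shows "rep y (\<lambda>t. tc D (qqs \<sigma> y t) x) (\<lambda>n. kernel_coeff as D x (lat_shift y n))"
proof -
 interpret primitive_basis N b bs \<sigma> "dvs \<sigma>" by (rule prim[OF \<sigma>])
 have g: "generic y" by (rule U_generic[OF y \<sigma>])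
 have "Ck_on k UNIV (\<lambda>t. exp (pairing m y) * (\<Sum>i\<le>D. pairing (t - m) x ^ i / fact i * tc (D - i) (gq y) x))" for m k
  unfolding divide_inverse pairing_diff_left diff_conv_add_uminus[of "pairing _ _"]
  by (intro Ck_on_mult Ck_on_const Ck_on_sum Ck_on_power Ck_on_add Ck_on_linear bounded_linear_pairing_left)
 then have "smooth_on (areg N \<Delta>) (\<lambda>t. tc D (qq y t) x)"
  unfolding tc_qq[OF g] by (rule smooth_RR_sum[OF \<sigma> areg_open])
 then show ?thesis
  unfolding rep_def using exchange[OF g test_fun_mono[OF _ subset_UNIV] as] by blast
qed

text \<open>The degree 0 case of \<open>rep_kernel\<close>: the lowest kernel coefficient is
  \<open>phi \<Delta> \<sigma>\<close>, and the constant Taylor coefficient of \<open>qqs\<close> is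
  \<open>FFs\<close> at \<open>y\<close>.\<close>

lemma rep_phi:
 assumes \<sigma>: "\<sigma> \<in> bases \<Delta>" and y: "y \<in> U_set N \<Delta>"
 shows "rep y (\<lambda>t. FFs \<sigma> t y) (\<lambda>n. phi \<Delta> \<sigma> (lat_shift y n))"
proof -
 interpret primitive_basis N b bs \<sigma> "dvs \<sigma>" by (rule prim[OF \<sigma>])
 have g: "generic y" by (rule U_generic[OF y \<sigma>])
 have as: "set (list_of \<sigma>) = \<sigma>" "distinct (list_of \<sigma>)" using list_of[OF fin] by auto
 have "tc 0 (qqs \<sigma> y t) 0 = FF t y" for t by (simp add: tc_0 qq_def)
 then have "rep y (\<lambda>t. FF t y) (\<lambda>n. kernel_coeff (list_of \<sigma>) 0 0 (lat_shift y n))"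
  using rep_kernel[OF \<sigma> y as, of 0 0] by simp
 then show ?thesis
  by (rule rep_cong) (rule phi_kernel_0[OF \<sigma> U_regular[OF y] as])
qed

end

section \<open>The trace formula\<close>

text \<open>An operator that is a sum of terms \<open>d \<sigma>\<close> tensor
  \<open>V \<sigma>\<close> has trace the sum of \<open>d \<sigma> (V \<sigma>)\<close>. Expanding
  \<open>V \<sigma>\<close> in the basis picked by the definition of the trace shows that this
  choice does not affect the value.\<close>

lemma trace_on_dual_family:
 assumes fin: "finite \<Delta>" and B: "basis_of_bases \<Delta> B" and d: "dual_family \<Delta> B d"
  and V: "\<And>\<sigma>. \<sigma> \<in> B \<Longrightarrow> V \<sigma> \<in> S_space \<Delta>"
  and A: "\<And>g. g \<in> S_space \<Delta> \<Longrightarrow> A g = (\<lambda>z. \<Sum>\<sigma>\<in>B. d \<sigma> g * V \<sigma> z)"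
 shows "trace_on (S_space \<Delta>) A = (\<Sum>\<sigma>\<in>B. d \<sigma> (V \<sigma>))"
proof -
 have finB: "finite B" by (rule basis_of_bases_finite[OF fin B])
 define b where "b = (SOME b. cfun.independent b \<and> cfun.span b = S_space \<Delta>)"
 let ?rep = "cfun.representation b"
 have "\<exists>b. cfun.independent b \<and> cfun.span b = S_space \<Delta>"
  using B by (intro exI[of _ "phi \<Delta> ` B"]) (auto simp: basis_of_bases_def)
 then have b: "cfun.independent b \<and> cfun.span b = S_space \<Delta>" unfolding b_def by (rule someI_ex)
 have "b \<subseteq> cfun.span (phi \<Delta> ` B)" using b B cfun.span_superset[of b] by (auto simp: basis_of_bases_def)
 then have finb: "finite b" using cfun.independent_span_bound[of "phi \<Delta> ` B" b] finB b by auto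
 have bS: "g \<in> S_space \<Delta>" if "g \<in> b" for g using that cfun.span_base[OF that] b by simp
 have lin: "?rep (\<lambda>z. \<Sum>\<sigma>\<in>B'. c \<sigma> * V \<sigma> z) g = (\<Sum>\<sigma>\<in>B'. c \<sigma> * ?rep (V \<sigma>) g)"
  if "B' \<subseteq> B" for B' c g
  using finite_subset[OF that finB] that
 proof (induction B' rule: finite_induct)
  case empty
  then show ?case using cfun.representation_zero[of b] by (simp add: zero_fun_def)
 next
  case (insert \<sigma> B')
  let ?h = "\<lambda>z. \<Sum>\<sigma>\<in>B'. c \<sigma> * V \<sigma> z"
  have S: "V \<sigma> \<in> cfun.span b" "?h \<in> cfun.span b" using V insert.prems b by (auto intro!: S_space_sum)
  have "?rep ((\<lambda>z. c \<sigma> * V \<sigma> z) + ?h) g = ?rep (\<lambda>z. c \<sigma> * V \<sigma> z) g + ?rep ?h g"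
   using cfun.representation_add[of b ?h "\<lambda>z. c \<sigma> * V \<sigma> z"] b S cfun_span_scale[OF S(1)] by simp
  also have "?rep (\<lambda>z. c \<sigma> * V \<sigma> z) g = c \<sigma> * ?rep (V \<sigma>) g"
   using cfun.representation_scale[of b "V \<sigma>" "c \<sigma>"] b S by simp
  finally show ?case using insert by (simp add: plus_fun_def)
 qed
 have recon: "V \<sigma> = (\<lambda>z. \<Sum>g\<in>b. ?rep (V \<sigma>) g * g z)" if "\<sigma> \<in> B" for \<sigma>
 proof -
  have app: "(sum f X) z = (\<Sum>g\<in>X. f g z)" for f :: "(complex^'n \<Rightarrow> complex) \<Rightarrow> complex^'n \<Rightarrow> complex" and X z
   by (induction X rule: infinite_finite_induct) (simp_all add: zero_fun_def plus_fun_def)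
  have "(\<Sum>g\<in>b. (\<lambda>z. ?rep (V \<sigma>) g * g z)) = V \<sigma>"
   by (rule cfun.sum_representation_eq) (use b V[OF that] finb in auto)
  then show ?thesis by (simp add: fun_eq_iff app)
 qed
 have "trace_on (S_space \<Delta>) A = (\<Sum>g\<in>b. ?rep (A g) g)"
  unfolding trace_on_def b_def[symmetric] Let_def ..
 also have "\<dots> = (\<Sum>g\<in>b. \<Sum>\<sigma>\<in>B. d \<sigma> g * ?rep (V \<sigma>) g)"
  by (intro sum.cong refl) (simp add: A[OF bS] lin)
 also have "\<dots> = (\<Sum>\<sigma>\<in>B. \<Sum>g\<in>b. ?rep (V \<sigma>) g * d \<sigma> g)"
  by (subst sum.swap) (simp add: mult.commute)
 also have "\<dots> = (\<Sum>\<sigma>\<in>B. d \<sigma> (V \<sigma>))"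
 proof (intro sum.cong refl)
  fix \<sigma> assume s: "\<sigma> \<in> B"
  have "d \<sigma> (V \<sigma>) = d \<sigma> (\<lambda>z. \<Sum>g\<in>b. ?rep (V \<sigma>) g * g z)" using recon[OF s] by simp
  also have "\<dots> = (\<Sum>g\<in>b. ?rep (V \<sigma>) g * d \<sigma> g)"
   by (rule dual_family_sum[OF d s finb bS])
  finally show "(\<Sum>g\<in>b. ?rep (V \<sigma>) g * d \<sigma> g) = d \<sigma> (V \<sigma>)" ..
 qed
 finally show ?thesis .
qed

lemma IRes_rat_sum:
 fixes \<Delta> :: "(real^'n) set"
 assumes "finite \<Delta>" "0 \<notin> \<Delta>" "os \<in> ordered_bases \<Delta>" "finite A" "\<And>x. x \<in> A \<Longrightarrow> g x \<in> R_space \<Delta>"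
 shows "IRes_rat os (\<lambda>z. \<Sum>x\<in>A. c x * g x z) = (\<Sum>x\<in>A. c x * IRes_rat os (g x))"
proof -
 obtain e where "flag os e" using flag_exists[OF assms(3)] by blast
 then interpret flag os e .
 show ?thesis using assms(4,5)
 proof (induction A rule: finite_induct)
  case empty
  then show ?case using IRes_linear[OF assms(1,2) R_zero R_zero, of 0 0] by simp
 next
  case (insert x A)
  have "(\<lambda>z. \<Sum>x\<in>A. c x * g x z) \<in> R_space \<Delta>" using insert by (intro R_sum R_scale) auto
  then show ?case using insert IRes_linear[OF assms(1,2), of "g x" "\<lambda>z. \<Sum>x\<in>A. c x * g x z" "c x" 1] by simp
 qed
qed

lemma Res_zero:
 fixes \<Delta> :: "(real^'n) set"
 assumes "finite \<Delta>" "0 \<notin> \<Delta>" shows "Res \<Delta> (\<lambda>z. 0) = (\<lambda>z. 0)" "germ_quot \<Delta> [] (\<lambda>z. 0) (\<lambda>z. 0)"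
proof -
 show g: "germ_quot \<Delta> [] (\<lambda>z. 0) (\<lambda>z. 0)"
  using holo_at0_const[of 0] by (auto simp: germ_quot_def holo_at0_def)
 from Res_linear(1)[OF assms g nice_const g nice_const, of 0 0] show "Res \<Delta> (\<lambda>z. 0) = (\<lambda>z. 0)" by simp
qed

lemma Res_sum:
 fixes \<Delta> :: "(real^'n) set"
 assumes "finite \<Delta>" "0 \<notin> \<Delta>" "finite A" "\<And>x. x \<in> A \<Longrightarrow> \<exists>ks h. germ_quot \<Delta> ks h (g x) \<and> nice h"
 shows "Res \<Delta> (\<lambda>z. \<Sum>x\<in>A. c x * g x z) = (\<lambda>z. \<Sum>x\<in>A. c x * Res \<Delta> (g x) z) \<and>
  (\<exists>ks h. germ_quot \<Delta> ks h (\<lambda>z. \<Sum>x\<in>A. c x * g x z) \<and> nice h)"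
 using assms(3,4)
proof (induction A rule: finite_induct)
 case empty
 show ?case using Res_zero[OF assms(1,2)] nice_const[of 0] by auto
next
 case (insert x A)
 let ?s = "\<lambda>z. \<Sum>x\<in>A. c x * g x z"
 obtain ks h where 1: "germ_quot \<Delta> ks h (g x)" "nice h" using insert.prems by blast
 have IH: "Res \<Delta> ?s = (\<lambda>z. \<Sum>x\<in>A. c x * Res \<Delta> (g x) z)" "\<exists>ks h. germ_quot \<Delta> ks h ?s \<and> nice h"
  using insert.IH insert.prems by auto
 obtain ks' h' where 2: "germ_quot \<Delta> ks' h' ?s" "nice h'" using IH(2) by blast
 have e: "(\<lambda>z. \<Sum>x\<in>insert x A. c x * g x z) = (\<lambda>z. c x * g x z + 1 * ?s z)" using insert by simp
 show ?case
  unfolding e using Res_linear[OF assms(1,2) 1 2, of "c x" 1] IH(1) insert by simp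
qed

text \<open>The residue depends only on the germ at 0; this is needed because the formula for the
  Eisenstein series at \<open>y - z\<close> is available only for \<open>z\<close> near 0.\<close>

lemma Res_cong:
 fixes \<Delta> :: "(real^'n) set"
 assumes "finite \<Delta>" "0 \<notin> \<Delta>" "germ_quot \<Delta> ks h g" "nice h" "open W" "0 \<in> W" "\<And>z. z \<in> W \<Longrightarrow> g' z = g z"
 shows "Res \<Delta> g' = Res \<Delta> g"
proof -
 obtain U where U: "0 \<in> U" "holo_on U h" "\<And>z. z \<in> U \<Longrightarrow> regular \<Delta> z \<Longrightarrow> g z = h z / lprod ks z"
  and ks: "set ks \<subseteq> \<Delta>" using assms(3) by (auto simp: germ_quot_def)
 have "germ_quot \<Delta> ks h g'" unfolding germ_quot_def
 proof (intro conjI ks exI[of _ "U \<inter> W"] ballI impI)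
  show "0 \<in> U \<inter> W" using U assms by simp
  show "holo_on (U \<inter> W) h" using U(2) assms(5) by (auto simp: holo_on_def)
  show "g' z = h z / lprod ks z" if "z \<in> U \<inter> W" "regular \<Delta> z" for z using U(3) assms(7) that by simp
 qed
 then show ?thesis using Res_germ[OF assms(1,2) _ assms(4) order.refl] assms(3) by simp
qed

section \<open>The residue formulas\<close>

context eisenstein
begin

lemma germ_quot_qqs:
 assumes "\<sigma> \<in> bases \<Delta>" "y \<in> U_set N \<Delta>" "set ks \<subseteq> \<Delta>"
 shows "germ_quot \<Delta> ks (qqs \<sigma> y t) (\<lambda>z. exp (pairing t z) * quot \<Delta> ks (\<lambda>z. 1) z * FFs \<sigma> t (y - z))"
  and "nice (qqs \<sigma> y t)"
proof -
 interpret primitive_basis N b bs \<sigma> "dvs \<sigma>" by (rule prim[OF assms(1)])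
 show n: "nice (qq y t)" by (rule nice_qq[OF U_generic[OF assms(2,1)]])
 then obtain U where "0 \<in> U" "holo_on U (qq y t)" using nice_holo by (auto simp: holo_at0_def)
 then show "germ_quot \<Delta> ks (qq y t) (\<lambda>z. exp (pairing t z) * quot \<Delta> ks (\<lambda>z. 1) z * FF t (y - z))"
  using assms(3) unfolding germ_quot_def by (auto simp: quot_def off_hyperplanes_def qq_def intro!: exI[of _ U])
qed

context
 fixes B d and y :: "complex^'n"
 assumes B: "basis_of_bases \<Delta> B" and d: "dual_family \<Delta> B d" and y: "y \<in> U_set N \<Delta>"
begin

definition summand :: "(complex^'n \<Rightarrow> complex) \<Rightarrow> (real^'n) set \<Rightarrow> real^'n \<Rightarrow> complex^'n \<Rightarrow> complex" where
 "summand f \<sigma> t z = exp (pairing t z) * f z * FFs \<sigma> t (y - z)"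

text \<open>The residue formula in its distributional form. Existence of a \<open>nice\<close>
  presentation belongs to it, since \<open>Res\<close> is known to be linear only on such
  germs.\<close>

definition good :: "(complex^'n \<Rightarrow> complex) \<Rightarrow> bool" where
 "good f \<longleftrightarrow> (\<forall>\<sigma>\<in>B. \<forall>t. \<exists>ks h. germ_quot \<Delta> ks h (summand f \<sigma> t) \<and> nice h) \<and>
   rep y (\<lambda>t. \<Sum>\<sigma>\<in>B. d \<sigma> (Res \<Delta> (summand f \<sigma> t))) (\<lambda>n. f (lat_shift y n))"

lemma finB: "finite B" by (rule basis_of_bases_finite[OF fin\<Delta> B])
lemma Bb: "\<sigma> \<in> B \<Longrightarrow> \<sigma> \<in> bases \<Delta>" using B by (auto simp: basis_of_bases_def)

lemma d_zero: "\<sigma> \<in> B \<Longrightarrow> d \<sigma> (\<lambda>z. 0) = 0"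
 using dual_family_sum[OF d, of \<sigma> "{}"] by simp

lemma good_zero: "good (\<lambda>z. 0)"
proof -
 have s: "summand (\<lambda>z. 0) \<sigma> t = (\<lambda>z. 0)" for \<sigma> t by (simp add: summand_def fun_eq_iff)
 have "\<exists>ks h. germ_quot \<Delta> ks h (\<lambda>z. 0) \<and> nice h" using Res_zero(2)[OF fin\<Delta> z\<Delta>] nice_const[of 0] by blast
 then show ?thesis unfolding good_def s Res_zero(1)[OF fin\<Delta> z\<Delta>] by (simp add: d_zero rep_zero)
qed

lemma good_lincomb:
 assumes "good f" "good f'" shows "good (\<lambda>z. c * f z + c' * f' z)"
proof -
 have s: "summand (\<lambda>z. c * f z + c' * f' z) \<sigma> t = (\<lambda>z. c * summand f \<sigma> t z + c' * summand f' \<sigma> t z)" for \<sigma> t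
  by (simp add: summand_def fun_eq_iff algebra_simps)
 have g: "\<exists>ks h. germ_quot \<Delta> ks h (summand f \<sigma> t) \<and> nice h" "\<exists>ks h. germ_quot \<Delta> ks h (summand f' \<sigma> t) \<and> nice h" if "\<sigma> \<in> B" for \<sigma> t
  using assms that by (auto simp: good_def)
 have 1: "\<exists>ks h. germ_quot \<Delta> ks h (\<lambda>z. c * summand f \<sigma> t z + c' * summand f' \<sigma> t z) \<and> nice h" if s: "\<sigma> \<in> B" for \<sigma> t
 proof -
  obtain ks h where 1: "germ_quot \<Delta> ks h (summand f \<sigma> t)" "nice h" using g(1)[OF s] by blast
  obtain ks' h' where 2: "germ_quot \<Delta> ks' h' (summand f' \<sigma> t)" "nice h'" using g(2)[OF s] by blast
  show ?thesis by (rule Res_linear(2)[OF fin\<Delta> z\<Delta> 1 2])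
 qed
 have 2: "d \<sigma> (Res \<Delta> (\<lambda>z. c * summand f \<sigma> t z + c' * summand f' \<sigma> t z)) = c * d \<sigma> (Res \<Delta> (summand f \<sigma> t)) + c' * d \<sigma> (Res \<Delta> (summand f' \<sigma> t))"
  if s: "\<sigma> \<in> B" for \<sigma> t
 proof -
  obtain ks h where 1: "germ_quot \<Delta> ks h (summand f \<sigma> t)" "nice h" using g(1)[OF s] by blast
  obtain ks' h' where 2: "germ_quot \<Delta> ks' h' (summand f' \<sigma> t)" "nice h'" using g(2)[OF s] by blast
  show ?thesis unfolding Res_linear(1)[OF fin\<Delta> z\<Delta> 1 2]
   by (rule dual_family_linear[OF d s Res_germ_S[OF fin\<Delta> z\<Delta> 1] Res_germ_S[OF fin\<Delta> z\<Delta> 2]])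
 qed
 have "rep y (\<lambda>t. c * (\<Sum>\<sigma>\<in>B. d \<sigma> (Res \<Delta> (summand f \<sigma> t))) + c' * (\<Sum>\<sigma>\<in>B. d \<sigma> (Res \<Delta> (summand f' \<sigma> t)))) (\<lambda>n. c * f (lat_shift y n) + c' * f' (lat_shift y n))"
  using assms by (intro rep_lincomb) (auto simp: good_def)
 moreover have "(\<Sum>\<sigma>\<in>B. d \<sigma> (Res \<Delta> (\<lambda>z. c * summand f \<sigma> t z + c' * summand f' \<sigma> t z))) =
   c * (\<Sum>\<sigma>\<in>B. d \<sigma> (Res \<Delta> (summand f \<sigma> t))) + c' * (\<Sum>\<sigma>\<in>B. d \<sigma> (Res \<Delta> (summand f' \<sigma> t)))" for t
  unfolding sum_distrib_left sum.distrib[symmetric] by (intro sum.cong refl 2)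
 ultimately show ?thesis unfolding good_def s using 1 by simp
qed

text \<open>The functional \<open>d \<sigma>\<close> after the residue, on numerators of the
  critical degree \<open>D\<close>, is one and the same combination of evaluations on both sides:
  applied to the Taylor component of \<open>qqs\<close> it gives the residue term, applied to the
  kernel coefficient it gives, summed over \<sigma>, the value of the fraction.
  \<open>rep_kernel\<close> links the two.\<close>

lemma good_quot:
 assumes ks: "set ks \<subseteq> \<Delta>" "span (set ks) = UNIV"
 shows "good (quot \<Delta> ks (\<lambda>z. 1))"
proof -
 let ?f = "quot \<Delta> ks (\<lambda>z. 1)"
 \<comment> \<open>A spanning denominator has at least \<open>CARD('n)\<close> factors, so the
   subtraction defining \<open>D\<close> is not truncated.\<close>
 have "CARD('n) \<le> card (set ks)" using dim_le_card[of "set ks" "set ks"] ks(2) dim_span[of "set ks"] span_superset[of "set ks"] by (simp add: dim_UNIV)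
 then have D: "length ks = (length ks - CARD('n)) + CARD('n)" using card_length[of ks] by simp
 define D where "D = length ks - CARD('n)"
 note D = D[folded D_def]
 have R: "?f \<in> R_space \<Delta>" by (intro R_quot ks poly_fun.const)
 have "\<forall>\<sigma>\<in>B. \<exists>l. \<forall>q\<in>hom_poly D. d \<sigma> (Res_rat \<Delta> (\<lambda>z. ?f z * q z)) = ev l q"
  using functional_ev[OF fin\<Delta> z\<Delta> B d _ R] by blast
 from bchoice[OF this] obtain l where l0: "\<forall>\<sigma>\<in>B. \<forall>q\<in>hom_poly D. d \<sigma> (Res_rat \<Delta> (\<lambda>z. ?f z * q z)) = ev (l \<sigma>) q" ..
 have "(\<lambda>z. ?f z * q z) = quot \<Delta> ks q" for q by (auto simp: quot_def off_hyperplanes_def)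
 with l0 have l: "d \<sigma> (Res_rat \<Delta> (quot \<Delta> ks q)) = ev (l \<sigma>) q" if "\<sigma> \<in> B" "q \<in> hom_poly D" for \<sigma> q using that by simp
 have Res: "d \<sigma> (Res \<Delta> (summand ?f \<sigma> t)) = ev (l \<sigma>) (tc D (qqs \<sigma> y t))" if s: "\<sigma> \<in> B" for \<sigma> t
 proof -
  note g = germ_quot_qqs[OF Bb[OF s] y ks(1), of t]
  have "Res \<Delta> (summand ?f \<sigma> t) = Res_rat \<Delta> (quot \<Delta> ks (tc D (qqs \<sigma> y t)))"
   unfolding summand_def[abs_def] by (rule Res_germ_degree[OF fin\<Delta> z\<Delta> g D])
  then show ?thesis using l[OF s nice_tc[OF g(2)]] by simp
 qed
 have "rep y (\<lambda>t. \<Sum>\<sigma>\<in>B. 1 * ev (l \<sigma>) (tc D (qqs \<sigma> y t))) (\<lambda>n. \<Sum>\<sigma>\<in>B. 1 * ev (l \<sigma>) (\<lambda>x. kernel_coeff (list_of \<sigma>) D x (lat_shift y n)))"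
 proof (rule rep_sum[OF finB])
  fix \<sigma> assume s: "\<sigma> \<in> B"
  have "set (list_of \<sigma>) = \<sigma>" "distinct (list_of \<sigma>)" using list_of[OF basis_finite[OF Bb[OF s]]] by auto
  then show "rep y (\<lambda>t. ev (l \<sigma>) (tc D (qqs \<sigma> y t))) (\<lambda>n. ev (l \<sigma>) (\<lambda>x. kernel_coeff (list_of \<sigma>) D x (lat_shift y n)))"
   by (intro rep_ev rep_kernel[OF Bb[OF s] y])
 qed
 then have "rep y (\<lambda>t. \<Sum>\<sigma>\<in>B. 1 * ev (l \<sigma>) (tc D (qqs \<sigma> y t))) (\<lambda>n. ?f (lat_shift y n))"
 proof (rule rep_cong)
  fix n assume n: "n \<in> N"
  have "?f (lat_shift y n) = (\<Sum>\<sigma>\<in>B. d \<sigma> (Res_rat \<Delta> (quot \<Delta> ks (\<lambda>z. kernel_coeff (list_of \<sigma>) D z (lat_shift y n)))))"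
   by (rule kernel_formula[OF fin\<Delta> z\<Delta> B d ks D U_regular[OF y n]])
  then show "(\<Sum>\<sigma>\<in>B. 1 * ev (l \<sigma>) (\<lambda>x. kernel_coeff (list_of \<sigma>) D x (lat_shift y n))) = ?f (lat_shift y n)"
   by (simp add: l[OF _ kernel_coeff_hom])
 qed
 then have "rep y (\<lambda>t. \<Sum>\<sigma>\<in>B. d \<sigma> (Res \<Delta> (summand ?f \<sigma> t))) (\<lambda>n. ?f (lat_shift y n))"
  by (simp add: Res)
 moreover have "\<exists>ks h. germ_quot \<Delta> ks h (summand ?f \<sigma> t) \<and> nice h" if "\<sigma> \<in> B" for \<sigma> t
  unfolding summand_def[abs_def] using germ_quot_qqs[OF Bb[OF that] y ks(1)] by blast
 ultimately show ?thesis unfolding good_def by blast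
qed

lemma good_G: assumes "f \<in> G_space \<Delta>" shows "good f"
 using assms unfolding G_space_def
proof (induction rule: cfun_span_induct)
 case (add g h) then show ?case using good_lincomb[of g h 1 1] by simp
next
 case (scale c g) then show ?case using good_lincomb[of g g c 0] by simp
next
 case (base f) then show ?case using good_quot by blast
qed (rule good_zero)

lemma Eis_S:
 assumes "s \<in> S_space \<Delta>" "t \<in> areg N \<Delta>" "w \<in> U_set N \<Delta>"
 shows "Eis N \<Delta> t s w = (\<Sum>\<sigma>\<in>B. d \<sigma> s * FFs \<sigma> t w)"
proof (rule rep_Eis[OF _ assms(2)])
 have "rep w (\<lambda>t. \<Sum>\<sigma>\<in>B. d \<sigma> s * FFs \<sigma> t w) (\<lambda>n. \<Sum>\<sigma>\<in>B. d \<sigma> s * phi \<Delta> \<sigma> (lat_shift w n))"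
  by (rule rep_sum[OF finB rep_phi[OF Bb assms(3)]])
 then show "rep w (\<lambda>t. \<Sum>\<sigma>\<in>B. d \<sigma> s * FFs \<sigma> t w) (\<lambda>n. s (lat_shift w n))"
  by (rule rep_cong) (subst S_expand[OF fin\<Delta> B d assms(1)], rule refl)
qed

lemma U_set_near: obtains W where "open W" "(0 :: complex^'n) \<in> W" "\<And>z. z \<in> W \<Longrightarrow> y - z \<in> U_set N \<Delta>"
proof -
 have nz: "pairing \<alpha> (lat_shift y n) \<noteq> 0" if "\<alpha> \<in> \<Delta>" "n \<in> N" for \<alpha> n using y that by (auto simp: U_set_def)
 obtain \<delta> where \<delta>: "\<delta> > 0" "\<And>\<alpha> n. \<alpha> \<in> \<Delta> \<Longrightarrow> n \<in> N \<Longrightarrow> \<delta> \<le> norm (pairing \<alpha> (lat_shift y n))"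
  using shift_gap[OF fin\<Delta> \<Delta>M nz] by blast
 have c: "continuous_on UNIV (pairing \<alpha>)" for \<alpha> :: "real^'n"
  by (intro continuous_at_imp_continuous_on ballI has_derivative_continuous[OF has_derivative_pairing])
 show ?thesis
 proof (rule that[of "\<Inter>\<alpha>\<in>\<Delta>. {z. norm (pairing \<alpha> z) < \<delta>}"])
  show "open (\<Inter>\<alpha>\<in>\<Delta>. {z. norm (pairing \<alpha> z) < \<delta>})"
   using fin\<Delta> by (intro open_INT ballI open_Collect_less continuous_on_norm c continuous_on_const)
  show "(0 :: complex^'n) \<in> (\<Inter>\<alpha>\<in>\<Delta>. {z. norm (pairing \<alpha> z) < \<delta>})" using \<delta>(1) by simp
  fix z assume z: "z \<in> (\<Inter>\<alpha>\<in>\<Delta>. {z. norm (pairing \<alpha> z) < \<delta>})"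
  show "y - z \<in> U_set N \<Delta>" unfolding U_set_def
  proof (intro CollectI ballI)
   fix n \<alpha> assume *: "n \<in> N" "\<alpha> \<in> \<Delta>"
   then have "norm (pairing \<alpha> z) < norm (pairing \<alpha> (lat_shift y n))" using z \<delta>(2)[of \<alpha> n] by auto
   then show "pairing \<alpha> (lat_shift (y - z) n) \<noteq> 0" by (auto simp: lat_shift_diff pairing_diff_right)
  qed
 qed
qed

theorem Eis_formulas:
 assumes f: "f \<in> G_space \<Delta>" and t: "t \<in> areg N \<Delta>"
 shows "Eis N \<Delta> t f y = (\<Sum>\<sigma>\<in>B. d \<sigma> (Res \<Delta> (summand f \<sigma> t)))" (is ?sum)
  and "Eis N \<Delta> t f y = trace_on (S_space \<Delta>)
   (Res \<Delta> \<circ> mult_op (\<lambda>z. exp (pairing t z) * f z) \<circ> translate_op y \<circ> reflect_op \<circ> Eis N \<Delta> t \<circ> Res_rat \<Delta>)" (is ?trace)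
  and "diagonal_basis \<Delta> OB \<Longrightarrow> set ` OB = B \<Longrightarrow> Eis N \<Delta> t f y = (\<Sum>os\<in>OB. IRes \<Delta> os (summand f (set os) t))"
proof -
 have gf: "good f" by (rule good_G[OF f])
 then have g: "\<exists>ks h. germ_quot \<Delta> ks h (summand f \<sigma> t) \<and> nice h" if "\<sigma> \<in> B" for \<sigma> using that by (simp add: good_def)
 show sum: ?sum by (rule rep_Eis[OF _ t]) (use gf in \<open>simp add: good_def\<close>)
 have RS: "Res \<Delta> (summand f \<sigma> t) \<in> S_space \<Delta>" if "\<sigma> \<in> B" for \<sigma>
  using g[OF that] Res_germ_S[OF fin\<Delta> z\<Delta>] by blast
 obtain W where W: "open W" "0 \<in> W" "\<And>z. z \<in> W \<Longrightarrow> y - z \<in> U_set N \<Delta>" using U_set_near by blast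
 show ?trace unfolding sum
 proof (rule trace_on_dual_family[OF fin\<Delta> B d RS, symmetric])
  fix s assume s: "s \<in> S_space \<Delta>"
  have Rs: "Res \<Delta> (\<lambda>z. \<Sum>\<sigma>\<in>B. d \<sigma> s * summand f \<sigma> t z) = (\<lambda>z. \<Sum>\<sigma>\<in>B. d \<sigma> s * Res \<Delta> (summand f \<sigma> t) z)"
   "\<exists>ks h. germ_quot \<Delta> ks h (\<lambda>z. \<Sum>\<sigma>\<in>B. d \<sigma> s * summand f \<sigma> t z) \<and> nice h"
   using Res_sum[OF fin\<Delta> z\<Delta> finB g, of "\<lambda>\<sigma>. \<sigma>" "\<lambda>\<sigma>. d \<sigma> s"] by simp_all
  obtain ks h where kh: "germ_quot \<Delta> ks h (\<lambda>z. \<Sum>\<sigma>\<in>B. d \<sigma> s * summand f \<sigma> t z)" "nice h" using Rs(2) by blast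
  \<comment> \<open>Near \<open>z = 0\<close> the point \<open>y - z\<close> stays in
    \<open>U_set N \<Delta>\<close>, where \<open>Eis_S\<close> expands the series; the two germs
    agree there.\<close>
  have "Res \<Delta> (\<lambda>z. exp (pairing t z) * f z * Eis N \<Delta> t s (y - z)) = Res \<Delta> (\<lambda>z. \<Sum>\<sigma>\<in>B. d \<sigma> s * summand f \<sigma> t z)"
  proof (rule Res_cong[OF fin\<Delta> z\<Delta> kh W(1,2)])
   fix z assume z: "z \<in> W"
   show "exp (pairing t z) * f z * Eis N \<Delta> t s (y - z) = (\<Sum>\<sigma>\<in>B. d \<sigma> s * summand f \<sigma> t z)"
    unfolding Eis_S[OF s t W(3)[OF z]] sum_distrib_left summand_def by (intro sum.cong refl) (simp add: algebra_simps)
  qed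
  then show "(Res \<Delta> \<circ> mult_op (\<lambda>z. exp (pairing t z) * f z) \<circ> translate_op y \<circ> reflect_op \<circ> Eis N \<Delta> t \<circ> Res_rat \<Delta>) s =
    (\<lambda>z. \<Sum>\<sigma>\<in>B. d \<sigma> s * Res \<Delta> (summand f \<sigma> t) z)"
   unfolding Rs(1) by (simp add: Res_rat_S[OF fin\<Delta> z\<Delta> s] mult_op_def[abs_def] translate_op_def[abs_def] reflect_op_def[abs_def])
 qed
 show "Eis N \<Delta> t f y = (\<Sum>os\<in>OB. IRes \<Delta> os (summand f (set os) t))" if OB: "diagonal_basis \<Delta> OB" "set ` OB = B"
 proof -
  have inj: "inj_on set OB" and ord: "OB \<subseteq> ordered_bases \<Delta>"
   and diag: "\<And>os ot. os \<in> OB \<Longrightarrow> ot \<in> OB \<Longrightarrow> IRes_rat ot (phi \<Delta> (set os)) = (if set os = set ot then 1 else 0)"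
   using OB(1) by (auto simp: diagonal_basis_def)
  \<comment> \<open>On \<open>S_space \<Delta>\<close> the iterated residues of a diagonal basis
    take the same values on the \<open>phi\<close> as the dual family, hence coincide with
    it.\<close>
  have "IRes \<Delta> ot (summand f (set ot) t) = d (set ot) (Res \<Delta> (summand f (set ot) t))" if ot: "ot \<in> OB" for ot
  proof -
   have oB: "set ot \<in> B" using ot OB(2) by blast
   have oo: "ot \<in> ordered_bases \<Delta>" using ot ord by blast
   obtain ks h where kh: "germ_quot \<Delta> ks h (summand f (set ot) t)" "nice h" using g[OF oB] by blast
   define s where "s = Res \<Delta> (summand f (set ot) t)"
   have s: "s \<in> S_space \<Delta>" unfolding s_def by (rule RS[OF oB])
   have "IRes \<Delta> ot (summand f (set ot) t) = IRes_rat ot s" unfolding s_def by (rule IRes_germ[OF fin\<Delta> z\<Delta> kh oo])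
   also have "\<dots> = IRes_rat ot (\<lambda>z. \<Sum>\<sigma>\<in>B. d \<sigma> s * phi \<Delta> \<sigma> z)" using S_expand[OF fin\<Delta> B d s] by simp
   also have "\<dots> = (\<Sum>\<sigma>\<in>B. d \<sigma> s * IRes_rat ot (phi \<Delta> \<sigma>))"
   proof (rule IRes_rat_sum[OF fin\<Delta> z\<Delta> oo finB])
    fix \<sigma> assume "\<sigma> \<in> B"
    then show "phi \<Delta> \<sigma> \<in> R_space \<Delta>" using phi_in_S[OF Bb] S_space_R[OF fin\<Delta>] by blast
   qed
   also have "\<dots> = (\<Sum>\<sigma>\<in>B. if \<sigma> = set ot then d \<sigma> s else 0)"
   proof (intro sum.cong refl)
    fix \<sigma> assume "\<sigma> \<in> B"
    then obtain os where "os \<in> OB" "\<sigma> = set os" using OB(2) by blast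
    then show "d \<sigma> s * IRes_rat ot (phi \<Delta> \<sigma>) = (if \<sigma> = set ot then d \<sigma> s else 0)" using diag[OF _ ot] by simp
   qed
   also have "\<dots> = d (set ot) s" using finB oB by simp
   finally show ?thesis unfolding s_def .
  qed
  then show ?thesis unfolding sum OB(2)[symmetric] sum.reindex[OF inj] by simp
 qed
qed

end

end

theorem theorem19:
  fixes N \<Delta> :: "(real^'n) set"
    and f :: "complex^'n \<Rightarrow> complex"
    and a :: "(real^'n) set"
    and B :: "(real^'n) set set"
    and d :: "(real^'n) set \<Rightarrow> (complex^'n \<Rightarrow> complex) \<Rightarrow> complex"
    and y :: "complex^'n"
    and t :: "real^'n"
  assumes "is_lattice N"
    and "finite \<Delta>"
    and "\<Delta> \<subseteq> dual_lattice N"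
    and "0 \<notin> \<Delta>"
    and "\<And>\<alpha>. \<alpha> \<in> \<Delta> \<Longrightarrow> indivisible_in (dual_lattice N) \<alpha>"
    and "f \<in> G_space \<Delta>"
    and "a \<in> alcoves N \<Delta>"
    and "basis_of_bases \<Delta> B"
    and "dual_family \<Delta> B d"
    and "y \<in> U_set N \<Delta>"
    and "t \<in> a"
  shows "Eis N \<Delta> t f y =
           trace_on (S_space \<Delta>)
             (Res \<Delta> \<circ> mult_op (\<lambda>z. exp (pairing t z) * f z) \<circ> translate_op y \<circ> reflect_op
                \<circ> Eis N \<Delta> t \<circ> Res_rat \<Delta>) \<and>
         Eis N \<Delta> t f y =
           (\<Sum>\<sigma>\<in>B. d \<sigma> (Res \<Delta> (\<lambda>z. exp (pairing t z) * f z * F_fun N a \<sigma> (y - z)))) \<and>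
         (\<forall>OB. diagonal_basis \<Delta> OB \<and> set ` OB = B \<longrightarrow>
           Eis N \<Delta> t f y =
             (\<Sum>os\<in>OB. IRes \<Delta> os (\<lambda>z. exp (pairing t z) * f z * F_fun N a (set os) (y - z))))"
proof -
  obtain b bs where "lattice N b bs" using lattice_exists[OF assms(1)] by blast
  then interpret lattice N b bs .
  interpret eisenstein N b bs \<Delta> by unfold_locales (use assms(2-5) in auto)
  have t: "t \<in> areg N \<Delta>" using in_components_subset[OF assms(7)[unfolded alcoves_def]] assms(11) by blast
  \<comment> \<open>\<open>F_fun\<close> is built at an arbitrary chosen point of the alcove and
    \<open>summand\<close> at the given \<open>t\<close>; the index set is constant on the alcove,
    so the two functions agree.\<close>
  have F: "(\<lambda>z. exp (pairing t z) * f z * F_fun N a \<sigma> (y - z)) = summand y f \<sigma> t" if "\<sigma> \<in> B" for \<sigma>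
  proof -
    have "\<sigma> \<in> bases \<Delta>" using that assms(8) by (auto simp: basis_of_bases_def)
    from lattice_basis.F_fun_alcove[OF lbasis[OF this] this assms(7,11)]
    show ?thesis by (simp add: summand_def[OF assms(8-10)] fun_eq_iff)
  qed
  note E = Eis_formulas[OF assms(8-10) assms(6) t]
  have 1: "(\<Sum>\<sigma>\<in>B. d \<sigma> (Res \<Delta> (\<lambda>z. exp (pairing t z) * f z * F_fun N a \<sigma> (y - z)))) = (\<Sum>\<sigma>\<in>B. d \<sigma> (Res \<Delta> (summand y f \<sigma> t)))"
    by (intro sum.cong refl) (simp add: F)
  have 2: "(\<Sum>os\<in>OB. IRes \<Delta> os (\<lambda>z. exp (pairing t z) * f z * F_fun N a (set os) (y - z))) = (\<Sum>os\<in>OB. IRes \<Delta> os (summand y f (set os) t))"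
    if "set ` OB = B" for OB
  proof (intro sum.cong refl)
    fix os assume "os \<in> OB"
    then have "set os \<in> B" using that by blast
    from F[OF this] show "IRes \<Delta> os (\<lambda>z. exp (pairing t z) * f z * F_fun N a (set os) (y - z)) = IRes \<Delta> os (summand y f (set os) t)" by simp
  qed
  show ?thesis
  proof (intro conjI allI impI)
    fix OB assume OB: "diagonal_basis \<Delta> OB \<and> set ` OB = B"
    show "Eis N \<Delta> t f y = (\<Sum>os\<in>OB. IRes \<Delta> os (\<lambda>z. exp (pairing t z) * f z * F_fun N a (set os) (y - z)))"
      unfolding 2[OF OB[THEN conjunct2]] by (rule E(3)) (use OB in auto)
  qed (use E(1,2) 1 in simp_all)
qed

end
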